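(* Let $\mathbf{C}\times\mathbf{D}\to\mathbf{E}$, $(A,B)\mapsto A\wedge B$, be a biexact functor between Waldhausen categories. Then there are morphisms of square groups $$\varphi^{ij}\colon\mathcal{D}^{sg}_i\mathbf{C}\circledcirc\mathcal{D}^{sg}_j\mathbf{D}\longrightarrow\mathcal{D}^{sg}_{i+j}\mathbf{E},\qquad i,\,j,\,i+j\in\{0,1\},$$ defined by $$\begin{aligned} \varphi^{00}_e([A]\circledcirc[C])&=[A\wedge C],\\ \varphi^{01}_e([A]\circledcirc[C\stackrel{\sim}{\to}C'])&=[A\wedge C\stackrel{\sim}{\to}A\wedge C'],\\ \varphi^{01}_e([A]\circledcirc[C\rightarrowtail D\twoheadrightarrow D/C])&=[A\wedge C\rightarrowtail A\wedge D\twoheadrightarrow A\wedge(D/C)],\\ \varphi^{10}_e([A\stackrel{\sim}{\to}A']\circledcirc[C])&=[A\wedge C\stackrel{\sim}{\to}A'\wedge C],\\ \varphi^{10}_e([A\rightarrowtail B\twoheadrightarrow B/A]\circledcirc[C])&=[A\wedge C\rightarrowtail B\wedge C\twoheadrightarrow(B/A)\wedge C],\\ \varphi^{ij}_{ee}([A]\otimes[A']\otimes[C]\otimes[C'])&=[A\wedge C]\otimes[A'\wedge C'], \end{aligned}$$ and the following identities of morphisms of square groups hold: $$\varphi^{01}(\partial\circledcirc1)=\varphi^{10}(1\circledcirc\partial)\colon\mathcal{D}_1^{sg}\mathbf{C}\circledcirc\mathcal{D}_1^{sg}\mathbf{D}\to\mathcal{D}_1^{sg}\mathbf{E},$$ $$\partial\varphi^{01}=\varphi^{00}(1\circledcirc\partial)\colon\mathcal{D}_0^{sg}\mathbf{C}\circledcirc\mathcal{D}_1^{sg}\mathbf{D}\to\mathcal{D}_0^{sg}\mathbf{E},$$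 $$\partial\varphi^{10}=\varphi^{00}(\partial\circledcirc1)\colon\mathcal{D}_1^{sg}\mathbf{C}\circledcirc\mathcal{D}_0^{sg}\mathbf{D}\to\mathcal{D}_0^{sg}\mathbf{E}.$$
   Context: Groups are written additively, $[x,y]=-x-y+x+y$, $K^{ab}$ is the abelianization of a group $K$, and $\{x\}\in K^{ab}$ is the class of $x\in K$. **Stable quadratic modules.** A stable quadratic module $C_*$ is a diagram of group homomorphisms $C_0^{ab}\otimes C_0^{ab}\xrightarrow{\omega}C_1\xrightarrow{\partial}C_0$ such that for $c_i,d_i\in C_i$: $\partial\omega(\{c_0\}\otimes\{d_0\})=[d_0,c_0]$; $\omega(\{\partial c_1\}\otimes\{\partial d_1\})=[d_1,c_1]$; $\omega(\{c_0\}\otimes\{d_0\}+\{d_0\}\otimes\{c_0\})=0$. Write $\langle c_0,d_0\rangle=\omega(\{c_0\}\otimes\{d_0\})$. Morphisms are pairs of homomorphisms compatible with $\partial$ and $\langle\cdot,\cdot\rangle$. A stable quadratic module given by generators (in degrees $0,1$) and relations is characterized by the usual universal property. **The model $\mathcal{D}_*\mathbf{C}$.** Let $\mathbf C$ be a Waldhausen category with distinguished zero object $*$, cofibrations $\rightarrowtail$, weak equivalences $\stackrel{\sim}{\to}$, cofiber sequences $A\rightarrowtail B\twoheadrightarrow B/A$ (exact functors preserve all this structure, including $*$; biexact functors are in Waldhausen's sense). $\mathcal{D}_*\mathbf C$ is the stable quadratic module generated in degree $0$ by symbols $[A]$ for every object $A$, and in degree $1$ by symbols $[A\stackrel{\sim}{\to}A']$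 for every weak equivalence and $[A\rightarrowtail B\twoheadrightarrow B/A]$ for every cofiber sequence, subject to: (1) $\partial[A\stackrel{\sim}{\to}A']=-[A']+[A]$. (2) $\partial[A\rightarrowtail B\twoheadrightarrow B/A]=-[B]+[B/A]+[A]$. (3) $[*]=0$. (4) $[A\stackrel{1_A}{\to}A]=0$. (5) $[A\stackrel{1_A}{\to}A\twoheadrightarrow *]=0$ and $[*\rightarrowtail A\stackrel{1_A}{\to}A]=0$. (6) $[A\stackrel{\sim}{\to}C]=[B\stackrel{\sim}{\to}C]+[A\stackrel{\sim}{\to}B]$ for composable weak equivalences $A\stackrel{\sim}{\to}B\stackrel{\sim}{\to}C$. (7) For every commutative diagram given by a map from a cofiber sequence $A\rightarrowtail B\twoheadrightarrow B/A$ to a cofiber sequence $A'\rightarrowtail B'\twoheadrightarrow B'/A'$ whose three components are weak equivalences: $[A\stackrel{\sim}{\to}A']+[B/A\stackrel{\sim}{\to}B'/A']+\langle[A],-[B'/A']+[B/A]\rangle=-[A'\rightarrowtail B'\twoheadrightarrow B'/A']+[B\stackrel{\sim}{\to}B']+[A\rightarrowtail B\twoheadrightarrow B/A]$. (8) For every commutative diagram consisting of four cofiber sequences $A\rightarrowtail B\twoheadrightarrow B/A$, $A\rightarrowtail C\twoheadrightarrow C/A$, $B\rightarrowtail C\twoheadrightarrow C/B$, $B/A\rightarrowtail C/A\twoheadrightarrow C/B$ (with $A\rightarrowtail C$ the composite $A\rightarrowtail B\rightarrowtail C$): $[B\rightarrowtail C\twoheadrightarrow C/B]+[A\rightarrowtail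 B\twoheadrightarrow B/A]=[A\rightarrowtail C\twoheadrightarrow C/A]+[B/A\rightarrowtail C/A\twoheadrightarrow C/B]+\langle[A],-[C/A]+[C/B]+[B/A]\rangle$. (9) For objects $A,B$: $\langle[A],[B]\rangle=-[B\stackrel{i_2}{\rightarrowtail}A\vee B\stackrel{p_1}{\twoheadrightarrow}A]+[A\stackrel{i_1}{\rightarrowtail}A\vee B\stackrel{p_2}{\twoheadrightarrow}B]$, with $i_j,p_j$ the inclusions and projections of a coproduct $A\vee B$. **Square groups.** A square group $M$ is a diagram $M_e\underset{P}{\overset{H}{\rightleftarrows}}M_{ee}$ with $M_e$ a group, $M_{ee}$ an abelian group, $P\colon M_{ee}\to M_e$ a homomorphism, and $H\colon M_e\to M_{ee}$ a quadratic map, i.e. $(x|y)_H=H(x+y)-H(y)-H(x)$ is bilinear, such that for $a\in M_{ee}$, $x,y\in M_e$: $(P(a)|x)_H=0=(x|P(a))_H$, $P(x|y)_H=[x,y]$, $PHP(a)=P(a)+P(a)$. Then $T=HP-1\colon M_{ee}\to M_{ee}$ is an involution and $\Delta\colon\operatorname{Coker}P\to M_{ee}$, $\Delta(x)=(x|x)_H-H(x)+TH(x)$, is a homomorphism. A morphism $f\colon M\to N$ is a pair of homomorphisms $f_e,f_{ee}$ commuting with $H$ and $P$. **Tensor product.** $M\circledcirc N$ is defined as follows. $(M\circledcirc N)_e$ is generated by symbols $x\circledcirc y$, $a\bar\otimes b$ ($x\in M_e,y\in N_e,a\in M_{ee},b\in N_{ee}$) with relations: $a\bar\otimes b$ is bilinear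 and central; $x\circledcirc(y_1+y_2)=x\circledcirc y_1+x\circledcirc y_2+H(x)\bar\otimes(y_2|y_1)_H$; $(x_1+x_2)\circledcirc y=x_1\circledcirc y+x_2\circledcirc y$; $P(a)\circledcirc y=a\bar\otimes(y|y)_H$; $T(a)\bar\otimes T(b)=-a\bar\otimes b$; $x\circledcirc P(b)=\Delta(x)\bar\otimes b$. $(M\circledcirc N)_{ee}=M_{ee}\otimes N_{ee}$, $P(a\otimes b)=a\bar\otimes b$, and $H$ is the unique quadratic map with $H(x\circledcirc y)=\Delta(x)\otimes H(y)+H(x)\otimes(y|y)_H$, $H(a\bar\otimes b)=a\otimes b-T(a)\otimes T(b)$, $(a\bar\otimes b|-)_H=0=(-|a\bar\otimes b)_H$, $(x\circledcirc y|x'\circledcirc y')_H=(x|x')_H\otimes(y|y')_H$. It is functorial in the evident way. **The square groups $\mathcal{D}_i^{sg}$.** $\mathcal{D}_0\mathbf C$ is the free group of nilpotency class $2$ with basis the classes $[A]$ of objects $A\neq *$. Let $H\colon\mathcal{D}_0\mathbf C\to(\mathcal{D}_0\mathbf C)^{ab}\otimes(\mathcal{D}_0\mathbf C)^{ab}$ be the unique quadratic map with $H([A])=0$ for all objects $A$ and $(x|y)_H=\{y\}\otimes\{x\}$. The square group $\mathcal{D}_0^{sg}\mathbf C$ has $e$-part $\mathcal{D}_0\mathbf C$, $ee$-part $(\mathcal{D}_0\mathbf C)^{ab}\otimes(\mathcal{D}_0\mathbf C)^{ab}$, structure maps $H$ and $P=\partial\omega$. The square group $\mathcal{D}_1^{sg}\mathbf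 C$ has $e$-part $\mathcal{D}_1\mathbf C$, the same $ee$-part, and structure maps $H\partial$ and $P=\omega$. $\partial\colon\mathcal{D}_1^{sg}\mathbf C\to\mathcal{D}_0^{sg}\mathbf C$ is the square group morphism given by $\partial$ on $e$-parts and the identity on $ee$-parts. *)

theory Defs
  imports "HOL-Algebra.Generated_Groups"
begin

text \<open>
  Groups are HOL-Algebra groups. The mathematical text writes them additively; here the group
  operation of a record \<open>G\<close> is \<open>\<otimes>\<^bsub>G\<^esub>\<close>, and the additive signs \<open>+\<close>, \<open>-\<close>, \<open>0\<close> are used only
  for formal expressions in generators. The commutator is \<open>[x,y] = -x - y + x + y\<close>.
\<close>

definition gcommutator :: "('a, 'z) monoid_scheme \<Rightarrow> 'a \<Rightarrow> 'a \<Rightarrow> 'a" where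
  "gcommutator G x y = inv\<^bsub>G\<^esub> x \<otimes>\<^bsub>G\<^esub> inv\<^bsub>G\<^esub> y \<otimes>\<^bsub>G\<^esub> x \<otimes>\<^bsub>G\<^esub> y"

definition abelianization :: "'a monoid \<Rightarrow> 'a set monoid" where
  "abelianization G = G Mod derived G (carrier G)"

definition ab_class :: "'a monoid \<Rightarrow> 'a \<Rightarrow> 'a set" where
  "ab_class G x = derived G (carrier G) #>\<^bsub>G\<^esub> x"

definition biadditive ::
    "('a, 'x) monoid_scheme \<Rightarrow> ('b, 'y) monoid_scheme \<Rightarrow> ('c, 'z) monoid_scheme
      \<Rightarrow> ('a \<Rightarrow> 'b \<Rightarrow> 'c) \<Rightarrow> bool" where
  "biadditive A B G f \<longleftrightarrow>
     (\<forall>a\<in>carrier A. f a \<in> hom B G) \<and> (\<forall>b\<in>carrier B. (\<lambda>a. f a b) \<in> hom A G)"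


section \<open>Waldhausen categories and biexact functors\<close>

record ('o, 'm) cat =
  Obj :: "'o set"
  Arr :: "'m set"
  Src :: "'m \<Rightarrow> 'o"
  Tgt :: "'m \<Rightarrow> 'o"
  Ide :: "'o \<Rightarrow> 'm"
  Cmp :: "'m \<Rightarrow> 'm \<Rightarrow> 'm"  (infixl "\<cdot>\<index>" 70)

definition arrows :: "('o, 'm, 'z) cat_scheme \<Rightarrow> 'o \<Rightarrow> 'o \<Rightarrow> 'm set" where
  "arrows C A B = {f \<in> Arr C. Src C f = A \<and> Tgt C f = B}"

locale category =
  fixes C :: "('o, 'm, 'z) cat_scheme" (structure)
  assumes Src_closed: "f \<in> Arr C \<Longrightarrow> Src C f \<in> Obj C"
    and Tgt_closed: "f \<in> Arr C \<Longrightarrow> Tgt C f \<in> Obj C"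
    and Ide_arrow: "A \<in> Obj C \<Longrightarrow> Ide C A \<in> arrows C A A"
    and Cmp_arrow: "f \<in> arrows C X Y \<Longrightarrow> g \<in> arrows C Y Z \<Longrightarrow> g \<cdot> f \<in> arrows C X Z"
    and Ide_left: "f \<in> Arr C \<Longrightarrow> Ide C (Tgt C f) \<cdot> f = f"
    and Ide_right: "f \<in> Arr C \<Longrightarrow> f \<cdot> Ide C (Src C f) = f"
    and Cmp_assoc: "f \<in> arrows C W X \<Longrightarrow> g \<in> arrows C X Y \<Longrightarrow> h \<in> arrows C Y Z \<Longrightarrow>
           (h \<cdot> g) \<cdot> f = h \<cdot> (g \<cdot> f)"

definition cat_iso :: "('o, 'm, 'z) cat_scheme \<Rightarrow> 'm \<Rightarrow> bool" where
  "cat_iso C f \<longleftrightarrow> f \<in> Arr C \<and>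
     (\<exists>g \<in> arrows C (Tgt C f) (Src C f).
        g \<cdot>\<^bsub>C\<^esub> f = Ide C (Src C f) \<and> f \<cdot>\<^bsub>C\<^esub> g = Ide C (Tgt C f))"

definition zero_object :: "('o, 'm, 'z) cat_scheme \<Rightarrow> 'o \<Rightarrow> bool" where
  "zero_object C Z \<longleftrightarrow> Z \<in> Obj C \<and>
     (\<forall>A \<in> Obj C. (\<exists>!f. f \<in> arrows C A Z) \<and> (\<exists>!f. f \<in> arrows C Z A))"

text \<open>
  \<open>is_pushout C f g h k\<close>: the square \<open>h \<cdot> f = k \<cdot> g\<close> is a push-out of
  \<open>Tgt f \<leftarrow> Src f = Src g \<rightarrow> Tgt g\<close>, where \<open>h\<close> starts at \<open>Tgt f\<close> and \<open>k\<close> starts at \<open>Tgt g\<close>.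
\<close>

definition is_pushout :: "('o, 'm, 'z) cat_scheme \<Rightarrow> 'm \<Rightarrow> 'm \<Rightarrow> 'm \<Rightarrow> 'm \<Rightarrow> bool" where
  "is_pushout C f g h k \<longleftrightarrow>
     f \<in> Arr C \<and> g \<in> Arr C \<and> h \<in> Arr C \<and> k \<in> Arr C \<and> Src C f = Src C g \<and>
     Src C h = Tgt C f \<and> Src C k = Tgt C g \<and> Tgt C h = Tgt C k \<and>
     h \<cdot>\<^bsub>C\<^esub> f = k \<cdot>\<^bsub>C\<^esub> g \<and>
     (\<forall>Z \<in> Obj C. \<forall>u \<in> arrows C (Tgt C f) Z. \<forall>v \<in> arrows C (Tgt C g) Z.
        u \<cdot>\<^bsub>C\<^esub> f = v \<cdot>\<^bsub>C\<^esub> g \<longrightarrow>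
        (\<exists>!w. w \<in> arrows C (Tgt C h) Z \<and> w \<cdot>\<^bsub>C\<^esub> h = u \<and> w \<cdot>\<^bsub>C\<^esub> k = v))"

definition is_coproduct :: "('o, 'm, 'z) cat_scheme \<Rightarrow> 'm \<Rightarrow> 'm \<Rightarrow> bool" where
  "is_coproduct C i\<^sub>1 i\<^sub>2 \<longleftrightarrow>
     i\<^sub>1 \<in> Arr C \<and> i\<^sub>2 \<in> Arr C \<and> Tgt C i\<^sub>1 = Tgt C i\<^sub>2 \<and>
     (\<forall>Z \<in> Obj C. \<forall>u \<in> arrows C (Src C i\<^sub>1) Z. \<forall>v \<in> arrows C (Src C i\<^sub>2) Z.
        (\<exists>!w. w \<in> arrows C (Tgt C i\<^sub>1) Z \<and> w \<cdot>\<^bsub>C\<^esub> i\<^sub>1 = u \<and> w \<cdot>\<^bsub>C\<^esub> i\<^sub>2 = v))"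

record ('o, 'm) waldcat = "('o, 'm) cat" +
  Zero :: 'o
  Cof :: "'m set"
  Weq :: "'m set"

definition zero_map :: "('o, 'm) waldcat \<Rightarrow> 'm \<Rightarrow> bool" where
  "zero_map C f \<longleftrightarrow>
     (\<exists>A \<in> Obj C. \<exists>B \<in> Obj C. \<exists>u \<in> arrows C A (Zero C). \<exists>v \<in> arrows C (Zero C) B.
        f = v \<cdot>\<^bsub>C\<^esub> u)"

text \<open>Waldhausen's axioms Cof 1--3 and Weq 1--2; \<open>gluing\<close> is Weq 2.\<close>

locale waldhausen_category = category C
  for C :: "('o, 'm) waldcat" (structure) +
  assumes zero: "zero_object C (Zero C)"
    and Cof_subset: "Cof C \<subseteq> Arr C"
    and Cof_Cmp: "f \<in> Cof C \<Longrightarrow> g \<in> Cof C \<Longrightarrow> Tgt C f = Src C g \<Longrightarrow> g \<cdot> f \<in> Cof C"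
    and Cof_iso: "cat_iso C f \<Longrightarrow> f \<in> Cof C"
    and Cof_zero: "A \<in> Obj C \<Longrightarrow> f \<in> arrows C (Zero C) A \<Longrightarrow> f \<in> Cof C"
    and pushout_exists: "f \<in> Cof C \<Longrightarrow> g \<in> Arr C \<Longrightarrow> Src C f = Src C g \<Longrightarrow>
           \<exists>h k. is_pushout C f g h k"
    and Cof_pushout: "f \<in> Cof C \<Longrightarrow> is_pushout C f g h k \<Longrightarrow> k \<in> Cof C"
    and Weq_subset: "Weq C \<subseteq> Arr C"
    and Weq_Cmp: "f \<in> Weq C \<Longrightarrow> g \<in> Weq C \<Longrightarrow> Tgt C f = Src C g \<Longrightarrow> g \<cdot> f \<in> Weq C"
    and Weq_iso: "cat_iso C f \<Longrightarrow> f \<in> Weq C"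
    and gluing: "\<lbrakk> f \<in> Cof C; is_pushout C f g h k; f' \<in> Cof C; is_pushout C f' g' h' k';
           a \<in> Weq C; b \<in> Weq C; c \<in> Weq C;
           a \<in> arrows C (Src C f) (Src C f'); b \<in> arrows C (Tgt C f) (Tgt C f');
           c \<in> arrows C (Tgt C g) (Tgt C g');
           b \<cdot> f = f' \<cdot> a; c \<cdot> g = g' \<cdot> a;
           w \<in> arrows C (Tgt C h) (Tgt C h'); w \<cdot> h = h' \<cdot> b; w \<cdot> k = k' \<cdot> c \<rbrakk>
         \<Longrightarrow> w \<in> Weq C"

text \<open>
  A cofiber sequence \<open>A \<rightarrowtail> B \<twoheadrightarrow> B/A\<close> is the pair \<open>(i, p)\<close> of its maps; \<open>B/A\<close> is
  any push-out of \<open>B \<leftarrow> A \<rightarrow> *\<close>, so it is determined only up to canonical isomorphism.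
\<close>

definition cofseq :: "('o, 'm) waldcat \<Rightarrow> 'm \<Rightarrow> 'm \<Rightarrow> bool" where
  "cofseq C i p \<longleftrightarrow> i \<in> Cof C \<and>
     (\<exists>t \<in> arrows C (Src C i) (Zero C). \<exists>z \<in> arrows C (Zero C) (Tgt C p).
        is_pushout C i t p z)"

definition is_functor ::
    "('o, 'm, 'y) cat_scheme \<Rightarrow> ('p, 'n, 'z) cat_scheme \<Rightarrow> ('o \<Rightarrow> 'p) \<Rightarrow> ('m \<Rightarrow> 'n) \<Rightarrow> bool" where
  "is_functor C D Fo Fm \<longleftrightarrow>
     (\<forall>A \<in> Obj C. Fo A \<in> Obj D) \<and>
     (\<forall>f \<in> Arr C. Fm f \<in> arrows D (Fo (Src C f)) (Fo (Tgt C f))) \<and>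
     (\<forall>A \<in> Obj C. Fm (Ide C A) = Ide D (Fo A)) \<and>
     (\<forall>f \<in> Arr C. \<forall>g \<in> Arr C. Tgt C f = Src C g \<longrightarrow>
        Fm (g \<cdot>\<^bsub>C\<^esub> f) = Fm g \<cdot>\<^bsub>D\<^esub> Fm f)"

definition exact_functor ::
    "('o, 'm) waldcat \<Rightarrow> ('p, 'n) waldcat \<Rightarrow> ('o \<Rightarrow> 'p) \<Rightarrow> ('m \<Rightarrow> 'n) \<Rightarrow> bool" where
  "exact_functor C D Fo Fm \<longleftrightarrow>
     is_functor C D Fo Fm \<and> Fo (Zero C) = Zero D \<and>
     (\<forall>f \<in> Cof C. Fm f \<in> Cof D) \<and> (\<forall>f \<in> Weq C. Fm f \<in> Weq D) \<and>
     (\<forall>f g h k. f \<in> Cof C \<and> is_pushout C f g h k \<longrightarrow>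
        is_pushout D (Fm f) (Fm g) (Fm h) (Fm k))"

definition prod_cat ::
    "('o, 'm, 'y) cat_scheme \<Rightarrow> ('p, 'n, 'z) cat_scheme \<Rightarrow> ('o \<times> 'p, 'm \<times> 'n) cat" where
  "prod_cat C D = \<lparr>
     Obj = Obj C \<times> Obj D, Arr = Arr C \<times> Arr D,
     Src = map_prod (Src C) (Src D), Tgt = map_prod (Tgt C) (Tgt D),
     Ide = map_prod (Ide C) (Ide D),
     Cmp = (\<lambda>(g, g') (f, f'). (g \<cdot>\<^bsub>C\<^esub> f, g' \<cdot>\<^bsub>D\<^esub> f')) \<rparr>"

text \<open>
  Biexactness in Waldhausen's sense: exactness in each variable, and for cofibrations
  \<open>A \<rightarrowtail> A'\<close>, \<open>B \<rightarrowtail> B'\<close> the induced map from the push-out of \<open>A' \<and> B\<close> and \<open>A \<and> B'\<close> under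
  \<open>A \<and> B\<close> to \<open>A' \<and> B'\<close> is a cofibration.
\<close>

definition biexact_functor ::
    "('o, 'm) waldcat \<Rightarrow> ('p, 'n) waldcat \<Rightarrow> ('q, 'r) waldcat
      \<Rightarrow> ('o \<times> 'p \<Rightarrow> 'q) \<Rightarrow> ('m \<times> 'n \<Rightarrow> 'r) \<Rightarrow> bool" where
  "biexact_functor C D E Fo Fm \<longleftrightarrow>
     is_functor (prod_cat C D) E Fo Fm \<and>
     (\<forall>A \<in> Obj C. exact_functor D E (\<lambda>B. Fo (A, B)) (\<lambda>g. Fm (Ide C A, g))) \<and>
     (\<forall>B \<in> Obj D. exact_functor C E (\<lambda>A. Fo (A, B)) (\<lambda>f. Fm (f, Ide D B))) \<and>
     (\<forall>i \<in> Cof C. \<forall>j \<in> Cof D. \<forall>h k.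
        is_pushout E (Fm (i, Ide D (Src D j))) (Fm (Ide C (Src C i), j)) h k \<longrightarrow>
        (\<forall>w \<in> arrows E (Tgt E h) (Fo (Tgt C i, Tgt D j)).
           w \<cdot>\<^bsub>E\<^esub> h = Fm (Ide C (Tgt C i), j) \<and> w \<cdot>\<^bsub>E\<^esub> k = Fm (i, Ide D (Tgt D j))
           \<longrightarrow> w \<in> Cof E))"


section \<open>Groups given by generators and relations\<close>

datatype (gens: 'g) gterm =
  GGen 'g | GZero | GAdd "'g gterm" "'g gterm" | GNeg "'g gterm"

instantiation gterm :: (type) "{zero, plus, uminus}"
begin
definition zero_gterm where "0 = GZero"
definition plus_gterm where "s + t = GAdd s t"
definition uminus_gterm where "- t = GNeg t"
instance ..
end

definition gterms :: "'g set \<Rightarrow> 'g gterm set" where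
  "gterms S = {t. gens t \<subseteq> S}"

inductive geq :: "'g set \<Rightarrow> ('g gterm \<times> 'g gterm) set \<Rightarrow> 'g gterm \<Rightarrow> 'g gterm \<Rightarrow> bool"
  for S R where
  geq_rel: "(s, t) \<in> R \<Longrightarrow> s \<in> gterms S \<Longrightarrow> t \<in> gterms S \<Longrightarrow> geq S R s t"
| geq_refl: "t \<in> gterms S \<Longrightarrow> geq S R t t"
| geq_sym: "geq S R s t \<Longrightarrow> geq S R t s"
| geq_trans: "geq S R s t \<Longrightarrow> geq S R t u \<Longrightarrow> geq S R s u"
| geq_add: "geq S R s s' \<Longrightarrow> geq S R t t' \<Longrightarrow> geq S R (s + t) (s' + t')"
| geq_neg: "geq S R s s' \<Longrightarrow> geq S R (- s) (- s')"
| geq_assoc: "s \<in> gterms S \<Longrightarrow> t \<in> gterms S \<Longrightarrow> u \<in> gterms S \<Longrightarrow>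
     geq S R ((s + t) + u) (s + (t + u))"
| geq_zero_left: "t \<in> gterms S \<Longrightarrow> geq S R (0 + t) t"
| geq_neg_left: "t \<in> gterms S \<Longrightarrow> geq S R (- t + t) 0"

definition gclass :: "'g set \<Rightarrow> ('g gterm \<times> 'g gterm) set \<Rightarrow> 'g gterm \<Rightarrow> 'g gterm set" where
  "gclass S R t = {u. geq S R t u}"

definition presented_group ::
    "'g set \<Rightarrow> ('g gterm \<times> 'g gterm) set \<Rightarrow> 'g gterm set monoid" where
  "presented_group S R = \<lparr>
     carrier = gclass S R ` gterms S,
     mult = (\<lambda>X Y. {u. \<exists>s\<in>X. \<exists>t\<in>Y. geq S R (s + t) u}),
     one = gclass S R 0 \<rparr>"


lemma gterms_simps [simp]:
  "GGen g \<in> gterms S \<longleftrightarrow> g \<in> S"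
  "(0::'g gterm) \<in> gterms S"
  "s + t \<in> gterms S \<longleftrightarrow> s \<in> gterms S \<and> t \<in> gterms S"
  "- t \<in> gterms S \<longleftrightarrow> t \<in> gterms S"
  by (auto simp: gterms_def zero_gterm_def plus_gterm_def uminus_gterm_def)

lemma geq_gterms: "geq S R s t \<Longrightarrow> s \<in> gterms S \<and> t \<in> gterms S"
  by (induction rule: geq.induct) auto

lemma gclass_eq_iff:
  assumes "s \<in> gterms S" shows "gclass S R s = gclass S R t \<longleftrightarrow> geq S R s t"
  using assms unfolding gclass_def set_eq_iff mem_Collect_eq
  by (meson geq_refl geq_sym geq_trans)

lemma gclass_eqI: "geq S R s t \<Longrightarrow> gclass S R s = gclass S R t"
  using gclass_eq_iff geq_gterms by blast

lemma presented_mult: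
  assumes "s \<in> gterms S" "t \<in> gterms S"
  shows "gclass S R s \<otimes>\<^bsub>presented_group S R\<^esub> gclass S R t = gclass S R (s + t)"
  using assms unfolding presented_group_def gclass_def
  by (auto intro: geq_add geq_refl geq_trans geq_sym)

lemma presented_carrier: "carrier (presented_group S R) = gclass S R ` gterms S"
  by (simp add: presented_group_def)

lemma presented_one: "\<one>\<^bsub>presented_group S R\<^esub> = gclass S R 0"
  by (simp add: presented_group_def)

lemma presented_group_group: "group (presented_group S R)"
proof (rule groupI)
  show "\<one>\<^bsub>presented_group S R\<^esub> \<in> carrier (presented_group S R)"
    by (simp add: presented_one presented_carrier)
next
  fix x assume "x \<in> carrier (presented_group S R)"
  then obtain t where t: "t \<in> gterms S" "x = gclass S R t" by (auto simp: presented_carrier)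
  show "\<one>\<^bsub>presented_group S R\<^esub> \<otimes>\<^bsub>presented_group S R\<^esub> x = x"
    using t by (simp add: presented_one presented_mult gclass_eq_iff geq_zero_left)
  have "gclass S R (- t) \<otimes>\<^bsub>presented_group S R\<^esub> x = \<one>\<^bsub>presented_group S R\<^esub>"
    using t by (simp add: presented_one presented_mult gclass_eq_iff geq_neg_left)
  then show "\<exists>y\<in>carrier (presented_group S R). y \<otimes>\<^bsub>presented_group S R\<^esub> x = \<one>\<^bsub>presented_group S R\<^esub>"
    using t by (auto simp: presented_carrier)
qed (auto simp: presented_carrier presented_mult del: equalityI intro!: gclass_eqI geq_assoc)

lemma presented_inv:
  assumes "t \<in> gterms S"
  shows "inv\<^bsub>presented_group S R\<^esub> gclass S R t = gclass S R (- t)"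
proof -
  interpret group "presented_group S R" by (rule presented_group_group)
  show ?thesis
    by (rule inv_equality)
       (use assms in \<open>auto simp: presented_one presented_mult gclass_eq_iff geq_neg_left presented_carrier\<close>)
qed

primrec geval :: "('a, 'z) monoid_scheme \<Rightarrow> ('g \<Rightarrow> 'a) \<Rightarrow> 'g gterm \<Rightarrow> 'a" where
  "geval G f (GGen g) = f g"
| "geval G f GZero = \<one>\<^bsub>G\<^esub>"
| "geval G f (GAdd s t) = geval G f s \<otimes>\<^bsub>G\<^esub> geval G f t"
| "geval G f (GNeg t) = inv\<^bsub>G\<^esub> geval G f t"

lemma geval_simps [simp]:
  "geval G f 0 = \<one>\<^bsub>G\<^esub>"
  "geval G f (s + t) = geval G f s \<otimes>\<^bsub>G\<^esub> geval G f t"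
  "geval G f (- t) = inv\<^bsub>G\<^esub> geval G f t"
  by (auto simp: zero_gterm_def plus_gterm_def uminus_gterm_def)

lemma gterm_cases_induct [consumes 1, case_names gen zero add neg]:
  assumes "t \<in> gterms S" "\<And>g. g \<in> S \<Longrightarrow> P (GGen g)" "P 0"
    "\<And>s t. s \<in> gterms S \<Longrightarrow> t \<in> gterms S \<Longrightarrow> P s \<Longrightarrow> P t \<Longrightarrow> P (s + t)"
    "\<And>t. t \<in> gterms S \<Longrightarrow> P t \<Longrightarrow> P (- t)"
  shows "P t"
  using assms(1)
proof (induction t)
  case (GGen g) then show ?case using assms(2) by simp
next
  case GZero then show ?case using assms(3) by (simp add: zero_gterm_def)
next
  case (GAdd s t) then show ?case using assms(4)[of s t] by (simp add: gterms_def plus_gterm_def)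
next
  case (GNeg t) then show ?case using assms(5)[of t] by (simp add: gterms_def uminus_gterm_def)
qed

lemma geval_closed:
  assumes "group G" "f \<in> S \<rightarrow> carrier G" "t \<in> gterms S" shows "geval G f t \<in> carrier G"
proof -
  interpret group G by fact
  from assms(3) show ?thesis
    by (induction rule: gterm_cases_induct) (use assms(2) in auto)
qed

lemma geval_geq:
  assumes G: "group G" and f: "f \<in> S \<rightarrow> carrier G"
    and R: "\<And>s t. (s, t) \<in> R \<Longrightarrow> s \<in> gterms S \<Longrightarrow> t \<in> gterms S \<Longrightarrow> geval G f s = geval G f t"
    and "geq S R s t"
  shows "geval G f s = geval G f t"
proof -
  interpret group G by fact
  from assms(4) show ?thesis
    by (induction rule: geq.induct)
       (auto simp: R geval_closed[OF G f] m_assoc)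
qed

lemma presented_hom_eqI:
  assumes G: "group G" and h: "h \<in> hom (presented_group S R) G" "k \<in> hom (presented_group S R) G"
    and "\<And>g. g \<in> S \<Longrightarrow> h (gclass S R (GGen g)) = k (gclass S R (GGen g))"
    and "u \<in> carrier (presented_group S R)"
  shows "h u = k u"
proof -
  interpret P: group "presented_group S R" by (rule presented_group_group)
  interpret G: group G by fact
  interpret h: group_hom "presented_group S R" G h by unfold_locales (use h in auto)
  interpret k: group_hom "presented_group S R" G k by unfold_locales (use h in auto)
  have "h (gclass S R t) = k (gclass S R t)" if "t \<in> gterms S" for t
    using that
  proof (induction rule: gterm_cases_induct)
    case zero then show ?case using h.hom_one k.hom_one by (simp add: presented_one)
  next
    case (add s t)
    then show ?case
      using h.hom_mult[of "gclass S R s" "gclass S R t"] k.hom_mult[of "gclass S R s" "gclass S R t"]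
      by (simp add: presented_mult presented_carrier)
  next
    case (neg t)
    then show ?case
      using h.hom_inv[of "gclass S R t"] k.hom_inv[of "gclass S R t"]
      by (simp add: presented_inv presented_carrier)
  qed (use assms in auto)
  then show ?thesis using assms(5) by (auto simp: presented_carrier)
qed

lemma presented_universal:
  assumes G: "group G" and f: "f \<in> S \<rightarrow> carrier G"
    and R: "\<And>s t. (s, t) \<in> R \<Longrightarrow> s \<in> gterms S \<Longrightarrow> t \<in> gterms S \<Longrightarrow> geval G f s = geval G f t"
  shows "\<exists>!h. h \<in> hom (presented_group S R) G \<inter> extensional (carrier (presented_group S R)) \<and>
              (\<forall>g\<in>S. h (gclass S R (GGen g)) = f g)"
proof (rule ex_ex1I)
  interpret group G by fact
  define h where "h = restrict (\<lambda>X. geval G f (SOME t. t \<in> X)) (carrier (presented_group S R))"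
  have h: "h (gclass S R t) = geval G f t" if t: "t \<in> gterms S" for t
  proof -
    have "t \<in> gclass S R t" using t by (simp add: gclass_def geq_refl)
    then have "(SOME u. u \<in> gclass S R t) \<in> gclass S R t" by (rule someI)
    then have "geval G f t = geval G f (SOME u. u \<in> gclass S R t)"
      using geval_geq[OF G f R] by (simp add: gclass_def)
    then show ?thesis using t by (simp add: h_def presented_carrier)
  qed
  have "h \<in> hom (presented_group S R) G"
    by (rule homI) (auto simp: presented_carrier presented_mult h geval_closed[OF G f])
  moreover have "h \<in> extensional (carrier (presented_group S R))" by (simp add: h_def)
  moreover have "\<forall>g\<in>S. h (gclass S R (GGen g)) = f g" by (simp add: h)
  ultimately show "\<exists>h. h \<in> hom (presented_group S R) G \<inter> extensional (carrier (presented_group S R)) \<and>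
              (\<forall>g\<in>S. h (gclass S R (GGen g)) = f g)" by blast
next
  fix h k
  assume hk: "h \<in> hom (presented_group S R) G \<inter> extensional (carrier (presented_group S R)) \<and>
              (\<forall>g\<in>S. h (gclass S R (GGen g)) = f g)"
    "k \<in> hom (presented_group S R) G \<inter> extensional (carrier (presented_group S R)) \<and>
              (\<forall>g\<in>S. k (gclass S R (GGen g)) = f g)"
  have "h u = k u" if "u \<in> carrier (presented_group S R)" for u
    by (rule presented_hom_eqI[OF G _ _ _ that]) (use hk in auto)
  then show "h = k"
    using hk by (intro extensionalityI[of _ "carrier (presented_group S R)"]) auto
qed


section \<open>Tensor products of abelian groups\<close>

inductive_set tensor_rel ::
    "'a monoid \<Rightarrow> 'b monoid \<Rightarrow> (('a \<times> 'b) gterm \<times> ('a \<times> 'b) gterm) set"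
  for A B where
  "(GGen (a \<otimes>\<^bsub>A\<^esub> a', b), GGen (a, b) + GGen (a', b)) \<in> tensor_rel A B"
    if "a \<in> carrier A" "a' \<in> carrier A" "b \<in> carrier B"
| "(GGen (a, b \<otimes>\<^bsub>B\<^esub> b'), GGen (a, b) + GGen (a, b')) \<in> tensor_rel A B"
    if "a \<in> carrier A" "b \<in> carrier B" "b' \<in> carrier B"
| "(s + t, t + s) \<in> tensor_rel A B"

definition tensor_group :: "'a monoid \<Rightarrow> 'b monoid \<Rightarrow> ('a \<times> 'b) gterm set monoid" where
  "tensor_group A B = presented_group (carrier A \<times> carrier B) (tensor_rel A B)"

definition tensor_elt :: "'a monoid \<Rightarrow> 'b monoid \<Rightarrow> 'a \<Rightarrow> 'b \<Rightarrow> ('a \<times> 'b) gterm set" where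
  "tensor_elt A B a b = gclass (carrier A \<times> carrier B) (tensor_rel A B) (GGen (a, b))"

text \<open>The homomorphism out of \<open>A \<otimes> B\<close> induced by a biadditive map.\<close>

definition tensor_lift ::
    "'a monoid \<Rightarrow> 'b monoid \<Rightarrow> 'c monoid \<Rightarrow> ('a \<Rightarrow> 'b \<Rightarrow> 'c) \<Rightarrow> ('a \<times> 'b) gterm set \<Rightarrow> 'c" where
  "tensor_lift A B G f = (THE h.
     h \<in> hom (tensor_group A B) G \<inter> extensional (carrier (tensor_group A B)) \<and>
     (\<forall>a\<in>carrier A. \<forall>b\<in>carrier B. h (tensor_elt A B a b) = f a b))"


lemma tensor_elt_closed:
  "a \<in> carrier A \<Longrightarrow> b \<in> carrier B \<Longrightarrow> tensor_elt A B a b \<in> carrier (tensor_group A B)"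
  by (auto simp: tensor_elt_def tensor_group_def presented_carrier)

lemma tensor_comm_group: "comm_group (tensor_group A B)"
  unfolding tensor_group_def
  by (rule group.group_comm_groupI[OF presented_group_group])
     (auto simp: presented_carrier presented_mult del: equalityI intro!: gclass_eqI geq_rel tensor_rel.intros)

lemma tensor_biadditive:
  assumes "monoid A" "monoid B"
  shows "biadditive A B (tensor_group A B) (tensor_elt A B)"
proof -
  interpret A: monoid A by fact
  interpret B: monoid B by fact
  show ?thesis unfolding biadditive_def
    by (auto del: equalityI intro!: homI tensor_elt_closed)
       (auto simp: tensor_elt_def tensor_group_def presented_mult
          del: equalityI intro!: gclass_eqI geq_rel tensor_rel.intros)
qed

text \<open>The universal property of the tensor product, for maps whose values commute; the group of
  values need not be abelian.\<close>

lemma tensor_universal: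
  assumes G: "group G" and f: "biadditive A B G f"
    and comm: "\<And>a b a' b'. a \<in> carrier A \<Longrightarrow> b \<in> carrier B \<Longrightarrow> a' \<in> carrier A \<Longrightarrow> b' \<in> carrier B \<Longrightarrow>
       f a b \<otimes>\<^bsub>G\<^esub> f a' b' = f a' b' \<otimes>\<^bsub>G\<^esub> f a b"
  shows "\<exists>!h. h \<in> hom (tensor_group A B) G \<inter> extensional (carrier (tensor_group A B)) \<and>
              (\<forall>a\<in>carrier A. \<forall>b\<in>carrier B. h (tensor_elt A B a b) = f a b)"
proof -
  interpret group G by fact
  define F where "F = (\<lambda>(a, b). f a b)"
  have F: "F \<in> carrier A \<times> carrier B \<rightarrow> carrier G"
    using f by (auto simp: F_def biadditive_def hom_def)
  note cl = geval_closed[OF G F]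
  have Fc: "F g \<in> carrier G" if "g \<in> carrier A \<times> carrier B" for g using F that by auto
  have mult_comm: "(x \<otimes>\<^bsub>G\<^esub> y) \<otimes>\<^bsub>G\<^esub> z = z \<otimes>\<^bsub>G\<^esub> (x \<otimes>\<^bsub>G\<^esub> y)"
    if "x \<in> carrier G" "y \<in> carrier G" "z \<in> carrier G"
      "x \<otimes>\<^bsub>G\<^esub> z = z \<otimes>\<^bsub>G\<^esub> x" "y \<otimes>\<^bsub>G\<^esub> z = z \<otimes>\<^bsub>G\<^esub> y" for x y z
  proof -
    have "(x \<otimes>\<^bsub>G\<^esub> y) \<otimes>\<^bsub>G\<^esub> z = x \<otimes>\<^bsub>G\<^esub> (z \<otimes>\<^bsub>G\<^esub> y)" using that by (simp add: m_assoc)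
    also have "\<dots> = (z \<otimes>\<^bsub>G\<^esub> x) \<otimes>\<^bsub>G\<^esub> y" using that by (simp flip: m_assoc)
    finally show ?thesis using that by (simp add: m_assoc)
  qed
  have inv_comm: "inv\<^bsub>G\<^esub> x \<otimes>\<^bsub>G\<^esub> y = y \<otimes>\<^bsub>G\<^esub> inv\<^bsub>G\<^esub> x"
    if "x \<in> carrier G" "y \<in> carrier G" "x \<otimes>\<^bsub>G\<^esub> y = y \<otimes>\<^bsub>G\<^esub> x" for x y
    using that by (metis inv_closed inv_solve_left inv_solve_right m_assoc m_closed)
  have c1: "geval G F t \<otimes>\<^bsub>G\<^esub> F g = F g \<otimes>\<^bsub>G\<^esub> geval G F t"
    if "t \<in> gterms (carrier A \<times> carrier B)" and g: "g \<in> carrier A \<times> carrier B" for g t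
    using that(1)
  proof (induction rule: gterm_cases_induct)
    case (gen g') then show ?case using g by (auto simp: F_def comm)
  next
    case zero then show ?case using Fc[OF g] by simp
  next
    case (add s t) then show ?case using Fc[OF g] cl mult_comm by simp
  next
    case (neg t) then show ?case using Fc[OF g] cl inv_comm by simp
  qed
  have c2: "geval G F s \<otimes>\<^bsub>G\<^esub> geval G F t = geval G F t \<otimes>\<^bsub>G\<^esub> geval G F s"
    if "s \<in> gterms (carrier A \<times> carrier B)" and t: "t \<in> gterms (carrier A \<times> carrier B)" for s t
    using that(1)
  proof (induction rule: gterm_cases_induct)
    case (gen g) then show ?case using c1[OF t gen] by simp
  next
    case zero then show ?case using cl[OF t] by simp
  next
    case (add u v) then show ?case using cl t mult_comm by simp
  next
    case (neg s) then show ?case using cl t inv_comm by simp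
  qed
  have "\<exists>!h. h \<in> hom (tensor_group A B) G \<inter> extensional (carrier (tensor_group A B)) \<and>
          (\<forall>g\<in>carrier A \<times> carrier B. h (gclass (carrier A \<times> carrier B) (tensor_rel A B) (GGen g)) = F g)"
    unfolding tensor_group_def
  proof (rule presented_universal[OF G F])
    fix s t assume "(s, t) \<in> tensor_rel A B"
      "s \<in> gterms (carrier A \<times> carrier B)" "t \<in> gterms (carrier A \<times> carrier B)"
    then show "geval G F s = geval G F t"
      by (induction rule: tensor_rel.induct)
         (use f c2 in \<open>auto simp: F_def biadditive_def hom_def\<close>)
  qed
  then show ?thesis by (simp add: tensor_elt_def F_def split_paired_Ball_Sigma)
qed


section \<open>Stable quadratic modules\<close>

record ('a, 'b) sqmod =
  sq0 :: "'a monoid"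
  sq1 :: "'b monoid"
  sqd :: "'b \<Rightarrow> 'a"
  sqw :: "('a set \<times> 'a set) gterm set \<Rightarrow> 'b"

definition ab_tensor :: "'a monoid \<Rightarrow> ('a set \<times> 'a set) gterm set monoid" where
  "ab_tensor G = tensor_group (abelianization G) (abelianization G)"

definition ab_tensor_elt :: "'a monoid \<Rightarrow> 'a \<Rightarrow> 'a \<Rightarrow> ('a set \<times> 'a set) gterm set" where
  "ab_tensor_elt G x y =
     tensor_elt (abelianization G) (abelianization G) (ab_class G x) (ab_class G y)"

definition sqbr :: "('a, 'b) sqmod \<Rightarrow> 'a \<Rightarrow> 'a \<Rightarrow> 'b" where
  "sqbr Q x y = sqw Q (ab_tensor_elt (sq0 Q) x y)"

locale stable_quadratic_module =
  fixes Q :: "('a, 'b) sqmod"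
  assumes group0: "group (sq0 Q)"
    and group1: "group (sq1 Q)"
    and d_hom: "sqd Q \<in> hom (sq1 Q) (sq0 Q)"
    and w_hom: "sqw Q \<in> hom (ab_tensor (sq0 Q)) (sq1 Q)"
    and d_br: "x \<in> carrier (sq0 Q) \<Longrightarrow> y \<in> carrier (sq0 Q) \<Longrightarrow>
           sqd Q (sqbr Q x y) = gcommutator (sq0 Q) y x"
    and br_d: "c \<in> carrier (sq1 Q) \<Longrightarrow> d \<in> carrier (sq1 Q) \<Longrightarrow>
           sqbr Q (sqd Q c) (sqd Q d) = gcommutator (sq1 Q) d c"
    and br_sym: "x \<in> carrier (sq0 Q) \<Longrightarrow> y \<in> carrier (sq0 Q) \<Longrightarrow>
           sqw Q (ab_tensor_elt (sq0 Q) x y \<otimes>\<^bsub>ab_tensor (sq0 Q)\<^esub> ab_tensor_elt (sq0 Q) y x)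
             = \<one>\<^bsub>sq1 Q\<^esub>"

definition sqmod_hom :: "('a, 'b) sqmod \<Rightarrow> ('c, 'd) sqmod \<Rightarrow> (('a \<Rightarrow> 'c) \<times> ('b \<Rightarrow> 'd)) set" where
  "sqmod_hom M N = {(h0, h1).
     h0 \<in> hom (sq0 M) (sq0 N) \<inter> extensional (carrier (sq0 M)) \<and>
     h1 \<in> hom (sq1 M) (sq1 N) \<inter> extensional (carrier (sq1 M)) \<and>
     (\<forall>c\<in>carrier (sq1 M). h0 (sqd M c) = sqd N (h1 c)) \<and>
     (\<forall>x\<in>carrier (sq0 M). \<forall>y\<in>carrier (sq0 M). h1 (sqbr M x y) = sqbr N (h0 x) (h0 y))}"

lemma abelianization_carrier: "carrier (abelianization G) = ab_class G ` carrier G"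
  by (simp add: abelianization_def ab_class_def[abs_def] carrier_FactGroup)

lemma abelianization_comm_group: "group G \<Longrightarrow> comm_group (abelianization G)"
  unfolding abelianization_def by (rule group.derived_quot_is_comm_group)

lemma ab_class_hom: "group G \<Longrightarrow> ab_class G \<in> hom G (abelianization G)"
  unfolding abelianization_def ab_class_def[abs_def]
  by (rule normal.r_coset_hom_Mod[OF group.derived_self_is_normal])

lemma hom_kills_commutators:
  assumes G: "group G" and K: "group K" and f: "f \<in> hom G K"
    and comm: "\<And>x y. x \<in> carrier G \<Longrightarrow> y \<in> carrier G \<Longrightarrow> f x \<otimes>\<^bsub>K\<^esub> f y = f y \<otimes>\<^bsub>K\<^esub> f x"
    and xy: "x \<in> carrier G" "y \<in> carrier G" "ab_class G x = ab_class G y"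
  shows "f x = f y"
proof -
  interpret group_hom G K f using G K f by (simp add: group_hom_def group_hom_axioms_def)
  have sub: "subgroup (kernel G K f) G" by (rule subgroup_kernel)
  have "derived_set G (carrier G) \<subseteq> kernel G K f"
  proof -
    have "f (a \<otimes>\<^bsub>G\<^esub> b \<otimes>\<^bsub>G\<^esub> inv\<^bsub>G\<^esub> a \<otimes>\<^bsub>G\<^esub> inv\<^bsub>G\<^esub> b) = \<one>\<^bsub>K\<^esub>" if "a \<in> carrier G" "b \<in> carrier G" for a b
    proof -
      have "f (a \<otimes>\<^bsub>G\<^esub> b \<otimes>\<^bsub>G\<^esub> inv\<^bsub>G\<^esub> a \<otimes>\<^bsub>G\<^esub> inv\<^bsub>G\<^esub> b) = (f a \<otimes>\<^bsub>K\<^esub> f b) \<otimes>\<^bsub>K\<^esub> inv\<^bsub>K\<^esub> f a \<otimes>\<^bsub>K\<^esub> inv\<^bsub>K\<^esub> f b"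
        using that by simp
      also have "\<dots> = (f b \<otimes>\<^bsub>K\<^esub> f a) \<otimes>\<^bsub>K\<^esub> inv\<^bsub>K\<^esub> f a \<otimes>\<^bsub>K\<^esub> inv\<^bsub>K\<^esub> f b"
        using that comm by simp
      also have "\<dots> = \<one>\<^bsub>K\<^esub>" using that by (simp add: H.m_assoc)
      finally show ?thesis .
    qed
    then show ?thesis by (auto simp: kernel_def)
  qed
  then have D: "derived G (carrier G) \<subseteq> kernel G K f"
    unfolding derived_def by (rule G.generate_subgroup_incl[OF _ sub])
  have "x \<in> derived G (carrier G) #>\<^bsub>G\<^esub> y"
    using xy G.rcos_self[OF xy(1) G.derived_is_subgroup[OF subset_refl]] by (simp add: ab_class_def)
  then obtain d where "d \<in> derived G (carrier G)" "x = d \<otimes>\<^bsub>G\<^esub> y"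
    by (auto simp: r_coset_def)
  then show ?thesis using D xy by (auto simp: kernel_def)
qed

lemma biadditive_commute:
  assumes G: "group G" and K: "group K" and f: "biadditive G G K f"
    and xs: "x \<in> carrier G" "y \<in> carrier G" "x' \<in> carrier G" "y' \<in> carrier G"
  shows "f x y \<otimes>\<^bsub>K\<^esub> f x' y' = f x' y' \<otimes>\<^bsub>K\<^esub> f x y"
proof -
  interpret G: group G by fact
  interpret K: group K by fact
  have cl: "f a b \<in> carrier K" if "a \<in> carrier G" "b \<in> carrier G" for a b
    using f that by (auto simp: biadditive_def hom_def)
  have r: "f a (b \<otimes>\<^bsub>G\<^esub> c) = f a b \<otimes>\<^bsub>K\<^esub> f a c" if "a \<in> carrier G" "b \<in> carrier G" "c \<in> carrier G" for a b c
    using f that by (auto simp: biadditive_def hom_def)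
  have l: "f (a \<otimes>\<^bsub>G\<^esub> b) c = f a c \<otimes>\<^bsub>K\<^esub> f b c" if "a \<in> carrier G" "b \<in> carrier G" "c \<in> carrier G" for a b c
    using f that by (auto simp: biadditive_def hom_def)
  have A: "f a b \<otimes>\<^bsub>K\<^esub> f a' b' = f a' b' \<otimes>\<^bsub>K\<^esub> f a b"
    if "a \<in> carrier G" "b \<in> carrier G" "a' \<in> carrier G" "b' \<in> carrier G" for a b a' b'
  proof -
    have e1: "f (a' \<otimes>\<^bsub>G\<^esub> a) (b \<otimes>\<^bsub>G\<^esub> b') = (f a' b \<otimes>\<^bsub>K\<^esub> f a' b') \<otimes>\<^bsub>K\<^esub> (f a b \<otimes>\<^bsub>K\<^esub> f a b')"
      using that l[of a' a "b \<otimes>\<^bsub>G\<^esub> b'"] by (simp add: r)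
    have e2: "f (a' \<otimes>\<^bsub>G\<^esub> a) (b \<otimes>\<^bsub>G\<^esub> b') = (f a' b \<otimes>\<^bsub>K\<^esub> f a b) \<otimes>\<^bsub>K\<^esub> (f a' b' \<otimes>\<^bsub>K\<^esub> f a b')"
      using that r[of "a' \<otimes>\<^bsub>G\<^esub> a" b b'] by (simp add: l)
    have "f a' b \<otimes>\<^bsub>K\<^esub> ((f a' b' \<otimes>\<^bsub>K\<^esub> f a b) \<otimes>\<^bsub>K\<^esub> f a b') = f a' b \<otimes>\<^bsub>K\<^esub> ((f a b \<otimes>\<^bsub>K\<^esub> f a' b') \<otimes>\<^bsub>K\<^esub> f a b')"
      using e1 e2 that by (simp add: K.m_assoc cl)
    then show ?thesis using that by (simp add: cl)
  qed
  show ?thesis by (rule A) (use xs in auto)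
qed

text \<open>A homomorphism on the tensor square of the abelianization is the same as a biadditive map.\<close>

lemma ab_tensor_universal:
  assumes G: "group G" and K: "group K" and f: "biadditive G G K f"
  shows "\<exists>!h. h \<in> hom (ab_tensor G) K \<inter> extensional (carrier (ab_tensor G)) \<and>
              (\<forall>x\<in>carrier G. \<forall>y\<in>carrier G. h (ab_tensor_elt G x y) = f x y)"
proof -
  interpret G: group G by fact
  interpret K: group K by fact
  define rep where "rep U = (SOME x. x \<in> carrier G \<and> ab_class G x = U)" for U
  have rep: "rep U \<in> carrier G \<and> ab_class G (rep U) = U" if "U \<in> carrier (abelianization G)" for U
    unfolding rep_def by (rule someI_ex) (use that in \<open>auto simp: abelianization_carrier\<close>)
  have cong: "f x y = f x' y'"
    if "x \<in> carrier G" "y \<in> carrier G" "x' \<in> carrier G" "y' \<in> carrier G"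
      "ab_class G x = ab_class G x'" "ab_class G y = ab_class G y'" for x y x' y'
  proof -
    have "f x y = f x y'"
      by (rule hom_kills_commutators[OF G K]) (use that f biadditive_commute[OF G K f] in \<open>auto simp: biadditive_def\<close>)
    also have "f x y' = f x' y'"
      by (rule hom_kills_commutators[OF G K, of "\<lambda>x. f x y'"])
         (use that f biadditive_commute[OF G K f] in \<open>auto simp: biadditive_def\<close>)
    finally show ?thesis .
  qed
  define F where "F U V = f (rep U) (rep V)" for U V
  have F: "F (ab_class G x) (ab_class G y) = f x y" if "x \<in> carrier G" "y \<in> carrier G" for x y
    unfolding F_def by (rule cong) (use that rep in \<open>auto simp: abelianization_carrier\<close>)
  have mult: "ab_class G x \<otimes>\<^bsub>abelianization G\<^esub> ab_class G y = ab_class G (x \<otimes>\<^bsub>G\<^esub> y)"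
    if "x \<in> carrier G" "y \<in> carrier G" for x y
    using ab_class_hom[OF G] that by (simp add: hom_def)
  have "biadditive (abelianization G) (abelianization G) K F"
    unfolding biadditive_def abelianization_carrier
    using f by (auto simp: hom_def abelianization_carrier F mult biadditive_def Pi_iff)
  moreover have "F U V \<otimes>\<^bsub>K\<^esub> F U' V' = F U' V' \<otimes>\<^bsub>K\<^esub> F U V"
    if "U \<in> carrier (abelianization G)" "V \<in> carrier (abelianization G)"
      "U' \<in> carrier (abelianization G)" "V' \<in> carrier (abelianization G)" for U V U' V'
    unfolding F_def by (rule biadditive_commute[OF G K f]) (use rep that in auto)
  ultimately have "\<exists>!h. h \<in> hom (tensor_group (abelianization G) (abelianization G)) K
      \<inter> extensional (carrier (tensor_group (abelianization G) (abelianization G))) \<and>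
      (\<forall>U\<in>carrier (abelianization G). \<forall>V\<in>carrier (abelianization G).
         h (tensor_elt (abelianization G) (abelianization G) U V) = F U V)"
    by (rule tensor_universal[OF K])
  then show ?thesis
    by (simp add: ab_tensor_def ab_tensor_elt_def abelianization_carrier F)
qed

lemma ab_tensor_elt_closed:
  "x \<in> carrier G \<Longrightarrow> y \<in> carrier G \<Longrightarrow> ab_tensor_elt G x y \<in> carrier (ab_tensor G)"
  by (auto simp: ab_tensor_def ab_tensor_elt_def abelianization_carrier intro!: tensor_elt_closed)

lemma (in stable_quadratic_module) sqbr_closed:
  "x \<in> carrier (sq0 Q) \<Longrightarrow> y \<in> carrier (sq0 Q) \<Longrightarrow> sqbr Q x y \<in> carrier (sq1 Q)"
  using w_hom by (auto simp: sqbr_def hom_def Pi_iff ab_tensor_elt_closed)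

lemma (in stable_quadratic_module) sqbr_biadditive: "biadditive (sq0 Q) (sq0 Q) (sq1 Q) (sqbr Q)"
proof -
  interpret A: comm_group "abelianization (sq0 Q)" by (rule abelianization_comm_group[OF group0])
  have t: "biadditive (abelianization (sq0 Q)) (abelianization (sq0 Q)) (ab_tensor (sq0 Q))
      (tensor_elt (abelianization (sq0 Q)) (abelianization (sq0 Q)))"
    unfolding ab_tensor_def by (rule tensor_biadditive) unfold_locales
  have m: "ab_class (sq0 Q) (x \<otimes>\<^bsub>sq0 Q\<^esub> y) =
      ab_class (sq0 Q) x \<otimes>\<^bsub>abelianization (sq0 Q)\<^esub> ab_class (sq0 Q) y"
    if "x \<in> carrier (sq0 Q)" "y \<in> carrier (sq0 Q)" for x y
    using ab_class_hom[OF group0] that by (simp add: hom_def)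
  have e: "ab_tensor_elt (sq0 Q) (x \<otimes>\<^bsub>sq0 Q\<^esub> x') y =
        ab_tensor_elt (sq0 Q) x y \<otimes>\<^bsub>ab_tensor (sq0 Q)\<^esub> ab_tensor_elt (sq0 Q) x' y"
      "ab_tensor_elt (sq0 Q) y (x \<otimes>\<^bsub>sq0 Q\<^esub> x') =
        ab_tensor_elt (sq0 Q) y x \<otimes>\<^bsub>ab_tensor (sq0 Q)\<^esub> ab_tensor_elt (sq0 Q) y x'"
    if "x \<in> carrier (sq0 Q)" "x' \<in> carrier (sq0 Q)" "y \<in> carrier (sq0 Q)" for x x' y
    using t that by (auto simp: ab_tensor_elt_def m biadditive_def hom_def abelianization_carrier)
  have w: "sqw Q (u \<otimes>\<^bsub>ab_tensor (sq0 Q)\<^esub> v) = sqw Q u \<otimes>\<^bsub>sq1 Q\<^esub> sqw Q v"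
    if "u \<in> carrier (ab_tensor (sq0 Q))" "v \<in> carrier (ab_tensor (sq0 Q))" for u v
    using w_hom that by (simp add: hom_def)
  show ?thesis
    unfolding biadditive_def
    by (auto simp: sqbr_closed intro!: homI) (auto simp: sqbr_def e w ab_tensor_elt_closed)
qed

text \<open>
  Stable quadratic modules given by generators and relations: two-sorted expressions in
  generators \<open>'a\<close> of degree 0 and \<open>'b\<close> of degree 1, with \<open>Bd\<close> for \<open>\<partial>\<close> and \<open>Br\<close> for
  \<open>\<langle>\<cdot>,\<cdot>\<rangle>\<close>, modulo the congruence generated by the axioms and the given relations. The bracket
  rules \<open>eq1_br_add_left\<close>, \<open>eq1_br_add_right\<close> say that \<open>\<langle>\<cdot>,\<cdot>\<rangle>\<close> is biadditive, which is what it
  takes to induce a homomorphism \<open>\<omega>\<close> on the tensor square of the abelianization.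
\<close>

datatype (gens0: 'a, gens1: 'b) qterm0 =
    Gen0 'a | Zero0 | Add0 "('a, 'b) qterm0" "('a, 'b) qterm0" | Neg0 "('a, 'b) qterm0"
  | Bd "('a, 'b) qterm1"
and (gens0': 'a, gens1': 'b) qterm1 =
    Gen1 'b | Zero1 | Add1 "('a, 'b) qterm1" "('a, 'b) qterm1" | Neg1 "('a, 'b) qterm1"
  | Br "('a, 'b) qterm0" "('a, 'b) qterm0"

instantiation qterm0 :: (type, type) "{zero, plus, uminus}"
begin
definition zero_qterm0 where "0 = Zero0"
definition plus_qterm0 where "s + t = Add0 s t"
definition uminus_qterm0 where "- t = Neg0 t"
instance ..
end

instantiation qterm1 :: (type, type) "{zero, plus, uminus}"
begin
definition zero_qterm1 where "0 = Zero1"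
definition plus_qterm1 where "s + t = Add1 s t"
definition uminus_qterm1 where "- t = Neg1 t"
instance ..
end

definition qterms0 :: "'a set \<Rightarrow> 'b set \<Rightarrow> ('a, 'b) qterm0 set" where
  "qterms0 S0 S1 = {t. gens0 t \<subseteq> S0 \<and> gens1 t \<subseteq> S1}"

definition qterms1 :: "'a set \<Rightarrow> 'b set \<Rightarrow> ('a, 'b) qterm1 set" where
  "qterms1 S0 S1 = {t. gens0' t \<subseteq> S0 \<and> gens1' t \<subseteq> S1}"

inductive
  eq0 :: "'a set \<Rightarrow> 'b set \<Rightarrow> (('a, 'b) qterm0 \<times> ('a, 'b) qterm0) set
    \<Rightarrow> (('a, 'b) qterm1 \<times> ('a, 'b) qterm1) set \<Rightarrow> ('a, 'b) qterm0 \<Rightarrow> ('a, 'b) qterm0 \<Rightarrow> bool"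
and
  eq1 :: "'a set \<Rightarrow> 'b set \<Rightarrow> (('a, 'b) qterm0 \<times> ('a, 'b) qterm0) set
    \<Rightarrow> (('a, 'b) qterm1 \<times> ('a, 'b) qterm1) set \<Rightarrow> ('a, 'b) qterm1 \<Rightarrow> ('a, 'b) qterm1 \<Rightarrow> bool"
for S0 S1 R0 R1 where
  eq0_rel: "(x, y) \<in> R0 \<Longrightarrow> x \<in> qterms0 S0 S1 \<Longrightarrow> y \<in> qterms0 S0 S1 \<Longrightarrow> eq0 S0 S1 R0 R1 x y"
| eq0_refl: "x \<in> qterms0 S0 S1 \<Longrightarrow> eq0 S0 S1 R0 R1 x x"
| eq0_sym: "eq0 S0 S1 R0 R1 x y \<Longrightarrow> eq0 S0 S1 R0 R1 y x"
| eq0_trans: "eq0 S0 S1 R0 R1 x y \<Longrightarrow> eq0 S0 S1 R0 R1 y z \<Longrightarrow> eq0 S0 S1 R0 R1 x z"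
| eq0_add: "eq0 S0 S1 R0 R1 x x' \<Longrightarrow> eq0 S0 S1 R0 R1 y y' \<Longrightarrow>
     eq0 S0 S1 R0 R1 (x + y) (x' + y')"
| eq0_neg: "eq0 S0 S1 R0 R1 x x' \<Longrightarrow> eq0 S0 S1 R0 R1 (- x) (- x')"
| eq0_bd: "eq1 S0 S1 R0 R1 c c' \<Longrightarrow> eq0 S0 S1 R0 R1 (Bd c) (Bd c')"
| eq0_assoc: "x \<in> qterms0 S0 S1 \<Longrightarrow> y \<in> qterms0 S0 S1 \<Longrightarrow> z \<in> qterms0 S0 S1 \<Longrightarrow>
     eq0 S0 S1 R0 R1 ((x + y) + z) (x + (y + z))"
| eq0_zero_left: "x \<in> qterms0 S0 S1 \<Longrightarrow> eq0 S0 S1 R0 R1 (0 + x) x"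
| eq0_neg_left: "x \<in> qterms0 S0 S1 \<Longrightarrow> eq0 S0 S1 R0 R1 (- x + x) 0"
| eq0_bd_add: "c \<in> qterms1 S0 S1 \<Longrightarrow> d \<in> qterms1 S0 S1 \<Longrightarrow>
     eq0 S0 S1 R0 R1 (Bd (c + d)) (Bd c + Bd d)"
| eq0_bd_br: "x \<in> qterms0 S0 S1 \<Longrightarrow> y \<in> qterms0 S0 S1 \<Longrightarrow>
     eq0 S0 S1 R0 R1 (Bd (Br x y)) (- y + - x + y + x)"
| eq1_rel: "(c, d) \<in> R1 \<Longrightarrow> c \<in> qterms1 S0 S1 \<Longrightarrow> d \<in> qterms1 S0 S1 \<Longrightarrow> eq1 S0 S1 R0 R1 c d"
| eq1_refl: "c \<in> qterms1 S0 S1 \<Longrightarrow> eq1 S0 S1 R0 R1 c c"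
| eq1_sym: "eq1 S0 S1 R0 R1 c d \<Longrightarrow> eq1 S0 S1 R0 R1 d c"
| eq1_trans: "eq1 S0 S1 R0 R1 c d \<Longrightarrow> eq1 S0 S1 R0 R1 d e \<Longrightarrow> eq1 S0 S1 R0 R1 c e"
| eq1_add: "eq1 S0 S1 R0 R1 c c' \<Longrightarrow> eq1 S0 S1 R0 R1 d d' \<Longrightarrow>
     eq1 S0 S1 R0 R1 (c + d) (c' + d')"
| eq1_neg: "eq1 S0 S1 R0 R1 c c' \<Longrightarrow> eq1 S0 S1 R0 R1 (- c) (- c')"
| eq1_br: "eq0 S0 S1 R0 R1 x x' \<Longrightarrow> eq0 S0 S1 R0 R1 y y' \<Longrightarrow>
     eq1 S0 S1 R0 R1 (Br x y) (Br x' y')"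
| eq1_assoc: "c \<in> qterms1 S0 S1 \<Longrightarrow> d \<in> qterms1 S0 S1 \<Longrightarrow> e \<in> qterms1 S0 S1 \<Longrightarrow>
     eq1 S0 S1 R0 R1 ((c + d) + e) (c + (d + e))"
| eq1_zero_left: "c \<in> qterms1 S0 S1 \<Longrightarrow> eq1 S0 S1 R0 R1 (0 + c) c"
| eq1_neg_left: "c \<in> qterms1 S0 S1 \<Longrightarrow> eq1 S0 S1 R0 R1 (- c + c) 0"
| eq1_br_add_left: "x \<in> qterms0 S0 S1 \<Longrightarrow> x' \<in> qterms0 S0 S1 \<Longrightarrow> y \<in> qterms0 S0 S1 \<Longrightarrow>
     eq1 S0 S1 R0 R1 (Br (x + x') y) (Br x y + Br x' y)"
| eq1_br_add_right: "x \<in> qterms0 S0 S1 \<Longrightarrow> y \<in> qterms0 S0 S1 \<Longrightarrow> y' \<in> qterms0 S0 S1 \<Longrightarrow>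
     eq1 S0 S1 R0 R1 (Br x (y + y')) (Br x y + Br x y')"
| eq1_br_bd: "c \<in> qterms1 S0 S1 \<Longrightarrow> d \<in> qterms1 S0 S1 \<Longrightarrow>
     eq1 S0 S1 R0 R1 (Br (Bd c) (Bd d)) (- d + - c + d + c)"
| eq1_br_sym: "x \<in> qterms0 S0 S1 \<Longrightarrow> y \<in> qterms0 S0 S1 \<Longrightarrow>
     eq1 S0 S1 R0 R1 (Br x y + Br y x) 0"

definition class0 :: "'a set \<Rightarrow> 'b set \<Rightarrow> (('a, 'b) qterm0 \<times> ('a, 'b) qterm0) set
    \<Rightarrow> (('a, 'b) qterm1 \<times> ('a, 'b) qterm1) set \<Rightarrow> ('a, 'b) qterm0 \<Rightarrow> ('a, 'b) qterm0 set" where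
  "class0 S0 S1 R0 R1 x = {y. eq0 S0 S1 R0 R1 x y}"

definition class1 :: "'a set \<Rightarrow> 'b set \<Rightarrow> (('a, 'b) qterm0 \<times> ('a, 'b) qterm0) set
    \<Rightarrow> (('a, 'b) qterm1 \<times> ('a, 'b) qterm1) set \<Rightarrow> ('a, 'b) qterm1 \<Rightarrow> ('a, 'b) qterm1 set" where
  "class1 S0 S1 R0 R1 c = {d. eq1 S0 S1 R0 R1 c d}"

definition presented0 :: "'a set \<Rightarrow> 'b set \<Rightarrow> (('a, 'b) qterm0 \<times> ('a, 'b) qterm0) set
    \<Rightarrow> (('a, 'b) qterm1 \<times> ('a, 'b) qterm1) set \<Rightarrow> ('a, 'b) qterm0 set monoid" where
  "presented0 S0 S1 R0 R1 = \<lparr>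
     carrier = class0 S0 S1 R0 R1 ` qterms0 S0 S1,
     mult = (\<lambda>X Y. {u. \<exists>x\<in>X. \<exists>y\<in>Y. eq0 S0 S1 R0 R1 (x + y) u}),
     one = class0 S0 S1 R0 R1 0 \<rparr>"

definition presented1 :: "'a set \<Rightarrow> 'b set \<Rightarrow> (('a, 'b) qterm0 \<times> ('a, 'b) qterm0) set
    \<Rightarrow> (('a, 'b) qterm1 \<times> ('a, 'b) qterm1) set \<Rightarrow> ('a, 'b) qterm1 set monoid" where
  "presented1 S0 S1 R0 R1 = \<lparr>
     carrier = class1 S0 S1 R0 R1 ` qterms1 S0 S1,
     mult = (\<lambda>X Y. {u. \<exists>c\<in>X. \<exists>d\<in>Y. eq1 S0 S1 R0 R1 (c + d) u}),
     one = class1 S0 S1 R0 R1 0 \<rparr>"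

definition presented_bracket :: "'a set \<Rightarrow> 'b set \<Rightarrow> (('a, 'b) qterm0 \<times> ('a, 'b) qterm0) set
    \<Rightarrow> (('a, 'b) qterm1 \<times> ('a, 'b) qterm1) set
    \<Rightarrow> ('a, 'b) qterm0 set \<Rightarrow> ('a, 'b) qterm0 set \<Rightarrow> ('a, 'b) qterm1 set" where
  "presented_bracket S0 S1 R0 R1 X Y = {u. \<exists>x\<in>X. \<exists>y\<in>Y. eq1 S0 S1 R0 R1 (Br x y) u}"

definition presented_sqmod :: "'a set \<Rightarrow> 'b set \<Rightarrow> (('a, 'b) qterm0 \<times> ('a, 'b) qterm0) set
    \<Rightarrow> (('a, 'b) qterm1 \<times> ('a, 'b) qterm1) set
    \<Rightarrow> (('a, 'b) qterm0 set, ('a, 'b) qterm1 set) sqmod" where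
  "presented_sqmod S0 S1 R0 R1 = \<lparr>
     sq0 = presented0 S0 S1 R0 R1,
     sq1 = presented1 S0 S1 R0 R1,
     sqd = (\<lambda>X. {u. \<exists>c\<in>X. eq0 S0 S1 R0 R1 (Bd c) u}),
     sqw = (THE h.
       h \<in> hom (ab_tensor (presented0 S0 S1 R0 R1)) (presented1 S0 S1 R0 R1)
           \<inter> extensional (carrier (ab_tensor (presented0 S0 S1 R0 R1))) \<and>
       (\<forall>X\<in>carrier (presented0 S0 S1 R0 R1). \<forall>Y\<in>carrier (presented0 S0 S1 R0 R1).
          h (ab_tensor_elt (presented0 S0 S1 R0 R1) X Y)
            = presented_bracket S0 S1 R0 R1 X Y)) \<rparr>"


lemma qterms_simps [simp]:
  "Gen0 a \<in> qterms0 S0 S1 \<longleftrightarrow> a \<in> S0"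
  "0 \<in> qterms0 S0 S1"
  "x + y \<in> qterms0 S0 S1 \<longleftrightarrow> x \<in> qterms0 S0 S1 \<and> y \<in> qterms0 S0 S1"
  "- x \<in> qterms0 S0 S1 \<longleftrightarrow> x \<in> qterms0 S0 S1"
  "Bd c \<in> qterms0 S0 S1 \<longleftrightarrow> c \<in> qterms1 S0 S1"
  "Gen1 b \<in> qterms1 S0 S1 \<longleftrightarrow> b \<in> S1"
  "0 \<in> qterms1 S0 S1"
  "c + d \<in> qterms1 S0 S1 \<longleftrightarrow> c \<in> qterms1 S0 S1 \<and> d \<in> qterms1 S0 S1"
  "- c \<in> qterms1 S0 S1 \<longleftrightarrow> c \<in> qterms1 S0 S1"
  "Br x y \<in> qterms1 S0 S1 \<longleftrightarrow> x \<in> qterms0 S0 S1 \<and> y \<in> qterms0 S0 S1"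
  by (auto simp: qterms0_def qterms1_def zero_qterm0_def plus_qterm0_def uminus_qterm0_def
      zero_qterm1_def plus_qterm1_def uminus_qterm1_def)

lemma eq_qterms:
  "eq0 S0 S1 R0 R1 x y \<Longrightarrow> x \<in> qterms0 S0 S1 \<and> y \<in> qterms0 S0 S1"
  "eq1 S0 S1 R0 R1 c d \<Longrightarrow> c \<in> qterms1 S0 S1 \<and> d \<in> qterms1 S0 S1"
  by (induction rule: eq0_eq1.inducts) auto

lemma class0_eqI: "eq0 S0 S1 R0 R1 x y \<Longrightarrow> class0 S0 S1 R0 R1 x = class0 S0 S1 R0 R1 y"
  unfolding class0_def by (blast intro: eq0_sym eq0_trans)

lemma class1_eqI: "eq1 S0 S1 R0 R1 c d \<Longrightarrow> class1 S0 S1 R0 R1 c = class1 S0 S1 R0 R1 d"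
  unfolding class1_def by (blast intro: eq1_sym eq1_trans)

context
  fixes S0 :: "'a set" and S1 :: "'b set"
    and R0 :: "(('a, 'b) qterm0 \<times> ('a, 'b) qterm0) set"
    and R1 :: "(('a, 'b) qterm1 \<times> ('a, 'b) qterm1) set"
begin

private abbreviation "K0 \<equiv> class0 S0 S1 R0 R1"
private abbreviation "K1 \<equiv> class1 S0 S1 R0 R1"
private abbreviation "T0 \<equiv> qterms0 S0 S1"
private abbreviation "T1 \<equiv> qterms1 S0 S1"
private abbreviation "P0 \<equiv> presented0 S0 S1 R0 R1"
private abbreviation "P1 \<equiv> presented1 S0 S1 R0 R1"
private abbreviation "Q \<equiv> presented_sqmod S0 S1 R0 R1"

lemma presented0_carrier: "carrier P0 = K0 ` T0"
  and presented1_carrier: "carrier P1 = K1 ` T1"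
  and presented0_one: "\<one>\<^bsub>P0\<^esub> = K0 0"
  and presented1_one: "\<one>\<^bsub>P1\<^esub> = K1 0"
  by (simp_all add: presented0_def presented1_def)

lemma presented0_mult:
  "x \<in> T0 \<Longrightarrow> y \<in> T0 \<Longrightarrow> K0 x \<otimes>\<^bsub>P0\<^esub> K0 y = K0 (x + y)"
  unfolding presented0_def class0_def by (auto intro: eq0_add eq0_refl eq0_trans)

lemma presented1_mult:
  "c \<in> T1 \<Longrightarrow> d \<in> T1 \<Longrightarrow> K1 c \<otimes>\<^bsub>P1\<^esub> K1 d = K1 (c + d)"
  unfolding presented1_def class1_def by (auto intro: eq1_add eq1_refl eq1_trans)

lemma presented_bracket_class:
  "x \<in> T0 \<Longrightarrow> y \<in> T0 \<Longrightarrow> presented_bracket S0 S1 R0 R1 (K0 x) (K0 y) = K1 (Br x y)"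
  unfolding presented_bracket_def class0_def class1_def
  by (auto intro: eq1_br eq0_refl eq1_trans)

lemma presented_bd_class: "c \<in> T1 \<Longrightarrow> sqd Q (K1 c) = K0 (Bd c)"
  unfolding presented_sqmod_def class0_def class1_def
  by (auto intro: eq0_bd eq1_refl eq0_trans)

lemma presented0_group: "group P0"
proof (rule groupI)
  fix X assume "X \<in> carrier P0"
  then obtain x where "x \<in> T0" "X = K0 x" by (auto simp: presented0_carrier)
  then show "\<exists>Y\<in>carrier P0. Y \<otimes>\<^bsub>P0\<^esub> X = \<one>\<^bsub>P0\<^esub>"
    by (intro bexI[of _ "K0 (- x)"])
       (auto simp: presented0_carrier presented0_mult presented0_one
          del: equalityI intro!: class0_eqI eq0_neg_left)
qed (auto simp: presented0_carrier presented0_mult presented0_one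
      del: equalityI intro!: class0_eqI eq0_assoc eq0_zero_left)

lemma presented1_group: "group P1"
proof (rule groupI)
  fix X assume "X \<in> carrier P1"
  then obtain c where "c \<in> T1" "X = K1 c" by (auto simp: presented1_carrier)
  then show "\<exists>Y\<in>carrier P1. Y \<otimes>\<^bsub>P1\<^esub> X = \<one>\<^bsub>P1\<^esub>"
    by (intro bexI[of _ "K1 (- c)"])
       (auto simp: presented1_carrier presented1_mult presented1_one
          del: equalityI intro!: class1_eqI eq1_neg_left)
qed (auto simp: presented1_carrier presented1_mult presented1_one
      del: equalityI intro!: class1_eqI eq1_assoc eq1_zero_left)

lemma presented0_inv: "x \<in> T0 \<Longrightarrow> inv\<^bsub>P0\<^esub> K0 x = K0 (- x)"
  by (rule group.inv_equality[OF presented0_group])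
     (auto simp: presented0_carrier presented0_mult presented0_one
          del: equalityI intro!: class0_eqI eq0_neg_left)

lemma presented1_inv: "c \<in> T1 \<Longrightarrow> inv\<^bsub>P1\<^esub> K1 c = K1 (- c)"
  by (rule group.inv_equality[OF presented1_group])
     (auto simp: presented1_carrier presented1_mult presented1_one
          del: equalityI intro!: class1_eqI eq1_neg_left)

lemma presented_bracket_biadditive: "biadditive P0 P0 P1 (presented_bracket S0 S1 R0 R1)"
  unfolding biadditive_def
  by (auto simp: hom_def presented0_carrier presented1_carrier presented0_mult presented1_mult
        presented_bracket_class del: equalityI intro!: class1_eqI eq1_br_add_left eq1_br_add_right)

lemma presented_w:
  "sqw Q \<in> hom (ab_tensor P0) P1 \<inter> extensional (carrier (ab_tensor P0))"
  "X \<in> carrier P0 \<Longrightarrow> Y \<in> carrier P0 \<Longrightarrow>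
     sqw Q (ab_tensor_elt P0 X Y) = presented_bracket S0 S1 R0 R1 X Y"
  using theI'[OF ab_tensor_universal[OF presented0_group presented1_group presented_bracket_biadditive]]
  unfolding presented_sqmod_def by auto

lemma presented_br_class: "x \<in> T0 \<Longrightarrow> y \<in> T0 \<Longrightarrow> sqbr Q (K0 x) (K0 y) = K1 (Br x y)"
  using presented_w(2)[of "K0 x" "K0 y"]
  by (simp add: sqbr_def presented0_carrier presented_bracket_class)
     (simp add: presented_sqmod_def)

lemma presented_sq01: "sq0 Q = P0" "sq1 Q = P1"
  by (simp_all add: presented_sqmod_def)

lemma presented_stable_quadratic_module: "stable_quadratic_module Q"
proof (rule stable_quadratic_module.intro)
  show "group (sq0 Q)" "group (sq1 Q)"
    by (simp_all add: presented_sq01 presented0_group presented1_group)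
  show "sqd Q \<in> hom (sq1 Q) (sq0 Q)"
    by (auto simp: hom_def presented_sq01 presented0_carrier presented1_carrier presented_bd_class
        presented0_mult presented1_mult del: equalityI intro!: class0_eqI eq0_bd_add)
  show "sqw Q \<in> hom (ab_tensor (sq0 Q)) (sq1 Q)"
    using presented_w(1) by (simp add: presented_sq01)
next
  fix X Y assume "X \<in> carrier (sq0 Q)" "Y \<in> carrier (sq0 Q)"
  then obtain x y where xy: "x \<in> T0" "y \<in> T0" "X = K0 x" "Y = K0 y"
    by (auto simp: presented_sq01 presented0_carrier)
  show "sqd Q (sqbr Q X Y) = gcommutator (sq0 Q) Y X"
    using xy by (auto simp: presented_br_class presented_bd_class gcommutator_def presented_sq01
        presented0_mult presented0_inv del: equalityI intro!: class0_eqI eq0_bd_br)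
  have "sqw Q (ab_tensor_elt P0 X Y \<otimes>\<^bsub>ab_tensor P0\<^esub> ab_tensor_elt P0 Y X)
      = sqw Q (ab_tensor_elt P0 X Y) \<otimes>\<^bsub>P1\<^esub> sqw Q (ab_tensor_elt P0 Y X)"
    using presented_w(1) xy by (intro hom_mult[of _ "ab_tensor P0" P1] ab_tensor_elt_closed)
      (auto simp: presented0_carrier)
  also have "\<dots> = \<one>\<^bsub>P1\<^esub>"
    using xy by (auto simp: presented_w(2) presented0_carrier presented_bracket_class presented1_mult
        presented1_one del: equalityI intro!: class1_eqI eq1_br_sym)
  finally show "sqw Q (ab_tensor_elt (sq0 Q) X Y \<otimes>\<^bsub>ab_tensor (sq0 Q)\<^esub> ab_tensor_elt (sq0 Q) Y X)
      = \<one>\<^bsub>sq1 Q\<^esub>" by (simp add: presented_sq01)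
next
  fix X Y assume "X \<in> carrier (sq1 Q)" "Y \<in> carrier (sq1 Q)"
  then obtain c d where cd: "c \<in> T1" "d \<in> T1" "X = K1 c" "Y = K1 d"
    by (auto simp: presented_sq01 presented1_carrier)
  then show "sqbr Q (sqd Q X) (sqd Q Y) = gcommutator (sq1 Q) Y X"
    by (auto simp: presented_br_class presented_bd_class gcommutator_def presented_sq01
        presented1_mult presented1_inv del: equalityI intro!: class1_eqI eq1_br_bd)
qed


primrec qeval0 :: "('c, 'd) sqmod \<Rightarrow> ('a \<Rightarrow> 'c) \<Rightarrow> ('b \<Rightarrow> 'd) \<Rightarrow> ('a, 'b) qterm0 \<Rightarrow> 'c"
  and qeval1 :: "('c, 'd) sqmod \<Rightarrow> ('a \<Rightarrow> 'c) \<Rightarrow> ('b \<Rightarrow> 'd) \<Rightarrow> ('a, 'b) qterm1 \<Rightarrow> 'd" where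
  "qeval0 N f0 f1 (Gen0 a) = f0 a"
| "qeval0 N f0 f1 Zero0 = \<one>\<^bsub>sq0 N\<^esub>"
| "qeval0 N f0 f1 (Add0 x y) = qeval0 N f0 f1 x \<otimes>\<^bsub>sq0 N\<^esub> qeval0 N f0 f1 y"
| "qeval0 N f0 f1 (Neg0 x) = inv\<^bsub>sq0 N\<^esub> qeval0 N f0 f1 x"
| "qeval0 N f0 f1 (Bd c) = sqd N (qeval1 N f0 f1 c)"
| "qeval1 N f0 f1 (Gen1 b) = f1 b"
| "qeval1 N f0 f1 Zero1 = \<one>\<^bsub>sq1 N\<^esub>"
| "qeval1 N f0 f1 (Add1 c d) = qeval1 N f0 f1 c \<otimes>\<^bsub>sq1 N\<^esub> qeval1 N f0 f1 d"
| "qeval1 N f0 f1 (Neg1 c) = inv\<^bsub>sq1 N\<^esub> qeval1 N f0 f1 c"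
| "qeval1 N f0 f1 (Br x y) = sqbr N (qeval0 N f0 f1 x) (qeval0 N f0 f1 y)"

lemma qeval_simps [simp]:
  "qeval0 N f0 f1 0 = \<one>\<^bsub>sq0 N\<^esub>"
  "qeval0 N f0 f1 (x + y) = qeval0 N f0 f1 x \<otimes>\<^bsub>sq0 N\<^esub> qeval0 N f0 f1 y"
  "qeval0 N f0 f1 (- x) = inv\<^bsub>sq0 N\<^esub> qeval0 N f0 f1 x"
  "qeval1 N f0 f1 0 = \<one>\<^bsub>sq1 N\<^esub>"
  "qeval1 N f0 f1 (c + d) = qeval1 N f0 f1 c \<otimes>\<^bsub>sq1 N\<^esub> qeval1 N f0 f1 d"
  "qeval1 N f0 f1 (- c) = inv\<^bsub>sq1 N\<^esub> qeval1 N f0 f1 c"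
  by (simp_all add: zero_qterm0_def plus_qterm0_def uminus_qterm0_def
      zero_qterm1_def plus_qterm1_def uminus_qterm1_def)

lemma qterm_induct:
  assumes "\<And>a. a \<in> S0 \<Longrightarrow> A (Gen0 a)" "A 0"
    "\<And>x y. x \<in> T0 \<Longrightarrow> y \<in> T0 \<Longrightarrow> A x \<Longrightarrow> A y \<Longrightarrow> A (x + y)"
    "\<And>x. x \<in> T0 \<Longrightarrow> A x \<Longrightarrow> A (- x)" "\<And>c. c \<in> T1 \<Longrightarrow> B c \<Longrightarrow> A (Bd c)"
    "\<And>b. b \<in> S1 \<Longrightarrow> B (Gen1 b)" "B 0"
    "\<And>c d. c \<in> T1 \<Longrightarrow> d \<in> T1 \<Longrightarrow> B c \<Longrightarrow> B d \<Longrightarrow> B (c + d)"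
    "\<And>c. c \<in> T1 \<Longrightarrow> B c \<Longrightarrow> B (- c)"
    "\<And>x y. x \<in> T0 \<Longrightarrow> y \<in> T0 \<Longrightarrow> A x \<Longrightarrow> A y \<Longrightarrow> B (Br x y)"
  shows "x \<in> T0 \<Longrightarrow> A x" and "c \<in> T1 \<Longrightarrow> B c"
proof (induction x and c rule: qterm0.induct qterm1.induct)
qed (use assms[unfolded zero_qterm0_def plus_qterm0_def uminus_qterm0_def
      zero_qterm1_def plus_qterm1_def uminus_qterm1_def]
    in \<open>auto simp: qterms_simps[unfolded zero_qterm0_def plus_qterm0_def uminus_qterm0_def
      zero_qterm1_def plus_qterm1_def uminus_qterm1_def]\<close>)

context
  fixes N :: "('c, 'd) sqmod" and f0 :: "'a \<Rightarrow> 'c" and f1 :: "'b \<Rightarrow> 'd"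
  assumes N: "stable_quadratic_module N"
    and f0: "f0 \<in> S0 \<rightarrow> carrier (sq0 N)" and f1: "f1 \<in> S1 \<rightarrow> carrier (sq1 N)"
begin

interpretation N: stable_quadratic_module N by (rule N)
interpretation G0: group "sq0 N" by (rule N.group0)
interpretation G1: group "sq1 N" by (rule N.group1)
interpretation d: group_hom "sq1 N" "sq0 N" "sqd N"
  by unfold_locales (rule N.d_hom)

private abbreviation "e0 \<equiv> qeval0 N f0 f1"
private abbreviation "e1 \<equiv> qeval1 N f0 f1"

lemma qeval_closed:
  "x \<in> T0 \<Longrightarrow> e0 x \<in> carrier (sq0 N)"
  "c \<in> T1 \<Longrightarrow> e1 c \<in> carrier (sq1 N)"
  using qterm_induct[of "\<lambda>x. e0 x \<in> carrier (sq0 N)" "\<lambda>c. e1 c \<in> carrier (sq1 N)"] f0 f1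
  by (auto simp: N.sqbr_closed Pi_iff)

lemma qeval_eq:
  assumes r0: "\<And>x y. (x, y) \<in> R0 \<Longrightarrow> x \<in> T0 \<Longrightarrow> y \<in> T0 \<Longrightarrow> e0 x = e0 y"
    and r1: "\<And>c d. (c, d) \<in> R1 \<Longrightarrow> c \<in> T1 \<Longrightarrow> d \<in> T1 \<Longrightarrow> e1 c = e1 d"
  shows "eq0 S0 S1 R0 R1 x y \<Longrightarrow> e0 x = e0 y"
    and "eq1 S0 S1 R0 R1 c d \<Longrightarrow> e1 c = e1 d"
proof (induction rule: eq0_eq1.inducts)
  case (eq1_br_sym x y)
  then show ?case
    using N.br_sym[of "e0 x" "e0 y"] N.w_hom
    by (simp add: qeval_closed sqbr_def hom_mult ab_tensor_elt_closed)
qed (use N.sqbr_biadditive in \<open>auto simp: r0 r1 qeval_closed G0.m_assoc G1.m_assoc N.d_br N.br_d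
       gcommutator_def biadditive_def hom_def\<close>)

lemma presented_sqmod_universal_aux:
  assumes r0: "\<And>x y. (x, y) \<in> R0 \<Longrightarrow> x \<in> T0 \<Longrightarrow> y \<in> T0 \<Longrightarrow> e0 x = e0 y"
    and r1: "\<And>c d. (c, d) \<in> R1 \<Longrightarrow> c \<in> T1 \<Longrightarrow> d \<in> T1 \<Longrightarrow> e1 c = e1 d"
  shows "\<exists>!h. h \<in> sqmod_hom Q N \<and> (\<forall>a\<in>S0. fst h (K0 (Gen0 a)) = f0 a) \<and>
              (\<forall>b\<in>S1. snd h (K1 (Gen1 b)) = f1 b)"
proof (rule ex_ex1I)
  define h0 where "h0 = restrict (\<lambda>X. e0 (SOME x. x \<in> X)) (carrier P0)"
  define h1 where "h1 = restrict (\<lambda>X. e1 (SOME c. c \<in> X)) (carrier P1)"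
  have h0: "h0 (K0 x) = e0 x" if x: "x \<in> T0" for x
  proof -
    have "x \<in> K0 x" using x by (simp add: class0_def eq0_refl)
    then have "(SOME y. y \<in> K0 x) \<in> K0 x" by (rule someI)
    then have "e0 x = e0 (SOME y. y \<in> K0 x)"
      using qeval_eq(1)[OF r0 r1] by (simp add: class0_def)
    then show ?thesis using x by (simp add: h0_def presented0_carrier)
  qed
  have h1: "h1 (K1 c) = e1 c" if c: "c \<in> T1" for c
  proof -
    have "c \<in> K1 c" using c by (simp add: class1_def eq1_refl)
    then have "(SOME d. d \<in> K1 c) \<in> K1 c" by (rule someI)
    then have "e1 c = e1 (SOME d. d \<in> K1 c)"
      using qeval_eq(2)[OF r0 r1] by (simp add: class1_def)
    then show ?thesis using c by (simp add: h1_def presented1_carrier)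
  qed
  have "(h0, h1) \<in> sqmod_hom Q N"
    unfolding sqmod_hom_def presented_sq01
    by (auto simp: hom_def presented0_carrier presented1_carrier h0 h1 qeval_closed presented0_mult
        presented1_mult presented_bd_class presented_br_class)
       (auto simp: h0_def h1_def presented0_carrier presented1_carrier)
  then show "\<exists>h. h \<in> sqmod_hom Q N \<and> (\<forall>a\<in>S0. fst h (K0 (Gen0 a)) = f0 a) \<and>
              (\<forall>b\<in>S1. snd h (K1 (Gen1 b)) = f1 b)"
    by (intro exI[of _ "(h0, h1)"]) (simp add: h0 h1)
next
  fix h k
  assume "h \<in> sqmod_hom Q N \<and> (\<forall>a\<in>S0. fst h (K0 (Gen0 a)) = f0 a) \<and>
              (\<forall>b\<in>S1. snd h (K1 (Gen1 b)) = f1 b)"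
    and "k \<in> sqmod_hom Q N \<and> (\<forall>a\<in>S0. fst k (K0 (Gen0 a)) = f0 a) \<and>
              (\<forall>b\<in>S1. snd k (K1 (Gen1 b)) = f1 b)"
  moreover have "(\<forall>x\<in>T0. g0 (K0 x) = e0 x) \<and> (\<forall>c\<in>T1. g1 (K1 c) = e1 c)"
    if g: "(g0, g1) \<in> sqmod_hom Q N" "\<forall>a\<in>S0. g0 (K0 (Gen0 a)) = f0 a"
      "\<forall>b\<in>S1. g1 (K1 (Gen1 b)) = f1 b" for g0 g1
  proof -
    interpret P0: group P0 by (rule presented0_group)
    interpret P1: group P1 by (rule presented1_group)
    interpret g0: group_hom P0 "sq0 N" g0
      by unfold_locales (use g(1) in \<open>auto simp: sqmod_hom_def presented_sq01\<close>)
    interpret g1: group_hom P1 "sq1 N" g1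
      by unfold_locales (use g(1) in \<open>auto simp: sqmod_hom_def presented_sq01\<close>)
    have z: "g0 (K0 0) = \<one>\<^bsub>sq0 N\<^esub>" "g1 (K1 0) = \<one>\<^bsub>sq1 N\<^esub>"
      using g0.hom_one g1.hom_one by (simp_all add: presented0_one presented1_one)
    have a: "g0 (K0 (x + y)) = g0 (K0 x) \<otimes>\<^bsub>sq0 N\<^esub> g0 (K0 y)"
      if "x \<in> T0" "y \<in> T0" for x y
      using g0.hom_mult[of "K0 x" "K0 y"] that by (simp add: presented0_carrier presented0_mult)
    have a': "g0 (K0 (- x)) = inv\<^bsub>sq0 N\<^esub> g0 (K0 x)" if "x \<in> T0" for x
      using g0.hom_inv[of "K0 x"] that by (simp add: presented0_carrier presented0_inv)
    have b: "g1 (K1 (c + d)) = g1 (K1 c) \<otimes>\<^bsub>sq1 N\<^esub> g1 (K1 d)"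
      if "c \<in> T1" "d \<in> T1" for c d
      using g1.hom_mult[of "K1 c" "K1 d"] that by (simp add: presented1_carrier presented1_mult)
    have b': "g1 (K1 (- c)) = inv\<^bsub>sq1 N\<^esub> g1 (K1 c)" if "c \<in> T1" for c
      using g1.hom_inv[of "K1 c"] that by (simp add: presented1_carrier presented1_inv)
    have bd: "g0 (K0 (Bd c)) = sqd N (g1 (K1 c))" if "c \<in> T1" for c
    proof -
      have "K1 c \<in> carrier (sq1 Q)" using that by (simp add: presented_sq01 presented1_carrier)
      then have "g0 (sqd Q (K1 c)) = sqd N (g1 (K1 c))" using g(1) by (simp add: sqmod_hom_def)
      then show ?thesis using that by (simp add: presented_bd_class)
    qed
    have br: "g1 (K1 (Br x y)) = sqbr N (g0 (K0 x)) (g0 (K0 y))" if "x \<in> T0" "y \<in> T0" for x y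
    proof -
      have "K0 x \<in> carrier (sq0 Q)" "K0 y \<in> carrier (sq0 Q)"
        using that by (simp_all add: presented_sq01 presented0_carrier)
      then have "g1 (sqbr Q (K0 x) (K0 y)) = sqbr N (g0 (K0 x)) (g0 (K0 y))"
        using g(1) by (simp add: sqmod_hom_def)
      then show ?thesis using that by (simp add: presented_br_class)
    qed
    have "g0 (K0 x) = e0 x" if "x \<in> T0" for x
      by (rule qterm_induct(1)[where A = "\<lambda>x. g0 (K0 x) = e0 x" and B = "\<lambda>c. g1 (K1 c) = e1 c"])
         (simp_all add: z a a' b b' bd br g(2,3) that)
    moreover have "g1 (K1 c) = e1 c" if "c \<in> T1" for c
      by (rule qterm_induct(2)[where A = "\<lambda>x. g0 (K0 x) = e0 x" and B = "\<lambda>c. g1 (K1 c) = e1 c"])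
         (simp_all add: z a a' b b' bd br g(2,3) that)
    ultimately show ?thesis by blast
  qed
  ultimately have *: "fst h (K0 x) = fst k (K0 x)" "snd h (K1 c) = snd k (K1 c)"
    if "x \<in> T0" "c \<in> T1" for x c
    using that by (metis prod.collapse)+
  show "h = k"
  proof (rule prod_eqI)
    show "fst h = fst k"
      using \<open>h \<in> _ \<and> _\<close> \<open>k \<in> _ \<and> _\<close> *(1)[of _ 0]
      by (intro extensionalityI[of _ "carrier P0"])
         (auto simp: sqmod_hom_def presented_sq01 presented0_carrier)
    show "snd h = snd k"
      using \<open>h \<in> _ \<and> _\<close> \<open>k \<in> _ \<and> _\<close> *(2)[of 0]
      by (intro extensionalityI[of _ "carrier P1"])
         (auto simp: sqmod_hom_def presented_sq01 presented1_carrier)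
  qed
qed

end
end

theorem presented_sqmod_universal:
  assumes "stable_quadratic_module N"
    and "f0 \<in> S0 \<rightarrow> carrier (sq0 N)" and "f1 \<in> S1 \<rightarrow> carrier (sq1 N)"
    and "\<And>x y. (x, y) \<in> R0 \<Longrightarrow> x \<in> qterms0 S0 S1 \<Longrightarrow> y \<in> qterms0 S0 S1 \<Longrightarrow>
           qeval0 N f0 f1 x = qeval0 N f0 f1 y"
    and "\<And>c d. (c, d) \<in> R1 \<Longrightarrow> c \<in> qterms1 S0 S1 \<Longrightarrow> d \<in> qterms1 S0 S1 \<Longrightarrow>
           qeval1 N f0 f1 c = qeval1 N f0 f1 d"
  shows "\<exists>!h. h \<in> sqmod_hom (presented_sqmod S0 S1 R0 R1) N \<and>
              (\<forall>a\<in>S0. fst h (class0 S0 S1 R0 R1 (Gen0 a)) = f0 a) \<and>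
              (\<forall>b\<in>S1. snd h (class1 S0 S1 R0 R1 (Gen1 b)) = f1 b)"
  by (rule presented_sqmod_universal_aux) (use assms in auto)


section \<open>The stable quadratic module of a Waldhausen category\<close>

datatype 'm deg1_gen = WE 'm | CS 'm 'm

abbreviation we :: "'m \<Rightarrow> ('o, 'm deg1_gen) qterm1" where "we f \<equiv> Gen1 (WE f)"
abbreviation cs :: "'m \<Rightarrow> 'm \<Rightarrow> ('o, 'm deg1_gen) qterm1" where "cs i p \<equiv> Gen1 (CS i p)"

definition deg1_gens :: "('o, 'm) waldcat \<Rightarrow> 'm deg1_gen set" where
  "deg1_gens C = WE ` Weq C \<union> {CS i p |i p. cofseq C i p}"

inductive_set D_rel0 ::
    "('o, 'm) waldcat \<Rightarrow> (('o, 'm deg1_gen) qterm0 \<times> ('o, 'm deg1_gen) qterm0) set"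
  for C where
  D_bd_we: "(Bd (we f), - Gen0 (Tgt C f) + Gen0 (Src C f)) \<in> D_rel0 C"
    if "f \<in> Weq C"
| D_bd_cs: "(Bd (cs i p), - Gen0 (Tgt C i) + Gen0 (Tgt C p) + Gen0 (Src C i)) \<in> D_rel0 C"
    if "cofseq C i p"
| D_zero: "(Gen0 (Zero C), 0) \<in> D_rel0 C"

inductive_set D_rel1 ::
    "('o, 'm) waldcat \<Rightarrow> (('o, 'm deg1_gen) qterm1 \<times> ('o, 'm deg1_gen) qterm1) set"
  for C where
  D_we_id: "(we (Ide C A), 0) \<in> D_rel1 C"
    if "A \<in> Obj C"
| D_cs_id_left: "(cs (Ide C A) p, 0) \<in> D_rel1 C"
    if "A \<in> Obj C" "p \<in> arrows C A (Zero C)"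
| D_cs_id_right: "(cs i (Ide C A), 0) \<in> D_rel1 C"
    if "A \<in> Obj C" "i \<in> arrows C (Zero C) A"
| D_we_comp: "(we (g \<cdot>\<^bsub>C\<^esub> f), we g + we f) \<in> D_rel1 C"
    if "f \<in> Weq C" "g \<in> Weq C" "Tgt C f = Src C g"
| D_we_cs: "(we a + we c + Br (Gen0 (Src C i)) (- Gen0 (Tgt C p') + Gen0 (Tgt C p)),
             - cs i' p' + we b + cs i p) \<in> D_rel1 C"
    if "cofseq C i p" "cofseq C i' p'" "a \<in> Weq C" "b \<in> Weq C" "c \<in> Weq C"
       "a \<in> arrows C (Src C i) (Src C i')" "b \<in> arrows C (Tgt C i) (Tgt C i')"
       "c \<in> arrows C (Tgt C p) (Tgt C p')"
       "b \<cdot>\<^bsub>C\<^esub> i = i' \<cdot>\<^bsub>C\<^esub> a" "c \<cdot>\<^bsub>C\<^esub> p = p' \<cdot>\<^bsub>C\<^esub> b"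
  \<comment> \<open>\<open>i : A \<rightarrow> B\<close>, \<open>j : B \<rightarrow> C\<close>, \<open>p : B \<rightarrow> B/A\<close>, \<open>q : C \<rightarrow> C/A\<close>, \<open>r : C \<rightarrow> C/B\<close>,
      \<open>k : B/A \<rightarrow> C/A\<close>, \<open>s : C/A \<rightarrow> C/B\<close>\<close>
| D_cs_cs: "(cs j r + cs i p,
             cs (j \<cdot>\<^bsub>C\<^esub> i) q + cs k s
               + Br (Gen0 (Src C i)) (- Gen0 (Tgt C q) + Gen0 (Tgt C r) + Gen0 (Tgt C p)))
            \<in> D_rel1 C"
    if "Tgt C i = Src C j"
       "cofseq C i p" "cofseq C (j \<cdot>\<^bsub>C\<^esub> i) q" "cofseq C j r" "cofseq C k s"
       "k \<in> arrows C (Tgt C p) (Tgt C q)" "s \<in> arrows C (Tgt C q) (Tgt C r)"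
       "k \<cdot>\<^bsub>C\<^esub> p = q \<cdot>\<^bsub>C\<^esub> j" "s \<cdot>\<^bsub>C\<^esub> q = r"
| D_coprod: "(Br (Gen0 A) (Gen0 B), - cs i\<^sub>2 p\<^sub>1 + cs i\<^sub>1 p\<^sub>2) \<in> D_rel1 C"
    if "is_coproduct C i\<^sub>1 i\<^sub>2" "Src C i\<^sub>1 = A" "Src C i\<^sub>2 = B"
       "p\<^sub>1 \<in> arrows C (Tgt C i\<^sub>1) A" "p\<^sub>2 \<in> arrows C (Tgt C i\<^sub>1) B"
       "p\<^sub>1 \<cdot>\<^bsub>C\<^esub> i\<^sub>1 = Ide C A" "zero_map C (p\<^sub>1 \<cdot>\<^bsub>C\<^esub> i\<^sub>2)"
       "zero_map C (p\<^sub>2 \<cdot>\<^bsub>C\<^esub> i\<^sub>1)" "p\<^sub>2 \<cdot>\<^bsub>C\<^esub> i\<^sub>2 = Ide C B"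

type_synonym ('o, 'm) D0elt = "('o, 'm deg1_gen) qterm0 set"
type_synonym ('o, 'm) D1elt = "('o, 'm deg1_gen) qterm1 set"
type_synonym ('o, 'm) Deelt = "(('o, 'm) D0elt set \<times> ('o, 'm) D0elt set) gterm set"

definition Dmod :: "('o, 'm) waldcat \<Rightarrow> (('o, 'm) D0elt, ('o, 'm) D1elt) sqmod" where
  "Dmod C = presented_sqmod (Obj C) (deg1_gens C) (D_rel0 C) (D_rel1 C)"

definition D_ob :: "('o, 'm) waldcat \<Rightarrow> 'o \<Rightarrow> ('o, 'm) D0elt" where
  "D_ob C A = class0 (Obj C) (deg1_gens C) (D_rel0 C) (D_rel1 C) (Gen0 A)"

definition D_we :: "('o, 'm) waldcat \<Rightarrow> 'm \<Rightarrow> ('o, 'm) D1elt" where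
  "D_we C f = class1 (Obj C) (deg1_gens C) (D_rel0 C) (D_rel1 C) (we f)"

definition D_cs :: "('o, 'm) waldcat \<Rightarrow> 'm \<Rightarrow> 'm \<Rightarrow> ('o, 'm) D1elt" where
  "D_cs C i p = class1 (Obj C) (deg1_gens C) (D_rel0 C) (D_rel1 C) (cs i p)"


section \<open>Square groups\<close>

record ('e, 'f) sqgroup =
  sge :: "'e monoid"
  sgee :: "'f monoid"
  sgH :: "'e \<Rightarrow> 'f"
  sgP :: "'f \<Rightarrow> 'e"

text \<open>\<open>cross G A h x y\<close> is \<open>(x|y)\<^sub>h = h(x + y) - h(y) - h(x)\<close>.\<close>

definition cross :: "'a monoid \<Rightarrow> 'b monoid \<Rightarrow> ('a \<Rightarrow> 'b) \<Rightarrow> 'a \<Rightarrow> 'a \<Rightarrow> 'b" where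
  "cross G A h x y = h (x \<otimes>\<^bsub>G\<^esub> y) \<otimes>\<^bsub>A\<^esub> inv\<^bsub>A\<^esub> h y \<otimes>\<^bsub>A\<^esub> inv\<^bsub>A\<^esub> h x"

definition quadratic_map :: "'a monoid \<Rightarrow> 'b monoid \<Rightarrow> ('a \<Rightarrow> 'b) \<Rightarrow> bool" where
  "quadratic_map G A h \<longleftrightarrow> h \<in> carrier G \<rightarrow> carrier A \<and> biadditive G G A (cross G A h)"

abbreviation sgcross :: "('e, 'f) sqgroup \<Rightarrow> 'e \<Rightarrow> 'e \<Rightarrow> 'f" where
  "sgcross M \<equiv> cross (sge M) (sgee M) (sgH M)"

locale square_group =
  fixes M :: "('e, 'f) sqgroup"
  assumes group_e: "group (sge M)"
    and group_ee: "comm_group (sgee M)"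
    and P_hom: "sgP M \<in> hom (sgee M) (sge M)"
    and H_quadratic: "quadratic_map (sge M) (sgee M) (sgH M)"
    and cross_P_left: "a \<in> carrier (sgee M) \<Longrightarrow> x \<in> carrier (sge M) \<Longrightarrow>
           sgcross M (sgP M a) x = \<one>\<^bsub>sgee M\<^esub>"
    and cross_P_right: "a \<in> carrier (sgee M) \<Longrightarrow> x \<in> carrier (sge M) \<Longrightarrow>
           sgcross M x (sgP M a) = \<one>\<^bsub>sgee M\<^esub>"
    and P_cross: "x \<in> carrier (sge M) \<Longrightarrow> y \<in> carrier (sge M) \<Longrightarrow>
           sgP M (sgcross M x y) = gcommutator (sge M) x y"
    and PHP: "a \<in> carrier (sgee M) \<Longrightarrow>
           sgP M (sgH M (sgP M a)) = sgP M a \<otimes>\<^bsub>sge M\<^esub> sgP M a"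

definition sgT :: "('e, 'f) sqgroup \<Rightarrow> 'f \<Rightarrow> 'f" where
  "sgT M a = sgH M (sgP M a) \<otimes>\<^bsub>sgee M\<^esub> inv\<^bsub>sgee M\<^esub> a"

text \<open>The composite of \<open>\<Delta>\<close> with the projection of \<open>M\<^sub>e\<close> onto the cokernel of \<open>P\<close>.\<close>

definition sgDelta :: "('e, 'f) sqgroup \<Rightarrow> 'e \<Rightarrow> 'f" where
  "sgDelta M x =
     sgcross M x x \<otimes>\<^bsub>sgee M\<^esub> inv\<^bsub>sgee M\<^esub> (sgH M x) \<otimes>\<^bsub>sgee M\<^esub> sgT M (sgH M x)"

text \<open>
  Morphisms are pairs of functions made \<open>undefined\<close> outside the carriers, so that equality of
  morphisms is equality in HOL.
\<close>

definition sg_hom :: "('e, 'f) sqgroup \<Rightarrow> ('g, 'h) sqgroup \<Rightarrow> (('e \<Rightarrow> 'g) \<times> ('f \<Rightarrow> 'h)) set" where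
  "sg_hom M N = {(f, g).
     square_group M \<and> square_group N \<and>
     f \<in> hom (sge M) (sge N) \<inter> extensional (carrier (sge M)) \<and>
     g \<in> hom (sgee M) (sgee N) \<inter> extensional (carrier (sgee M)) \<and>
     (\<forall>x\<in>carrier (sge M). g (sgH M x) = sgH N (f x)) \<and>
     (\<forall>a\<in>carrier (sgee M). f (sgP M a) = sgP N (g a))}"

definition sg_id :: "('e, 'f) sqgroup \<Rightarrow> ('e \<Rightarrow> 'e) \<times> ('f \<Rightarrow> 'f)" where
  "sg_id M = (restrict id (carrier (sge M)), restrict id (carrier (sgee M)))"

definition sg_comp ::
    "('e, 'f) sqgroup \<Rightarrow> ('i \<Rightarrow> 'j) \<times> ('k \<Rightarrow> 'l) \<Rightarrow> ('e \<Rightarrow> 'i) \<times> ('f \<Rightarrow> 'k)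
      \<Rightarrow> ('e \<Rightarrow> 'j) \<times> ('f \<Rightarrow> 'l)" where
  "sg_comp M g f =
     (compose (carrier (sge M)) (fst g) (fst f), compose (carrier (sgee M)) (snd g) (snd f))"


section \<open>The tensor product of square groups\<close>

datatype ('x, 'y, 'a, 'b) circ_gen = Circ 'x 'y | Bar 'a 'b

definition circ_gens :: "('x, 'a) sqgroup \<Rightarrow> ('y, 'b) sqgroup \<Rightarrow> ('x, 'y, 'a, 'b) circ_gen set" where
  "circ_gens M N =
     {Circ x y |x y. x \<in> carrier (sge M) \<and> y \<in> carrier (sge N)} \<union>
     {Bar a b |a b. a \<in> carrier (sgee M) \<and> b \<in> carrier (sgee N)}"

inductive_set circ_rel :: "('x, 'a) sqgroup \<Rightarrow> ('y, 'b) sqgroup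
    \<Rightarrow> (('x, 'y, 'a, 'b) circ_gen gterm \<times> ('x, 'y, 'a, 'b) circ_gen gterm) set"
  for M N where
  bar_add_left: "(GGen (Bar (a \<otimes>\<^bsub>sgee M\<^esub> a') b), GGen (Bar a b) + GGen (Bar a' b)) \<in> circ_rel M N"
    if "a \<in> carrier (sgee M)" "a' \<in> carrier (sgee M)" "b \<in> carrier (sgee N)"
| bar_add_right: "(GGen (Bar a (b \<otimes>\<^bsub>sgee N\<^esub> b')), GGen (Bar a b) + GGen (Bar a b')) \<in> circ_rel M N"
    if "a \<in> carrier (sgee M)" "b \<in> carrier (sgee N)" "b' \<in> carrier (sgee N)"
| bar_central: "(GGen (Bar a b) + t, t + GGen (Bar a b)) \<in> circ_rel M N"
    if "a \<in> carrier (sgee M)" "b \<in> carrier (sgee N)"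
| circ_add_right: "(GGen (Circ x (y\<^sub>1 \<otimes>\<^bsub>sge N\<^esub> y\<^sub>2)),
       GGen (Circ x y\<^sub>1) + GGen (Circ x y\<^sub>2) + GGen (Bar (sgH M x) (sgcross N y\<^sub>2 y\<^sub>1))) \<in> circ_rel M N"
    if "x \<in> carrier (sge M)" "y\<^sub>1 \<in> carrier (sge N)" "y\<^sub>2 \<in> carrier (sge N)"
| circ_add_left: "(GGen (Circ (x\<^sub>1 \<otimes>\<^bsub>sge M\<^esub> x\<^sub>2) y),
       GGen (Circ x\<^sub>1 y) + GGen (Circ x\<^sub>2 y)) \<in> circ_rel M N"
    if "x\<^sub>1 \<in> carrier (sge M)" "x\<^sub>2 \<in> carrier (sge M)" "y \<in> carrier (sge N)"
| circ_P_left: "(GGen (Circ (sgP M a) y), GGen (Bar a (sgcross N y y))) \<in> circ_rel M N"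
    if "a \<in> carrier (sgee M)" "y \<in> carrier (sge N)"
| bar_T: "(GGen (Bar (sgT M a) (sgT N b)), - GGen (Bar a b)) \<in> circ_rel M N"
    if "a \<in> carrier (sgee M)" "b \<in> carrier (sgee N)"
| circ_P_right: "(GGen (Circ x (sgP N b)), GGen (Bar (sgDelta M x) b)) \<in> circ_rel M N"
    if "x \<in> carrier (sge M)" "b \<in> carrier (sgee N)"

definition circ_e :: "('x, 'a) sqgroup \<Rightarrow> ('y, 'b) sqgroup
    \<Rightarrow> ('x, 'y, 'a, 'b) circ_gen gterm set monoid" where
  "circ_e M N = presented_group (circ_gens M N) (circ_rel M N)"

definition circ_elt :: "('x, 'a) sqgroup \<Rightarrow> ('y, 'b) sqgroup \<Rightarrow> 'x \<Rightarrow> 'y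
    \<Rightarrow> ('x, 'y, 'a, 'b) circ_gen gterm set" where
  "circ_elt M N x y = gclass (circ_gens M N) (circ_rel M N) (GGen (Circ x y))"

definition bar_elt :: "('x, 'a) sqgroup \<Rightarrow> ('y, 'b) sqgroup \<Rightarrow> 'a \<Rightarrow> 'b
    \<Rightarrow> ('x, 'y, 'a, 'b) circ_gen gterm set" where
  "bar_elt M N a b = gclass (circ_gens M N) (circ_rel M N) (GGen (Bar a b))"

abbreviation circ_ee :: "('x, 'a) sqgroup \<Rightarrow> ('y, 'b) sqgroup \<Rightarrow> ('a \<times> 'b) gterm set monoid" where
  "circ_ee M N \<equiv> tensor_group (sgee M) (sgee N)"

abbreviation ee_elt :: "('x, 'a) sqgroup \<Rightarrow> ('y, 'b) sqgroup \<Rightarrow> 'a \<Rightarrow> 'b \<Rightarrow> ('a \<times> 'b) gterm set" where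
  "ee_elt M N \<equiv> tensor_elt (sgee M) (sgee N)"

definition circ_H :: "('x, 'a) sqgroup \<Rightarrow> ('y, 'b) sqgroup
    \<Rightarrow> ('x, 'y, 'a, 'b) circ_gen gterm set \<Rightarrow> ('a \<times> 'b) gterm set" where
  "circ_H M N = (THE h.
     h \<in> extensional (carrier (circ_e M N)) \<and>
     quadratic_map (circ_e M N) (circ_ee M N) h \<and>
     (\<forall>x\<in>carrier (sge M). \<forall>y\<in>carrier (sge N).
        h (circ_elt M N x y) =
          ee_elt M N (sgDelta M x) (sgH N y) \<otimes>\<^bsub>circ_ee M N\<^esub> ee_elt M N (sgH M x) (sgcross N y y)) \<and>
     (\<forall>a\<in>carrier (sgee M). \<forall>b\<in>carrier (sgee N).
        h (bar_elt M N a b) =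
          ee_elt M N a b \<otimes>\<^bsub>circ_ee M N\<^esub> inv\<^bsub>circ_ee M N\<^esub> (ee_elt M N (sgT M a) (sgT N b))) \<and>
     (\<forall>a\<in>carrier (sgee M). \<forall>b\<in>carrier (sgee N). \<forall>u\<in>carrier (circ_e M N).
        cross (circ_e M N) (circ_ee M N) h (bar_elt M N a b) u = \<one>\<^bsub>circ_ee M N\<^esub> \<and>
        cross (circ_e M N) (circ_ee M N) h u (bar_elt M N a b) = \<one>\<^bsub>circ_ee M N\<^esub>) \<and>
     (\<forall>x\<in>carrier (sge M). \<forall>y\<in>carrier (sge N). \<forall>x'\<in>carrier (sge M). \<forall>y'\<in>carrier (sge N).
        cross (circ_e M N) (circ_ee M N) h (circ_elt M N x y) (circ_elt M N x' y') =
          ee_elt M N (sgcross M x x') (sgcross N y y')))"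

definition circ_prod :: "('x, 'a) sqgroup \<Rightarrow> ('y, 'b) sqgroup
    \<Rightarrow> (('x, 'y, 'a, 'b) circ_gen gterm set, ('a \<times> 'b) gterm set) sqgroup"
    (infixl "\<circledcirc>" 70) where
  "M \<circledcirc> N = \<lparr>
     sge = circ_e M N, sgee = circ_ee M N, sgH = circ_H M N,
     sgP = tensor_lift (sgee M) (sgee N) (circ_e M N) (bar_elt M N) \<rparr>"

text \<open>The induced morphism \<open>f \<circledcirc> g\<close> for \<open>f : M \<rightarrow> M'\<close> and \<open>g : N \<rightarrow> N'\<close>.\<close>

definition circ_map ::
    "('x, 'a) sqgroup \<Rightarrow> ('x2, 'a2) sqgroup \<Rightarrow> ('x \<Rightarrow> 'x2) \<times> ('a \<Rightarrow> 'a2)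
      \<Rightarrow> ('y, 'b) sqgroup \<Rightarrow> ('y2, 'b2) sqgroup \<Rightarrow> ('y \<Rightarrow> 'y2) \<times> ('b \<Rightarrow> 'b2)
      \<Rightarrow> (('x, 'y, 'a, 'b) circ_gen gterm set \<Rightarrow> ('x2, 'y2, 'a2, 'b2) circ_gen gterm set) \<times>
         (('a \<times> 'b) gterm set \<Rightarrow> ('a2 \<times> 'b2) gterm set)" where
  "circ_map M M' f N N' g = (THE h.
     h \<in> sg_hom (M \<circledcirc> N) (M' \<circledcirc> N') \<and>
     (\<forall>x\<in>carrier (sge M). \<forall>y\<in>carrier (sge N).
        fst h (circ_elt M N x y) = circ_elt M' N' (fst f x) (fst g y)) \<and>
     (\<forall>a\<in>carrier (sgee M). \<forall>b\<in>carrier (sgee N).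
        fst h (bar_elt M N a b) = bar_elt M' N' (snd f a) (snd g b) \<and>
        snd h (ee_elt M N a b) = ee_elt M' N' (snd f a) (snd g b)))"


section \<open>The square groups of a Waldhausen category\<close>

text \<open>
  The degree 0 group of \<open>Dmod C\<close> is the free group of nilpotency class 2 on the objects other
  than the zero object: each relation on \<open>\<partial>\<close> determines \<open>\<partial>\<close> on one generator of degree 1,
  the axioms make every commutator central, and \<open>[*] = 0\<close> is the only other relation.
\<close>

definition D0_H :: "('o, 'm) waldcat \<Rightarrow> ('o, 'm) D0elt \<Rightarrow> ('o, 'm) Deelt" where
  "D0_H C = (THE h.
     h \<in> extensional (carrier (sq0 (Dmod C))) \<and>
     quadratic_map (sq0 (Dmod C)) (ab_tensor (sq0 (Dmod C))) h \<and>
     (\<forall>A\<in>Obj C. h (D_ob C A) = \<one>\<^bsub>ab_tensor (sq0 (Dmod C))\<^esub>) \<and>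
     (\<forall>x\<in>carrier (sq0 (Dmod C)). \<forall>y\<in>carrier (sq0 (Dmod C)).
        cross (sq0 (Dmod C)) (ab_tensor (sq0 (Dmod C))) h x y = ab_tensor_elt (sq0 (Dmod C)) y x))"

definition D0sg :: "('o, 'm) waldcat \<Rightarrow> (('o, 'm) D0elt, ('o, 'm) Deelt) sqgroup" where
  "D0sg C = \<lparr>
     sge = sq0 (Dmod C), sgee = ab_tensor (sq0 (Dmod C)), sgH = D0_H C,
     sgP = sqd (Dmod C) \<circ> sqw (Dmod C) \<rparr>"

definition D1sg :: "('o, 'm) waldcat \<Rightarrow> (('o, 'm) D1elt, ('o, 'm) Deelt) sqgroup" where
  "D1sg C = \<lparr>
     sge = sq1 (Dmod C), sgee = ab_tensor (sq0 (Dmod C)), sgH = D0_H C \<circ> sqd (Dmod C),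
     sgP = sqw (Dmod C) \<rparr>"

definition Dsg_bd :: "('o, 'm) waldcat
    \<Rightarrow> (('o, 'm) D1elt \<Rightarrow> ('o, 'm) D0elt) \<times> (('o, 'm) Deelt \<Rightarrow> ('o, 'm) Deelt)" where
  "Dsg_bd C = (restrict (sqd (Dmod C)) (carrier (sge (D1sg C))),
               restrict id (carrier (sgee (D1sg C))))"

text \<open>The element \<open>{[A]} \<otimes> {[B]}\<close> of the common \<open>ee\<close>-part.\<close>

definition D_ee :: "('o, 'm) waldcat \<Rightarrow> 'o \<Rightarrow> 'o \<Rightarrow> ('o, 'm) Deelt" where
  "D_ee C A B = ab_tensor_elt (sq0 (Dmod C)) (D_ob C A) (D_ob C B)"


section \<open>The defining conditions of the product morphisms\<close>

text \<open>The common condition on \<open>ee\<close>-parts, which are the same for all three pairs \<open>(i,j)\<close>.\<close>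

definition phi_ee :: "('o, 'm) waldcat \<Rightarrow> ('p, 'n) waldcat \<Rightarrow> ('q, 'r) waldcat \<Rightarrow> ('o \<times> 'p \<Rightarrow> 'q)
    \<Rightarrow> ((('o, 'm) Deelt \<times> ('p, 'n) Deelt) gterm set \<Rightarrow> ('q, 'r) Deelt) \<Rightarrow> bool" where
  "phi_ee C D E Fo g \<longleftrightarrow>
     (\<forall>A\<in>Obj C. \<forall>A'\<in>Obj C. \<forall>B\<in>Obj D. \<forall>B'\<in>Obj D.
        g (ee_elt (D0sg C) (D0sg D) (D_ee C A A') (D_ee D B B'))
          = D_ee E (Fo (A, B)) (Fo (A', B')))"

definition is_phi00 where
  "is_phi00 C D E Fo \<phi> \<longleftrightarrow>
     \<phi> \<in> sg_hom (D0sg C \<circledcirc> D0sg D) (D0sg E) \<and>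
     (\<forall>A\<in>Obj C. \<forall>B\<in>Obj D.
        fst \<phi> (circ_elt (D0sg C) (D0sg D) (D_ob C A) (D_ob D B)) = D_ob E (Fo (A, B))) \<and>
     phi_ee C D E Fo (snd \<phi>)"

definition is_phi01 where
  "is_phi01 C D E Fo Fm \<phi> \<longleftrightarrow>
     \<phi> \<in> sg_hom (D0sg C \<circledcirc> D1sg D) (D1sg E) \<and>
     (\<forall>A\<in>Obj C. \<forall>g\<in>Weq D.
        fst \<phi> (circ_elt (D0sg C) (D1sg D) (D_ob C A) (D_we D g)) = D_we E (Fm (Ide C A, g))) \<and>
     (\<forall>A\<in>Obj C. \<forall>i p. cofseq D i p \<longrightarrow>
        fst \<phi> (circ_elt (D0sg C) (D1sg D) (D_ob C A) (D_cs D i p))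
          = D_cs E (Fm (Ide C A, i)) (Fm (Ide C A, p))) \<and>
     phi_ee C D E Fo (snd \<phi>)"

definition is_phi10 where
  "is_phi10 C D E Fo Fm \<phi> \<longleftrightarrow>
     \<phi> \<in> sg_hom (D1sg C \<circledcirc> D0sg D) (D1sg E) \<and>
     (\<forall>f\<in>Weq C. \<forall>B\<in>Obj D.
        fst \<phi> (circ_elt (D1sg C) (D0sg D) (D_we C f) (D_ob D B)) = D_we E (Fm (f, Ide D B))) \<and>
     (\<forall>i p. cofseq C i p \<longrightarrow> (\<forall>B\<in>Obj D.
        fst \<phi> (circ_elt (D1sg C) (D0sg D) (D_cs C i p) (D_ob D B))
          = D_cs E (Fm (i, Ide D B)) (Fm (p, Ide D B)))) \<and>
     phi_ee C D E Fo (snd \<phi>)"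

end

theory Submission
  imports Defs
begin

text \<open>
  The degree 0 group \<open>D0 C\<close> is free of nilpotency class 2 on the objects, so the product with a
  fixed element is prescribed on objects by the exact functors \<open>A \<and> -\<close> and \<open>- \<and> B\<close> and extended:
  additively in the first variable, and in the second one by the law
  \<open>x(y + y') = xy + xy' + \<langle>H(x), (y'|y)\<rangle>\<close>. Maps obeying such a law are sections of a central extension
  of class 2 (\<open>twist\<close>), hence exist and are determined by their values on objects; the same device
  yields \<open>H\<close> on \<open>D0 C\<close> and on \<open>M \<circledcirc> N\<close>.

  The identity \<open>(\<partial>c)d = c(\<partial>d)\<close> reduces by the two laws to generators. For two weak equivalences
  it is relation (6), for a weak equivalence and a cofiber sequence relation (7). For two cofiber
  sequences, factor the corner of the resulting \<open>3 \<times> 3\<close> diagram through the push-out \<open>X\<close> of its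
  upper left square: the two ways around give relation (8) four times, and they differ by
  relation (9) for the cofiber of the corner in \<open>X\<close>, which is a coproduct.
\<close>

section \<open>Commutators and biadditive maps\<close>

text \<open>Freeness of \<open>D0 C\<close> is not built into its definition. It is extracted from
  the universal property of the presented module by mapping into a class-two group K taken in both
  degrees, with \<partial> the identity: there every degree 1 generator must go to its own boundary,
  and the relations become identities between words in K. \<open>D1 C\<close> has no such freeness,
  so dependence on a degree 1 argument always comes from an exact functor, and extension happens in
  the degree 0 variable: \<open>F0\<close> and \<open>F1\<close> are extended over their first
  argument, \<open>F2\<close> over its second.

  Comparisons rest on one fact: a map with prescribed deviation from additivity is determined by its
  values on generators, even if the target is not commutative. The deviation is dictated by the
  tensor product; the work lies in its compatibility with \<partial>, \<omega> and the involution T.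

  In the identity for two degree 1 arguments the boundaries contain negatives and appear in a fixed
  order, while the relations of E have their own order; the commutators this produces are cancelled
  by values of H. The condition on corner maps enters with two cofiber sequences, where the map out
  of X must be a cofibration.\<close>

context group
begin

lemma inv_mult_cancel [simp]:
  "x \<in> carrier G \<Longrightarrow> y \<in> carrier G \<Longrightarrow> inv x \<otimes> (x \<otimes> y) = y"
  "x \<in> carrier G \<Longrightarrow> y \<in> carrier G \<Longrightarrow> x \<otimes> (inv x \<otimes> y) = y"
  by (simp_all flip: m_assoc)

lemma gcommutator_closed [simp]:
  "x \<in> carrier G \<Longrightarrow> y \<in> carrier G \<Longrightarrow> gcommutator G x y \<in> carrier G"
  by (simp add: gcommutator_def)

text \<open>With [x,y] = -x - y + x + y the commutator is the term to add on the right when x + y is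
  turned into y + x. This characterization and its converse \<open>gcommutatorI\<close> replace the
  definition in later computations.\<close>

lemma gcommutator_swap:
  "x \<in> carrier G \<Longrightarrow> y \<in> carrier G \<Longrightarrow> x \<otimes> y = y \<otimes> x \<otimes> gcommutator G x y"
  by (simp add: gcommutator_def m_assoc)

lemma gcommutatorI:
  assumes "x \<in> carrier G" "y \<in> carrier G" "c \<in> carrier G" "x \<otimes> y = y \<otimes> x \<otimes> c"
  shows "gcommutator G x y = c"
  using assms by (simp add: gcommutator_def m_assoc)

lemma gcommutator_one_iff:
  "x \<in> carrier G \<Longrightarrow> y \<in> carrier G \<Longrightarrow> gcommutator G x y = \<one> \<longleftrightarrow> x \<otimes> y = y \<otimes> x"
  using gcommutator_swap[of x y] gcommutatorI[of x y \<one>] by auto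

lemma inv_gcommutator:
  "x \<in> carrier G \<Longrightarrow> y \<in> carrier G \<Longrightarrow> inv (gcommutator G x y) = gcommutator G y x"
  by (simp add: gcommutator_def inv_mult_group m_assoc)

lemma comm_inv:
  assumes "x \<in> carrier G" "y \<in> carrier G" "x \<otimes> y = y \<otimes> x"
  shows "inv x \<otimes> y = y \<otimes> inv x"
  by (metis assms inv_closed inv_solve_left inv_solve_right m_assoc m_closed)

end

lemma (in group_hom) hom_gcommutator:
  "x \<in> carrier G \<Longrightarrow> y \<in> carrier G \<Longrightarrow> h (gcommutator G x y) = gcommutator H (h x) (h y)"
  by (simp add: gcommutator_def)

lemma biadditiveI:
  assumes "\<And>a b. a \<in> carrier A \<Longrightarrow> b \<in> carrier B \<Longrightarrow> f a b \<in> carrier K"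
    and "\<And>a a' b. a \<in> carrier A \<Longrightarrow> a' \<in> carrier A \<Longrightarrow> b \<in> carrier B \<Longrightarrow>
           f (a \<otimes>\<^bsub>A\<^esub> a') b = f a b \<otimes>\<^bsub>K\<^esub> f a' b"
    and "\<And>a b b'. a \<in> carrier A \<Longrightarrow> b \<in> carrier B \<Longrightarrow> b' \<in> carrier B \<Longrightarrow>
           f a (b \<otimes>\<^bsub>B\<^esub> b') = f a b \<otimes>\<^bsub>K\<^esub> f a b'"
  shows "biadditive A B K f"
  using assms by (auto simp: biadditive_def hom_def)

text \<open>The target is an arbitrary group: besides pairings into tensor products there are
  pairings, such as brackets, into degree 1 groups that need not be commutative.\<close>

locale biadditive_map = A: group A + B: group B + K: group K
  for A :: "('a, 'x) monoid_scheme" and B :: "('b, 'y) monoid_scheme"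
    and K :: "('c, 'z) monoid_scheme" and f +
  assumes biadd: "biadditive A B K f"
begin

lemma closed [simp]: "a \<in> carrier A \<Longrightarrow> b \<in> carrier B \<Longrightarrow> f a b \<in> carrier K"
  using biadd by (auto simp: biadditive_def hom_def)

lemma add_left:
  "a \<in> carrier A \<Longrightarrow> a' \<in> carrier A \<Longrightarrow> b \<in> carrier B \<Longrightarrow> f (a \<otimes>\<^bsub>A\<^esub> a') b = f a b \<otimes>\<^bsub>K\<^esub> f a' b"
  using biadd by (auto simp: biadditive_def hom_def)

lemma add_right:
  "a \<in> carrier A \<Longrightarrow> b \<in> carrier B \<Longrightarrow> b' \<in> carrier B \<Longrightarrow> f a (b \<otimes>\<^bsub>B\<^esub> b') = f a b \<otimes>\<^bsub>K\<^esub> f a b'"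
  using biadd by (auto simp: biadditive_def hom_def)

lemma hom_left: "b \<in> carrier B \<Longrightarrow> group_hom A K (\<lambda>a. f a b)"
  using biadd by unfold_locales (auto simp: biadditive_def)

lemma hom_right: "a \<in> carrier A \<Longrightarrow> group_hom B K (f a)"
  using biadd by unfold_locales (auto simp: biadditive_def)

lemma one_left [simp]: "b \<in> carrier B \<Longrightarrow> f \<one>\<^bsub>A\<^esub> b = \<one>\<^bsub>K\<^esub>"
  using group_hom.hom_one[OF hom_left] .

lemma one_right [simp]: "a \<in> carrier A \<Longrightarrow> f a \<one>\<^bsub>B\<^esub> = \<one>\<^bsub>K\<^esub>"
  using group_hom.hom_one[OF hom_right] .

lemma inv_left: "a \<in> carrier A \<Longrightarrow> b \<in> carrier B \<Longrightarrow> f (inv\<^bsub>A\<^esub> a) b = inv\<^bsub>K\<^esub> f a b"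
  using group_hom.hom_inv[OF hom_left] .

lemma inv_right: "a \<in> carrier A \<Longrightarrow> b \<in> carrier B \<Longrightarrow> f a (inv\<^bsub>B\<^esub> b) = inv\<^bsub>K\<^esub> f a b"
  using group_hom.hom_inv[OF hom_right] .

text \<open>A homomorphism kills [a,a'] exactly when the two images commute, which has to be assumed
  as K need not be commutative.\<close>

lemma gcommutator_left:
  assumes "a \<in> carrier A" "a' \<in> carrier A" "b \<in> carrier B"
    and "f a b \<otimes>\<^bsub>K\<^esub> f a' b = f a' b \<otimes>\<^bsub>K\<^esub> f a b"
  shows "f (gcommutator A a a') b = \<one>\<^bsub>K\<^esub>"
  using group_hom.hom_gcommutator[OF hom_left] assms K.gcommutator_one_iff by simp

lemma gcommutator_right:
  assumes "a \<in> carrier A" "b \<in> carrier B" "b' \<in> carrier B"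
    and "f a b \<otimes>\<^bsub>K\<^esub> f a b' = f a b' \<otimes>\<^bsub>K\<^esub> f a b"
  shows "f a (gcommutator B b b') = \<one>\<^bsub>K\<^esub>"
  using group_hom.hom_gcommutator[OF hom_right] assms K.gcommutator_one_iff by simp

end

lemma biadditive_mapI:
  "group A \<Longrightarrow> group B \<Longrightarrow> group K \<Longrightarrow> biadditive A B K f \<Longrightarrow> biadditive_map A B K f"
  by (simp add: biadditive_map_def biadditive_map_axioms_def)

lemma biadditive_compose:
  assumes f: "biadditive A B K f" and h: "h \<in> hom K L" and g: "g \<in> hom A' A" "g' \<in> hom B' B"
  shows "biadditive A' B' L (\<lambda>a b. h (f (g a) (g' b)))"
proof -
  have "f a \<in> hom B K" if "a \<in> carrier A" for a using f that by (simp add: biadditive_def)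
  moreover have "(\<lambda>a. f a b) \<in> hom A K" if "b \<in> carrier B" for b
    using f that by (simp add: biadditive_def)
  ultimately show ?thesis using h g by (intro biadditiveI) (simp_all add: hom_def Pi_iff)
qed

section \<open>Groups of nilpotency class at most two\<close>

locale nil2_group = group G for G :: "'a monoid" (structure) +
  assumes commutator_central: "x \<in> carrier G \<Longrightarrow> y \<in> carrier G \<Longrightarrow> z \<in> carrier G \<Longrightarrow>
    gcommutator G x y \<otimes> z = z \<otimes> gcommutator G x y"
begin

text \<open>Moving b to the left through a + a' leaves [a,b] between a and a'; centrality lets it
  pass to the right. The second variable is treated alike.\<close>

lemma gcommutator_biadditive: "biadditive G G G (gcommutator G)"
proof (rule biadditiveI)
  fix a a' b assume c: "a \<in> carrier G" "a' \<in> carrier G" "b \<in> carrier G"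
  show "gcommutator G (a \<otimes> a') b = gcommutator G a b \<otimes> gcommutator G a' b"
  proof (rule gcommutatorI)
    have "a \<otimes> a' \<otimes> b = a \<otimes> b \<otimes> a' \<otimes> gcommutator G a' b"
      using c gcommutator_swap[of a' b] by (simp add: m_assoc)
    also have "a \<otimes> b = b \<otimes> a \<otimes> gcommutator G a b" using c by (intro gcommutator_swap)
    also have "b \<otimes> a \<otimes> gcommutator G a b \<otimes> a' \<otimes> gcommutator G a' b
       = b \<otimes> a \<otimes> (gcommutator G a b \<otimes> a') \<otimes> gcommutator G a' b"
      using c by (simp add: m_assoc)
    also have "\<dots> = b \<otimes> (a \<otimes> a') \<otimes> (gcommutator G a b \<otimes> gcommutator G a' b)"
      using c by (simp add: commutator_central[of a b a'] m_assoc)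
    finally show "a \<otimes> a' \<otimes> b = b \<otimes> (a \<otimes> a') \<otimes> (gcommutator G a b \<otimes> gcommutator G a' b)" .
  qed (use c in auto)
next
  fix a b b' assume c: "a \<in> carrier G" "b \<in> carrier G" "b' \<in> carrier G"
  show "gcommutator G a (b \<otimes> b') = gcommutator G a b \<otimes> gcommutator G a b'"
  proof (rule gcommutatorI)
    have "a \<otimes> (b \<otimes> b') = b \<otimes> a \<otimes> (gcommutator G a b \<otimes> b')"
      using c gcommutator_swap[of a b] by (simp flip: m_assoc)
    also have "\<dots> = b \<otimes> (a \<otimes> b') \<otimes> gcommutator G a b"
      using c by (simp add: commutator_central[of a b b'] m_assoc)
    also have "a \<otimes> b' = b' \<otimes> a \<otimes> gcommutator G a b'" using c by (intro gcommutator_swap)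
    finally show "a \<otimes> (b \<otimes> b') = b \<otimes> b' \<otimes> a \<otimes> (gcommutator G a b \<otimes> gcommutator G a b')"
      using c by (simp add: commutator_central[of a b "gcommutator G a b'"] m_assoc)
  qed (use c in auto)
qed simp

end

lemma biadditive_flip: "biadditive A B K f \<Longrightarrow> biadditive B A K (\<lambda>b a. f a b)"
  by (simp add: biadditive_def)

text \<open>The group structure on \<open>K \<times> G\<close> whose sections over \<open>G\<close> are the maps \<open>g\<close> with
  \<open>g(x + y) = g(x) + g(y) + \<beta>(x, y)\<close>.\<close>

definition twist :: "'k monoid \<Rightarrow> 'g monoid \<Rightarrow> ('g \<Rightarrow> 'g \<Rightarrow> 'k) \<Rightarrow> ('k \<times> 'g) monoid" where
  "twist K G \<beta> = \<lparr>carrier = carrier K \<times> carrier G,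
     mult = (\<lambda>(u, x) (v, y). (u \<otimes>\<^bsub>K\<^esub> v \<otimes>\<^bsub>K\<^esub> \<beta> x y, x \<otimes>\<^bsub>G\<^esub> y)),
     one = (\<one>\<^bsub>K\<^esub>, \<one>\<^bsub>G\<^esub>)\<rparr>"

lemma twist_simps [simp]:
  "carrier (twist K G \<beta>) = carrier K \<times> carrier G"
  "(u, x) \<otimes>\<^bsub>twist K G \<beta>\<^esub> (v, y) = (u \<otimes>\<^bsub>K\<^esub> v \<otimes>\<^bsub>K\<^esub> \<beta> x y, x \<otimes>\<^bsub>G\<^esub> y)"
  "\<one>\<^bsub>twist K G \<beta>\<^esub> = (\<one>\<^bsub>K\<^esub>, \<one>\<^bsub>G\<^esub>)"
  by (simp_all add: twist_def)

section \<open>Central extensions by biadditive cocycles\<close>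

locale central_cocycle = biadditive_map G G K \<beta>
  for K :: "'k monoid" and G :: "'g monoid" and \<beta> +
  assumes central: "x \<in> carrier G \<Longrightarrow> y \<in> carrier G \<Longrightarrow> u \<in> carrier K \<Longrightarrow>
    \<beta> x y \<otimes>\<^bsub>K\<^esub> u = u \<otimes>\<^bsub>K\<^esub> \<beta> x y"
begin

lemma central2: "x \<in> carrier G \<Longrightarrow> y \<in> carrier G \<Longrightarrow> u \<in> carrier K \<Longrightarrow> v \<in> carrier K \<Longrightarrow>
    \<beta> x y \<otimes>\<^bsub>K\<^esub> (u \<otimes>\<^bsub>K\<^esub> v) = u \<otimes>\<^bsub>K\<^esub> (\<beta> x y \<otimes>\<^bsub>K\<^esub> v)"
  using central[of x y u] by (simp flip: K.m_assoc)

text \<open>Biadditivity gives the cocycle identity: both bracketings of three factors produce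
  \<beta>(x,y), \<beta>(x,z) and \<beta>(y,z), and centrality makes their order and position
  irrelevant.\<close>

lemma twist_group: "group (twist K G \<beta>)"
proof (rule groupI)
  fix p q r assume "p \<in> carrier (twist K G \<beta>)" "q \<in> carrier (twist K G \<beta>)" "r \<in> carrier (twist K G \<beta>)"
  then obtain u x v y w z where pqr: "p = (u, x)" "q = (v, y)" "r = (w, z)"
    and c: "u \<in> carrier K" "v \<in> carrier K" "w \<in> carrier K"
      "x \<in> carrier G" "y \<in> carrier G" "z \<in> carrier G" by auto
  have "u \<otimes>\<^bsub>K\<^esub> v \<otimes>\<^bsub>K\<^esub> \<beta> x y \<otimes>\<^bsub>K\<^esub> w \<otimes>\<^bsub>K\<^esub> (\<beta> x z \<otimes>\<^bsub>K\<^esub> \<beta> y z)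
      = u \<otimes>\<^bsub>K\<^esub> v \<otimes>\<^bsub>K\<^esub> w \<otimes>\<^bsub>K\<^esub> (\<beta> x y \<otimes>\<^bsub>K\<^esub> (\<beta> x z \<otimes>\<^bsub>K\<^esub> \<beta> y z))"
    using c by (simp add: K.m_assoc central2[of x y w])
  also have "\<beta> x y \<otimes>\<^bsub>K\<^esub> (\<beta> x z \<otimes>\<^bsub>K\<^esub> \<beta> y z) = \<beta> y z \<otimes>\<^bsub>K\<^esub> (\<beta> x y \<otimes>\<^bsub>K\<^esub> \<beta> x z)"
    using c central[of y z "\<beta> x y \<otimes>\<^bsub>K\<^esub> \<beta> x z"] by (simp add: K.m_assoc)
  finally show "p \<otimes>\<^bsub>twist K G \<beta>\<^esub> q \<otimes>\<^bsub>twist K G \<beta>\<^esub> r = p \<otimes>\<^bsub>twist K G \<beta>\<^esub> (q \<otimes>\<^bsub>twist K G \<beta>\<^esub> r)"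
    using c by (simp add: pqr K.m_assoc A.m_assoc add_left add_right)
next
  fix p assume "p \<in> carrier (twist K G \<beta>)"
  then obtain u x where p: "p = (u, x)" "u \<in> carrier K" "x \<in> carrier G" by auto
  show "\<exists>q\<in>carrier (twist K G \<beta>). q \<otimes>\<^bsub>twist K G \<beta>\<^esub> p = \<one>\<^bsub>twist K G \<beta>\<^esub>"
  \<comment> \<open>The leading term -\<beta>(-x,x) offsets what the cocycle contributes to the
    product with (u,x).\<close>
  proof (rule bexI[of _ "(inv\<^bsub>K\<^esub> \<beta> (inv\<^bsub>G\<^esub> x) x \<otimes>\<^bsub>K\<^esub> inv\<^bsub>K\<^esub> u, inv\<^bsub>G\<^esub> x)"])
  qed (use p in \<open>auto simp: K.m_assoc\<close>)
qed auto

lemma kills_commutators: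
  assumes "x \<in> carrier G" "y \<in> carrier G" "z \<in> carrier G"
  shows "\<beta> (gcommutator G x y) z = \<one>\<^bsub>K\<^esub>" "\<beta> z (gcommutator G x y) = \<one>\<^bsub>K\<^esub>"
  by (rule gcommutator_left gcommutator_right; (rule central)?; use assms in simp)+

text \<open>The commutator of (u,x) and (v,y) is ([u,v] + \<beta>(x,y) - \<beta>(y,x), [x,y]). Its
  first component is central and \<beta> vanishes on the second, so it is central in the extension.
  Class two is needed because \<open>D0 C\<close> is free only among such groups.\<close>

lemma twist_nil2:
  assumes K: "nil2_group K" and G: "nil2_group G"
  shows "nil2_group (twist K G \<beta>)"
proof -
  interpret T: group "twist K G \<beta>" by (rule twist_group)
  interpret K': nil2_group K by fact
  interpret G': nil2_group G by fact
  show ?thesis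
  proof
    fix p q r assume "p \<in> carrier (twist K G \<beta>)" "q \<in> carrier (twist K G \<beta>)" "r \<in> carrier (twist K G \<beta>)"
    then obtain u x v y w z where pqr: "p = (u, x)" "q = (v, y)" "r = (w, z)"
      and c [simp]: "u \<in> carrier K" "v \<in> carrier K" "w \<in> carrier K"
        "x \<in> carrier G" "y \<in> carrier G" "z \<in> carrier G" by auto
    define k where "k = gcommutator K u v \<otimes>\<^bsub>K\<^esub> \<beta> x y \<otimes>\<^bsub>K\<^esub> inv\<^bsub>K\<^esub> \<beta> y x"
    have k [simp]: "k \<in> carrier K" by (simp add: k_def)
    have kc: "k \<otimes>\<^bsub>K\<^esub> t = t \<otimes>\<^bsub>K\<^esub> k" if "t \<in> carrier K" for t
    proof -
      have "gcommutator K u v \<otimes>\<^bsub>K\<^esub> (t \<otimes>\<^bsub>K\<^esub> s) = t \<otimes>\<^bsub>K\<^esub> (gcommutator K u v \<otimes>\<^bsub>K\<^esub> s)"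
        if "s \<in> carrier K" for s
        using that \<open>t \<in> carrier K\<close> K'.commutator_central[of u v t] by (simp flip: K.m_assoc)
      then show ?thesis
        using that K.comm_inv[OF _ _ central[of y x t]]
        by (simp add: k_def K.m_assoc central2[of x y t])
    qed
    have uv: "v \<otimes>\<^bsub>K\<^esub> u \<otimes>\<^bsub>K\<^esub> \<beta> y x \<otimes>\<^bsub>K\<^esub> k = u \<otimes>\<^bsub>K\<^esub> v \<otimes>\<^bsub>K\<^esub> \<beta> x y"
    proof -
      have "v \<otimes>\<^bsub>K\<^esub> u \<otimes>\<^bsub>K\<^esub> \<beta> y x \<otimes>\<^bsub>K\<^esub> k = v \<otimes>\<^bsub>K\<^esub> u \<otimes>\<^bsub>K\<^esub> (k \<otimes>\<^bsub>K\<^esub> \<beta> y x)"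
        by (simp add: K.m_assoc kc)
      also have "k \<otimes>\<^bsub>K\<^esub> \<beta> y x = gcommutator K u v \<otimes>\<^bsub>K\<^esub> \<beta> x y"
        by (simp add: k_def K.m_assoc)
      also have "v \<otimes>\<^bsub>K\<^esub> u \<otimes>\<^bsub>K\<^esub> (gcommutator K u v \<otimes>\<^bsub>K\<^esub> \<beta> x y) = u \<otimes>\<^bsub>K\<^esub> v \<otimes>\<^bsub>K\<^esub> \<beta> x y"
        by (simp add: K.gcommutator_swap[of u v] K.m_assoc)
      finally show ?thesis .
    qed
    have cm: "gcommutator (twist K G \<beta>) p q = (k, gcommutator G x y)"
      by (rule T.gcommutatorI)
        (simp_all add: pqr kills_commutators uv A.gcommutator_swap[of x y])
    show "gcommutator (twist K G \<beta>) p q \<otimes>\<^bsub>twist K G \<beta>\<^esub> r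
        = r \<otimes>\<^bsub>twist K G \<beta>\<^esub> gcommutator (twist K G \<beta>) p q"
      unfolding cm unfolding pqr by (simp add: kills_commutators kc G'.commutator_central)
  qed
qed

end

lemma comm_group_nil2: "comm_group A \<Longrightarrow> nil2_group A"
proof -
  assume "comm_group A"
  then interpret comm_group A .
  show ?thesis by unfold_locales (simp add: m_comm)
qed

lemma group_homI: "group G \<Longrightarrow> group H \<Longrightarrow> h \<in> hom G H \<Longrightarrow> group_hom G H h"
  by (simp add: group_hom_def group_hom_axioms_def)


section \<open>Presented groups and tensor products\<close>

lemma presented_group_induct [consumes 1, case_names gen one mult inv]:
  assumes "u \<in> carrier (presented_group S R)"
    and gen: "\<And>g. g \<in> S \<Longrightarrow> P (gclass S R (GGen g))"
    and one: "P \<one>\<^bsub>presented_group S R\<^esub>"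
    and mult: "\<And>u v. u \<in> carrier (presented_group S R) \<Longrightarrow> v \<in> carrier (presented_group S R) \<Longrightarrow>
           P u \<Longrightarrow> P v \<Longrightarrow> P (u \<otimes>\<^bsub>presented_group S R\<^esub> v)"
    and inv: "\<And>u. u \<in> carrier (presented_group S R) \<Longrightarrow> P u \<Longrightarrow> P (inv\<^bsub>presented_group S R\<^esub> u)"
  shows "P u"
proof -
  have "P (gclass S R t)" if "t \<in> gterms S" for t
    using that
  proof (induction rule: gterm_cases_induct)
    case zero then show ?case using one by (simp add: presented_one)
  next
    case (add s t)
    then show ?case using mult[of "gclass S R s" "gclass S R t"]
      by (simp add: presented_mult presented_carrier)
  next
    case (neg t)
    then show ?case using inv[of "gclass S R t"] by (simp add: presented_inv presented_carrier)
  qed (use gen in auto)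
  then show ?thesis using assms(1) by (auto simp: presented_carrier)
qed

lemma tensor_group_induct [consumes 1, case_names gen one mult inv]:
  assumes "u \<in> carrier (tensor_group A B)"
    and "\<And>a b. a \<in> carrier A \<Longrightarrow> b \<in> carrier B \<Longrightarrow> P (tensor_elt A B a b)"
    and "P \<one>\<^bsub>tensor_group A B\<^esub>"
    and "\<And>u v. u \<in> carrier (tensor_group A B) \<Longrightarrow> v \<in> carrier (tensor_group A B) \<Longrightarrow>
           P u \<Longrightarrow> P v \<Longrightarrow> P (u \<otimes>\<^bsub>tensor_group A B\<^esub> v)"
    and "\<And>u. u \<in> carrier (tensor_group A B) \<Longrightarrow> P u \<Longrightarrow> P (inv\<^bsub>tensor_group A B\<^esub> u)"
  shows "P u"
  using assms unfolding tensor_group_def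
  by (induction rule: presented_group_induct) (auto simp: tensor_elt_def)

lemma tensor_hom_eqI:
  assumes "group K" "h \<in> hom (tensor_group A B) K" "k \<in> hom (tensor_group A B) K"
    and "\<And>a b. a \<in> carrier A \<Longrightarrow> b \<in> carrier B \<Longrightarrow> h (tensor_elt A B a b) = k (tensor_elt A B a b)"
    and "u \<in> carrier (tensor_group A B)"
  shows "h u = k u"
  by (rule presented_hom_eqI[OF assms(1) assms(2,3)[unfolded tensor_group_def] _
        assms(5)[unfolded tensor_group_def]])
     (use assms(4) in \<open>auto simp: tensor_elt_def\<close>)

lemma ab_tensor_comm_group: "comm_group (ab_tensor G)"
  by (simp add: ab_tensor_def tensor_comm_group)

lemma ab_tensor_biadditive:
  assumes "group G" shows "biadditive G G (ab_tensor G) (ab_tensor_elt G)"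
proof -
  interpret A: comm_group "abelianization G" by (rule abelianization_comm_group[OF assms])
  have "biadditive (abelianization G) (abelianization G) (ab_tensor G)
      (tensor_elt (abelianization G) (abelianization G))"
    unfolding ab_tensor_def by (rule tensor_biadditive) unfold_locales
  from biadditive_compose[OF this, of id "ab_tensor G" "ab_class G" G "ab_class G" G]
  show ?thesis using ab_class_hom[OF assms] by (simp add: ab_tensor_elt_def[abs_def] hom_def)
qed

lemma ab_tensor_biadditive_map: "group G \<Longrightarrow> biadditive_map G G (ab_tensor G) (ab_tensor_elt G)"
  using ab_tensor_comm_group[of G, THEN comm_group.axioms(2)] ab_tensor_biadditive[of G]
  by (simp add: biadditive_mapI)

lemma ab_tensor_induct [consumes 1, case_names gen one mult inv]:
  assumes "u \<in> carrier (ab_tensor G)"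
    and "\<And>x y. x \<in> carrier G \<Longrightarrow> y \<in> carrier G \<Longrightarrow> P (ab_tensor_elt G x y)"
    and "P \<one>\<^bsub>ab_tensor G\<^esub>"
    and "\<And>u v. u \<in> carrier (ab_tensor G) \<Longrightarrow> v \<in> carrier (ab_tensor G) \<Longrightarrow>
           P u \<Longrightarrow> P v \<Longrightarrow> P (u \<otimes>\<^bsub>ab_tensor G\<^esub> v)"
    and "\<And>u. u \<in> carrier (ab_tensor G) \<Longrightarrow> P u \<Longrightarrow> P (inv\<^bsub>ab_tensor G\<^esub> u)"
  shows "P u"
  using assms unfolding ab_tensor_def
  by (induction rule: tensor_group_induct) (auto simp: ab_tensor_elt_def abelianization_carrier)

lemma ab_tensor_hom_eqI:
  assumes "group K" "h \<in> hom (ab_tensor G) K" "k \<in> hom (ab_tensor G) K"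
    and "\<And>x y. x \<in> carrier G \<Longrightarrow> y \<in> carrier G \<Longrightarrow> h (ab_tensor_elt G x y) = k (ab_tensor_elt G x y)"
    and "u \<in> carrier (ab_tensor G)"
  shows "h u = k u"
  by (rule tensor_hom_eqI[OF assms(1) assms(2,3)[unfolded ab_tensor_def] _
        assms(5)[unfolded ab_tensor_def]])
     (use assms(4) in \<open>auto simp: ab_tensor_elt_def abelianization_carrier\<close>)

lemma tensor_lift:
  assumes "group K" "biadditive A B K f"
    and "\<And>a b a' b'. a \<in> carrier A \<Longrightarrow> b \<in> carrier B \<Longrightarrow> a' \<in> carrier A \<Longrightarrow> b' \<in> carrier B \<Longrightarrow>
       f a b \<otimes>\<^bsub>K\<^esub> f a' b' = f a' b' \<otimes>\<^bsub>K\<^esub> f a b"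
  shows "tensor_lift A B K f \<in> hom (tensor_group A B) K"
    and "tensor_lift A B K f \<in> extensional (carrier (tensor_group A B))"
    and "a \<in> carrier A \<Longrightarrow> b \<in> carrier B \<Longrightarrow> tensor_lift A B K f (tensor_elt A B a b) = f a b"
  using theI'[OF tensor_universal[OF assms]] unfolding tensor_lift_def by auto

text \<open>The four-variable map is extended one tensor square at a time: for fixed y and y' over
  X, and then, the result being biadditive in y and y', for a fixed element of the first square over
  Y. Biadditivity is checked by comparing homomorphisms on generators; pointwise sums of
  homomorphisms are homomorphisms because K is commutative.\<close>

lemma ab_tensor_tensor_hom_exists:
  fixes X :: "'x monoid" and Y :: "'y monoid" and K :: "'k monoid"
  assumes X: "group X" and Y: "group Y" and K: "comm_group K"
    and XX: "\<And>y y'. y \<in> carrier Y \<Longrightarrow> y' \<in> carrier Y \<Longrightarrow> biadditive X X K (\<lambda>x x'. f x x' y y')"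
    and YY: "\<And>x x'. x \<in> carrier X \<Longrightarrow> x' \<in> carrier X \<Longrightarrow> biadditive Y Y K (f x x')"
  obtains \<phi> where "\<phi> \<in> hom (tensor_group (ab_tensor X) (ab_tensor Y)) K"
    and "\<phi> \<in> extensional (carrier (tensor_group (ab_tensor X) (ab_tensor Y)))"
    and "\<And>x x' y y'. x \<in> carrier X \<Longrightarrow> x' \<in> carrier X \<Longrightarrow> y \<in> carrier Y \<Longrightarrow> y' \<in> carrier Y \<Longrightarrow>
       \<phi> (tensor_elt (ab_tensor X) (ab_tensor Y) (ab_tensor_elt X x x') (ab_tensor_elt Y y y')) = f x x' y y'"
proof -
  interpret K: comm_group K by fact
  have Kg: "group K" by unfold_locales
  interpret TX: comm_group "ab_tensor X" by (rule ab_tensor_comm_group)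
  interpret TY: comm_group "ab_tensor Y" by (rule ab_tensor_comm_group)
  have "\<forall>y\<in>carrier Y. \<forall>y'\<in>carrier Y. \<exists>h. h \<in> hom (ab_tensor X) K \<and>
      (\<forall>x\<in>carrier X. \<forall>x'\<in>carrier X. h (ab_tensor_elt X x x') = f x x' y y')"
    using ab_tensor_universal[OF X Kg XX] by blast
  then obtain h where h: "\<And>y y'. y \<in> carrier Y \<Longrightarrow> y' \<in> carrier Y \<Longrightarrow> h y y' \<in> hom (ab_tensor X) K"
    and he: "\<And>y y' x x'. y \<in> carrier Y \<Longrightarrow> y' \<in> carrier Y \<Longrightarrow> x \<in> carrier X \<Longrightarrow> x' \<in> carrier X \<Longrightarrow>
      h y y' (ab_tensor_elt X x x') = f x x' y y'" by metis
  have mh: "(\<lambda>a. g a \<otimes>\<^bsub>K\<^esub> g' a) \<in> hom (ab_tensor X) K"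
    if "g \<in> hom (ab_tensor X) K" "g' \<in> hom (ab_tensor X) K" for g g'
    using that by (auto simp: hom_def Pi_iff K.m_ac)
  have hc: "h y y' a \<in> carrier K" if "y \<in> carrier Y" "y' \<in> carrier Y" "a \<in> carrier (ab_tensor X)" for y y' a
    using h[of y y'] that by (auto simp: hom_def)
  interpret Y: group Y by fact
  note fY = biadditive_mapI[OF Y Y Kg YY]
  note fY_add = biadditive_map.add_left[OF fY] biadditive_map.add_right[OF fY]
  have hb: "biadditive Y Y K (\<lambda>y y'. h y y' a)" if a: "a \<in> carrier (ab_tensor X)" for a
  proof (rule biadditiveI)
    fix y z y' assume c: "y \<in> carrier Y" "z \<in> carrier Y" "y' \<in> carrier Y"
    show "h (y \<otimes>\<^bsub>Y\<^esub> z) y' a = h y y' a \<otimes>\<^bsub>K\<^esub> h z y' a"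
      by (rule ab_tensor_hom_eqI[OF Kg _ mh _ a])
        (use c h in \<open>auto simp: he fY_add\<close>)
    show "h y (z \<otimes>\<^bsub>Y\<^esub> y') a = h y z a \<otimes>\<^bsub>K\<^esub> h y y' a"
      by (rule ab_tensor_hom_eqI[OF Kg _ mh _ a])
        (use c h in \<open>auto simp: he fY_add\<close>)
  qed (use a hc in auto)
  have "\<forall>a\<in>carrier (ab_tensor X). \<exists>k. k \<in> hom (ab_tensor Y) K \<and>
      (\<forall>y\<in>carrier Y. \<forall>y'\<in>carrier Y. k (ab_tensor_elt Y y y') = h y y' a)"
    using ab_tensor_universal[OF Y Kg hb] by blast
  then obtain k where k: "\<And>a. a \<in> carrier (ab_tensor X) \<Longrightarrow> k a \<in> hom (ab_tensor Y) K"
    and ke: "\<And>a y y'. a \<in> carrier (ab_tensor X) \<Longrightarrow> y \<in> carrier Y \<Longrightarrow> y' \<in> carrier Y \<Longrightarrow>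
      k a (ab_tensor_elt Y y y') = h y y' a" by metis
  have mk: "(\<lambda>a. g a \<otimes>\<^bsub>K\<^esub> g' a) \<in> hom (ab_tensor Y) K"
    if "g \<in> hom (ab_tensor Y) K" "g' \<in> hom (ab_tensor Y) K" for g g'
    using that by (auto simp: hom_def Pi_iff K.m_ac)
  have kb: "biadditive (ab_tensor X) (ab_tensor Y) K k"
  proof (rule biadditiveI)
    fix a a' b assume c: "a \<in> carrier (ab_tensor X)" "a' \<in> carrier (ab_tensor X)" "b \<in> carrier (ab_tensor Y)"
    show "k (a \<otimes>\<^bsub>ab_tensor X\<^esub> a') b = k a b \<otimes>\<^bsub>K\<^esub> k a' b"
      by (rule ab_tensor_hom_eqI[OF Kg _ mk _ c(3)])
        (use c k h in \<open>auto simp: ke hom_def\<close>)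
  qed (use k in \<open>auto simp: hom_def\<close>)
  show thesis
    by (rule that[of "tensor_lift (ab_tensor X) (ab_tensor Y) K k"])
       (use tensor_lift[OF Kg kb] kb in \<open>auto simp: K.m_comm biadditive_def hom_def Pi_iff
          ab_tensor_elt_closed ke he\<close>)
qed

section \<open>Commutators in stable quadratic modules\<close>

context stable_quadratic_module
begin

sublocale G0: group "sq0 Q" by (rule group0)
sublocale G1: group "sq1 Q" by (rule group1)
sublocale d: group_hom "sq1 Q" "sq0 Q" "sqd Q" by unfold_locales (rule d_hom)
sublocale T: comm_group "ab_tensor (sq0 Q)" by (rule ab_tensor_comm_group)
sublocale w: group_hom "ab_tensor (sq0 Q)" "sq1 Q" "sqw Q" by unfold_locales (rule w_hom)
sublocale e: biadditive_map "sq0 Q" "sq0 Q" "ab_tensor (sq0 Q)" "ab_tensor_elt (sq0 Q)"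
  by (rule ab_tensor_biadditive_map) (rule group0)
sublocale br: biadditive_map "sq0 Q" "sq0 Q" "sq1 Q" "sqbr Q"
  by (intro biadditive_mapI group0 group1 sqbr_biadditive)

lemma tensor_gcommutator:
  assumes "x \<in> carrier (sq0 Q)" "y \<in> carrier (sq0 Q)" "z \<in> carrier (sq0 Q)"
  shows "ab_tensor_elt (sq0 Q) (gcommutator (sq0 Q) x y) z = \<one>\<^bsub>ab_tensor (sq0 Q)\<^esub>"
    and "ab_tensor_elt (sq0 Q) z (gcommutator (sq0 Q) x y) = \<one>\<^bsub>ab_tensor (sq0 Q)\<^esub>"
  by (rule e.gcommutator_left e.gcommutator_right; use assms in \<open>simp add: T.m_comm\<close>)+

text \<open>On a generator \<partial>\<omega> is a commutator, and commutators vanish in the tensor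
  square of the abelianization.\<close>

lemma tensor_dw:
  assumes "a \<in> carrier (ab_tensor (sq0 Q))" "z \<in> carrier (sq0 Q)"
  shows "ab_tensor_elt (sq0 Q) (sqd Q (sqw Q a)) z = \<one>\<^bsub>ab_tensor (sq0 Q)\<^esub>"
    and "ab_tensor_elt (sq0 Q) z (sqd Q (sqw Q a)) = \<one>\<^bsub>ab_tensor (sq0 Q)\<^esub>"
  using assms(1)
  by (induction rule: ab_tensor_induct)
     (use assms(2) d_br in \<open>auto simp: tensor_gcommutator e.add_left e.add_right e.inv_left e.inv_right
        ab_tensor_elt_closed sqbr_def\<close>)

text \<open>The commutator of \<omega>(a) with c is the bracket of \<partial>c with
  \<partial>\<omega>(a), which vanishes by \<open>tensor_dw\<close>.\<close>

lemma w_central: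
  assumes "a \<in> carrier (ab_tensor (sq0 Q))" "c \<in> carrier (sq1 Q)"
  shows "sqw Q a \<otimes>\<^bsub>sq1 Q\<^esub> c = c \<otimes>\<^bsub>sq1 Q\<^esub> sqw Q a"
  using br_d[of c "sqw Q a"] assms G1.gcommutator_one_iff[of "sqw Q a" c]
  by (simp add: tensor_dw sqbr_def)

lemma dw_central:
  assumes a: "a \<in> carrier (ab_tensor (sq0 Q))" and x: "x \<in> carrier (sq0 Q)"
  shows "sqd Q (sqw Q a) \<otimes>\<^bsub>sq0 Q\<^esub> x = x \<otimes>\<^bsub>sq0 Q\<^esub> sqd Q (sqw Q a)"
  using d_br[of x "sqd Q (sqw Q a)"] assms G0.gcommutator_one_iff[of "sqd Q (sqw Q a)" x]
  by (simp add: tensor_dw sqbr_def)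

text \<open>Commutators in degree 0 are values of \<partial>\<omega>, hence central; in degree 1
  they are values of \<omega>, with the same conclusion.\<close>

lemma sq0_nil2: "nil2_group (sq0 Q)"
proof
  fix x y z assume "x \<in> carrier (sq0 Q)" "y \<in> carrier (sq0 Q)" "z \<in> carrier (sq0 Q)"
  then show "gcommutator (sq0 Q) x y \<otimes>\<^bsub>sq0 Q\<^esub> z = z \<otimes>\<^bsub>sq0 Q\<^esub> gcommutator (sq0 Q) x y"
    using dw_central[of "ab_tensor_elt (sq0 Q) y x" z] d_br[of y x]
    by (simp add: sqbr_def ab_tensor_elt_closed)
qed

lemma sq1_nil2: "nil2_group (sq1 Q)"
proof
  fix x y z assume "x \<in> carrier (sq1 Q)" "y \<in> carrier (sq1 Q)" "z \<in> carrier (sq1 Q)"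
  then show "gcommutator (sq1 Q) x y \<otimes>\<^bsub>sq1 Q\<^esub> z = z \<otimes>\<^bsub>sq1 Q\<^esub> gcommutator (sq1 Q) x y"
    using w_central[of "ab_tensor_elt (sq0 Q) (sqd Q y) (sqd Q x)" z] br_d[of y x]
    by (simp add: sqbr_def ab_tensor_elt_closed)
qed

end

text \<open>With \<partial> the identity, the axioms force the bracket to be the commutator with
  reversed arguments; \<omega> is any homomorphism inducing it. Tested against this module, the
  universal property of a presentation becomes a freeness statement about its degree 0
  group.\<close>

lemma (in nil2_group) nil2_sqmod:
  fixes Q
  defines "Q \<equiv> \<lparr>sq0 = G, sq1 = G, sqd = id, sqw = SOME h. h \<in> hom (ab_tensor G) G \<and>
      (\<forall>x\<in>carrier G. \<forall>y\<in>carrier G. h (ab_tensor_elt G x y) = gcommutator G y x)\<rparr>"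
  shows "stable_quadratic_module Q"
    and "x \<in> carrier G \<Longrightarrow> y \<in> carrier G \<Longrightarrow> sqbr Q x y = gcommutator G y x"
proof -
  interpret T: comm_group "ab_tensor G" by (rule ab_tensor_comm_group)
  have "\<exists>h. h \<in> hom (ab_tensor G) G \<and>
      (\<forall>x\<in>carrier G. \<forall>y\<in>carrier G. h (ab_tensor_elt G x y) = gcommutator G y x)"
    using ab_tensor_universal[OF is_group is_group biadditive_flip[OF gcommutator_biadditive]] by blast
  from someI_ex[OF this] have w: "sqw Q \<in> hom (ab_tensor G) G"
    "\<And>x y. x \<in> carrier G \<Longrightarrow> y \<in> carrier G \<Longrightarrow> sqw Q (ab_tensor_elt G x y) = gcommutator G y x"
    by (simp_all add: Q_def)
  show br: "sqbr Q x y = gcommutator G y x" if "x \<in> carrier G" "y \<in> carrier G" for x y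
    using w(2)[of x y] that by (simp add: sqbr_def) (simp add: Q_def)
  have s: "sq0 Q = G" "sq1 Q = G" "sqd Q = id" by (simp_all add: Q_def)
  show "stable_quadratic_module Q"
  proof
    fix x y assume xy: "x \<in> carrier (sq0 Q)" "y \<in> carrier (sq0 Q)"
    then show "sqd Q (sqbr Q x y) = gcommutator (sq0 Q) y x" by (simp add: s br)
    have "gcommutator G y x \<otimes> gcommutator G x y = \<one>"
      using xy inv_gcommutator[of x y, symmetric] by (simp add: s)
    then show "sqw Q (ab_tensor_elt (sq0 Q) x y \<otimes>\<^bsub>ab_tensor (sq0 Q)\<^esub> ab_tensor_elt (sq0 Q) y x)
        = \<one>\<^bsub>sq1 Q\<^esub>"
      using xy w by (simp add: s hom_mult[OF w(1)] ab_tensor_elt_closed)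
  qed (use w(1) in \<open>auto simp: s hom_def br is_group m_assoc\<close>)
qed

section \<open>Quadratic maps\<close>

text \<open>The law at 0 + 0 and at -x + x determines the values at 0 and at -x, for any \<beta> and
  without commutativity. So in an induction over generators, two maps with the same deviation from
  additivity need only be compared on the generators.\<close>

lemma quadratic_law_agree:
  assumes G: "group G" and K: "group K"
    and h: "\<And>x. x \<in> carrier G \<Longrightarrow> h x \<in> carrier K" "\<And>x. x \<in> carrier G \<Longrightarrow> h' x \<in> carrier K"
    and \<beta>: "\<And>x y. x \<in> carrier G \<Longrightarrow> y \<in> carrier G \<Longrightarrow> \<beta> x y \<in> carrier K"
    and law: "\<And>x y. x \<in> carrier G \<Longrightarrow> y \<in> carrier G \<Longrightarrow> h (x \<otimes>\<^bsub>G\<^esub> y) = h x \<otimes>\<^bsub>K\<^esub> h y \<otimes>\<^bsub>K\<^esub> \<beta> x y"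
      "\<And>x y. x \<in> carrier G \<Longrightarrow> y \<in> carrier G \<Longrightarrow> h' (x \<otimes>\<^bsub>G\<^esub> y) = h' x \<otimes>\<^bsub>K\<^esub> h' y \<otimes>\<^bsub>K\<^esub> \<beta> x y"
  shows "h \<one>\<^bsub>G\<^esub> = h' \<one>\<^bsub>G\<^esub>"
    and "x \<in> carrier G \<Longrightarrow> h x = h' x \<Longrightarrow> h (inv\<^bsub>G\<^esub> x) = h' (inv\<^bsub>G\<^esub> x)"
proof -
  interpret G: group G by fact
  interpret K: group K by fact
  have "h \<one>\<^bsub>G\<^esub> \<otimes>\<^bsub>K\<^esub> (h \<one>\<^bsub>G\<^esub> \<otimes>\<^bsub>K\<^esub> \<beta> \<one>\<^bsub>G\<^esub> \<one>\<^bsub>G\<^esub>) = h \<one>\<^bsub>G\<^esub> \<otimes>\<^bsub>K\<^esub> \<one>\<^bsub>K\<^esub>"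
    "h' \<one>\<^bsub>G\<^esub> \<otimes>\<^bsub>K\<^esub> (h' \<one>\<^bsub>G\<^esub> \<otimes>\<^bsub>K\<^esub> \<beta> \<one>\<^bsub>G\<^esub> \<one>\<^bsub>G\<^esub>) = h' \<one>\<^bsub>G\<^esub> \<otimes>\<^bsub>K\<^esub> \<one>\<^bsub>K\<^esub>"
    using law(1)[of "\<one>\<^bsub>G\<^esub>" "\<one>\<^bsub>G\<^esub>"] law(2)[of "\<one>\<^bsub>G\<^esub>" "\<one>\<^bsub>G\<^esub>"] h \<beta> by (simp_all add: K.m_assoc)
  then have "h \<one>\<^bsub>G\<^esub> \<otimes>\<^bsub>K\<^esub> \<beta> \<one>\<^bsub>G\<^esub> \<one>\<^bsub>G\<^esub> = h' \<one>\<^bsub>G\<^esub> \<otimes>\<^bsub>K\<^esub> \<beta> \<one>\<^bsub>G\<^esub> \<one>\<^bsub>G\<^esub>"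
    using h \<beta> by simp
  then show one: "h \<one>\<^bsub>G\<^esub> = h' \<one>\<^bsub>G\<^esub>" using h \<beta> by simp
  assume x: "x \<in> carrier G" "h x = h' x"
  have "h (inv\<^bsub>G\<^esub> x) \<otimes>\<^bsub>K\<^esub> (h' x \<otimes>\<^bsub>K\<^esub> \<beta> (inv\<^bsub>G\<^esub> x) x)
      = h' (inv\<^bsub>G\<^esub> x) \<otimes>\<^bsub>K\<^esub> (h' x \<otimes>\<^bsub>K\<^esub> \<beta> (inv\<^bsub>G\<^esub> x) x)"
    using law(1)[of "inv\<^bsub>G\<^esub> x" x] law(2)[of "inv\<^bsub>G\<^esub> x" x] x one h \<beta> by (simp add: K.m_assoc)
  then show "h (inv\<^bsub>G\<^esub> x) = h' (inv\<^bsub>G\<^esub> x)" using x h \<beta> by simp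
qed

text \<open>\<open>cross\<close> is a difference; rewritten as an additive law with a correction
  term it fits the results on prescribed deviations. \<open>cross_eqI\<close> and
  \<open>quadratic_mapI\<close> lead back.\<close>

lemma quadratic_map_law:
  assumes "group G" "comm_group A" "quadratic_map G A h" "x \<in> carrier G" "y \<in> carrier G"
  shows "h (x \<otimes>\<^bsub>G\<^esub> y) = h x \<otimes>\<^bsub>A\<^esub> h y \<otimes>\<^bsub>A\<^esub> cross G A h x y"
proof -
  interpret G: group G by fact
  interpret A: comm_group A by fact
  have "h u \<in> carrier A" if "u \<in> carrier G" for u using assms(3) that by (auto simp: quadratic_map_def)
  then show ?thesis using assms(4,5) by (simp add: cross_def A.m_assoc A.m_comm[of "h (x \<otimes>\<^bsub>G\<^esub> y)"])
qed

lemma cross_eqI: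
  assumes "comm_group A" "h x \<in> carrier A" "h y \<in> carrier A" "b \<in> carrier A"
    and "h (x \<otimes>\<^bsub>G\<^esub> y) = h x \<otimes>\<^bsub>A\<^esub> h y \<otimes>\<^bsub>A\<^esub> b"
  shows "cross G A h x y = b"
proof -
  interpret A: comm_group A by fact
  have "cross G A h x y = b \<otimes>\<^bsub>A\<^esub> (h x \<otimes>\<^bsub>A\<^esub> (h y \<otimes>\<^bsub>A\<^esub> inv\<^bsub>A\<^esub> h y \<otimes>\<^bsub>A\<^esub> inv\<^bsub>A\<^esub> h x))"
    unfolding cross_def assms(5) using assms(2-4)
    by (simp add: A.m_ac del: A.r_inv A.l_inv A.inv_mult_cancel)
  then show ?thesis using assms(2-4) by simp
qed

lemma quadratic_mapI:
  assumes A: "comm_group A" and G: "group G" and h: "\<And>x. x \<in> carrier G \<Longrightarrow> h x \<in> carrier A"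
    and \<beta>: "biadditive G G A \<beta>"
    and law: "\<And>x y. x \<in> carrier G \<Longrightarrow> y \<in> carrier G \<Longrightarrow> h (x \<otimes>\<^bsub>G\<^esub> y) = h x \<otimes>\<^bsub>A\<^esub> h y \<otimes>\<^bsub>A\<^esub> \<beta> x y"
  shows "quadratic_map G A h" and "x \<in> carrier G \<Longrightarrow> y \<in> carrier G \<Longrightarrow> cross G A h x y = \<beta> x y"
proof -
  interpret A: comm_group A by fact
  interpret b: biadditive_map G G A \<beta> by (intro biadditive_mapI G \<beta>) unfold_locales
  have c: "cross G A h x y = \<beta> x y" if "x \<in> carrier G" "y \<in> carrier G" for x y
    by (rule cross_eqI[OF A]) (use that h law in auto)
  show "quadratic_map G A h"
    using \<beta> h by (auto simp: quadratic_map_def c intro!: biadditiveI b.add_left b.add_right)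
  show "x \<in> carrier G \<Longrightarrow> y \<in> carrier G \<Longrightarrow> cross G A h x y = \<beta> x y" by (rule c)
qed


section \<open>Square groups\<close>

context square_group
begin

sublocale G: group "sge M" by (rule group_e)
sublocale A: comm_group "sgee M" by (rule group_ee)
sublocale P: group_hom "sgee M" "sge M" "sgP M" by unfold_locales (rule P_hom)
sublocale X: biadditive_map "sge M" "sge M" "sgee M" "sgcross M"
  using H_quadratic by unfold_locales (simp add: quadratic_map_def)

abbreviation "T \<equiv> sgT M"
abbreviation "\<Delta> \<equiv> sgDelta M"

lemma H_closed [simp]: "x \<in> carrier (sge M) \<Longrightarrow> sgH M x \<in> carrier (sgee M)"
  using H_quadratic by (auto simp: quadratic_map_def)

lemma H_mult:
  "x \<in> carrier (sge M) \<Longrightarrow> y \<in> carrier (sge M) \<Longrightarrow>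
     sgH M (x \<otimes>\<^bsub>sge M\<^esub> y) = sgH M x \<otimes>\<^bsub>sgee M\<^esub> sgH M y \<otimes>\<^bsub>sgee M\<^esub> sgcross M x y"
  by (rule quadratic_map_law[OF group_e group_ee H_quadratic])

lemma T_closed [simp]: "a \<in> carrier (sgee M) \<Longrightarrow> T a \<in> carrier (sgee M)"
  by (simp add: sgT_def)

lemma Delta_closed [simp]: "x \<in> carrier (sge M) \<Longrightarrow> \<Delta> x \<in> carrier (sgee M)"
  by (simp add: sgDelta_def)

text \<open>The commutator [P(a),x] is P of the cross effect (P(a)|x), which is zero.\<close>

lemma P_central:
  "a \<in> carrier (sgee M) \<Longrightarrow> x \<in> carrier (sge M) \<Longrightarrow> sgP M a \<otimes>\<^bsub>sge M\<^esub> x = x \<otimes>\<^bsub>sge M\<^esub> sgP M a"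
  using P_cross[of "sgP M a" x] cross_P_left[of a x] G.gcommutator_one_iff[of "sgP M a" x] by simp

lemma swap:
  "x \<in> carrier (sge M) \<Longrightarrow> y \<in> carrier (sge M) \<Longrightarrow>
     x \<otimes>\<^bsub>sge M\<^esub> y = y \<otimes>\<^bsub>sge M\<^esub> x \<otimes>\<^bsub>sge M\<^esub> sgP M (sgcross M x y)"
  using G.gcommutator_swap[of x y] by (simp only: P_cross)

lemma H_P: "a \<in> carrier (sgee M) \<Longrightarrow> sgH M (sgP M a) = a \<otimes>\<^bsub>sgee M\<^esub> T a"
  using A.m_comm[of "sgH M (sgP M a)" "inv\<^bsub>sgee M\<^esub> a"] by (simp add: sgT_def)

lemma HP_hom: "(\<lambda>a. sgH M (sgP M a)) \<in> hom (sgee M) (sgee M)"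
  by (auto simp: hom_def H_mult cross_P_left)

lemma T_hom: "T \<in> hom (sgee M) (sgee M)"
proof (rule homI)
  fix a b assume "a \<in> carrier (sgee M)" "b \<in> carrier (sgee M)"
  then show "T (a \<otimes>\<^bsub>sgee M\<^esub> b) = T a \<otimes>\<^bsub>sgee M\<^esub> T b"
    using hom_mult[OF HP_hom, of a b] by (simp add: sgT_def A.inv_mult A.m_ac)
qed simp

sublocale T: group_hom "sgee M" "sgee M" T by unfold_locales (rule T_hom)

lemma P_T: "a \<in> carrier (sgee M) \<Longrightarrow> sgP M (T a) = sgP M a"
  by (simp add: sgT_def PHP G.m_assoc)

text \<open>Since PT = P, the formula HP = 1 + T has the same value at a and at T(a).\<close>

lemma T_T: "a \<in> carrier (sgee M) \<Longrightarrow> T (T a) = a"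
proof -
  assume a: "a \<in> carrier (sgee M)"
  have "a \<otimes>\<^bsub>sgee M\<^esub> T a = T a \<otimes>\<^bsub>sgee M\<^esub> T (T a)" using H_P[of a] H_P[of "T a"] a by (simp add: P_T)
  then have "T a \<otimes>\<^bsub>sgee M\<^esub> T (T a) = T a \<otimes>\<^bsub>sgee M\<^esub> a" using a by (simp add: A.m_comm)
  then show ?thesis using a by simp
qed

text \<open>Evaluate H on both sides of x + y = y + x + P(x|y): the left side has the cross term
  (x|y), the right side has (y|x) together with HP(x|y) = (x|y) + T(x|y).\<close>

lemma T_cross:
  assumes [simp]: "x \<in> carrier (sge M)" "y \<in> carrier (sge M)"
  shows "T (sgcross M x y) = inv\<^bsub>sgee M\<^esub> sgcross M y x"
proof -
  let ?c = "sgcross M x y" and ?d = "sgcross M y x"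
  have "sgH M (x \<otimes>\<^bsub>sge M\<^esub> y) = sgH M (y \<otimes>\<^bsub>sge M\<^esub> x \<otimes>\<^bsub>sge M\<^esub> sgP M ?c)"
    by (subst swap) simp_all
  then have "sgH M x \<otimes>\<^bsub>sgee M\<^esub> sgH M y \<otimes>\<^bsub>sgee M\<^esub> ?c
      = (sgH M y \<otimes>\<^bsub>sgee M\<^esub> sgH M x \<otimes>\<^bsub>sgee M\<^esub> ?d) \<otimes>\<^bsub>sgee M\<^esub> (?c \<otimes>\<^bsub>sgee M\<^esub> T ?c)"
    by (simp add: H_mult cross_P_right H_P)
  also have "\<dots> = (sgH M x \<otimes>\<^bsub>sgee M\<^esub> sgH M y \<otimes>\<^bsub>sgee M\<^esub> ?c) \<otimes>\<^bsub>sgee M\<^esub> (?d \<otimes>\<^bsub>sgee M\<^esub> T ?c)"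
    by (simp add: A.m_ac)
  finally have "(sgH M x \<otimes>\<^bsub>sgee M\<^esub> sgH M y \<otimes>\<^bsub>sgee M\<^esub> ?c) \<otimes>\<^bsub>sgee M\<^esub> (?d \<otimes>\<^bsub>sgee M\<^esub> T ?c)
      = (sgH M x \<otimes>\<^bsub>sgee M\<^esub> sgH M y \<otimes>\<^bsub>sgee M\<^esub> ?c) \<otimes>\<^bsub>sgee M\<^esub> \<one>\<^bsub>sgee M\<^esub>"
    by simp
  then have "?d \<otimes>\<^bsub>sgee M\<^esub> T ?c = \<one>\<^bsub>sgee M\<^esub>" by (subst (asm) A.Units_l_cancel) simp_all
  then show ?thesis by (intro A.inv_equality[symmetric]) (simp_all add: A.m_comm)
qed

text \<open>The mixed terms (x|y) and (y|x) of (x+y|x+y) cancel against the cross terms of -H and of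
  TH, the latter by \<open>T_cross\<close>.\<close>

lemma Delta_hom: "\<Delta> \<in> hom (sge M) (sgee M)"
proof (rule homI)
  fix x y assume [simp]: "x \<in> carrier (sge M)" "y \<in> carrier (sge M)"
  let ?c = "sgcross M x y" and ?d = "sgcross M y x"
  define i j where "i = inv\<^bsub>sgee M\<^esub> ?c" and "j = inv\<^bsub>sgee M\<^esub> ?d"
  note ij = i_def[symmetric] j_def[symmetric]
  have [simp]: "i \<in> carrier (sgee M)" "j \<in> carrier (sgee M)" by (simp_all add: i_def j_def)
  have "\<Delta> (x \<otimes>\<^bsub>sge M\<^esub> y) = \<Delta> x \<otimes>\<^bsub>sgee M\<^esub> \<Delta> y \<otimes>\<^bsub>sgee M\<^esub> ((?c \<otimes>\<^bsub>sgee M\<^esub> i) \<otimes>\<^bsub>sgee M\<^esub> (?d \<otimes>\<^bsub>sgee M\<^esub> j))"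
    by (simp add: sgDelta_def H_mult X.add_left X.add_right T_cross A.inv_mult A.m_ac ij)
  then show "\<Delta> (x \<otimes>\<^bsub>sge M\<^esub> y) = \<Delta> x \<otimes>\<^bsub>sgee M\<^esub> \<Delta> y" by (simp add: i_def j_def)
qed simp

text \<open>So \<Delta>, defined here on the whole \<open>e\<close>-part, factors through the
  cokernel of P.\<close>

lemma Delta_P: "a \<in> carrier (sgee M) \<Longrightarrow> \<Delta> (sgP M a) = \<one>\<^bsub>sgee M\<^esub>"
  by (simp add: sgDelta_def cross_P_left H_P T_T A.m_comm[of "T a" a])

lemma T_Delta: "x \<in> carrier (sge M) \<Longrightarrow> T (\<Delta> x) = inv\<^bsub>sgee M\<^esub> \<Delta> x"
  by (simp add: sgDelta_def T_cross T_T A.inv_mult A.m_ac)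

end

lemma sg_homD:
  assumes "f \<in> sg_hom M N"
  shows "square_group M" "square_group N" "group_hom (sge M) (sge N) (fst f)"
    "group_hom (sgee M) (sgee N) (snd f)" "x \<in> carrier (sge M) \<Longrightarrow> snd f (sgH M x) = sgH N (fst f x)"
    "a \<in> carrier (sgee M) \<Longrightarrow> fst f (sgP M a) = sgP N (snd f a)"
    "fst f \<in> extensional (carrier (sge M))" "snd f \<in> extensional (carrier (sgee M))"
  using assms by (auto simp: sg_hom_def intro!: group_homI square_group.group_e
      comm_group.axioms(2)[OF square_group.group_ee])

text \<open>Cross effects, T and \<Delta> are expressed through H, P and the group
  operations.\<close>

lemma sg_hom_structure:
  assumes f: "f \<in> sg_hom M N"
  shows "x \<in> carrier (sge M) \<Longrightarrow> y \<in> carrier (sge M) \<Longrightarrow>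
      snd f (sgcross M x y) = sgcross N (fst f x) (fst f y)"
    and "a \<in> carrier (sgee M) \<Longrightarrow> snd f (sgT M a) = sgT N (snd f a)"
    and "x \<in> carrier (sge M) \<Longrightarrow> snd f (sgDelta M x) = sgDelta N (fst f x)"
proof -
  note D = sg_homD[OF f]
  interpret M: square_group M by (rule D)
  interpret N: square_group N by (rule D)
  interpret e: group_hom "sge M" "sge N" "fst f" by (rule D)
  interpret ee: group_hom "sgee M" "sgee N" "snd f" by (rule D)
  have c: "snd f (sgcross M x y) = sgcross N (fst f x) (fst f y)"
    if "x \<in> carrier (sge M)" "y \<in> carrier (sge M)" for x y
    using that by (simp add: cross_def D)
  have t: "snd f (sgT M a) = sgT N (snd f a)" if "a \<in> carrier (sgee M)" for a
    using that by (simp add: sgT_def D)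
  show "x \<in> carrier (sge M) \<Longrightarrow> y \<in> carrier (sge M) \<Longrightarrow>
      snd f (sgcross M x y) = sgcross N (fst f x) (fst f y)"
    and "a \<in> carrier (sgee M) \<Longrightarrow> snd f (sgT M a) = sgT N (snd f a)" by (fact c t)+
  show "x \<in> carrier (sge M) \<Longrightarrow> snd f (sgDelta M x) = sgDelta N (fst f x)"
    by (simp add: sgDelta_def c t D)
qed


section \<open>The tensor product of square groups\<close>

locale square_group_pair = M: square_group M + N: square_group N
  for M :: "('x, 'a) sqgroup" and N :: "('y, 'b) sqgroup"
begin

abbreviation "K \<equiv> circ_e M N"
abbreviation "EE \<equiv> circ_ee M N"
abbreviation "cc \<equiv> circ_elt M N"
abbreviation "bb \<equiv> bar_elt M N"
abbreviation "tt \<equiv> ee_elt M N"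

sublocale K: group K unfolding circ_e_def by (rule presented_group_group)
sublocale EE: comm_group EE by (rule tensor_comm_group)
sublocale t: biadditive_map "sgee M" "sgee N" EE tt
  by (intro biadditive_mapI M.A.is_group N.A.is_group EE.is_group tensor_biadditive
      M.A.is_monoid N.A.is_monoid)

lemma cc_closed [simp]: "x \<in> carrier (sge M) \<Longrightarrow> y \<in> carrier (sge N) \<Longrightarrow> cc x y \<in> carrier K"
  and bb_closed [simp]: "a \<in> carrier (sgee M) \<Longrightarrow> b \<in> carrier (sgee N) \<Longrightarrow> bb a b \<in> carrier K"
  by (auto simp: circ_elt_def bar_elt_def circ_e_def presented_carrier circ_gens_def intro!: imageI)

lemma gens_simps:
  "Circ x y \<in> circ_gens M N \<longleftrightarrow> x \<in> carrier (sge M) \<and> y \<in> carrier (sge N)"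
  "Bar a b \<in> circ_gens M N \<longleftrightarrow> a \<in> carrier (sgee M) \<and> b \<in> carrier (sgee N)"
  by (auto simp: circ_gens_def)

lemma rel:
  assumes "(s, t) \<in> circ_rel M N" "s \<in> gterms (circ_gens M N)" "t \<in> gterms (circ_gens M N)"
  shows "gclass (circ_gens M N) (circ_rel M N) s = gclass (circ_gens M N) (circ_rel M N) t"
  by (rule gclass_eqI, rule geq_rel) (use assms in auto)

lemma cc_add_left:
  "x \<in> carrier (sge M) \<Longrightarrow> x' \<in> carrier (sge M) \<Longrightarrow> y \<in> carrier (sge N) \<Longrightarrow>
     cc (x \<otimes>\<^bsub>sge M\<^esub> x') y = cc x y \<otimes>\<^bsub>K\<^esub> cc x' y"
  using rel[OF circ_add_left, of x x' y]
  by (simp add: circ_elt_def circ_e_def presented_mult gens_simps)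

lemma cc_add_right:
  "x \<in> carrier (sge M) \<Longrightarrow> y \<in> carrier (sge N) \<Longrightarrow> y' \<in> carrier (sge N) \<Longrightarrow>
     cc x (y \<otimes>\<^bsub>sge N\<^esub> y') = cc x y \<otimes>\<^bsub>K\<^esub> cc x y' \<otimes>\<^bsub>K\<^esub> bb (sgH M x) (sgcross N y' y)"
  using rel[OF circ_add_right, of x y y']
  by (simp add: circ_elt_def bar_elt_def circ_e_def presented_mult gens_simps)

lemma cc_P_left:
  "a \<in> carrier (sgee M) \<Longrightarrow> y \<in> carrier (sge N) \<Longrightarrow> cc (sgP M a) y = bb a (sgcross N y y)"
  using rel[OF circ_P_left, of a y] by (simp add: circ_elt_def bar_elt_def gens_simps)

lemma cc_P_right:
  "x \<in> carrier (sge M) \<Longrightarrow> b \<in> carrier (sgee N) \<Longrightarrow> cc x (sgP N b) = bb (sgDelta M x) b"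
  using rel[OF circ_P_right, of x b] by (simp add: circ_elt_def bar_elt_def gens_simps)

lemma bb_T:
  "a \<in> carrier (sgee M) \<Longrightarrow> b \<in> carrier (sgee N) \<Longrightarrow> bb (sgT M a) (sgT N b) = inv\<^bsub>K\<^esub> bb a b"
  using rel[OF bar_T, of a b] by (simp add: bar_elt_def gens_simps circ_e_def presented_inv)

lemma bb_biadditive: "biadditive (sgee M) (sgee N) K bb"
proof (rule biadditiveI)
  fix a a' b assume c: "a \<in> carrier (sgee M)" "a' \<in> carrier (sgee M)" "b \<in> carrier (sgee N)"
  show "bb (a \<otimes>\<^bsub>sgee M\<^esub> a') b = bb a b \<otimes>\<^bsub>K\<^esub> bb a' b"
    using rel[OF bar_add_left, of a a' b] c
    by (simp add: bar_elt_def circ_e_def presented_mult gens_simps)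
next
  fix a b b' assume c: "a \<in> carrier (sgee M)" "b \<in> carrier (sgee N)" "b' \<in> carrier (sgee N)"
  show "bb a (b \<otimes>\<^bsub>sgee N\<^esub> b') = bb a b \<otimes>\<^bsub>K\<^esub> bb a b'"
    using rel[OF bar_add_right, of a b b'] c
    by (simp add: bar_elt_def circ_e_def presented_mult gens_simps)
qed simp

sublocale b: biadditive_map "sgee M" "sgee N" K bb
  by (intro biadditive_mapI M.A.is_group N.A.is_group K.is_group bb_biadditive)

lemma bb_central:
  assumes "a \<in> carrier (sgee M)" "b \<in> carrier (sgee N)" "u \<in> carrier K"
  shows "bb a b \<otimes>\<^bsub>K\<^esub> u = u \<otimes>\<^bsub>K\<^esub> bb a b"
proof -
  obtain t where "t \<in> gterms (circ_gens M N)" "u = gclass (circ_gens M N) (circ_rel M N) t"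
    using assms(3) by (auto simp: circ_e_def presented_carrier)
  then show ?thesis using rel[OF bar_central, of a b t] assms
    by (simp add: bar_elt_def circ_e_def presented_mult gens_simps)
qed

lemma circ_induct [consumes 1, case_names circ bar one mult inv]:
  assumes "u \<in> carrier K"
    and "\<And>x y. x \<in> carrier (sge M) \<Longrightarrow> y \<in> carrier (sge N) \<Longrightarrow> R (cc x y)"
    and "\<And>a b. a \<in> carrier (sgee M) \<Longrightarrow> b \<in> carrier (sgee N) \<Longrightarrow> R (bb a b)"
    and "R \<one>\<^bsub>K\<^esub>"
    and "\<And>u v. u \<in> carrier K \<Longrightarrow> v \<in> carrier K \<Longrightarrow> R u \<Longrightarrow> R v \<Longrightarrow> R (u \<otimes>\<^bsub>K\<^esub> v)"
    and "\<And>u. u \<in> carrier K \<Longrightarrow> R u \<Longrightarrow> R (inv\<^bsub>K\<^esub> u)"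
  shows "R u"
  using assms unfolding circ_e_def
  by (induction rule: presented_group_induct) (auto simp: circ_elt_def bar_elt_def circ_gens_def)

lemma circ_hom_eqI:
  assumes L: "group L" and h: "h \<in> hom K L" "k \<in> hom K L"
    and "\<And>x y. x \<in> carrier (sge M) \<Longrightarrow> y \<in> carrier (sge N) \<Longrightarrow> h (cc x y) = k (cc x y)"
    and "\<And>a b. a \<in> carrier (sgee M) \<Longrightarrow> b \<in> carrier (sgee N) \<Longrightarrow> h (bb a b) = k (bb a b)"
    and "u \<in> carrier K"
  shows "h u = k u"
proof -
  interpret h: group_hom K L h using L h by (intro group_homI K.is_group) auto
  interpret k: group_hom K L k using L h by (intro group_homI K.is_group) auto
  show ?thesis using assms(6) by (induction rule: circ_induct) (use assms in auto)
qed

text \<open>One assumption per relation of the presentation. The target is any group, not the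
  \<open>e\<close>-part of a square group, since it will also be the central extension that yields
  H.\<close>

lemma circ_hom_exists:
  assumes L: "group L"
    and fc: "\<And>x y. x \<in> carrier (sge M) \<Longrightarrow> y \<in> carrier (sge N) \<Longrightarrow> fc x y \<in> carrier L"
    and fb: "biadditive (sgee M) (sgee N) L fb"
    and central: "\<And>a b u. a \<in> carrier (sgee M) \<Longrightarrow> b \<in> carrier (sgee N) \<Longrightarrow> u \<in> carrier L \<Longrightarrow>
       fb a b \<otimes>\<^bsub>L\<^esub> u = u \<otimes>\<^bsub>L\<^esub> fb a b"
    and left: "\<And>x x' y. x \<in> carrier (sge M) \<Longrightarrow> x' \<in> carrier (sge M) \<Longrightarrow> y \<in> carrier (sge N) \<Longrightarrow>
       fc (x \<otimes>\<^bsub>sge M\<^esub> x') y = fc x y \<otimes>\<^bsub>L\<^esub> fc x' y"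
    and right: "\<And>x y y'. x \<in> carrier (sge M) \<Longrightarrow> y \<in> carrier (sge N) \<Longrightarrow> y' \<in> carrier (sge N) \<Longrightarrow>
       fc x (y \<otimes>\<^bsub>sge N\<^esub> y') = fc x y \<otimes>\<^bsub>L\<^esub> fc x y' \<otimes>\<^bsub>L\<^esub> fb (sgH M x) (sgcross N y' y)"
    and P_left: "\<And>a y. a \<in> carrier (sgee M) \<Longrightarrow> y \<in> carrier (sge N) \<Longrightarrow>
       fc (sgP M a) y = fb a (sgcross N y y)"
    and P_right: "\<And>x b. x \<in> carrier (sge M) \<Longrightarrow> b \<in> carrier (sgee N) \<Longrightarrow>
       fc x (sgP N b) = fb (sgDelta M x) b"
    and T: "\<And>a b. a \<in> carrier (sgee M) \<Longrightarrow> b \<in> carrier (sgee N) \<Longrightarrow>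
       fb (sgT M a) (sgT N b) = inv\<^bsub>L\<^esub> fb a b"
  obtains h where "h \<in> hom K L" "h \<in> extensional (carrier K)"
    and "\<And>x y. x \<in> carrier (sge M) \<Longrightarrow> y \<in> carrier (sge N) \<Longrightarrow> h (cc x y) = fc x y"
    and "\<And>a b. a \<in> carrier (sgee M) \<Longrightarrow> b \<in> carrier (sgee N) \<Longrightarrow> h (bb a b) = fb a b"
proof -
  interpret L: group L by fact
  interpret fb: biadditive_map "sgee M" "sgee N" L fb
    by (intro biadditive_mapI M.A.is_group N.A.is_group L fb)
  define F where "F = case_circ_gen fc fb"
  have F [simp]: "F (Circ x y) = fc x y" "F (Bar a b) = fb a b" for x y a b by (simp_all add: F_def)
  have Fcl: "F \<in> circ_gens M N \<rightarrow> carrier L" by (auto simp: circ_gens_def fc)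
  have "\<exists>!h. h \<in> hom K L \<inter> extensional (carrier K) \<and>
      (\<forall>g\<in>circ_gens M N. h (gclass (circ_gens M N) (circ_rel M N) (GGen g)) = F g)"
    unfolding circ_e_def
  proof (rule presented_universal[OF L Fcl])
    fix s t assume st: "(s, t) \<in> circ_rel M N" "s \<in> gterms (circ_gens M N)" "t \<in> gterms (circ_gens M N)"
    from st(1) show "geval L F s = geval L F t"
    proof cases
      \<comment> \<open>This relation ranges over all words u, not only over generators; the value
        of u lies in L, where the images of bars are central.\<close>
      case (bar_central a b u)
      then have "geval L F u \<in> carrier L" using st by (intro geval_closed[OF L Fcl]) simp
      then show ?thesis using bar_central central by simp
    qed (simp_all add: fb.add_left fb.add_right left right P_left P_right T)
  qed
  then show thesis
    using that by (auto simp: circ_elt_def bar_elt_def gens_simps)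
qed

text \<open>The cross effect of H is built before H, one argument at a time, with bars sent to 0.
  The relations hold because the correction term of right additivity is a bar and because cross
  effects vanish on the image of P. The form then serves as the cocycle for H.\<close>

lemma cross_form_exists:
  obtains k where "biadditive K K EE k"
    and "\<And>x y x' y'. x \<in> carrier (sge M) \<Longrightarrow> y \<in> carrier (sge N) \<Longrightarrow> x' \<in> carrier (sge M) \<Longrightarrow>
       y' \<in> carrier (sge N) \<Longrightarrow> k (cc x y) (cc x' y') = tt (sgcross M x x') (sgcross N y y')"
    and "\<And>a b u. a \<in> carrier (sgee M) \<Longrightarrow> b \<in> carrier (sgee N) \<Longrightarrow> u \<in> carrier K \<Longrightarrow>
       k (bb a b) u = \<one>\<^bsub>EE\<^esub> \<and> k u (bb a b) = \<one>\<^bsub>EE\<^esub>"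
proof -
  have one: "biadditive (sgee M) (sgee N) EE (\<lambda>a b. \<one>\<^bsub>EE\<^esub>)" by (rule biadditiveI) simp_all
  have ex_h: "\<exists>h. h \<in> hom K EE \<and> (\<forall>x\<in>carrier (sge M). \<forall>y\<in>carrier (sge N).
        h (cc x y) = tt (sgcross M x x') (sgcross N y y')) \<and>
      (\<forall>a\<in>carrier (sgee M). \<forall>b\<in>carrier (sgee N). h (bb a b) = \<one>\<^bsub>EE\<^esub>)"
    if [simp]: "x' \<in> carrier (sge M)" "y' \<in> carrier (sge N)" for x' y'
    by (rule circ_hom_exists[OF EE.is_group _ one, of "\<lambda>x y. tt (sgcross M x x') (sgcross N y y')"])
      (auto simp: M.X.add_left N.X.add_left t.add_left t.add_right M.cross_P_left N.cross_P_left)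
  define h where "h x' y' = (SOME h. h \<in> hom K EE \<and> (\<forall>x\<in>carrier (sge M). \<forall>y\<in>carrier (sge N).
        h (cc x y) = tt (sgcross M x x') (sgcross N y y')) \<and>
      (\<forall>a\<in>carrier (sgee M). \<forall>b\<in>carrier (sgee N). h (bb a b) = \<one>\<^bsub>EE\<^esub>))" for x' y'
  note h_props = someI_ex[OF ex_h, folded h_def]
  have h: "h x' y' \<in> hom K EE" if "x' \<in> carrier (sge M)" "y' \<in> carrier (sge N)" for x' y'
    using h_props[OF that] by blast
  have hc: "h x' y' (cc x y) = tt (sgcross M x x') (sgcross N y y')"
    if "x' \<in> carrier (sge M)" "y' \<in> carrier (sge N)" "x \<in> carrier (sge M)" "y \<in> carrier (sge N)"
    for x' y' x y using h_props[OF that(1,2)] that(3,4) by blast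
  have hb: "h x' y' (bb a b) = \<one>\<^bsub>EE\<^esub>"
    if "x' \<in> carrier (sge M)" "y' \<in> carrier (sge N)" "a \<in> carrier (sgee M)" "b \<in> carrier (sgee N)"
    for x' y' a b using h_props[OF that(1,2)] that(3,4) by blast
  have hcl: "h x' y' u \<in> carrier EE" if "x' \<in> carrier (sge M)" "y' \<in> carrier (sge N)" "u \<in> carrier K" for x' y' u
    using h[of x' y'] that by (auto simp: hom_def)
  have hmult: "h x' y' (u \<otimes>\<^bsub>K\<^esub> v) = h x' y' u \<otimes>\<^bsub>EE\<^esub> h x' y' v"
    if "x' \<in> carrier (sge M)" "y' \<in> carrier (sge N)" "u \<in> carrier K" "v \<in> carrier K" for x' y' u v
    using h[of x' y'] that by (auto simp: hom_def)
  have prod: "(\<lambda>u. f u \<otimes>\<^bsub>EE\<^esub> g u) \<in> hom K EE" if "f \<in> hom K EE" "g \<in> hom K EE" for f g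
    using that by (auto simp: hom_def Pi_iff EE.m_ac)
  have triv: "(\<lambda>u. \<one>\<^bsub>EE\<^esub>) \<in> hom K EE" by (auto simp: hom_def)
  have "\<exists>k. k \<in> hom K EE \<and> (\<forall>x'\<in>carrier (sge M). \<forall>y'\<in>carrier (sge N). k (cc x' y') = h x' y' u) \<and>
      (\<forall>a\<in>carrier (sgee M). \<forall>b\<in>carrier (sgee N). k (bb a b) = \<one>\<^bsub>EE\<^esub>)" if u: "u \<in> carrier K" for u
  proof (rule circ_hom_exists[OF EE.is_group _ one, of "\<lambda>x' y'. h x' y' u"])
    fix x x' y assume c: "x \<in> carrier (sge M)" "x' \<in> carrier (sge M)" "y \<in> carrier (sge N)"
    show "h (x \<otimes>\<^bsub>sge M\<^esub> x') y u = h x y u \<otimes>\<^bsub>EE\<^esub> h x' y u"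
      by (rule circ_hom_eqI[OF EE.is_group h prod[OF h h] _ _ u])
        (use c in \<open>auto simp: hc hb M.X.add_right t.add_left\<close>)
  next
    fix x y y' assume c: "x \<in> carrier (sge M)" "y \<in> carrier (sge N)" "y' \<in> carrier (sge N)"
    have "h x (y \<otimes>\<^bsub>sge N\<^esub> y') u = h x y u \<otimes>\<^bsub>EE\<^esub> h x y' u"
      by (rule circ_hom_eqI[OF EE.is_group h prod[OF h h] _ _ u])
        (use c in \<open>auto simp: hc hb N.X.add_right t.add_right\<close>)
    then show "h x (y \<otimes>\<^bsub>sge N\<^esub> y') u = h x y u \<otimes>\<^bsub>EE\<^esub> h x y' u \<otimes>\<^bsub>EE\<^esub> \<one>\<^bsub>EE\<^esub>"
      using c u by (simp add: hcl)
  next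
    fix a y assume c: "a \<in> carrier (sgee M)" "y \<in> carrier (sge N)"
    show "h (sgP M a) y u = \<one>\<^bsub>EE\<^esub>"
      by (rule circ_hom_eqI[OF EE.is_group h triv _ _ u]) (use c in \<open>auto simp: hc hb M.cross_P_right\<close>)
  next
    fix x b assume c: "x \<in> carrier (sge M)" "b \<in> carrier (sgee N)"
    show "h x (sgP N b) u = \<one>\<^bsub>EE\<^esub>"
      by (rule circ_hom_eqI[OF EE.is_group h triv _ _ u]) (use c in \<open>auto simp: hc hb N.cross_P_right\<close>)
  qed (use u hcl in auto)
  then obtain k where k: "\<And>u. u \<in> carrier K \<Longrightarrow> k u \<in> hom K EE"
    and kc: "\<And>u x' y'. u \<in> carrier K \<Longrightarrow> x' \<in> carrier (sge M) \<Longrightarrow> y' \<in> carrier (sge N) \<Longrightarrow>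
      k u (cc x' y') = h x' y' u"
    and kb: "\<And>u a b. u \<in> carrier K \<Longrightarrow> a \<in> carrier (sgee M) \<Longrightarrow> b \<in> carrier (sgee N) \<Longrightarrow>
      k u (bb a b) = \<one>\<^bsub>EE\<^esub>"
    by metis
  have kbi: "biadditive K K EE k"
  proof (rule biadditiveI)
    fix u u' v assume c: "u \<in> carrier K" "u' \<in> carrier K" "v \<in> carrier K"
    show "k (u \<otimes>\<^bsub>K\<^esub> u') v = k u v \<otimes>\<^bsub>EE\<^esub> k u' v"
      by (rule circ_hom_eqI[OF EE.is_group k prod[OF k k] _ _ c(3)])
        (use c in \<open>auto simp: kc kb hmult\<close>)
  qed (use k in \<open>auto simp: hom_def\<close>)
  have kb': "k (bb a b) u = \<one>\<^bsub>EE\<^esub>" if "a \<in> carrier (sgee M)" "b \<in> carrier (sgee N)" "u \<in> carrier K" for a b u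
    by (rule circ_hom_eqI[OF EE.is_group k triv _ _ that(3)]) (use that in \<open>auto simp: kc kb hb\<close>)
  show thesis
    by (rule that[of k]) (use kbi kb kb' in \<open>auto simp: kc hc\<close>)
qed

text \<open>The description behind \<open>circ_H\<close>, named so that existence and uniqueness can
  be treated separately.\<close>

definition circ_H_spec where
  "circ_H_spec h \<longleftrightarrow> h \<in> extensional (carrier K) \<and> quadratic_map K EE h \<and>
     (\<forall>x\<in>carrier (sge M). \<forall>y\<in>carrier (sge N).
        h (cc x y) = tt (sgDelta M x) (sgH N y) \<otimes>\<^bsub>EE\<^esub> tt (sgH M x) (sgcross N y y)) \<and>
     (\<forall>a\<in>carrier (sgee M). \<forall>b\<in>carrier (sgee N).
        h (bb a b) = tt a b \<otimes>\<^bsub>EE\<^esub> inv\<^bsub>EE\<^esub> (tt (sgT M a) (sgT N b))) \<and>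
     (\<forall>a\<in>carrier (sgee M). \<forall>b\<in>carrier (sgee N). \<forall>u\<in>carrier K.
        cross K EE h (bb a b) u = \<one>\<^bsub>EE\<^esub> \<and> cross K EE h u (bb a b) = \<one>\<^bsub>EE\<^esub>) \<and>
     (\<forall>x\<in>carrier (sge M). \<forall>y\<in>carrier (sge N). \<forall>x'\<in>carrier (sge M). \<forall>y'\<in>carrier (sge N).
        cross K EE h (cc x y) (cc x' y') = tt (sgcross M x x') (sgcross N y y'))"

text \<open>The cross effects are biadditive and agree on generators, hence everywhere; quadratic
  maps with equal cross effects and equal values on generators coincide.\<close>

lemma circ_H_unique:
  assumes "circ_H_spec h" "circ_H_spec h'" shows "h = h'"
proof -
  have q: "quadratic_map K EE h" "quadratic_map K EE h'" using assms by (auto simp: circ_H_spec_def)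
  then have bi: "biadditive K K EE (cross K EE h)" "biadditive K K EE (cross K EE h')"
    by (auto simp: quadratic_map_def)
  have cr: "cross K EE h u v = cross K EE h' u v" if uv: "u \<in> carrier K" "v \<in> carrier K" for u v
  proof -
    have hl: "(\<lambda>u. f u v) \<in> hom K EE" if "biadditive K K EE f" "v \<in> carrier K" for f v
      using that by (simp add: biadditive_def)
    have hr: "f u \<in> hom K EE" if "biadditive K K EE f" "u \<in> carrier K" for f u
      using that by (simp add: biadditive_def)
    have "cross K EE h (cc x y) v = cross K EE h' (cc x y) v"
      if "x \<in> carrier (sge M)" "y \<in> carrier (sge N)" for x y
      by (rule circ_hom_eqI[OF EE.is_group hr[OF bi(1)] hr[OF bi(2)] _ _ uv(2)])
        (use that assms in \<open>simp_all add: circ_H_spec_def\<close>)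
    then show ?thesis
      by (intro circ_hom_eqI[OF EE.is_group hl[OF bi(1) uv(2)] hl[OF bi(2) uv(2)] _ _ uv(1)])
        (use uv assms in \<open>simp_all add: circ_H_spec_def\<close>)
  qed
  have cl: "h u \<in> carrier EE" "h' u \<in> carrier EE" if "u \<in> carrier K" for u
    using q that by (auto simp: quadratic_map_def)
  note law = quadratic_map_law[OF K.is_group EE.comm_group_axioms q(1)]
    quadratic_map_law[OF K.is_group EE.comm_group_axioms q(2)]
  have ccl: "cross K EE h u v \<in> carrier EE" if "u \<in> carrier K" "v \<in> carrier K" for u v
    using that cl by (simp add: cross_def)
  have agree: "h \<one>\<^bsub>K\<^esub> = h' \<one>\<^bsub>K\<^esub>" "\<And>u. u \<in> carrier K \<Longrightarrow> h u = h' u \<Longrightarrow> h (inv\<^bsub>K\<^esub> u) = h' (inv\<^bsub>K\<^esub> u)"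
    by (rule quadratic_law_agree[OF K.is_group EE.is_group cl ccl law(1)]; simp add: law(2) cr cl)+
  have "h u = h' u" if "u \<in> carrier K" for u
    using that
  proof (induction rule: circ_induct)
    case (mult u v) then show ?case by (simp add: law cr)
  qed (use assms agree in \<open>simp_all add: circ_H_spec_def\<close>)
  then show ?thesis using assms by (intro extensionalityI[of _ "carrier K"]) (auto simp: circ_H_spec_def)
qed

text \<open>H is the first component of a homomorphism from K to the extension of K by
  \<open>EE\<close> whose cocycle is the cross effect. Each relation of K thereby becomes an
  identity between the prescribed values of H.\<close>

lemma circ_H_exists: "\<exists>h. circ_H_spec h"
proof -
  obtain k where k: "biadditive K K EE k"
    and kc: "\<And>x y x' y'. x \<in> carrier (sge M) \<Longrightarrow> y \<in> carrier (sge N) \<Longrightarrow> x' \<in> carrier (sge M) \<Longrightarrow>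
       y' \<in> carrier (sge N) \<Longrightarrow> k (cc x y) (cc x' y') = tt (sgcross M x x') (sgcross N y y')"
    and kb: "\<And>a b u. a \<in> carrier (sgee M) \<Longrightarrow> b \<in> carrier (sgee N) \<Longrightarrow> u \<in> carrier K \<Longrightarrow>
       k (bb a b) u = \<one>\<^bsub>EE\<^esub> \<and> k u (bb a b) = \<one>\<^bsub>EE\<^esub>" by (rule cross_form_exists) blast
  interpret k: biadditive_map K K EE k by (intro biadditive_mapI K.is_group EE.is_group k)
  interpret tw: central_cocycle EE K k by unfold_locales (simp add: EE.m_comm)
  let ?W = "twist EE K k"
  interpret W: group ?W by (rule tw.twist_group)
  define fc where "fc x y = (tt (sgDelta M x) (sgH N y) \<otimes>\<^bsub>EE\<^esub> tt (sgH M x) (sgcross N y y), cc x y)" for x y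
  define fb where "fb a b = (tt a b \<otimes>\<^bsub>EE\<^esub> inv\<^bsub>EE\<^esub> (tt (sgT M a) (sgT N b)), bb a b)" for a b
  have fcl: "fc x y \<in> carrier ?W" if "x \<in> carrier (sge M)" "y \<in> carrier (sge N)" for x y
    using that by (simp add: fc_def)
  have fbi: "biadditive (sgee M) (sgee N) ?W fb"
    by (rule biadditiveI) (simp_all add: fb_def t.add_left t.add_right b.add_left b.add_right kb
        EE.inv_mult EE.m_ac)
  obtain h where h: "h \<in> hom K ?W"
    and hc: "\<And>x y. x \<in> carrier (sge M) \<Longrightarrow> y \<in> carrier (sge N) \<Longrightarrow> h (cc x y) = fc x y"
    and hb: "\<And>a b. a \<in> carrier (sgee M) \<Longrightarrow> b \<in> carrier (sgee N) \<Longrightarrow> h (bb a b) = fb a b"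
  proof (rule circ_hom_exists[OF W.is_group fcl fbi])
    fix a b u assume "a \<in> carrier (sgee M)" "b \<in> carrier (sgee N)" "u \<in> carrier ?W"
    then show "fb a b \<otimes>\<^bsub>?W\<^esub> u = u \<otimes>\<^bsub>?W\<^esub> fb a b"
      by (cases u) (simp add: fb_def kb bb_central EE.m_comm)
  next
    fix x x' y assume [simp]: "x \<in> carrier (sge M)" "x' \<in> carrier (sge M)" "y \<in> carrier (sge N)"
    show "fc (x \<otimes>\<^bsub>sge M\<^esub> x') y = fc x y \<otimes>\<^bsub>?W\<^esub> fc x' y"
      by (simp add: fc_def cc_add_left kc hom_mult[OF M.Delta_hom] M.H_mult t.add_left EE.m_ac)
  next
    \<comment> \<open>Right additivity. Expanding (y+y'|y+y') yields H(x)\<otimes>(y|y') and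
      H(x)\<otimes>(y'|y). The former cancels against the summand -H(x) of \<Delta>(x); the latter
      and the summand TH(x) of \<Delta>(x) together form H of the bar; the summand (x|x) is the
      cocycle.\<close>
    fix x y y' assume [simp]: "x \<in> carrier (sge M)" "y \<in> carrier (sge N)" "y' \<in> carrier (sge N)"
    let ?c = "sgcross N y y'" and ?d = "sgcross N y' y"
    have \<Delta>: "tt (sgDelta M x) ?c = tt (sgcross M x x) ?c \<otimes>\<^bsub>EE\<^esub> inv\<^bsub>EE\<^esub> tt (sgH M x) ?c
        \<otimes>\<^bsub>EE\<^esub> tt (sgT M (sgH M x)) ?c"
      by (simp add: sgDelta_def t.add_left t.inv_left)
    define i where "i = inv\<^bsub>EE\<^esub> tt (sgH M x) ?c"
    have [simp]: "i \<in> carrier EE" by (simp add: i_def)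
    let ?r = "tt (sgDelta M x) (sgH N y) \<otimes>\<^bsub>EE\<^esub> tt (sgDelta M x) (sgH N y') \<otimes>\<^bsub>EE\<^esub>
        tt (sgH M x) (sgcross N y y) \<otimes>\<^bsub>EE\<^esub> tt (sgH M x) (sgcross N y' y') \<otimes>\<^bsub>EE\<^esub>
        tt (sgH M x) ?d \<otimes>\<^bsub>EE\<^esub> tt (sgcross M x x) ?c \<otimes>\<^bsub>EE\<^esub> tt (sgT M (sgH M x)) ?c"
    have "fst (fc x (y \<otimes>\<^bsub>sge N\<^esub> y')) = ?r \<otimes>\<^bsub>EE\<^esub> (tt (sgH M x) ?c \<otimes>\<^bsub>EE\<^esub> i)"
      by (simp add: fc_def N.H_mult N.X.add_left N.X.add_right t.add_right \<Delta> EE.m_ac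
          i_def[symmetric])
    moreover have "fst (fc x y \<otimes>\<^bsub>?W\<^esub> fc x y' \<otimes>\<^bsub>?W\<^esub> fb (sgH M x) ?d) = ?r"
      by (simp add: fc_def fb_def kc kb N.T_cross t.inv_right EE.m_ac)
    ultimately have "fst (fc x (y \<otimes>\<^bsub>sge N\<^esub> y')) = fst (fc x y \<otimes>\<^bsub>?W\<^esub> fc x y' \<otimes>\<^bsub>?W\<^esub> fb (sgH M x) ?d)"
      by (simp add: i_def)
    then show "fc x (y \<otimes>\<^bsub>sge N\<^esub> y') = fc x y \<otimes>\<^bsub>?W\<^esub> fc x y' \<otimes>\<^bsub>?W\<^esub> fb (sgH M x) ?d"
      by (intro prod_eqI) (simp_all add: fc_def fb_def cc_add_right)
  next
    fix a y assume "a \<in> carrier (sgee M)" "y \<in> carrier (sge N)"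
    then show "fc (sgP M a) y = fb a (sgcross N y y)"
      by (simp add: fc_def fb_def cc_P_left M.Delta_P M.H_P N.T_cross t.inv_right t.add_left)
  next
    fix x b assume "x \<in> carrier (sge M)" "b \<in> carrier (sgee N)"
    then show "fc x (sgP N b) = fb (sgDelta M x) b"
      by (simp add: fc_def fb_def cc_P_right N.cross_P_left M.T_Delta N.H_P t.inv_left t.add_right)
  next
    fix a b assume c: "a \<in> carrier (sgee M)" "b \<in> carrier (sgee N)"
    show "fb (sgT M a) (sgT N b) = inv\<^bsub>?W\<^esub> fb a b"
      by (rule W.inv_equality[symmetric])
        (use c in \<open>simp_all add: fb_def kb M.T_T N.T_T bb_T EE.m_assoc\<close>)
  next
    fix h assume "h \<in> hom K ?W"
      and "\<And>x y. x \<in> carrier (sge M) \<Longrightarrow> y \<in> carrier (sge N) \<Longrightarrow> h (cc x y) = fc x y"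
      and "\<And>a b. a \<in> carrier (sgee M) \<Longrightarrow> b \<in> carrier (sgee N) \<Longrightarrow> h (bb a b) = fb a b"
    then show thesis by (rule that)
  qed
  \<comment> \<open>The homomorphism is a section over K, so the cocycle in its first component is
    evaluated at the arguments themselves.\<close>
  have snd_h: "snd (h u) = u" if "u \<in> carrier K" for u
  proof (rule circ_hom_eqI[OF K.is_group _ _ _ _ that, of "\<lambda>u. snd (h u)" "\<lambda>u. u"])
    show "(\<lambda>u. snd (h u)) \<in> hom K K"
    proof (rule homI)
      fix u v assume "u \<in> carrier K" "v \<in> carrier K"
      then show "snd (h (u \<otimes>\<^bsub>K\<^esub> v)) = snd (h u) \<otimes>\<^bsub>K\<^esub> snd (h v)"
        using h hom_mult[OF h, of u v] by (cases "h u", cases "h v") simp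
    qed (use h in \<open>auto simp: hom_def Pi_iff mem_Times_iff\<close>)
  qed (auto simp: hom_def hc hb fc_def fb_def)
  define H where "H = restrict (\<lambda>u. fst (h u)) (carrier K)"
  have Hcl: "H u \<in> carrier EE" if "u \<in> carrier K" for u
    using h that by (auto simp: H_def hom_def Pi_iff mem_Times_iff)
  have law: "H (u \<otimes>\<^bsub>K\<^esub> v) = H u \<otimes>\<^bsub>EE\<^esub> H v \<otimes>\<^bsub>EE\<^esub> k u v" if "u \<in> carrier K" "v \<in> carrier K" for u v
    using that hom_mult[OF h, of u v] snd_h[of u] snd_h[of v]
    by (cases "h u", cases "h v") (simp add: H_def)
  note Q = quadratic_mapI[OF EE.comm_group_axioms K.is_group Hcl k law]
  have "circ_H_spec H"
    unfolding circ_H_spec_def using Q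
    by (auto simp: kc kb) (auto simp: H_def hc hb fc_def fb_def)
  then show ?thesis by (rule exI[where P = circ_H_spec])
qed

lemma circ_H_spec: "circ_H_spec (circ_H M N)"
proof -
  have "circ_H M N = The circ_H_spec" unfolding circ_H_def circ_H_spec_def[abs_def] ..
  then show ?thesis using theI'[of circ_H_spec] circ_H_exists circ_H_unique by metis
qed

end

text \<open>This lemma and the next three carry a rule u + v = v + u + p over to products and
  inverses. The group K is not yet known to have class two, so the commutation needed of p is a
  hypothesis.\<close>

lemma (in group) comm_mult_right:
  assumes "u \<in> carrier G" "v \<in> carrier G" "w \<in> carrier G" "p \<in> carrier G" "q \<in> carrier G"
    and "u \<otimes> v = v \<otimes> u \<otimes> p" "u \<otimes> w = w \<otimes> u \<otimes> q" "p \<otimes> w = w \<otimes> p"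
  shows "u \<otimes> (v \<otimes> w) = v \<otimes> w \<otimes> u \<otimes> (q \<otimes> p)"
proof -
  have "u \<otimes> (v \<otimes> w) = v \<otimes> u \<otimes> (p \<otimes> w)" 
    using assms(1-5) by (simp add: m_assoc[symmetric, of u v w] assms(6) m_assoc[of "v \<otimes> u"])
  also have "\<dots> = v \<otimes> (u \<otimes> w) \<otimes> p" using assms(1-5) by (simp add: assms(8) m_assoc)
  finally show ?thesis using assms(1-5) by (simp add: assms(7) m_assoc)
qed

lemma (in group) comm_mult_left:
  assumes "u \<in> carrier G" "v \<in> carrier G" "w \<in> carrier G" "p \<in> carrier G" "q \<in> carrier G"
    and "u \<otimes> w = w \<otimes> u \<otimes> p" "v \<otimes> w = w \<otimes> v \<otimes> q" "p \<otimes> v = v \<otimes> p"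
  shows "(u \<otimes> v) \<otimes> w = w \<otimes> (u \<otimes> v) \<otimes> (p \<otimes> q)"
proof -
  have "(u \<otimes> v) \<otimes> w = (u \<otimes> w) \<otimes> v \<otimes> q" using assms(1-5) by (simp add: assms(7) m_assoc)
  also have "\<dots> = w \<otimes> u \<otimes> (p \<otimes> v) \<otimes> q" using assms(1-5) by (simp add: assms(6) m_assoc)
  finally show ?thesis using assms(1-5) by (simp add: assms(8) m_assoc)
qed

lemma (in group) comm_inv_right:
  assumes "u \<in> carrier G" "v \<in> carrier G" "p \<in> carrier G"
    and "u \<otimes> v = v \<otimes> u \<otimes> p" "p \<otimes> v = v \<otimes> p"
  shows "u \<otimes> inv v = inv v \<otimes> u \<otimes> inv p"
proof -
  have "inv v \<otimes> (u \<otimes> v) \<otimes> inv v = u \<otimes> (p \<otimes> inv v)"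
    using assms(1-3) by (simp add: assms(4) m_assoc)
  also have "p \<otimes> inv v = inv v \<otimes> p" using comm_inv[of v p] assms by simp
  finally have "inv v \<otimes> u = u \<otimes> inv v \<otimes> p" using assms(1-3) by (simp add: m_assoc)
  then show ?thesis using assms(1-3) by (simp add: m_assoc)
qed

lemma (in group) comm_inv_left:
  assumes "u \<in> carrier G" "v \<in> carrier G" "p \<in> carrier G"
    and "u \<otimes> v = v \<otimes> u \<otimes> p" "p \<otimes> u = u \<otimes> p"
  shows "inv u \<otimes> v = v \<otimes> inv u \<otimes> inv p"
proof -
  have "inv u \<otimes> (u \<otimes> v) \<otimes> inv u = inv u \<otimes> (v \<otimes> (u \<otimes> p) \<otimes> inv u)"
    using assms(1-3) by (simp add: assms(4) m_assoc)
  also have "u \<otimes> p = p \<otimes> u" using assms(5) ..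
  finally have "v \<otimes> inv u = inv u \<otimes> v \<otimes> p" using assms(1-3) by (simp add: m_assoc)
  then show ?thesis using assms(1-3) by (simp add: m_assoc)
qed

section \<open>Commutators in the tensor product, and its square group axioms\<close>

context square_group_pair
begin

abbreviation "pp \<equiv> sgP (M \<circledcirc> N)"
abbreviation "HH \<equiv> circ_H M N"

lemma circ_prod_simps [simp]:
  "sge (M \<circledcirc> N) = K" "sgee (M \<circledcirc> N) = EE" "sgH (M \<circledcirc> N) = HH"
  by (simp_all add: circ_prod_def)

lemma pp_tt [simp]: "a \<in> carrier (sgee M) \<Longrightarrow> b \<in> carrier (sgee N) \<Longrightarrow> pp (tt a b) = bb a b"
  and pp_hom: "pp \<in> hom EE K"
  using tensor_lift(1,3)[OF K.is_group bb_biadditive bb_central[OF _ _ bb_closed]]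
  by (auto simp: circ_prod_def)

sublocale pp: group_hom EE K pp by unfold_locales (rule pp_hom)

lemma HH_quadratic: "quadratic_map K EE HH"
  and HH_cc: "x \<in> carrier (sge M) \<Longrightarrow> y \<in> carrier (sge N) \<Longrightarrow>
     HH (cc x y) = tt (sgDelta M x) (sgH N y) \<otimes>\<^bsub>EE\<^esub> tt (sgH M x) (sgcross N y y)"
  and HH_bb: "a \<in> carrier (sgee M) \<Longrightarrow> b \<in> carrier (sgee N) \<Longrightarrow>
     HH (bb a b) = tt a b \<otimes>\<^bsub>EE\<^esub> inv\<^bsub>EE\<^esub> (tt (sgT M a) (sgT N b))"
  and cross_bb: "a \<in> carrier (sgee M) \<Longrightarrow> b \<in> carrier (sgee N) \<Longrightarrow> u \<in> carrier K \<Longrightarrow>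
     cross K EE HH (bb a b) u = \<one>\<^bsub>EE\<^esub>"
    "a \<in> carrier (sgee M) \<Longrightarrow> b \<in> carrier (sgee N) \<Longrightarrow> u \<in> carrier K \<Longrightarrow>
     cross K EE HH u (bb a b) = \<one>\<^bsub>EE\<^esub>"
  and cross_cc: "x \<in> carrier (sge M) \<Longrightarrow> y \<in> carrier (sge N) \<Longrightarrow> x' \<in> carrier (sge M) \<Longrightarrow>
     y' \<in> carrier (sge N) \<Longrightarrow>
     cross K EE HH (cc x y) (cc x' y') = tt (sgcross M x x') (sgcross N y y')"
  using circ_H_spec by (auto simp: circ_H_spec_def)

sublocale c: biadditive_map K K EE "cross K EE HH"
  using HH_quadratic by unfold_locales (simp add: quadratic_map_def)

lemma pp_central:
  assumes c: "c \<in> carrier EE" and u: "u \<in> carrier K"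
  shows "pp c \<otimes>\<^bsub>K\<^esub> u = u \<otimes>\<^bsub>K\<^esub> pp c"
  using c
proof (induction rule: tensor_group_induct)
  case (mult a b)
  have "pp a \<otimes>\<^bsub>K\<^esub> pp b \<otimes>\<^bsub>K\<^esub> u = pp a \<otimes>\<^bsub>K\<^esub> (u \<otimes>\<^bsub>K\<^esub> pp b)" using mult u by (simp add: K.m_assoc)
  also have "\<dots> = u \<otimes>\<^bsub>K\<^esub> pp a \<otimes>\<^bsub>K\<^esub> pp b" using mult u by (simp flip: K.m_assoc)
  finally show ?case using mult u by (simp add: K.m_assoc)
next
  case (inv a) then show ?case using u by (simp add: K.comm_inv)
qed (use u in \<open>simp_all add: bb_central\<close>)

text \<open>Expand (x + x')\<circledcirc>(y + y') in both orders. Splitting on the left first puts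
  x\<circledcirc>y' before x'\<circledcirc>y; splitting on the right first reverses them and
  replaces H(x) and H(x') by H(x + x'), whose cross term gives the extra bar.\<close>

lemma circ_swap_gens:
  assumes "x \<in> carrier (sge M)" "x' \<in> carrier (sge M)" "y \<in> carrier (sge N)" "y' \<in> carrier (sge N)"
  shows "cc x y' \<otimes>\<^bsub>K\<^esub> cc x' y = cc x' y \<otimes>\<^bsub>K\<^esub> cc x y' \<otimes>\<^bsub>K\<^esub> bb (sgcross M x x') (sgcross N y' y)"
proof -
  note [simp] = assms
  let ?h = "bb (sgH M x) (sgcross N y' y)" and ?h' = "bb (sgH M x') (sgcross N y' y)"
  have central: "?h \<otimes>\<^bsub>K\<^esub> (u \<otimes>\<^bsub>K\<^esub> v) = u \<otimes>\<^bsub>K\<^esub> (?h \<otimes>\<^bsub>K\<^esub> v)" if "u \<in> carrier K" "v \<in> carrier K" for u v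
    using that bb_central[of "sgH M x" "sgcross N y' y" u] by (simp flip: K.m_assoc)
  have "cc (x \<otimes>\<^bsub>sge M\<^esub> x') (y \<otimes>\<^bsub>sge N\<^esub> y')
      = cc x y \<otimes>\<^bsub>K\<^esub> cc x y' \<otimes>\<^bsub>K\<^esub> (?h \<otimes>\<^bsub>K\<^esub> (cc x' y \<otimes>\<^bsub>K\<^esub> (cc x' y' \<otimes>\<^bsub>K\<^esub> ?h')))"
    by (subst cc_add_left) (simp_all add: cc_add_right K.m_assoc)
  also have "\<dots> = cc x y \<otimes>\<^bsub>K\<^esub> (cc x y' \<otimes>\<^bsub>K\<^esub> cc x' y \<otimes>\<^bsub>K\<^esub> (cc x' y' \<otimes>\<^bsub>K\<^esub> ?h \<otimes>\<^bsub>K\<^esub> ?h'))"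
    by (simp add: central K.m_assoc)
  finally have 1: "cc (x \<otimes>\<^bsub>sge M\<^esub> x') (y \<otimes>\<^bsub>sge N\<^esub> y')
      = cc x y \<otimes>\<^bsub>K\<^esub> (cc x y' \<otimes>\<^bsub>K\<^esub> cc x' y \<otimes>\<^bsub>K\<^esub> (cc x' y' \<otimes>\<^bsub>K\<^esub> ?h \<otimes>\<^bsub>K\<^esub> ?h'))" .
  let ?z = "bb (sgcross M x x') (sgcross N y' y)"
  have "cc (x \<otimes>\<^bsub>sge M\<^esub> x') (y \<otimes>\<^bsub>sge N\<^esub> y')
      = cc x y \<otimes>\<^bsub>K\<^esub> (cc x' y \<otimes>\<^bsub>K\<^esub> cc x y' \<otimes>\<^bsub>K\<^esub> (cc x' y' \<otimes>\<^bsub>K\<^esub> (?h \<otimes>\<^bsub>K\<^esub> ?h' \<otimes>\<^bsub>K\<^esub> ?z)))"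
    by (subst cc_add_right) (simp_all add: cc_add_left M.H_mult b.add_left K.m_assoc)
  also have "cc x' y' \<otimes>\<^bsub>K\<^esub> (?h \<otimes>\<^bsub>K\<^esub> ?h' \<otimes>\<^bsub>K\<^esub> ?z) = ?z \<otimes>\<^bsub>K\<^esub> (cc x' y' \<otimes>\<^bsub>K\<^esub> ?h \<otimes>\<^bsub>K\<^esub> ?h')"
    using bb_central[of "sgcross M x x'" "sgcross N y' y" "cc x' y' \<otimes>\<^bsub>K\<^esub> ?h \<otimes>\<^bsub>K\<^esub> ?h'"]
    by (simp add: K.m_assoc)
  finally have "cc x y' \<otimes>\<^bsub>K\<^esub> cc x' y \<otimes>\<^bsub>K\<^esub> (cc x' y' \<otimes>\<^bsub>K\<^esub> ?h \<otimes>\<^bsub>K\<^esub> ?h')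
      = cc x' y \<otimes>\<^bsub>K\<^esub> cc x y' \<otimes>\<^bsub>K\<^esub> ?z \<otimes>\<^bsub>K\<^esub> (cc x' y' \<otimes>\<^bsub>K\<^esub> ?h \<otimes>\<^bsub>K\<^esub> ?h')"
    unfolding 1 by (simp add: K.m_assoc)
  then show ?thesis by (subst (asm) K.right_cancel) simp_all
qed

text \<open>This is the axiom P(u|v) = [u,v], spread from generators to each variable in turn; the
  central values of P let the corrections accumulate.\<close>

lemma circ_swap:
  assumes "u \<in> carrier K" "v \<in> carrier K"
  shows "u \<otimes>\<^bsub>K\<^esub> v = v \<otimes>\<^bsub>K\<^esub> u \<otimes>\<^bsub>K\<^esub> pp (cross K EE HH u v)"
proof -
  have pc: "pp c \<otimes>\<^bsub>K\<^esub> w = w \<otimes>\<^bsub>K\<^esub> pp c" if "c \<in> carrier EE" "w \<in> carrier K" for c w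
    by (rule pp_central[OF that])
  have g: "cc x y \<otimes>\<^bsub>K\<^esub> v = v \<otimes>\<^bsub>K\<^esub> cc x y \<otimes>\<^bsub>K\<^esub> pp (cross K EE HH (cc x y) v)"
    if [simp]: "x \<in> carrier (sge M)" "y \<in> carrier (sge N)" for x y
    using assms(2)
  proof (induction rule: circ_induct)
    case (circ x' y')
    then show ?case using circ_swap_gens[of x x' y' y] by (simp add: cross_cc)
  next
    case (bar a b) then show ?case by (simp add: cross_bb bb_central)
  next
    case (mult v w)
    have "pp (cross K EE HH (cc x y) (v \<otimes>\<^bsub>K\<^esub> w))
        = pp (cross K EE HH (cc x y) w) \<otimes>\<^bsub>K\<^esub> pp (cross K EE HH (cc x y) v)"
      using mult pc[of "cross K EE HH (cc x y) v" "pp (cross K EE HH (cc x y) w)"]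
      by (simp add: c.add_right)
    then show ?case
      using K.comm_mult_right[OF _ _ _ _ _ mult(3,4) pc] mult(1,2) by simp
  next
    case (inv v)
    then show ?case
      using K.comm_inv_right[OF _ _ _ inv(2) pc]
      by (simp add: c.inv_right)
  qed simp
  show ?thesis
    using assms(1)
  proof (induction rule: circ_induct)
    case (circ x y) then show ?case by (rule g)
  next
    case (bar a b) then show ?case using assms(2) by (simp add: cross_bb bb_central)
  next
    case (mult u w)
    then show ?case
      using K.comm_mult_left[OF _ _ _ _ _ mult(3,4) pc] assms(2)
      by (simp add: c.add_left)
  next
    case (inv u)
    then show ?case
      using K.comm_inv_left[OF _ _ _ inv(2) pc] assms(2)
      by (simp add: c.inv_left)
  qed (use assms(2) in simp)
qed

lemma cross_pp:
  assumes "a \<in> carrier EE" "u \<in> carrier K"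
  shows "cross K EE HH (pp a) u = \<one>\<^bsub>EE\<^esub>" "cross K EE HH u (pp a) = \<one>\<^bsub>EE\<^esub>"
  using assms(1)
  by (induction rule: tensor_group_induct)
     (use assms(2) in \<open>simp_all add: cross_bb c.add_left c.add_right c.inv_left c.inv_right\<close>)

lemma HH_closed [simp]: "u \<in> carrier K \<Longrightarrow> HH u \<in> carrier EE"
  using HH_quadratic by (auto simp: quadratic_map_def)

lemma HH_mult: "u \<in> carrier K \<Longrightarrow> v \<in> carrier K \<Longrightarrow>
    HH (u \<otimes>\<^bsub>K\<^esub> v) = HH u \<otimes>\<^bsub>EE\<^esub> HH v \<otimes>\<^bsub>EE\<^esub> cross K EE HH u v"
  by (rule quadratic_map_law[OF K.is_group EE.comm_group_axioms HH_quadratic])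

text \<open>For PHP = 2P, H of a bar is a\<otimes>b - T(a)\<otimes>T(b), and by the relation for T
  the second term contributes the same bar once more under P.\<close>

lemma circ_square_group: "square_group (M \<circledcirc> N)"
proof (rule square_group.intro; unfold circ_prod_simps)
  show "group K" "comm_group EE" "pp \<in> hom EE K" "quadratic_map K EE HH"
    by (fact K.is_group EE.comm_group_axioms pp_hom HH_quadratic)+
next
  fix a x assume "a \<in> carrier EE" "x \<in> carrier K"
  then show "cross K EE HH (pp a) x = \<one>\<^bsub>EE\<^esub>" "cross K EE HH x (pp a) = \<one>\<^bsub>EE\<^esub>"
    by (rule cross_pp)+
next
  fix x y assume "x \<in> carrier K" "y \<in> carrier K"
  then show "pp (cross K EE HH x y) = gcommutator K x y"
    by (intro K.gcommutatorI[symmetric] circ_swap) simp_all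
next
  fix a assume a: "a \<in> carrier EE"
  show "pp (HH (pp a)) = pp a \<otimes>\<^bsub>K\<^esub> pp a"
  proof (rule tensor_hom_eqI[OF K.is_group _ _ _ a])
    show "(\<lambda>a. pp (HH (pp a))) \<in> hom EE K"
      by (rule homI) (simp_all add: HH_mult cross_pp)
    show "(\<lambda>a. pp a \<otimes>\<^bsub>K\<^esub> pp a) \<in> hom EE K"
      by (rule homI) (simp_all add: K.m_assoc EE.m_comm flip: pp.hom_mult, simp add: EE.m_ac)
  qed (simp add: HH_bb bb_T)
qed

section \<open>Morphisms out of the tensor product, and functoriality\<close>

text \<open>A bar is P of a tensor, so the values on bars are dictated by the
  \<open>ee\<close>-part.\<close>

lemma circ_sg_hom_eqI:
  assumes f: "f \<in> sg_hom (M \<circledcirc> N) Z" and g: "g \<in> sg_hom (M \<circledcirc> N) Z"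
    and ee: "\<And>a b. a \<in> carrier (sgee M) \<Longrightarrow> b \<in> carrier (sgee N) \<Longrightarrow> snd f (tt a b) = snd g (tt a b)"
    and e: "\<And>x y. x \<in> carrier (sge M) \<Longrightarrow> y \<in> carrier (sge N) \<Longrightarrow> fst f (cc x y) = fst g (cc x y)"
  shows "f = g"
proof -
  note F = sg_homD[OF f, simplified] and G = sg_homD[OF g, simplified]
  interpret Z: square_group Z by (rule F)
  have bar: "fst f (bb a b) = fst g (bb a b)" if "a \<in> carrier (sgee M)" "b \<in> carrier (sgee N)" for a b
    using F(6)[of "tt a b"] G(6)[of "tt a b"] that by (simp add: ee)
  have "fst f u = fst g u" if "u \<in> carrier K" for u
    by (rule circ_hom_eqI[OF Z.group_e group_hom.homh[OF F(3)] group_hom.homh[OF G(3)] e bar that])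
  moreover have "snd f u = snd g u" if "u \<in> carrier EE" for u
    by (rule tensor_hom_eqI[OF Z.A.is_group group_hom.homh[OF F(4)] group_hom.homh[OF G(4)] ee that])
  ultimately show ?thesis
    using F(7,8) G(7,8) by (intro prod_eqI) (auto intro: extensionalityI)
qed

text \<open>The values on bars are not data: they must be P applied to g. Compatibility with cross
  effects and with H is assumed on symbols only; the first spreads by biadditivity, the second
  because both sides then have the same deviation.\<close>

lemma circ_sg_hom_exists:
  assumes Z: "square_group Z"
    and fc: "\<And>x y. x \<in> carrier (sge M) \<Longrightarrow> y \<in> carrier (sge N) \<Longrightarrow> fc x y \<in> carrier (sge Z)"
    and g: "g \<in> hom EE (sgee Z)" "g \<in> extensional (carrier EE)"
    and left: "\<And>x x' y. x \<in> carrier (sge M) \<Longrightarrow> x' \<in> carrier (sge M) \<Longrightarrow> y \<in> carrier (sge N) \<Longrightarrow>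
       fc (x \<otimes>\<^bsub>sge M\<^esub> x') y = fc x y \<otimes>\<^bsub>sge Z\<^esub> fc x' y"
    and right: "\<And>x y y'. x \<in> carrier (sge M) \<Longrightarrow> y \<in> carrier (sge N) \<Longrightarrow> y' \<in> carrier (sge N) \<Longrightarrow>
       fc x (y \<otimes>\<^bsub>sge N\<^esub> y') = fc x y \<otimes>\<^bsub>sge Z\<^esub> fc x y' \<otimes>\<^bsub>sge Z\<^esub> sgP Z (g (tt (sgH M x) (sgcross N y' y)))"
    and P_left: "\<And>a y. a \<in> carrier (sgee M) \<Longrightarrow> y \<in> carrier (sge N) \<Longrightarrow>
       fc (sgP M a) y = sgP Z (g (tt a (sgcross N y y)))"
    and P_right: "\<And>x b. x \<in> carrier (sge M) \<Longrightarrow> b \<in> carrier (sgee N) \<Longrightarrow>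
       fc x (sgP N b) = sgP Z (g (tt (sgDelta M x) b))"
    and T: "\<And>a b. a \<in> carrier (sgee M) \<Longrightarrow> b \<in> carrier (sgee N) \<Longrightarrow>
       g (tt (sgT M a) (sgT N b)) = inv\<^bsub>sgee Z\<^esub> sgT Z (g (tt a b))"
    and cross: "\<And>x y x' y'. x \<in> carrier (sge M) \<Longrightarrow> y \<in> carrier (sge N) \<Longrightarrow> x' \<in> carrier (sge M) \<Longrightarrow>
       y' \<in> carrier (sge N) \<Longrightarrow>
       sgcross Z (fc x y) (fc x' y') = g (tt (sgcross M x x') (sgcross N y y'))"
    and H: "\<And>x y. x \<in> carrier (sge M) \<Longrightarrow> y \<in> carrier (sge N) \<Longrightarrow>
       sgH Z (fc x y) = g (tt (sgDelta M x) (sgH N y) \<otimes>\<^bsub>EE\<^esub> tt (sgH M x) (sgcross N y y))"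
  obtains f where "f \<in> sg_hom (M \<circledcirc> N) Z" "snd f = g"
    and "\<And>x y. x \<in> carrier (sge M) \<Longrightarrow> y \<in> carrier (sge N) \<Longrightarrow> fst f (cc x y) = fc x y"
    and "\<And>a b. a \<in> carrier (sgee M) \<Longrightarrow> b \<in> carrier (sgee N) \<Longrightarrow> fst f (bb a b) = sgP Z (g (tt a b))"
proof -
  interpret Z: square_group Z by fact
  interpret g: group_hom EE "sgee Z" g by unfold_locales (rule g)
  let ?fb = "\<lambda>a b. sgP Z (g (tt a b))"
  have fb: "biadditive (sgee M) (sgee N) (sge Z) ?fb"
    by (rule biadditiveI) (simp_all add: t.add_left t.add_right)
  have Zc: "?fb a b \<otimes>\<^bsub>sge Z\<^esub> u = u \<otimes>\<^bsub>sge Z\<^esub> ?fb a b"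
    if "a \<in> carrier (sgee M)" "b \<in> carrier (sgee N)" "u \<in> carrier (sge Z)" for a b u
    using that by (simp add: Z.P_central)
  have fT: "?fb (sgT M a) (sgT N b) = inv\<^bsub>sge Z\<^esub> ?fb a b"
    if "a \<in> carrier (sgee M)" "b \<in> carrier (sgee N)" for a b
    using that by (simp add: T Z.P_T)
  obtain f where f: "f \<in> hom K (sge Z)" "f \<in> extensional (carrier K)"
    and fcc: "\<And>x y. x \<in> carrier (sge M) \<Longrightarrow> y \<in> carrier (sge N) \<Longrightarrow> f (cc x y) = fc x y"
    and fbb: "\<And>a b. a \<in> carrier (sgee M) \<Longrightarrow> b \<in> carrier (sgee N) \<Longrightarrow> f (bb a b) = ?fb a b"
    using circ_hom_exists[OF Z.group_e fc fb Zc left right P_left P_right fT] by blast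
  interpret f: group_hom K "sge Z" f by unfold_locales (rule f)
  have fP: "f (pp a) = sgP Z (g a)" if "a \<in> carrier EE" for a
    by (rule tensor_hom_eqI[OF Z.group_e _ _ _ that]) (auto simp: hom_def fbb)
  \<comment> \<open>Both sides are biadditive in u and v, and both vanish on bars because the image
    of P has no cross effect.\<close>
  have cr: "sgcross Z (f u) (f v) = g (cross K EE HH u v)" if uv: "u \<in> carrier K" "v \<in> carrier K" for u v
  proof -
    have bar: "sgcross Z (f (bb a b)) w = \<one>\<^bsub>sgee Z\<^esub>" "sgcross Z w (f (bb a b)) = \<one>\<^bsub>sgee Z\<^esub>"
      if "a \<in> carrier (sgee M)" "b \<in> carrier (sgee N)" "w \<in> carrier (sge Z)" for a b w
      using that by (simp_all add: fbb Z.cross_P_left Z.cross_P_right)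
    have 1: "sgcross Z (f (cc x y)) (f v) = g (cross K EE HH (cc x y) v)"
      if [simp]: "x \<in> carrier (sge M)" "y \<in> carrier (sge N)" for x y
      using uv(2)
      by (induction rule: circ_induct)
        (simp_all add: fcc fc cross cross_cc bar cross_bb Z.X.add_right c.add_right Z.X.inv_right c.inv_right)
    show ?thesis
      using uv(1)
      by (induction rule: circ_induct)
        (use uv(2) in \<open>simp_all add: 1 bar cross_bb Z.X.add_left c.add_left Z.X.inv_left c.inv_left\<close>)
  qed
  have agree: "g (HH \<one>\<^bsub>K\<^esub>) = sgH Z (f \<one>\<^bsub>K\<^esub>)"
    "\<And>u. u \<in> carrier K \<Longrightarrow> g (HH u) = sgH Z (f u) \<Longrightarrow> g (HH (inv\<^bsub>K\<^esub> u)) = sgH Z (f (inv\<^bsub>K\<^esub> u))"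
    by (rule quadratic_law_agree[OF K.is_group Z.A.is_group, of "\<lambda>u. g (HH u)" "\<lambda>u. sgH Z (f u)"
        "\<lambda>u v. g (cross K EE HH u v)"]; simp add: HH_mult Z.H_mult cr)+
  have fH: "g (HH u) = sgH Z (f u)" if "u \<in> carrier K" for u
    using that
  proof (induction rule: circ_induct)
    case (circ x y) then show ?case by (simp add: fcc H HH_cc)
  next
    case (bar a b) then show ?case by (simp add: fbb HH_bb T Z.H_P)
  next
    case (mult u v) then show ?case by (simp add: HH_mult Z.H_mult cr)
  qed (use agree in auto)
  show thesis
    by (rule that[of "(f, g)"])
      (use f g Z circ_square_group fP fH fcc fbb in \<open>auto simp: sg_hom_def\<close>)
qed

end

text \<open>Existence comes from \<open>circ_sg_hom_exists\<close> and uniqueness from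
  \<open>circ_sg_hom_eqI\<close>; together they make the description in \<open>circ_map\<close>
  meaningful.\<close>

lemma circ_map_props:
  assumes f: "f \<in> sg_hom M M'" and g: "g \<in> sg_hom N N'"
  shows "circ_map M M' f N N' g \<in> sg_hom (M \<circledcirc> N) (M' \<circledcirc> N')"
    and "x \<in> carrier (sge M) \<Longrightarrow> y \<in> carrier (sge N) \<Longrightarrow>
      fst (circ_map M M' f N N' g) (circ_elt M N x y) = circ_elt M' N' (fst f x) (fst g y)"
    and "a \<in> carrier (sgee M) \<Longrightarrow> b \<in> carrier (sgee N) \<Longrightarrow>
      snd (circ_map M M' f N N' g) (ee_elt M N a b) = ee_elt M' N' (snd f a) (snd g b)"
proof -
  note F = sg_homD[OF f] and G = sg_homD[OF g]
  note FS = sg_hom_structure[OF f] and GS = sg_hom_structure[OF g]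
  interpret MN: square_group_pair M N using F G by (simp add: square_group_pair_def)
  interpret MN': square_group_pair M' N' using F G by (simp add: square_group_pair_def)
  interpret fe: group_hom "sge M" "sge M'" "fst f" by (rule F)
  interpret fee: group_hom "sgee M" "sgee M'" "snd f" by (rule F)
  interpret ge: group_hom "sge N" "sge N'" "fst g" by (rule G)
  interpret gee: group_hom "sgee N" "sgee N'" "snd g" by (rule G)
  interpret Z: square_group "M' \<circledcirc> N'" by (rule MN'.circ_square_group)
  have bi: "biadditive (sgee M) (sgee N) MN'.EE (\<lambda>a b. MN'.tt (snd f a) (snd g b))"
    by (rule biadditiveI) (simp_all add: MN'.t.add_left MN'.t.add_right)
  define k where "k = tensor_lift (sgee M) (sgee N) MN'.EE (\<lambda>a b. MN'.tt (snd f a) (snd g b))"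
  have k: "k \<in> hom MN.EE MN'.EE" "k \<in> extensional (carrier MN.EE)"
    and kt: "\<And>a b. a \<in> carrier (sgee M) \<Longrightarrow> b \<in> carrier (sgee N) \<Longrightarrow> k (MN.tt a b) = MN'.tt (snd f a) (snd g b)"
    unfolding k_def using tensor_lift[OF MN'.EE.is_group bi] by (simp_all add: MN'.EE.m_comm)
  interpret k: group_hom MN.EE MN'.EE k by unfold_locales (rule k)
  \<comment> \<open>On the tensor product T = HP - 1 sends a\<otimes>b to
    -T(a)\<otimes>T(b).\<close>
  have TT: "MN'.tt (sgT M' a) (sgT N' b) = inv\<^bsub>MN'.EE\<^esub> sgT (M' \<circledcirc> N') (MN'.tt a b)"
    if "a \<in> carrier (sgee M')" "b \<in> carrier (sgee N')" for a b
    using that by (simp add: sgT_def[of "M' \<circledcirc> N'"] MN'.HH_bb MN'.EE.inv_mult MN'.EE.m_ac)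
  obtain h where h: "h \<in> sg_hom (M \<circledcirc> N) (M' \<circledcirc> N')" "snd h = k"
    and hc: "\<And>x y. x \<in> carrier (sge M) \<Longrightarrow> y \<in> carrier (sge N) \<Longrightarrow>
       fst h (MN.cc x y) = MN'.cc (fst f x) (fst g y)"
    and hb: "\<And>a b. a \<in> carrier (sgee M) \<Longrightarrow> b \<in> carrier (sgee N) \<Longrightarrow>
       fst h (MN.bb a b) = sgP (M' \<circledcirc> N') (k (MN.tt a b))"
    by (rule MN.circ_sg_hom_exists[OF MN'.circ_square_group, of "\<lambda>x y. MN'.cc (fst f x) (fst g y)" k])
      (use k in \<open>auto simp: MN'.cc_add_left MN'.cc_add_right kt F G FS GS MN'.cc_P_left MN'.cc_P_right
         TT MN'.cross_cc MN'.HH_cc\<close>)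
  let ?P = "\<lambda>h. h \<in> sg_hom (M \<circledcirc> N) (M' \<circledcirc> N') \<and>
     (\<forall>x\<in>carrier (sge M). \<forall>y\<in>carrier (sge N).
        fst h (circ_elt M N x y) = circ_elt M' N' (fst f x) (fst g y)) \<and>
     (\<forall>a\<in>carrier (sgee M). \<forall>b\<in>carrier (sgee N).
        fst h (bar_elt M N a b) = bar_elt M' N' (snd f a) (snd g b) \<and>
        snd h (ee_elt M N a b) = ee_elt M' N' (snd f a) (snd g b))"
  have "?P h" using h hc hb by (simp add: kt)
  moreover have "h' = h" if "?P h'" for h'
    using that \<open>?P h\<close> by (intro MN.circ_sg_hom_eqI[of h' "M' \<circledcirc> N'" h]) auto
  ultimately have "?P (THE h. ?P h)" by (rule theI)
  then have P: "?P (circ_map M M' f N N' g)" unfolding circ_map_def .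
  then show "circ_map M M' f N N' g \<in> sg_hom (M \<circledcirc> N) (M' \<circledcirc> N')" by blast
  from P show "x \<in> carrier (sge M) \<Longrightarrow> y \<in> carrier (sge N) \<Longrightarrow>
      fst (circ_map M M' f N N' g) (circ_elt M N x y) = circ_elt M' N' (fst f x) (fst g y)" by blast
  from P show "a \<in> carrier (sgee M) \<Longrightarrow> b \<in> carrier (sgee N) \<Longrightarrow>
      snd (circ_map M M' f N N' g) (ee_elt M N a b) = ee_elt M' N' (snd f a) (snd g b)" by blast
qed

section \<open>The stable quadratic module of a Waldhausen category\<close>

abbreviation D0 :: "('o, 'm) waldcat \<Rightarrow> ('o, 'm) D0elt monoid" where "D0 C \<equiv> sq0 (Dmod C)"
abbreviation D1 :: "('o, 'm) waldcat \<Rightarrow> ('o, 'm) D1elt monoid" where "D1 C \<equiv> sq1 (Dmod C)"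
abbreviation DE :: "('o, 'm) waldcat \<Rightarrow> ('o, 'm) Deelt monoid" where "DE C \<equiv> ab_tensor (D0 C)"
abbreviation dt :: "('o, 'm) waldcat \<Rightarrow> ('o, 'm) D0elt \<Rightarrow> ('o, 'm) D0elt \<Rightarrow> ('o, 'm) Deelt"
  where "dt C \<equiv> ab_tensor_elt (D0 C)"
abbreviation bd :: "('o, 'm) waldcat \<Rightarrow> ('o, 'm) D1elt \<Rightarrow> ('o, 'm) D0elt" where "bd C \<equiv> sqd (Dmod C)"
abbreviation dw :: "('o, 'm) waldcat \<Rightarrow> ('o, 'm) Deelt \<Rightarrow> ('o, 'm) D1elt" where "dw C \<equiv> sqw (Dmod C)"

context category
begin

lemma arrows_iff: "f \<in> arrows C A B \<longleftrightarrow> f \<in> Arr C \<and> Src C f = A \<and> Tgt C f = B"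
  by (auto simp: arrows_def)

lemma Cmp_simps:
  assumes "f \<in> Arr C" "g \<in> Arr C" "Tgt C f = Src C g"
  shows "g \<cdot> f \<in> Arr C" "Src C (g \<cdot> f) = Src C f" "Tgt C (g \<cdot> f) = Tgt C g"
  using Cmp_arrow[of f "Src C f" "Tgt C f" g "Tgt C g"] assms by (simp_all add: arrows_iff)

lemma Ide_simps [simp]:
  assumes "A \<in> Obj C"
  shows "Ide C A \<in> Arr C" "Src C (Ide C A) = A" "Tgt C (Ide C A) = A"
  using Ide_arrow[OF assms] by (simp_all add: arrows_iff)

end

context waldhausen_category
begin

lemma Zero_Obj [simp]: "Zero C \<in> Obj C"
  using zero by (simp add: zero_object_def)

lemma Weq_Arr: "f \<in> Weq C \<Longrightarrow> f \<in> Arr C" using Weq_subset by auto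
lemma Cof_Arr: "f \<in> Cof C \<Longrightarrow> f \<in> Arr C" using Cof_subset by auto

lemma Weq_Obj: "f \<in> Weq C \<Longrightarrow> Src C f \<in> Obj C" "f \<in> Weq C \<Longrightarrow> Tgt C f \<in> Obj C"
  by (simp_all add: Weq_Arr Src_closed Tgt_closed)

lemma cofseq_arrows:
  assumes "cofseq C i p"
  shows "i \<in> Arr C" "p \<in> Arr C" "Src C p = Tgt C i"
    "Src C i \<in> Obj C" "Tgt C i \<in> Obj C" "Tgt C p \<in> Obj C"
  using assms Cof_Arr by (auto simp: cofseq_def is_pushout_def intro: Src_closed Tgt_closed)

sublocale Q: stable_quadratic_module "Dmod C"
  unfolding Dmod_def by (rule presented_stable_quadratic_module)

abbreviation "K0 \<equiv> class0 (Obj C) (deg1_gens C) (D_rel0 C) (D_rel1 C)"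
abbreviation "K1 \<equiv> class1 (Obj C) (deg1_gens C) (D_rel0 C) (D_rel1 C)"
abbreviation "T0 \<equiv> qterms0 (Obj C) (deg1_gens C)"
abbreviation "T1 \<equiv> qterms1 (Obj C) (deg1_gens C)"

lemma D_carrier: "carrier (D0 C) = K0 ` T0" "carrier (D1 C) = K1 ` T1"
  by (simp_all add: Dmod_def presented_sq01 presented0_carrier presented1_carrier)

lemma K_simps:
  "K0 (Gen0 A) = D_ob C A" "K1 (we f) = D_we C f" "K1 (cs i p) = D_cs C i p"
  "K0 0 = \<one>\<^bsub>D0 C\<^esub>" "K1 0 = \<one>\<^bsub>D1 C\<^esub>"
  "x \<in> T0 \<Longrightarrow> y \<in> T0 \<Longrightarrow> K0 (x + y) = K0 x \<otimes>\<^bsub>D0 C\<^esub> K0 y"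
  "c \<in> T1 \<Longrightarrow> e \<in> T1 \<Longrightarrow> K1 (c + e) = K1 c \<otimes>\<^bsub>D1 C\<^esub> K1 e"
  "x \<in> T0 \<Longrightarrow> K0 (- x) = inv\<^bsub>D0 C\<^esub> K0 x"
  "c \<in> T1 \<Longrightarrow> K1 (- c) = inv\<^bsub>D1 C\<^esub> K1 c"
  "c \<in> T1 \<Longrightarrow> K0 (Bd c) = bd C (K1 c)"
  "x \<in> T0 \<Longrightarrow> y \<in> T0 \<Longrightarrow> K1 (Br x y) = sqbr (Dmod C) (K0 x) (K0 y)"
  by (simp_all add: Dmod_def presented_sq01 presented0_mult presented1_mult presented0_inv
      presented1_inv presented0_one presented1_one presented_bd_class presented_br_class
      D_ob_def D_we_def D_cs_def)

lemma gens_iff: "WE f \<in> deg1_gens C \<longleftrightarrow> f \<in> Weq C" "CS i p \<in> deg1_gens C \<longleftrightarrow> cofseq C i p"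
  by (auto simp: deg1_gens_def)

lemma D_closed [simp]:
  "A \<in> Obj C \<Longrightarrow> D_ob C A \<in> carrier (D0 C)"
  "f \<in> Weq C \<Longrightarrow> D_we C f \<in> carrier (D1 C)"
  "cofseq C i p \<Longrightarrow> D_cs C i p \<in> carrier (D1 C)"
  by (auto simp: D_carrier gens_iff simp flip: K_simps(1-3) intro!: imageI)

lemma rel0: "(x, y) \<in> D_rel0 C \<Longrightarrow> x \<in> T0 \<Longrightarrow> y \<in> T0 \<Longrightarrow> K0 x = K0 y"
  by (intro class0_eqI eq0_rel)

lemma rel1: "(x, y) \<in> D_rel1 C \<Longrightarrow> x \<in> T1 \<Longrightarrow> y \<in> T1 \<Longrightarrow> K1 x = K1 y"
  by (intro class1_eqI eq1_rel)

lemma bd_we: "f \<in> Weq C \<Longrightarrow> bd C (D_we C f) = inv\<^bsub>D0 C\<^esub> D_ob C (Tgt C f) \<otimes>\<^bsub>D0 C\<^esub> D_ob C (Src C f)"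
  using rel0[OF D_bd_we, of f] by (simp add: gens_iff Weq_Obj K_simps)

lemma bd_cs: "cofseq C i p \<Longrightarrow> bd C (D_cs C i p)
    = inv\<^bsub>D0 C\<^esub> D_ob C (Tgt C i) \<otimes>\<^bsub>D0 C\<^esub> D_ob C (Tgt C p) \<otimes>\<^bsub>D0 C\<^esub> D_ob C (Src C i)"
  using rel0[OF D_bd_cs, of i p] by (simp add: gens_iff cofseq_arrows K_simps)

lemma D_ob_Zero [simp]: "D_ob C (Zero C) = \<one>\<^bsub>D0 C\<^esub>"
  using rel0[OF D_zero] by (simp add: K_simps)

lemma Ide_Weq: "A \<in> Obj C \<Longrightarrow> Ide C A \<in> Weq C"
  using Ide_left[of "Ide C A"]
  by (intro Weq_iso) (auto simp: cat_iso_def arrows_iff intro!: bexI[of _ "Ide C A"])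

lemma D_we_Ide: "A \<in> Obj C \<Longrightarrow> D_we C (Ide C A) = \<one>\<^bsub>D1 C\<^esub>"
  using rel1[OF D_we_id, of A] by (simp add: gens_iff K_simps Ide_Weq)

lemma D_cs_Ide_left:
  "A \<in> Obj C \<Longrightarrow> p \<in> arrows C A (Zero C) \<Longrightarrow> cofseq C (Ide C A) p \<Longrightarrow> D_cs C (Ide C A) p = \<one>\<^bsub>D1 C\<^esub>"
  using rel1[OF D_cs_id_left, of A p] by (simp add: gens_iff K_simps)

lemma D_cs_Ide_right:
  "A \<in> Obj C \<Longrightarrow> i \<in> arrows C (Zero C) A \<Longrightarrow> cofseq C i (Ide C A) \<Longrightarrow> D_cs C i (Ide C A) = \<one>\<^bsub>D1 C\<^esub>"
  using rel1[OF D_cs_id_right, of A i] by (simp add: gens_iff K_simps)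

lemma D_we_Cmp: "f \<in> Weq C \<Longrightarrow> g \<in> Weq C \<Longrightarrow> Tgt C f = Src C g \<Longrightarrow>
    D_we C (g \<cdot> f) = D_we C g \<otimes>\<^bsub>D1 C\<^esub> D_we C f"
  using rel1[OF D_we_comp, of f g] by (simp add: gens_iff K_simps Weq_Cmp)

lemma D_we_cs_rel:
  assumes "cofseq C i p" "cofseq C i' p'" "a \<in> Weq C" "b \<in> Weq C" "c \<in> Weq C"
    and "a \<in> arrows C (Src C i) (Src C i')" "b \<in> arrows C (Tgt C i) (Tgt C i')"
      "c \<in> arrows C (Tgt C p) (Tgt C p')" "b \<cdot> i = i' \<cdot> a" "c \<cdot> p = p' \<cdot> b"
  shows "D_we C a \<otimes>\<^bsub>D1 C\<^esub> D_we C c \<otimes>\<^bsub>D1 C\<^esub> sqbr (Dmod C) (D_ob C (Src C i))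
        (inv\<^bsub>D0 C\<^esub> D_ob C (Tgt C p') \<otimes>\<^bsub>D0 C\<^esub> D_ob C (Tgt C p))
      = inv\<^bsub>D1 C\<^esub> D_cs C i' p' \<otimes>\<^bsub>D1 C\<^esub> D_we C b \<otimes>\<^bsub>D1 C\<^esub> D_cs C i p"
  using rel1[OF D_we_cs, OF assms] assms(1-5) cofseq_arrows[OF assms(1)] cofseq_arrows[OF assms(2)]
  by (simp add: gens_iff K_simps)

lemma D_cs_cs_rel:
  assumes "Tgt C i = Src C j"
      "cofseq C i p" "cofseq C (j \<cdot> i) q" "cofseq C j r" "cofseq C k s"
      "k \<in> arrows C (Tgt C p) (Tgt C q)" "s \<in> arrows C (Tgt C q) (Tgt C r)"
      "k \<cdot> p = q \<cdot> j" "s \<cdot> q = r"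
  shows "D_cs C j r \<otimes>\<^bsub>D1 C\<^esub> D_cs C i p = D_cs C (j \<cdot> i) q \<otimes>\<^bsub>D1 C\<^esub> D_cs C k s \<otimes>\<^bsub>D1 C\<^esub>
      sqbr (Dmod C) (D_ob C (Src C i))
        (inv\<^bsub>D0 C\<^esub> D_ob C (Tgt C q) \<otimes>\<^bsub>D0 C\<^esub> D_ob C (Tgt C r) \<otimes>\<^bsub>D0 C\<^esub> D_ob C (Tgt C p))"
  using rel1[OF D_cs_cs, OF assms] assms(2-5)
  by (simp add: gens_iff K_simps cofseq_arrows)

lemma D_coprod_rel:
  assumes "is_coproduct C i\<^sub>1 i\<^sub>2" "Src C i\<^sub>1 = A" "Src C i\<^sub>2 = B"
       "p\<^sub>1 \<in> arrows C (Tgt C i\<^sub>1) A" "p\<^sub>2 \<in> arrows C (Tgt C i\<^sub>1) B"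
       "p\<^sub>1 \<cdot> i\<^sub>1 = Ide C A" "zero_map C (p\<^sub>1 \<cdot> i\<^sub>2)"
       "zero_map C (p\<^sub>2 \<cdot> i\<^sub>1)" "p\<^sub>2 \<cdot> i\<^sub>2 = Ide C B"
    and cof: "cofseq C i\<^sub>2 p\<^sub>1" "cofseq C i\<^sub>1 p\<^sub>2"
  shows "sqbr (Dmod C) (D_ob C A) (D_ob C B) = inv\<^bsub>D1 C\<^esub> D_cs C i\<^sub>2 p\<^sub>1 \<otimes>\<^bsub>D1 C\<^esub> D_cs C i\<^sub>1 p\<^sub>2"
  using rel1[OF D_coprod, OF assms(1-9)] cof cofseq_arrows(4)[OF cof(1)] cofseq_arrows(4)[OF cof(2)]
    assms(2,3)
  by (simp add: gens_iff K_simps)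

section \<open>Generation of \<open>D0 C\<close> and \<open>D1 C\<close>, and freeness of
  \<open>D0 C\<close>\<close>

text \<open>Degree 0 terms may contain boundaries of degree 1 terms, yet the objects generate:
  boundaries of generators are given by relations, and boundaries of brackets are commutators. On
  degree 1 terms the induction therefore carries the claim about their boundaries.\<close>

lemma D0_induct [consumes 1, case_names ob one mult inv]:
  assumes "x \<in> carrier (D0 C)"
    and ob: "\<And>A. A \<in> Obj C \<Longrightarrow> R (D_ob C A)"
    and one: "R \<one>\<^bsub>D0 C\<^esub>"
    and mult: "\<And>x y. x \<in> carrier (D0 C) \<Longrightarrow> y \<in> carrier (D0 C) \<Longrightarrow> R x \<Longrightarrow> R y \<Longrightarrow> R (x \<otimes>\<^bsub>D0 C\<^esub> y)"
    and inv: "\<And>x. x \<in> carrier (D0 C) \<Longrightarrow> R x \<Longrightarrow> R (inv\<^bsub>D0 C\<^esub> x)"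
  shows "R x"
proof -
  have cl: "K0 t \<in> carrier (D0 C)" if "t \<in> T0" for t using that by (simp add: D_carrier)
  have cl1: "K1 t \<in> carrier (D1 C)" if "t \<in> T1" for t using that by (simp add: D_carrier)
  have "R (K0 t)" if "t \<in> T0" for t
  proof (rule qterm_induct(1)[OF _ _ _ _ _ _ _ _ _ _ that,
        where A = "\<lambda>x. R (K0 x)" and B = "\<lambda>c. R (K0 (Bd c))"])
    fix b assume "b \<in> deg1_gens C"
    then show "R (K0 (Bd (Gen1 b)))"
      by (cases b) (simp_all add: K_simps gens_iff bd_we bd_cs ob mult inv Weq_Obj cofseq_arrows)
  next
    fix x y assume "x \<in> T0" "y \<in> T0" "R (K0 x)" "R (K0 y)"
    then show "R (K0 (Bd (Br x y)))"
      by (simp add: K_simps Q.d_br gcommutator_def mult inv cl)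
  qed (simp_all add: K_simps ob one mult inv cl cl1)
  then show ?thesis using assms(1) by (auto simp: D_carrier)
qed

text \<open>Brackets are covered by the case of arbitrary values of \<omega>, so nothing has to be
  carried on degree 0 subterms.\<close>

lemma D1_induct [consumes 1, case_names we cs w one mult inv]:
  assumes "c \<in> carrier (D1 C)"
    and we: "\<And>f. f \<in> Weq C \<Longrightarrow> R (D_we C f)"
    and cs: "\<And>i p. cofseq C i p \<Longrightarrow> R (D_cs C i p)"
    and w: "\<And>a. a \<in> carrier (DE C) \<Longrightarrow> R (dw C a)"
    and one: "R \<one>\<^bsub>D1 C\<^esub>"
    and mult: "\<And>x y. x \<in> carrier (D1 C) \<Longrightarrow> y \<in> carrier (D1 C) \<Longrightarrow> R x \<Longrightarrow> R y \<Longrightarrow> R (x \<otimes>\<^bsub>D1 C\<^esub> y)"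
    and inv: "\<And>x. x \<in> carrier (D1 C) \<Longrightarrow> R x \<Longrightarrow> R (inv\<^bsub>D1 C\<^esub> x)"
  shows "R c"
proof -
  have cl: "K0 t \<in> carrier (D0 C)" if "t \<in> T0" for t using that by (simp add: D_carrier)
  have cl1: "K1 t \<in> carrier (D1 C)" if "t \<in> T1" for t using that by (simp add: D_carrier)
  have "R (K1 t)" if "t \<in> T1" for t
  proof (rule qterm_induct(2)[OF _ _ _ _ _ _ _ _ _ _ that,
        where A = "\<lambda>x. True" and B = "\<lambda>c. R (K1 c)"])
    fix b assume "b \<in> deg1_gens C"
    then show "R (K1 (Gen1 b))" by (cases b) (simp_all add: K_simps gens_iff we cs)
  next
    fix x y assume "x \<in> T0" "y \<in> T0"
    then show "R (K1 (Br x y))"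
      using w[of "dt C (K0 x) (K0 y)"] by (simp add: K_simps sqbr_def cl ab_tensor_elt_closed)
  qed (simp_all add: K_simps one mult inv cl1)
  then show ?thesis using assms(1) by (auto simp: D_carrier)
qed

lemma D0_hom_eqI:
  assumes "group L" "h \<in> hom (D0 C) L" "k \<in> hom (D0 C) L"
    and "\<And>A. A \<in> Obj C \<Longrightarrow> h (D_ob C A) = k (D_ob C A)" and "x \<in> carrier (D0 C)"
  shows "h x = k x"
proof -
  interpret h: group_hom "D0 C" L h using assms by (intro group_homI Q.G0.is_group) auto
  interpret k: group_hom "D0 C" L k using assms by (intro group_homI Q.G0.is_group) auto
  show ?thesis using assms(5) by (induction rule: D0_induct) (use assms(4) in auto)
qed

lemma D0_quadratic_eqI:
  assumes K: "group K"
    and h: "\<And>x. x \<in> carrier (D0 C) \<Longrightarrow> h x \<in> carrier K" "\<And>x. x \<in> carrier (D0 C) \<Longrightarrow> h' x \<in> carrier K"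
    and \<beta>: "\<And>x y. x \<in> carrier (D0 C) \<Longrightarrow> y \<in> carrier (D0 C) \<Longrightarrow> \<beta> x y \<in> carrier K"
    and law: "\<And>x y. x \<in> carrier (D0 C) \<Longrightarrow> y \<in> carrier (D0 C) \<Longrightarrow>
        h (x \<otimes>\<^bsub>D0 C\<^esub> y) = h x \<otimes>\<^bsub>K\<^esub> h y \<otimes>\<^bsub>K\<^esub> \<beta> x y"
      "\<And>x y. x \<in> carrier (D0 C) \<Longrightarrow> y \<in> carrier (D0 C) \<Longrightarrow>
        h' (x \<otimes>\<^bsub>D0 C\<^esub> y) = h' x \<otimes>\<^bsub>K\<^esub> h' y \<otimes>\<^bsub>K\<^esub> \<beta> x y"
    and gen: "\<And>A. A \<in> Obj C \<Longrightarrow> h (D_ob C A) = h' (D_ob C A)"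
    and x: "x \<in> carrier (D0 C)"
  shows "h x = h' x"
proof -
  note agree = quadratic_law_agree[OF Q.G0.is_group K h \<beta> law]
  show ?thesis
    using x by (induction rule: D0_induct) (simp_all add: gen agree law)
qed

text \<open>This is freeness on the objects other than the zero object, among groups of class two.
  In the module on K with \<partial> the identity, a degree 1 relation only asks that the boundaries
  of its two sides agree, an identity between words in the values of f.\<close>

lemma D0_lift:
  assumes K: "nil2_group K" and f: "\<And>A. A \<in> Obj C \<Longrightarrow> f A \<in> carrier K" "f (Zero C) = \<one>\<^bsub>K\<^esub>"
  obtains h where "h \<in> hom (D0 C) K" "\<And>A. A \<in> Obj C \<Longrightarrow> h (D_ob C A) = f A"
proof -
  interpret K: nil2_group K by fact
  define N where "N = \<lparr>sq0 = K, sq1 = K, sqd = id, sqw = SOME h. h \<in> hom (ab_tensor K) K \<and>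
      (\<forall>x\<in>carrier K. \<forall>y\<in>carrier K. h (ab_tensor_elt K x y) = gcommutator K y x)\<rparr>"
  have N: "stable_quadratic_module N" and br: "\<And>x y. x \<in> carrier K \<Longrightarrow> y \<in> carrier K \<Longrightarrow>
      sqbr N x y = gcommutator K y x"
    using K.nil2_sqmod by (simp_all add: N_def)
  have Ns [simp]: "sq0 N = K" "sq1 N = K" "sqd N = id" by (simp_all add: N_def)
  \<comment> \<open>With \<partial> the identity, the relations for boundaries leave no other
    choice.\<close>
  define f1 where "f1 = case_deg1_gen (\<lambda>g. inv\<^bsub>K\<^esub> f (Tgt C g) \<otimes>\<^bsub>K\<^esub> f (Src C g))
      (\<lambda>i p. inv\<^bsub>K\<^esub> f (Tgt C i) \<otimes>\<^bsub>K\<^esub> f (Tgt C p) \<otimes>\<^bsub>K\<^esub> f (Src C i))"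
  have f1 [simp]: "f1 (WE g) = inv\<^bsub>K\<^esub> f (Tgt C g) \<otimes>\<^bsub>K\<^esub> f (Src C g)"
    "f1 (CS i p) = inv\<^bsub>K\<^esub> f (Tgt C i) \<otimes>\<^bsub>K\<^esub> f (Tgt C p) \<otimes>\<^bsub>K\<^esub> f (Src C i)" for g i p
    by (simp_all add: f1_def)
  have "\<exists>!h. h \<in> sqmod_hom (Dmod C) N \<and> (\<forall>a\<in>Obj C. fst h (K0 (Gen0 a)) = f a) \<and>
      (\<forall>b\<in>deg1_gens C. snd h (K1 (Gen1 b)) = f1 b)"
    unfolding Dmod_def
  proof (rule presented_sqmod_universal[OF N])
    show "f \<in> Obj C \<rightarrow> carrier (sq0 N)" using f by simp
    show "f1 \<in> deg1_gens C \<rightarrow> carrier (sq1 N)"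
      by (auto simp: deg1_gens_def f Weq_Obj cofseq_arrows)
  next
    fix x y assume "(x, y) \<in> D_rel0 C"
    then show "qeval0 N f f1 x = qeval0 N f f1 y" by cases (simp_all add: f)
  next
    fix x y assume "(x, y) \<in> D_rel1 C"
    then show "qeval1 N f f1 x = qeval1 N f f1 y"
    proof cases
      case (D_we_cs i p i' p' a b c)
      then show ?thesis
        using cofseq_arrows[of i p] cofseq_arrows[of i' p']
        by (simp add: br f arrows_iff gcommutator_def K.m_assoc K.inv_mult_group)
    next
      case (D_cs_cs i j p q r k s)
      then have ar: "i \<in> Arr C" "j \<in> Arr C" by (auto simp: cofseq_arrows)
      note cmp = Cmp_simps[OF ar D_cs_cs(3)]
      show ?thesis
        using D_cs_cs cofseq_arrows[of i p] cofseq_arrows[of j r] cofseq_arrows[of k s]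
          cofseq_arrows[of "j \<cdot> i" q]
        by (simp add: br f arrows_iff gcommutator_def K.m_assoc K.inv_mult_group cmp)
    next
      case (D_coprod i1 i2 A B p1 p2)
      then show ?thesis
        using Src_closed[of i1] Src_closed[of i2] Tgt_closed[of i1]
        by (simp add: br f arrows_iff gcommutator_def K.m_assoc K.inv_mult_group is_coproduct_def)
    next
      case (D_we_comp g h)
      then show ?thesis using Weq_Arr[of g] Weq_Arr[of h] Weq_Obj[of g] Weq_Obj[of h]
        by (simp add: f Cmp_simps K.m_assoc)
    qed (simp_all add: f arrows_iff)
  qed
  then show thesis
    using that by (fastforce simp: sqmod_hom_def K_simps)
qed

text \<open>The homomorphism to the extension that sends [A] to (f(A), [A]) is a section, since its
  second component is the identity on objects. Its first component has deviation \<beta>.\<close>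

lemma D0_quadratic_lift:
  assumes K: "nil2_group K" and \<beta>: "central_cocycle K (D0 C) \<beta>"
    and f: "\<And>A. A \<in> Obj C \<Longrightarrow> f A \<in> carrier K" "f (Zero C) = \<one>\<^bsub>K\<^esub>"
  obtains h where "\<And>x. x \<in> carrier (D0 C) \<Longrightarrow> h x \<in> carrier K"
    and "\<And>x y. x \<in> carrier (D0 C) \<Longrightarrow> y \<in> carrier (D0 C) \<Longrightarrow>
        h (x \<otimes>\<^bsub>D0 C\<^esub> y) = h x \<otimes>\<^bsub>K\<^esub> h y \<otimes>\<^bsub>K\<^esub> \<beta> x y"
    and "\<And>A. A \<in> Obj C \<Longrightarrow> h (D_ob C A) = f A"
proof -
  interpret central_cocycle K "D0 C" \<beta> by fact
  have W: "nil2_group (twist K (D0 C) \<beta>)" by (rule twist_nil2[OF K Q.sq0_nil2])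
  obtain h where h: "h \<in> hom (D0 C) (twist K (D0 C) \<beta>)"
    "\<And>A. A \<in> Obj C \<Longrightarrow> h (D_ob C A) = (f A, D_ob C A)"
    by (rule D0_lift[OF W, of "\<lambda>A. (f A, D_ob C A)"]) (use f in auto)
  have cl: "h x \<in> carrier K \<times> carrier (D0 C)" if "x \<in> carrier (D0 C)" for x
    using h(1) that by (auto simp: hom_def Pi_iff)
  have snd_h: "snd (h x) = x" if "x \<in> carrier (D0 C)" for x
  proof (rule D0_hom_eqI[OF Q.G0.is_group _ _ _ that, of "\<lambda>x. snd (h x)" "\<lambda>x. x"])
    show "(\<lambda>x. snd (h x)) \<in> hom (D0 C) (D0 C)"
    proof (rule homI)
      fix x y assume "x \<in> carrier (D0 C)" "y \<in> carrier (D0 C)"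
      then show "snd (h (x \<otimes>\<^bsub>D0 C\<^esub> y)) = snd (h x) \<otimes>\<^bsub>D0 C\<^esub> snd (h y)"
        using hom_mult[OF h(1), of x y] by (cases "h x", cases "h y") simp
    qed (use cl in \<open>auto simp: mem_Times_iff\<close>)
  qed (auto simp: hom_def h(2))
  show thesis
  proof (rule that[of "\<lambda>x. fst (h x)"])
    fix x y assume "x \<in> carrier (D0 C)" "y \<in> carrier (D0 C)"
    then show "fst (h (x \<otimes>\<^bsub>D0 C\<^esub> y)) = fst (h x) \<otimes>\<^bsub>K\<^esub> fst (h y) \<otimes>\<^bsub>K\<^esub> \<beta> x y"
      using hom_mult[OF h(1), of x y] snd_h[of x] snd_h[of y]
      by (cases "h x", cases "h y") simp
  qed (use cl in \<open>auto simp: h(2) mem_Times_iff\<close>)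
qed


section \<open>The square groups of a Waldhausen category\<close>

text \<open>The reversed order is that of the cross effect (x|y) = {y}\<otimes>{x} of H.\<close>

lemma flip_tensor_cocycle: "central_cocycle (DE C) (D0 C) (\<lambda>x y. dt C y x)"
proof -
  interpret biadditive_map "D0 C" "D0 C" "DE C" "\<lambda>x y. dt C y x"
    by (rule biadditive_mapI[OF Q.G0.is_group Q.G0.is_group Q.T.is_group biadditive_flip[OF Q.e.biadd]])
  show ?thesis by unfold_locales (simp add: Q.T.m_comm)
qed

definition D0_H_spec where
  "D0_H_spec h \<longleftrightarrow> h \<in> extensional (carrier (D0 C)) \<and> quadratic_map (D0 C) (DE C) h \<and>
     (\<forall>A\<in>Obj C. h (D_ob C A) = \<one>\<^bsub>DE C\<^esub>) \<and>
     (\<forall>x\<in>carrier (D0 C). \<forall>y\<in>carrier (D0 C). cross (D0 C) (DE C) h x y = dt C y x)"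

lemma D0_H_spec: "D0_H_spec (D0_H C)"
proof -
  have law: "h (x \<otimes>\<^bsub>D0 C\<^esub> y) = h x \<otimes>\<^bsub>DE C\<^esub> h y \<otimes>\<^bsub>DE C\<^esub> dt C y x"
    if "D0_H_spec h" "x \<in> carrier (D0 C)" "y \<in> carrier (D0 C)" for h x y
    using quadratic_map_law[OF Q.G0.is_group Q.T.comm_group_axioms, of h x y] that
    by (simp add: D0_H_spec_def)
  have "h = h'" if "D0_H_spec h" "D0_H_spec h'" for h h'
  proof (rule extensionalityI[of _ "carrier (D0 C)"])
    fix x assume x: "x \<in> carrier (D0 C)"
    show "h x = h' x"
      by (rule D0_quadratic_eqI[OF Q.T.is_group _ _ _ _ _ _ x, where \<beta> = "\<lambda>x y. dt C y x"])
        (use that law[OF that(1)] law[OF that(2)] in \<open>auto simp: D0_H_spec_def quadratic_map_def\<close>)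
  qed (use that in \<open>auto simp: D0_H_spec_def\<close>)
  moreover have "\<exists>h. D0_H_spec h"
  proof -
    obtain h where h: "\<And>x. x \<in> carrier (D0 C) \<Longrightarrow> h x \<in> carrier (DE C)"
      "\<And>x y. x \<in> carrier (D0 C) \<Longrightarrow> y \<in> carrier (D0 C) \<Longrightarrow>
        h (x \<otimes>\<^bsub>D0 C\<^esub> y) = h x \<otimes>\<^bsub>DE C\<^esub> h y \<otimes>\<^bsub>DE C\<^esub> dt C y x"
      "\<And>A. A \<in> Obj C \<Longrightarrow> h (D_ob C A) = \<one>\<^bsub>DE C\<^esub>"
      by (rule D0_quadratic_lift[OF comm_group_nil2[OF Q.T.comm_group_axioms] flip_tensor_cocycle,
            of "\<lambda>A. \<one>\<^bsub>DE C\<^esub>"]) auto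
    let ?h = "restrict h (carrier (D0 C))"
    have "quadratic_map (D0 C) (DE C) ?h"
      "\<And>x y. x \<in> carrier (D0 C) \<Longrightarrow> y \<in> carrier (D0 C) \<Longrightarrow> cross (D0 C) (DE C) ?h x y = dt C y x"
      by (rule quadratic_mapI[OF Q.T.comm_group_axioms Q.G0.is_group];
          use h biadditive_flip[OF Q.e.biadd] in simp)+
    then have "D0_H_spec ?h" using h(3) by (simp add: D0_H_spec_def)
    then show ?thesis by (rule exI[where P = D0_H_spec])
  qed
  moreover have "D0_H C = The D0_H_spec" unfolding D0_H_def D0_H_spec_def[abs_def] ..
  ultimately show ?thesis using theI'[of D0_H_spec] by metis
qed

lemma D0_H_quadratic: "quadratic_map (D0 C) (DE C) (D0_H C)"
  and D0_H_ob [simp]: "A \<in> Obj C \<Longrightarrow> D0_H C (D_ob C A) = \<one>\<^bsub>DE C\<^esub>"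
  and D0_H_cross: "x \<in> carrier (D0 C) \<Longrightarrow> y \<in> carrier (D0 C) \<Longrightarrow>
     cross (D0 C) (DE C) (D0_H C) x y = dt C y x"
  using D0_H_spec by (auto simp: D0_H_spec_def)

lemma D0_H_closed [simp]: "x \<in> carrier (D0 C) \<Longrightarrow> D0_H C x \<in> carrier (DE C)"
  using D0_H_quadratic by (auto simp: quadratic_map_def)

lemma D0_H_mult: "x \<in> carrier (D0 C) \<Longrightarrow> y \<in> carrier (D0 C) \<Longrightarrow>
    D0_H C (x \<otimes>\<^bsub>D0 C\<^esub> y) = D0_H C x \<otimes>\<^bsub>DE C\<^esub> D0_H C y \<otimes>\<^bsub>DE C\<^esub> dt C y x"
  using quadratic_map_law[OF Q.G0.is_group Q.T.comm_group_axioms D0_H_quadratic, of x y]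
  by (simp add: D0_H_cross)

text \<open>Evaluate H on x + y = y + x + [x,y]; the cross effect with a commutator
  vanishes.\<close>

lemma D0_H_gcommutator:
  assumes [simp]: "x \<in> carrier (D0 C)" "y \<in> carrier (D0 C)"
  shows "D0_H C (gcommutator (D0 C) x y) = dt C y x \<otimes>\<^bsub>DE C\<^esub> inv\<^bsub>DE C\<^esub> dt C x y"
proof -
  let ?c = "D0_H C (gcommutator (D0 C) x y)"
  let ?l = "D0_H C x \<otimes>\<^bsub>DE C\<^esub> D0_H C y"
  have "D0_H C (x \<otimes>\<^bsub>D0 C\<^esub> y) = D0_H C (y \<otimes>\<^bsub>D0 C\<^esub> x \<otimes>\<^bsub>D0 C\<^esub> gcommutator (D0 C) x y)"
    by (subst Q.G0.gcommutator_swap) simp_all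
  then have "?l \<otimes>\<^bsub>DE C\<^esub> dt C y x = ?l \<otimes>\<^bsub>DE C\<^esub> (dt C x y \<otimes>\<^bsub>DE C\<^esub> ?c)"
    by (simp add: D0_H_mult Q.tensor_gcommutator Q.T.m_ac)
  then have "dt C y x = dt C x y \<otimes>\<^bsub>DE C\<^esub> ?c" by (subst (asm) Q.T.Units_l_cancel) simp_all
  then show ?thesis by (simp add: Q.T.m_comm[of "dt C x y" ?c] Q.T.m_assoc)
qed

end

text \<open>A common frame for both square groups of C: d is the identity for \<open>D0sg C\<close>
  and the boundary for \<open>D1sg C\<close>. As H is pulled back along d and d P =
  \<partial>\<omega>, cross effects, T and \<Delta> can be computed in degree 0, which allows one
  treatment of the products in all degrees.\<close>

locale Dsg = waldhausen_category C + square_group M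
  for C :: "('o, 'm) waldcat" and M :: "('e, ('o, 'm) Deelt) sqgroup" and d :: "'e \<Rightarrow> ('o, 'm) D0elt" +
  assumes ee [simp]: "sgee M = DE C"
    and d_hom: "d \<in> hom (sge M) (D0 C)"
    and H_eq: "x \<in> carrier (sge M) \<Longrightarrow> sgH M x = D0_H C (d x)"
    and d_P: "a \<in> carrier (DE C) \<Longrightarrow> d (sgP M a) = bd C (dw C a)"
begin

sublocale d: group_hom "sge M" "D0 C" d by unfold_locales (rule d_hom)

lemmas ee_simps [simp] = P.hom_closed[unfolded ee] P.hom_mult[unfolded ee] P.hom_one[unfolded ee]
  P.hom_inv[unfolded ee] H_closed[unfolded ee] T_closed[unfolded ee] T.hom_mult[unfolded ee]
  T.hom_inv[unfolded ee] Delta_closed[unfolded ee]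

lemma cross_eq: "x \<in> carrier (sge M) \<Longrightarrow> y \<in> carrier (sge M) \<Longrightarrow> sgcross M x y = dt C (d y) (d x)"
  by (simp add: cross_def H_eq flip: D0_H_cross)

lemma T_eq: "a \<in> carrier (DE C) \<Longrightarrow> T a = D0_H C (bd C (dw C a)) \<otimes>\<^bsub>DE C\<^esub> inv\<^bsub>DE C\<^esub> a"
  using P.hom_closed[of a] by (simp add: sgT_def H_eq d_P)

lemma T_dt: "x \<in> carrier (D0 C) \<Longrightarrow> y \<in> carrier (D0 C) \<Longrightarrow> T (dt C x y) = inv\<^bsub>DE C\<^esub> dt C y x"
  using Q.d_br[of x y]
  by (simp add: T_eq sqbr_def D0_H_gcommutator Q.T.m_ac)

lemma H_one [simp]: "sgH M \<one>\<^bsub>sge M\<^esub> = \<one>\<^bsub>DE C\<^esub>"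
  using HP_hom group_hom.hom_one[of "sgee M" "sgee M" "\<lambda>a. sgH M (sgP M a)"]
  by (simp add: group_hom_def group_hom_axioms_def)

end

text \<open>The axiom PHP = 2P on a generator: P(x\<otimes>y) is [y,x], its H is x\<otimes>y -
  y\<otimes>x, and P of each summand is again [y,x].\<close>

lemma Dsg_D0sg:
  assumes "waldhausen_category C" shows "Dsg C (D0sg C) (\<lambda>x. x)"
proof -
  interpret waldhausen_category C by fact
  have sg [simp]: "sge (D0sg C) = D0 C" "sgee (D0sg C) = DE C" "sgH (D0sg C) = D0_H C"
    "\<And>a. sgP (D0sg C) a = bd C (dw C a)" by (simp_all add: D0sg_def)
  have dh: "(\<lambda>a. bd C (dw C a)) \<in> hom (DE C) (D0 C)" by (rule homI) simp_all
  have P: "sgP (D0sg C) = (\<lambda>a. bd C (dw C a))" by (rule ext) simp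
  have "bd C (dw C (D0_H C (bd C (dw C a)))) = bd C (dw C a) \<otimes>\<^bsub>D0 C\<^esub> bd C (dw C a)"
    if "a \<in> carrier (DE C)" for a
  proof (rule ab_tensor_hom_eqI[OF Q.G0.is_group _ _ _ that])
    show "(\<lambda>a. bd C (dw C (D0_H C (bd C (dw C a))))) \<in> hom (DE C) (D0 C)"
      by (rule homI) (simp_all add: D0_H_mult Q.tensor_dw)
    show "(\<lambda>a. bd C (dw C a) \<otimes>\<^bsub>D0 C\<^esub> bd C (dw C a)) \<in> hom (DE C) (D0 C)"
    proof (rule homI)
      fix a b assume "a \<in> carrier (DE C)" "b \<in> carrier (DE C)"
      then show "bd C (dw C (a \<otimes>\<^bsub>DE C\<^esub> b)) \<otimes>\<^bsub>D0 C\<^esub> bd C (dw C (a \<otimes>\<^bsub>DE C\<^esub> b))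
          = bd C (dw C a) \<otimes>\<^bsub>D0 C\<^esub> bd C (dw C a) \<otimes>\<^bsub>D0 C\<^esub> (bd C (dw C b) \<otimes>\<^bsub>D0 C\<^esub> bd C (dw C b))"
        using Q.dw_central[of b "bd C (dw C a)"] Q.G0.m_assoc by (simp add: Q.G0.m_assoc flip: Q.G0.m_assoc[of "bd C (dw C b)"])
    qed simp
    fix x y assume "x \<in> carrier (D0 C)" "y \<in> carrier (D0 C)"
    then show "bd C (dw C (D0_H C (bd C (dw C (dt C x y))))) = bd C (dw C (dt C x y)) \<otimes>\<^bsub>D0 C\<^esub> bd C (dw C (dt C x y))"
      using Q.d_br[of x y] Q.d_br[of y x] Q.G0.inv_gcommutator[of x y]
      by (simp add: sqbr_def D0_H_gcommutator)
  qed
  then have "square_group (D0sg C)"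
    using D0_H_quadratic dh Q.G0.is_group Q.T.comm_group_axioms
    by (intro square_group.intro)
      (simp_all add: D0_H_cross Q.tensor_dw P Q.d_br[unfolded sqbr_def])
  then interpret S: square_group "D0sg C" .
  show ?thesis by unfold_locales (auto simp: hom_def)
qed

text \<open>For PHP = 2P the sign rule for commutators used in degree 0 is replaced by the symmetry
  axiom \<omega>(y\<otimes>x) = -\<omega>(x\<otimes>y).\<close>

lemma Dsg_D1sg:
  assumes "waldhausen_category C" shows "Dsg C (D1sg C) (bd C)"
proof -
  interpret waldhausen_category C by fact
  have sg [simp]: "sge (D1sg C) = D1 C" "sgee (D1sg C) = DE C" "\<And>x. sgH (D1sg C) x = D0_H C (bd C x)"
    "sgP (D1sg C) = dw C" by (simp_all add: D1sg_def)
  have cr: "cross (D1 C) (DE C) (sgH (D1sg C)) x y = dt C (bd C y) (bd C x)"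
    if "x \<in> carrier (D1 C)" "y \<in> carrier (D1 C)" for x y
    using that by (simp add: cross_def flip: D0_H_cross)
  have q: "quadratic_map (D1 C) (DE C) (sgH (D1sg C))"
    by (rule quadratic_mapI(1)[OF Q.T.comm_group_axioms Q.G1.is_group, where \<beta> = "\<lambda>x y. dt C (bd C y) (bd C x)"])
      (auto simp: D0_H_mult Q.e.add_left Q.e.add_right intro!: biadditiveI)
  have "dw C (D0_H C (bd C (dw C a))) = dw C a \<otimes>\<^bsub>D1 C\<^esub> dw C a"
    if "a \<in> carrier (DE C)" for a
  proof (rule ab_tensor_hom_eqI[OF Q.G1.is_group _ _ _ that])
    show "(\<lambda>a. dw C (D0_H C (bd C (dw C a)))) \<in> hom (DE C) (D1 C)"
      by (rule homI) (simp_all add: D0_H_mult Q.tensor_dw)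
    show "(\<lambda>a. dw C a \<otimes>\<^bsub>D1 C\<^esub> dw C a) \<in> hom (DE C) (D1 C)"
      by (rule homI) (simp_all add: Q.T.m_ac flip: Q.w.hom_mult)
    fix x y assume "x \<in> carrier (D0 C)" "y \<in> carrier (D0 C)"
    then show "dw C (D0_H C (bd C (dw C (dt C x y)))) = dw C (dt C x y) \<otimes>\<^bsub>D1 C\<^esub> dw C (dt C x y)"
      using Q.d_br[of x y] Q.br_sym[of x y] Q.G1.inv_equality[of "dw C (dt C x y)" "dw C (dt C y x)"]
      by (simp add: sqbr_def D0_H_gcommutator)
  qed
  then have "square_group (D1sg C)"
    using q Q.G1.is_group Q.T.comm_group_axioms Q.w_hom
    by (intro square_group.intro)
      (simp_all add: cr Q.tensor_dw Q.br_d[unfolded sqbr_def])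
  then interpret S: square_group "D1sg C" .
  show ?thesis by unfold_locales (auto simp: hom_def)
qed

lemma sg_id_hom:
  assumes "square_group M" shows "sg_id M \<in> sg_hom M M"
proof -
  interpret square_group M by fact
  show ?thesis using assms by (auto simp: sg_id_def sg_hom_def hom_def)
qed

lemma Dsg_bd_hom:
  assumes "waldhausen_category C" shows "Dsg_bd C \<in> sg_hom (D1sg C) (D0sg C)"
proof -
  interpret waldhausen_category C by fact
  interpret D0: Dsg C "D0sg C" "\<lambda>x. x" by (rule Dsg_D0sg) fact
  interpret D1: Dsg C "D1sg C" "bd C" by (rule Dsg_D1sg) fact
  have sg: "sge (D0sg C) = D0 C" "sge (D1sg C) = D1 C" "sgP (D1sg C) = dw C" "sgH (D0sg C) = D0_H C"
    "\<And>x. sgH (D1sg C) x = D0_H C (bd C x)" "\<And>a. sgP (D0sg C) a = bd C (dw C a)"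
    by (simp_all add: D0sg_def D1sg_def)
  show ?thesis
    using D0.square_group_axioms D1.square_group_axioms
    by (auto simp: Dsg_bd_def sg_hom_def hom_def sg)
qed


section \<open>Exact functors\<close>

lemma exact_functorD:
  assumes "exact_functor C E Go Gm"
  shows "\<And>A. A \<in> Obj C \<Longrightarrow> Go A \<in> Obj E" "\<And>f. f \<in> Arr C \<Longrightarrow> Gm f \<in> Arr E"
    "\<And>f. f \<in> Arr C \<Longrightarrow> Src E (Gm f) = Go (Src C f)" "\<And>f. f \<in> Arr C \<Longrightarrow> Tgt E (Gm f) = Go (Tgt C f)"
    "\<And>A. A \<in> Obj C \<Longrightarrow> Gm (Ide C A) = Ide E (Go A)"
    "\<And>f g. f \<in> Arr C \<Longrightarrow> g \<in> Arr C \<Longrightarrow> Tgt C f = Src C g \<Longrightarrow> Gm (g \<cdot>\<^bsub>C\<^esub> f) = Gm g \<cdot>\<^bsub>E\<^esub> Gm f"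
    "Go (Zero C) = Zero E" "\<And>f. f \<in> Cof C \<Longrightarrow> Gm f \<in> Cof E" "\<And>f. f \<in> Weq C \<Longrightarrow> Gm f \<in> Weq E"
    "\<And>f g h k. f \<in> Cof C \<Longrightarrow> is_pushout C f g h k \<Longrightarrow> is_pushout E (Gm f) (Gm g) (Gm h) (Gm k)"
  using assms by (auto simp: exact_functor_def is_functor_def arrows_def)

context waldhausen_category
begin

lemma from_Zero_unique: "f \<in> arrows C (Zero C) A \<Longrightarrow> g \<in> arrows C (Zero C) A \<Longrightarrow> f = g"
  using zero Tgt_closed[of f] by (auto simp: zero_object_def arrows_iff)

lemma to_Zero_unique: "f \<in> arrows C A (Zero C) \<Longrightarrow> g \<in> arrows C A (Zero C) \<Longrightarrow> f = g"
  using zero Src_closed[of f] by (auto simp: zero_object_def arrows_iff)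

lemma from_Zero_exists: "A \<in> Obj C \<Longrightarrow> \<exists>f. f \<in> arrows C (Zero C) A"
  and to_Zero_exists: "A \<in> Obj C \<Longrightarrow> \<exists>f. f \<in> arrows C A (Zero C)"
  using zero by (auto simp: zero_object_def)

text \<open>Exactness speaks of push-outs along cofibrations. Maps out of the zero object are
  cofibrations, so in this form coproducts are seen to be preserved as well.\<close>

lemma coproduct_iff_pushout:
  assumes "i\<^sub>1 \<in> Arr C" "i\<^sub>2 \<in> Arr C" "z\<^sub>1 \<in> arrows C (Zero C) (Src C i\<^sub>1)" "z\<^sub>2 \<in> arrows C (Zero C) (Src C i\<^sub>2)"
  shows "is_coproduct C i\<^sub>1 i\<^sub>2 \<longleftrightarrow> is_pushout C z\<^sub>1 z\<^sub>2 i\<^sub>1 i\<^sub>2"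
proof -
  have eq: "u \<cdot> z\<^sub>1 = v \<cdot> z\<^sub>2" if "u \<in> arrows C (Src C i\<^sub>1) Z" "v \<in> arrows C (Src C i\<^sub>2) Z" for u v Z
    using assms that by (intro from_Zero_unique[of _ Z]) (auto simp: arrows_iff Cmp_simps)
  show ?thesis
    using assms eq[of i\<^sub>1 "Tgt C i\<^sub>1" i\<^sub>2] eq by (auto simp: is_coproduct_def is_pushout_def arrows_iff)
qed

end

locale exact_fun = S: waldhausen_category C + R: waldhausen_category E
  for C :: "('o, 'm) waldcat" and E :: "('q, 'r) waldcat" and Go Gm +
  assumes exact: "exact_functor C E Go Gm"
begin

lemmas G = exact_functorD[OF exact]

lemma cofseq: assumes "cofseq C i p" shows "cofseq E (Gm i) (Gm p)"
proof -
  obtain t z where tz: "i \<in> Cof C" "t \<in> arrows C (Src C i) (Zero C)" "z \<in> arrows C (Zero C) (Tgt C p)"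
    "is_pushout C i t p z" using assms by (auto simp: cofseq_def)
  then show ?thesis
    unfolding cofseq_def
    by (intro conjI bexI[of _ "Gm t"] bexI[of _ "Gm z"])
      (use S.cofseq_arrows[OF assms] in \<open>auto simp: G S.arrows_iff R.arrows_iff\<close>)
qed

lemma coproduct: assumes "is_coproduct C i\<^sub>1 i\<^sub>2" shows "is_coproduct E (Gm i\<^sub>1) (Gm i\<^sub>2)"
proof -
  have ar: "i\<^sub>1 \<in> Arr C" "i\<^sub>2 \<in> Arr C" using assms by (auto simp: is_coproduct_def)
  obtain z\<^sub>1 z\<^sub>2 where z: "z\<^sub>1 \<in> arrows C (Zero C) (Src C i\<^sub>1)" "z\<^sub>2 \<in> arrows C (Zero C) (Src C i\<^sub>2)"
    using S.from_Zero_exists S.Src_closed ar by meson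
  have "is_pushout E (Gm z\<^sub>1) (Gm z\<^sub>2) (Gm i\<^sub>1) (Gm i\<^sub>2)"
    using assms S.coproduct_iff_pushout[OF ar z] S.Cof_zero[OF _ z(1)] S.Src_closed[OF ar(1)] by (intro G) auto
  then show ?thesis
    using z ar by (subst R.coproduct_iff_pushout) (auto simp: S.arrows_iff R.arrows_iff G)
qed

lemma zero_map: assumes "zero_map C f" shows "zero_map E (Gm f)"
proof -
  obtain A B u v where "A \<in> Obj C" "B \<in> Obj C" "u \<in> arrows C A (Zero C)" "v \<in> arrows C (Zero C) B" "f = v \<cdot>\<^bsub>C\<^esub> u"
    using assms by (auto simp: zero_map_def)
  then show ?thesis
    unfolding zero_map_def
    by (intro bexI[of _ "Go A"] bexI[of _ "Go B"] bexI[of _ "Gm u"] bexI[of _ "Gm v"])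
      (auto simp: S.arrows_iff R.arrows_iff G)
qed

text \<open>Each defining relation of \<open>Dmod C\<close> is carried to one of the same kind in
  \<open>Dmod E\<close>, because the functor preserves the diagrams that index the
  relations.\<close>

lemma induced_sqmod_hom:
  obtains g0 g1 where "(g0, g1) \<in> sqmod_hom (Dmod C) (Dmod E)"
    and "\<And>A. A \<in> Obj C \<Longrightarrow> g0 (D_ob C A) = D_ob E (Go A)"
    and "\<And>f. f \<in> Weq C \<Longrightarrow> g1 (D_we C f) = D_we E (Gm f)"
    and "\<And>i p. cofseq C i p \<Longrightarrow> g1 (D_cs C i p) = D_cs E (Gm i) (Gm p)"
proof -
  define f0 where "f0 A = D_ob E (Go A)" for A
  define f1 where "f1 = case_deg1_gen (\<lambda>g. D_we E (Gm g)) (\<lambda>i p. D_cs E (Gm i) (Gm p))"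
  have f1 [simp]: "f1 (WE g) = D_we E (Gm g)" "f1 (CS i p) = D_cs E (Gm i) (Gm p)" for g i p
    by (simp_all add: f1_def)
  have "\<exists>!h. h \<in> sqmod_hom (Dmod C) (Dmod E) \<and> (\<forall>a\<in>Obj C. fst h (S.K0 (Gen0 a)) = f0 a) \<and>
      (\<forall>b\<in>deg1_gens C. snd h (S.K1 (Gen1 b)) = f1 b)"
    unfolding Dmod_def[of C]
  proof (rule presented_sqmod_universal[OF R.Q.stable_quadratic_module_axioms])
    show "f0 \<in> Obj C \<rightarrow> carrier (D0 E)" by (auto simp: f0_def G)
    show "f1 \<in> deg1_gens C \<rightarrow> carrier (D1 E)" by (auto simp: deg1_gens_def G cofseq)
  next
    fix x y assume "(x, y) \<in> D_rel0 C"
    then show "qeval0 (Dmod E) f0 f1 x = qeval0 (Dmod E) f0 f1 y"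
      by cases (use S.cofseq_arrows S.Weq_Arr in \<open>auto simp: f0_def R.bd_we R.bd_cs G cofseq\<close>)
  next
    fix x y assume xy: "(x, y) \<in> D_rel1 C" "x \<in> S.T1" "y \<in> S.T1"
    from xy(1) show "qeval1 (Dmod E) f0 f1 x = qeval1 (Dmod E) f0 f1 y"
    proof cases
      case (D_we_id A) then show ?thesis by (simp add: G R.D_we_Ide)
    next
      case (D_cs_id_left A p)
      \<comment> \<open>A relation is imposed only between terms in actual generators, and this
        makes the pair a cofiber sequence. The same argument serves the other identity relation and
        the coproducts.\<close>
      then have "cofseq C (Ide C A) p" using xy by (simp add: S.gens_iff)
      then show ?thesis using D_cs_id_left cofseq[of "Ide C A" p]
        by (simp add: G R.arrows_iff S.arrows_iff R.D_cs_Ide_left)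
    next
      case (D_cs_id_right A i)
      then have "cofseq C i (Ide C A)" using xy by (simp add: S.gens_iff)
      then show ?thesis using D_cs_id_right cofseq[of i "Ide C A"]
        by (simp add: G R.arrows_iff S.arrows_iff R.D_cs_Ide_right)
    next
      case (D_we_comp f g)
      then show ?thesis using S.Weq_Arr[of f] S.Weq_Arr[of g] by (simp add: G R.D_we_Cmp)
    next
      case (D_we_cs i p i' p' a b c)
      note ar = S.cofseq_arrows[OF D_we_cs(3)] S.cofseq_arrows[OF D_we_cs(4)] S.Weq_Arr[OF D_we_cs(5)]
        S.Weq_Arr[OF D_we_cs(6)] S.Weq_Arr[OF D_we_cs(7)]
      have "Gm b \<cdot>\<^bsub>E\<^esub> Gm i = Gm i' \<cdot>\<^bsub>E\<^esub> Gm a" "Gm c \<cdot>\<^bsub>E\<^esub> Gm p = Gm p' \<cdot>\<^bsub>E\<^esub> Gm b"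
        using D_we_cs ar by (simp_all add: S.arrows_iff flip: G(6))
      then show ?thesis
        using R.D_we_cs_rel[OF cofseq[OF D_we_cs(3)] cofseq[OF D_we_cs(4)], of "Gm a" "Gm b" "Gm c"]
          D_we_cs ar by (simp add: G R.arrows_iff S.arrows_iff f0_def)
    next
      case (D_cs_cs i j p q r k s)
      note ar = S.cofseq_arrows[OF D_cs_cs(4)] S.cofseq_arrows[OF D_cs_cs(5)]
        S.cofseq_arrows[OF D_cs_cs(6)] S.cofseq_arrows[OF D_cs_cs(7)]
      have "Gm k \<cdot>\<^bsub>E\<^esub> Gm p = Gm q \<cdot>\<^bsub>E\<^esub> Gm j" "Gm s \<cdot>\<^bsub>E\<^esub> Gm q = Gm r"
        "Gm (j \<cdot>\<^bsub>C\<^esub> i) = Gm j \<cdot>\<^bsub>E\<^esub> Gm i"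
        using D_cs_cs ar by (simp_all add: S.arrows_iff S.Cmp_simps flip: G(6))
      then show ?thesis
        using R.D_cs_cs_rel[of "Gm i" "Gm j" "Gm p" "Gm q" "Gm r" "Gm k" "Gm s"]
          D_cs_cs ar cofseq[OF D_cs_cs(4)] cofseq[OF D_cs_cs(5)] cofseq[OF D_cs_cs(6)] cofseq[OF D_cs_cs(7)]
        by (simp add: G R.arrows_iff S.arrows_iff f0_def)
    next
      case (D_coprod i1 i2 A B p1 p2)
      then have cof: "cofseq C i2 p1" "cofseq C i1 p2" using xy by (simp_all add: S.gens_iff)
      note ar = S.cofseq_arrows[OF cof(1)] S.cofseq_arrows[OF cof(2)]
      have t: "Tgt C i1 = Tgt C i2" using D_coprod(3) by (simp add: is_coproduct_def)
      have "Gm p1 \<cdot>\<^bsub>E\<^esub> Gm i1 = Ide E (Go A)" "Gm p2 \<cdot>\<^bsub>E\<^esub> Gm i2 = Ide E (Go B)"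
        "zero_map E (Gm p1 \<cdot>\<^bsub>E\<^esub> Gm i2)" "zero_map E (Gm p2 \<cdot>\<^bsub>E\<^esub> Gm i1)"
        using D_coprod ar t zero_map by (auto simp: G(5) simp flip: G(6))
      then show ?thesis
        using R.D_coprod_rel[of "Gm i1" "Gm i2" "Go A" "Go B" "Gm p1" "Gm p2"] D_coprod ar
          cofseq[OF cof(1)] cofseq[OF cof(2)] coproduct[OF D_coprod(3)]
        by (simp add: G R.arrows_iff S.arrows_iff f0_def)
    qed
  qed
  then obtain h where h: "h \<in> sqmod_hom (Dmod C) (Dmod E)"
    "\<forall>a\<in>Obj C. fst h (S.K0 (Gen0 a)) = f0 a" "\<forall>b\<in>deg1_gens C. snd h (S.K1 (Gen1 b)) = f1 b" by blast
  show thesis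
    by (rule that[of "fst h" "snd h"])
      (use h S.gens_iff in \<open>auto simp: f0_def simp flip: S.K_simps(1-3)\<close>)
qed

end

context exact_fun
begin

definition induced where
  "induced = (SOME h. h \<in> sqmod_hom (Dmod C) (Dmod E) \<and>
     (\<forall>A\<in>Obj C. fst h (D_ob C A) = D_ob E (Go A)) \<and>
     (\<forall>f\<in>Weq C. snd h (D_we C f) = D_we E (Gm f)) \<and>
     (\<forall>i p. cofseq C i p \<longrightarrow> snd h (D_cs C i p) = D_cs E (Gm i) (Gm p)))"

definition "ind0 = fst induced"
definition "ind1 = snd induced"

lemma induced_props:
  shows ind0_hom: "ind0 \<in> hom (D0 C) (D0 E)"
    and ind1_hom: "ind1 \<in> hom (D1 C) (D1 E)"
    and ind_bd: "c \<in> carrier (D1 C) \<Longrightarrow> bd E (ind1 c) = ind0 (bd C c)"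
    and ind_br: "x \<in> carrier (D0 C) \<Longrightarrow> y \<in> carrier (D0 C) \<Longrightarrow>
      ind1 (dw C (dt C x y)) = dw E (dt E (ind0 x) (ind0 y))"
    and ind_ob: "A \<in> Obj C \<Longrightarrow> ind0 (D_ob C A) = D_ob E (Go A)"
    and ind_we: "f \<in> Weq C \<Longrightarrow> ind1 (D_we C f) = D_we E (Gm f)"
    and ind_cs: "cofseq C i p \<Longrightarrow> ind1 (D_cs C i p) = D_cs E (Gm i) (Gm p)"
proof -
  have "\<exists>h. h \<in> sqmod_hom (Dmod C) (Dmod E) \<and>
     (\<forall>A\<in>Obj C. fst h (D_ob C A) = D_ob E (Go A)) \<and>
     (\<forall>f\<in>Weq C. snd h (D_we C f) = D_we E (Gm f)) \<and>
     (\<forall>i p. cofseq C i p \<longrightarrow> snd h (D_cs C i p) = D_cs E (Gm i) (Gm p))"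
  proof (rule induced_sqmod_hom)
    fix g0 g1
    assume "(g0, g1) \<in> sqmod_hom (Dmod C) (Dmod E)"
      and "\<And>A. A \<in> Obj C \<Longrightarrow> g0 (D_ob C A) = D_ob E (Go A)"
      and "\<And>f. f \<in> Weq C \<Longrightarrow> g1 (D_we C f) = D_we E (Gm f)"
      and "\<And>i p. cofseq C i p \<Longrightarrow> g1 (D_cs C i p) = D_cs E (Gm i) (Gm p)"
    then show ?thesis by (intro exI[of _ "(g0, g1)"]) simp
  qed
  note props = someI_ex[OF this, folded induced_def]
  then have "induced \<in> sqmod_hom (Dmod C) (Dmod E)" by blast
  then show "ind0 \<in> hom (D0 C) (D0 E)" "ind1 \<in> hom (D1 C) (D1 E)"
    "c \<in> carrier (D1 C) \<Longrightarrow> bd E (ind1 c) = ind0 (bd C c)"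
    "x \<in> carrier (D0 C) \<Longrightarrow> y \<in> carrier (D0 C) \<Longrightarrow>
      ind1 (dw C (dt C x y)) = dw E (dt E (ind0 x) (ind0 y))"
    by (auto simp: ind0_def ind1_def sqmod_hom_def case_prod_beta sqbr_def)
  show "A \<in> Obj C \<Longrightarrow> ind0 (D_ob C A) = D_ob E (Go A)"
    "f \<in> Weq C \<Longrightarrow> ind1 (D_we C f) = D_we E (Gm f)"
    "cofseq C i p \<Longrightarrow> ind1 (D_cs C i p) = D_cs E (Gm i) (Gm p)"
    using props by (auto simp: ind0_def ind1_def)
qed

sublocale i0: group_hom "D0 C" "D0 E" ind0 by unfold_locales (rule ind0_hom)
sublocale i1: group_hom "D1 C" "D1 E" ind1 by unfold_locales (rule ind1_hom)

text \<open>Lifting from objects requires the value 0 at the zero object. For families of functors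
  such as A \<and> - this is the triviality of the functor at A = \<open>Zero C\<close>, in both
  degrees.\<close>

lemma induced_trivial:
  assumes triv: "\<And>A. A \<in> Obj C \<Longrightarrow> Go A = Zero E"
  shows "x \<in> carrier (D0 C) \<Longrightarrow> ind0 x = \<one>\<^bsub>D0 E\<^esub>"
    and "c \<in> carrier (D1 C) \<Longrightarrow> ind1 c = \<one>\<^bsub>D1 E\<^esub>"
proof -
  have 0: "ind0 x = \<one>\<^bsub>D0 E\<^esub>" if "x \<in> carrier (D0 C)" for x
    using that by (induction rule: S.D0_induct) (simp_all add: ind_ob triv)
  \<comment> \<open>Every map is sent to an endomorphism of the zero object, and there is only
    one.\<close>
  have m: "Gm f = Ide E (Zero E)" if "f \<in> Arr C" for f
    by (rule R.to_Zero_unique[of _ "Zero E"])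
      (use that in \<open>simp_all add: R.arrows_iff G triv S.Src_closed S.Tgt_closed\<close>)
  show "x \<in> carrier (D0 C) \<Longrightarrow> ind0 x = \<one>\<^bsub>D0 E\<^esub>" by (rule 0)
  assume "c \<in> carrier (D1 C)"
  then show "ind1 c = \<one>\<^bsub>D1 E\<^esub>"
  proof (induction rule: S.D1_induct)
    case (we f) then show ?case by (simp add: ind_we m S.Weq_Arr R.D_we_Ide)
  next
    case (cs i p)
    then show ?case using cofseq[OF cs] S.cofseq_arrows[OF cs]
      by (simp add: ind_cs m R.D_cs_Ide_left R.arrows_iff)
  next
    case (w a)
    then show ?case by (induction rule: ab_tensor_induct) (simp_all add: ind_br 0)
  qed simp_all
qed

end

context waldhausen_category
begin

interpretation S0: Dsg C "D0sg C" "\<lambda>x. x" by (rule Dsg_D0sg) unfold_locales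

text \<open>\<open>T\<close> and \<open>\<Delta>\<close> are the same for both square groups of \<open>C\<close>.\<close>

definition "TT a = D0_H C (bd C (dw C a)) \<otimes>\<^bsub>DE C\<^esub> inv\<^bsub>DE C\<^esub> a"
definition "DD x = dt C x x \<otimes>\<^bsub>DE C\<^esub> inv\<^bsub>DE C\<^esub> D0_H C x \<otimes>\<^bsub>DE C\<^esub> TT (D0_H C x)"

lemma sge_D0sg [simp]: "sge (D0sg C) = D0 C" "sgP (D0sg C) a = bd C (dw C a)" "sgH (D0sg C) = D0_H C"
  by (simp_all add: D0sg_def)

lemma sge_D1sg [simp]: "sge (D1sg C) = D1 C" "sgP (D1sg C) = dw C" "sgH (D1sg C) x = D0_H C (bd C x)"
  by (simp_all add: D1sg_def)

lemma TT_closed [simp]: "a \<in> carrier (DE C) \<Longrightarrow> TT a \<in> carrier (DE C)"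
  by (simp add: TT_def)

lemma TT_hom: "TT \<in> hom (DE C) (DE C)"
  by (rule homI) (simp_all add: TT_def D0_H_mult Q.tensor_dw Q.T.inv_mult Q.T.m_ac)

sublocale TT: group_hom "DE C" "DE C" TT by unfold_locales (rule TT_hom)

lemma TT_dt: "x \<in> carrier (D0 C) \<Longrightarrow> y \<in> carrier (D0 C) \<Longrightarrow> TT (dt C x y) = inv\<^bsub>DE C\<^esub> dt C y x"
  using S0.T_dt[of x y] by (simp add: S0.T_eq TT_def)

lemma D0_H_bd_w: "a \<in> carrier (DE C) \<Longrightarrow> D0_H C (bd C (dw C a)) = a \<otimes>\<^bsub>DE C\<^esub> TT a"
  by (simp add: TT_def Q.T.m_comm[of "D0_H C (bd C (dw C a))"])

lemma DD_eq: "x \<in> carrier (D0 C) \<Longrightarrow> DD x = sgDelta (D0sg C) x"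
  by (simp add: DD_def sgDelta_def S0.cross_eq D0_H_cross S0.T_eq TT_def)

lemma DD_closed [simp]: "x \<in> carrier (D0 C) \<Longrightarrow> DD x \<in> carrier (DE C)"
  by (simp add: DD_def)

lemma DD_mult: "x \<in> carrier (D0 C) \<Longrightarrow> y \<in> carrier (D0 C) \<Longrightarrow>
    DD (x \<otimes>\<^bsub>D0 C\<^esub> y) = DD x \<otimes>\<^bsub>DE C\<^esub> DD y"
  using hom_mult[OF S0.Delta_hom, of x y] by (simp add: DD_eq)

lemma DD_ob: "A \<in> Obj C \<Longrightarrow> DD (D_ob C A) = dt C (D_ob C A) (D_ob C A)"
  by (simp add: DD_def)

end

context Dsg
begin

lemma T_TT: "a \<in> carrier (DE C) \<Longrightarrow> T a = TT a"
  by (simp add: T_eq TT_def)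

lemma Delta_DD: "x \<in> carrier (sge M) \<Longrightarrow> \<Delta> x = DD (d x)"
  by (simp add: DD_def sgDelta_def cross_eq[unfolded ee] T_TT H_eq)

lemma P_TT: "a \<in> carrier (DE C) \<Longrightarrow> sgP M (TT a) = sgP M a"
  using P_T[of a] by (simp add: T_TT)

lemma swap_dt: "x \<in> carrier (sge M) \<Longrightarrow> y \<in> carrier (sge M) \<Longrightarrow>
    x \<otimes>\<^bsub>sge M\<^esub> y = y \<otimes>\<^bsub>sge M\<^esub> x \<otimes>\<^bsub>sge M\<^esub> sgP M (dt C (d y) (d x))"
  using swap[of x y] by (simp only: cross_eq)

lemma gcommutator_dt: "x \<in> carrier (sge M) \<Longrightarrow> y \<in> carrier (sge M) \<Longrightarrow>
    gcommutator (sge M) x y = sgP M (dt C (d y) (d x))"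
  using P_cross[of x y] by (simp only: cross_eq)

text \<open>Interchanging the two middle terms a' and b costs their commutator, which is P of a
  tensor. When sums of corrected values are regrouped, this term has to match a cross effect of
  H.\<close>

lemma shuffle:
  assumes [simp]: "a \<in> carrier (sge M)" "a' \<in> carrier (sge M)" "b \<in> carrier (sge M)" "b' \<in> carrier (sge M)"
    "p \<in> carrier (DE C)" "q \<in> carrier (DE C)"
  shows "(a \<otimes>\<^bsub>sge M\<^esub> a' \<otimes>\<^bsub>sge M\<^esub> sgP M p) \<otimes>\<^bsub>sge M\<^esub> (b \<otimes>\<^bsub>sge M\<^esub> b' \<otimes>\<^bsub>sge M\<^esub> sgP M q)
    = (a \<otimes>\<^bsub>sge M\<^esub> b) \<otimes>\<^bsub>sge M\<^esub> (a' \<otimes>\<^bsub>sge M\<^esub> b') \<otimes>\<^bsub>sge M\<^esub> sgP M (p \<otimes>\<^bsub>DE C\<^esub> q \<otimes>\<^bsub>DE C\<^esub> dt C (d b) (d a'))"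
proof -
  let ?k = "dt C (d b) (d a')"
  have "(a \<otimes>\<^bsub>sge M\<^esub> a' \<otimes>\<^bsub>sge M\<^esub> sgP M p) \<otimes>\<^bsub>sge M\<^esub> (b \<otimes>\<^bsub>sge M\<^esub> b' \<otimes>\<^bsub>sge M\<^esub> sgP M q)
      = a \<otimes>\<^bsub>sge M\<^esub> a' \<otimes>\<^bsub>sge M\<^esub> (sgP M p \<otimes>\<^bsub>sge M\<^esub> (b \<otimes>\<^bsub>sge M\<^esub> b')) \<otimes>\<^bsub>sge M\<^esub> sgP M q"
    by (simp add: G.m_assoc)
  also have "sgP M p \<otimes>\<^bsub>sge M\<^esub> (b \<otimes>\<^bsub>sge M\<^esub> b') = b \<otimes>\<^bsub>sge M\<^esub> b' \<otimes>\<^bsub>sge M\<^esub> sgP M p"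
    by (simp add: P_central)
  also have "a \<otimes>\<^bsub>sge M\<^esub> a' \<otimes>\<^bsub>sge M\<^esub> (b \<otimes>\<^bsub>sge M\<^esub> b' \<otimes>\<^bsub>sge M\<^esub> sgP M p) \<otimes>\<^bsub>sge M\<^esub> sgP M q
      = a \<otimes>\<^bsub>sge M\<^esub> (a' \<otimes>\<^bsub>sge M\<^esub> b) \<otimes>\<^bsub>sge M\<^esub> b' \<otimes>\<^bsub>sge M\<^esub> sgP M (p \<otimes>\<^bsub>DE C\<^esub> q)"
    by (simp add: G.m_assoc)
  also have "a' \<otimes>\<^bsub>sge M\<^esub> b = b \<otimes>\<^bsub>sge M\<^esub> a' \<otimes>\<^bsub>sge M\<^esub> sgP M ?k" by (rule swap_dt) simp_all
  also have "a \<otimes>\<^bsub>sge M\<^esub> (b \<otimes>\<^bsub>sge M\<^esub> a' \<otimes>\<^bsub>sge M\<^esub> sgP M ?k) \<otimes>\<^bsub>sge M\<^esub> b' \<otimes>\<^bsub>sge M\<^esub> sgP M (p \<otimes>\<^bsub>DE C\<^esub> q)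
      = a \<otimes>\<^bsub>sge M\<^esub> b \<otimes>\<^bsub>sge M\<^esub> a' \<otimes>\<^bsub>sge M\<^esub> (sgP M ?k \<otimes>\<^bsub>sge M\<^esub> b') \<otimes>\<^bsub>sge M\<^esub> sgP M (p \<otimes>\<^bsub>DE C\<^esub> q)"
    by (simp add: G.m_assoc)
  also have "sgP M ?k \<otimes>\<^bsub>sge M\<^esub> b' = b' \<otimes>\<^bsub>sge M\<^esub> sgP M ?k" by (simp add: P_central)
  also have "a \<otimes>\<^bsub>sge M\<^esub> b \<otimes>\<^bsub>sge M\<^esub> a' \<otimes>\<^bsub>sge M\<^esub> (b' \<otimes>\<^bsub>sge M\<^esub> sgP M ?k) \<otimes>\<^bsub>sge M\<^esub> sgP M (p \<otimes>\<^bsub>DE C\<^esub> q)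
      = (a \<otimes>\<^bsub>sge M\<^esub> b) \<otimes>\<^bsub>sge M\<^esub> (a' \<otimes>\<^bsub>sge M\<^esub> b') \<otimes>\<^bsub>sge M\<^esub> sgP M (?k \<otimes>\<^bsub>DE C\<^esub> (p \<otimes>\<^bsub>DE C\<^esub> q))"
    by (simp add: G.m_assoc)
  finally show ?thesis by (simp only: Q.T.m_comm[of ?k] Q.T.m_closed assms Q.e.closed d.hom_closed)
qed

end


section \<open>The pairing of a biexact functor\<close>

locale biexact = WC: waldhausen_category C + WD: waldhausen_category D + WE: waldhausen_category E
  for C :: "('o, 'm) waldcat" and D :: "('p, 'n) waldcat" and E :: "('q, 'r) waldcat" +
  fixes Fo :: "'o \<times> 'p \<Rightarrow> 'q" and Fm :: "'m \<times> 'n \<Rightarrow> 'r"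
  assumes biexact: "biexact_functor C D E Fo Fm"
begin

lemma exact_left: "A \<in> Obj C \<Longrightarrow> exact_fun D E (\<lambda>B. Fo (A, B)) (\<lambda>g. Fm (Ide C A, g))"
  using biexact WD.waldhausen_category_axioms WE.waldhausen_category_axioms
  by (auto simp: exact_fun_def exact_fun_axioms_def biexact_functor_def)

lemma exact_right: "B \<in> Obj D \<Longrightarrow> exact_fun C E (\<lambda>A. Fo (A, B)) (\<lambda>f. Fm (f, Ide D B))"
  using biexact WC.waldhausen_category_axioms WE.waldhausen_category_axioms
  by (auto simp: exact_fun_def exact_fun_axioms_def biexact_functor_def)

abbreviation "L0 A \<equiv> exact_fun.ind0 D E (\<lambda>B. Fo (A, B)) (\<lambda>g. Fm (Ide C A, g))"
abbreviation "L1 A \<equiv> exact_fun.ind1 D E (\<lambda>B. Fo (A, B)) (\<lambda>g. Fm (Ide C A, g))"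
abbreviation "R0 B \<equiv> exact_fun.ind0 C E (\<lambda>A. Fo (A, B)) (\<lambda>f. Fm (f, Ide D B))"
abbreviation "R1 B \<equiv> exact_fun.ind1 C E (\<lambda>A. Fo (A, B)) (\<lambda>f. Fm (f, Ide D B))"

lemma Fo_closed [simp]: "A \<in> Obj C \<Longrightarrow> B \<in> Obj D \<Longrightarrow> Fo (A, B) \<in> Obj E"
  using exact_fun.G(1)[OF exact_left] .

lemma Fo_Zero: "A \<in> Obj C \<Longrightarrow> Fo (A, Zero D) = Zero E" "B \<in> Obj D \<Longrightarrow> Fo (Zero C, B) = Zero E"
  using exact_fun.G(7)[OF exact_left] exact_fun.G(7)[OF exact_right] by auto

lemma L_hom: "A \<in> Obj C \<Longrightarrow> L0 A \<in> hom (D0 D) (D0 E)" "A \<in> Obj C \<Longrightarrow> L1 A \<in> hom (D1 D) (D1 E)"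
  by (rule exact_fun.induced_props[OF exact_left]; assumption)+

lemma L_Zero:
  "y \<in> carrier (D0 D) \<Longrightarrow> L0 (Zero C) y = \<one>\<^bsub>D0 E\<^esub>" "c \<in> carrier (D1 D) \<Longrightarrow> L1 (Zero C) c = \<one>\<^bsub>D1 E\<^esub>"
  by (rule exact_fun.induced_trivial[OF exact_left]; simp add: Fo_Zero)+

lemma R_Zero: "c \<in> carrier (D1 C) \<Longrightarrow> R1 (Zero D) c = \<one>\<^bsub>D1 E\<^esub>"
  by (rule exact_fun.induced_trivial[OF exact_right]; simp add: Fo_Zero)

text \<open>\<open>D0 C\<close> being free, a family of values on objects extends additively in the first variable.\<close>

definition ext_left where
  "ext_left K g x = (SOME h. h \<in> hom (D0 C) K \<and> (\<forall>A\<in>Obj C. h (D_ob C A) = g A)) x"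

lemma ext_left:
  assumes "nil2_group K" "\<And>A. A \<in> Obj C \<Longrightarrow> g A \<in> carrier K" "g (Zero C) = \<one>\<^bsub>K\<^esub>"
  shows "ext_left K g \<in> hom (D0 C) K" "A \<in> Obj C \<Longrightarrow> ext_left K g (D_ob C A) = g A"
proof -
  have "\<exists>h. h \<in> hom (D0 C) K \<and> (\<forall>A\<in>Obj C. h (D_ob C A) = g A)"
    by (rule WC.D0_lift[of K g, OF assms]) blast+
  from someI_ex[OF this] show "ext_left K g \<in> hom (D0 C) K"
    "A \<in> Obj C \<Longrightarrow> ext_left K g (D_ob C A) = g A"
    unfolding ext_left_def[abs_def] by auto
qed

text \<open>For an object A the map in y is the one induced by A \<and> -; the family is extended
  over x afterwards. Prescribing values on generators of the second variable would not work for
  \<open>F1\<close>, where that variable ranges over a group that is not free.\<close>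

definition "F0 x y = ext_left (D0 E) (\<lambda>A. L0 A y) x"
definition "F1 x c = ext_left (D1 E) (\<lambda>A. L1 A c) x"

lemma F0_hom: "y \<in> carrier (D0 D) \<Longrightarrow> (\<lambda>x. F0 x y) \<in> hom (D0 C) (D0 E)"
  and F0_ob: "A \<in> Obj C \<Longrightarrow> y \<in> carrier (D0 D) \<Longrightarrow> F0 (D_ob C A) y = L0 A y"
proof -
  have "L0 A y \<in> carrier (D0 E)" if "A \<in> Obj C" "y \<in> carrier (D0 D)" for A
    using L_hom(1)[OF that(1)] that(2) by (auto simp: hom_def)
  note ext = ext_left[OF WE.Q.sq0_nil2, of "\<lambda>A. L0 A y", OF this L_Zero(1)]
  show "y \<in> carrier (D0 D) \<Longrightarrow> (\<lambda>x. F0 x y) \<in> hom (D0 C) (D0 E)"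
    unfolding F0_def using ext(1) by simp
  show "A \<in> Obj C \<Longrightarrow> y \<in> carrier (D0 D) \<Longrightarrow> F0 (D_ob C A) y = L0 A y"
    unfolding F0_def using ext(2) by simp
qed

lemma F1_hom: "c \<in> carrier (D1 D) \<Longrightarrow> (\<lambda>x. F1 x c) \<in> hom (D0 C) (D1 E)"
  and F1_ob: "A \<in> Obj C \<Longrightarrow> c \<in> carrier (D1 D) \<Longrightarrow> F1 (D_ob C A) c = L1 A c"
proof -
  have "L1 A c \<in> carrier (D1 E)" if "A \<in> Obj C" "c \<in> carrier (D1 D)" for A
    using L_hom(2)[OF that(1)] that(2) by (auto simp: hom_def)
  note ext = ext_left[OF WE.Q.sq1_nil2, of "\<lambda>A. L1 A c", OF this L_Zero(2)]
  show "c \<in> carrier (D1 D) \<Longrightarrow> (\<lambda>x. F1 x c) \<in> hom (D0 C) (D1 E)"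
    unfolding F1_def using ext(1) by simp
  show "A \<in> Obj C \<Longrightarrow> c \<in> carrier (D1 D) \<Longrightarrow> F1 (D_ob C A) c = L1 A c"
    unfolding F1_def using ext(2) by simp
qed

lemma F0_closed [simp]: "x \<in> carrier (D0 C) \<Longrightarrow> y \<in> carrier (D0 D) \<Longrightarrow> F0 x y \<in> carrier (D0 E)"
  using F0_hom[of y] by (auto simp: hom_def)

lemma F0_mult: "x \<in> carrier (D0 C) \<Longrightarrow> x' \<in> carrier (D0 C) \<Longrightarrow> y \<in> carrier (D0 D) \<Longrightarrow>
    F0 (x \<otimes>\<^bsub>D0 C\<^esub> x') y = F0 x y \<otimes>\<^bsub>D0 E\<^esub> F0 x' y"
  using F0_hom[of y] by (auto simp: hom_def)

lemma F1_closed [simp]: "x \<in> carrier (D0 C) \<Longrightarrow> y \<in> carrier (D1 D) \<Longrightarrow> F1 x y \<in> carrier (D1 E)"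
  using F1_hom[of y] by (auto simp: hom_def)

lemma F0_ob_ob: "A \<in> Obj C \<Longrightarrow> B \<in> Obj D \<Longrightarrow> F0 (D_ob C A) (D_ob D B) = D_ob E (Fo (A, B))"
  by (simp add: F0_ob exact_fun.ind_ob[OF exact_left])

text \<open>Both functors give the same value on a pair of objects, and both sides are additive in
  x.\<close>

lemma F0_right_ob: "x \<in> carrier (D0 C) \<Longrightarrow> B \<in> Obj D \<Longrightarrow> F0 x (D_ob D B) = R0 B x"
  by (rule WC.D0_hom_eqI[OF WE.Q.G0.is_group F0_hom exact_fun.ind0_hom[OF exact_right]])
    (simp_all add: F0_ob_ob exact_fun.ind_ob[OF exact_right])

text \<open>This precedes the quadratic law for \<open>F0\<close>, which is stated through
  \<open>phi\<close>, and \<open>phi\<close> requires this biadditivity. Both sides are additive in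
  x, and on an object A the map in y is a homomorphism.\<close>

lemma dt_F0_right:
  assumes "x \<in> carrier (D0 C)" "y \<in> carrier (D0 D)" "y' \<in> carrier (D0 D)" "z \<in> carrier (D0 E)"
  shows "dt E (F0 x (y \<otimes>\<^bsub>D0 D\<^esub> y')) z = dt E (F0 x y) z \<otimes>\<^bsub>DE E\<^esub> dt E (F0 x y') z"
    and "dt E z (F0 x (y \<otimes>\<^bsub>D0 D\<^esub> y')) = dt E z (F0 x y) \<otimes>\<^bsub>DE E\<^esub> dt E z (F0 x y')"
proof -
  have L: "L0 A (y \<otimes>\<^bsub>D0 D\<^esub> y') = L0 A y \<otimes>\<^bsub>D0 E\<^esub> L0 A y'" "L0 A y \<in> carrier (D0 E)"
    "L0 A y' \<in> carrier (D0 E)" if "A \<in> Obj C" for A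
    using L_hom(1)[OF that] assms by (auto simp: hom_def)
  show "dt E (F0 x (y \<otimes>\<^bsub>D0 D\<^esub> y')) z = dt E (F0 x y) z \<otimes>\<^bsub>DE E\<^esub> dt E (F0 x y') z"
    by (rule WC.D0_hom_eqI[OF WE.Q.T.is_group _ _ _ assms(1), of "\<lambda>x. dt E (F0 x (y \<otimes>\<^bsub>D0 D\<^esub> y')) z"
          "\<lambda>x. dt E (F0 x y) z \<otimes>\<^bsub>DE E\<^esub> dt E (F0 x y') z"])
      (use assms in \<open>auto simp: F0_ob L WE.Q.e.add_left F0_mult WE.Q.T.m_ac intro!: homI\<close>)
  show "dt E z (F0 x (y \<otimes>\<^bsub>D0 D\<^esub> y')) = dt E z (F0 x y) \<otimes>\<^bsub>DE E\<^esub> dt E z (F0 x y')"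
    by (rule WC.D0_hom_eqI[OF WE.Q.T.is_group _ _ _ assms(1), of "\<lambda>x. dt E z (F0 x (y \<otimes>\<^bsub>D0 D\<^esub> y'))"
          "\<lambda>x. dt E z (F0 x y) \<otimes>\<^bsub>DE E\<^esub> dt E z (F0 x y')"])
      (use assms in \<open>auto simp: F0_ob L WE.Q.e.add_right F0_mult WE.Q.T.m_ac intro!: homI\<close>)
qed

section \<open>The common \<open>ee\<close>-part of the product morphisms\<close>

text \<open>The formula is required for all elements and not just for classes of objects because it
  will be evaluated on boundaries.\<close>

definition phi where
  "phi = (SOME \<phi>. \<phi> \<in> hom (tensor_group (DE C) (DE D)) (DE E) \<and>
     \<phi> \<in> extensional (carrier (tensor_group (DE C) (DE D))) \<and>
     (\<forall>x\<in>carrier (D0 C). \<forall>x'\<in>carrier (D0 C). \<forall>y\<in>carrier (D0 D). \<forall>y'\<in>carrier (D0 D).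
        \<phi> (tensor_elt (DE C) (DE D) (dt C x x') (dt D y y')) = dt E (F0 x y) (F0 x' y')))"

definition "ph a b = phi (tensor_elt (DE C) (DE D) a b)"

lemma phi_hom: "phi \<in> hom (tensor_group (DE C) (DE D)) (DE E)"
  and phi_ext: "phi \<in> extensional (carrier (tensor_group (DE C) (DE D)))"
  and ph_dt: "x \<in> carrier (D0 C) \<Longrightarrow> x' \<in> carrier (D0 C) \<Longrightarrow> y \<in> carrier (D0 D) \<Longrightarrow> y' \<in> carrier (D0 D) \<Longrightarrow>
     ph (dt C x x') (dt D y y') = dt E (F0 x y) (F0 x' y')"
proof -
  have "\<exists>\<phi>. \<phi> \<in> hom (tensor_group (DE C) (DE D)) (DE E) \<and>
     \<phi> \<in> extensional (carrier (tensor_group (DE C) (DE D))) \<and>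
     (\<forall>x\<in>carrier (D0 C). \<forall>x'\<in>carrier (D0 C). \<forall>y\<in>carrier (D0 D). \<forall>y'\<in>carrier (D0 D).
        \<phi> (tensor_elt (DE C) (DE D) (dt C x x') (dt D y y')) = dt E (F0 x y) (F0 x' y'))"
  proof (rule ab_tensor_tensor_hom_exists[OF WC.Q.G0.is_group WD.Q.G0.is_group
        WE.Q.T.comm_group_axioms, of "\<lambda>x x' y y'. dt E (F0 x y) (F0 x' y')"])
    fix y y' assume "y \<in> carrier (D0 D)" "y' \<in> carrier (D0 D)"
    then show "biadditive (D0 C) (D0 C) (DE E) (\<lambda>x x'. dt E (F0 x y) (F0 x' y'))"
      by (intro biadditiveI) (simp_all add: F0_mult WE.Q.e.add_left WE.Q.e.add_right)
  next
    fix x x' assume "x \<in> carrier (D0 C)" "x' \<in> carrier (D0 C)"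
    then show "biadditive (D0 D) (D0 D) (DE E) (\<lambda>y y'. dt E (F0 x y) (F0 x' y'))"
      by (intro biadditiveI) (simp_all add: dt_F0_right)
  qed blast
  from someI_ex[OF this, folded phi_def]
  show "phi \<in> hom (tensor_group (DE C) (DE D)) (DE E)"
    "phi \<in> extensional (carrier (tensor_group (DE C) (DE D)))"
    "x \<in> carrier (D0 C) \<Longrightarrow> x' \<in> carrier (D0 C) \<Longrightarrow> y \<in> carrier (D0 D) \<Longrightarrow> y' \<in> carrier (D0 D) \<Longrightarrow>
     ph (dt C x x') (dt D y y') = dt E (F0 x y) (F0 x' y')"
    by (auto simp: ph_def)
qed

sublocale ph: biadditive_map "DE C" "DE D" "DE E" ph
proof -
  have t: "biadditive (DE C) (DE D) (tensor_group (DE C) (DE D)) (tensor_elt (DE C) (DE D))"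
    by (rule tensor_biadditive[OF WC.Q.T.is_monoid WD.Q.T.is_monoid])
  have "biadditive (DE C) (DE D) (DE E) (\<lambda>a b. phi (tensor_elt (DE C) (DE D) (id a) (id b)))"
    by (rule biadditive_compose[OF t phi_hom]) (auto simp: hom_def)
  then show "biadditive_map (DE C) (DE D) (DE E) ph"
    by (intro biadditive_mapI WC.Q.T.is_group WD.Q.T.is_group WE.Q.T.is_group) (simp add: ph_def[abs_def])
qed

text \<open>On generators T negates and reverses a tensor. Reversing both factors reverses the
  product and their two signs cancel, so one sign is left over against T of the product.\<close>

lemma ph_TT:
  assumes a: "a \<in> carrier (DE C)" and b: "b \<in> carrier (DE D)"
  shows "ph (WC.TT a) (WD.TT b) = inv\<^bsub>DE E\<^esub> WE.TT (ph a b)"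
proof -
  have 1: "ph (WC.TT (dt C x x')) (WD.TT b) = inv\<^bsub>DE E\<^esub> WE.TT (ph (dt C x x') b)"
    if x: "x \<in> carrier (D0 C)" "x' \<in> carrier (D0 C)" for x x'
    using b
  proof (induction rule: ab_tensor_induct)
    case (gen y y')
    then show ?case using x by (simp add: ph_dt WC.TT_dt WD.TT_dt WE.TT_dt ph.inv_left ph.inv_right)
  next
    case (mult b b')
    then show ?case using x by (simp add: ph.add_right WE.Q.T.inv_mult)
  next
    case (inv b) then show ?case using x by (simp add: ph.inv_right)
  qed (use x in simp)
  show ?thesis
    using a
  proof (induction rule: ab_tensor_induct)
    case (mult a a')
    then show ?case using b by (simp add: ph.add_left WE.Q.T.inv_mult)
  next
    case (inv a) then show ?case using b by (simp add: ph.inv_left)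
  qed (use b 1 in simp_all)
qed

text \<open>As y\<otimes>y' = -T(y'\<otimes>y), \<open>ph_TT\<close> moves T outside the pairing,
  where P absorbs it.\<close>

lemma P_ph_TT:
  assumes "Dsg E Z dZ" "a \<in> carrier (DE C)" "y \<in> carrier (D0 D)" "y' \<in> carrier (D0 D)"
  shows "sgP Z (ph (WC.TT a) (dt D y y')) = sgP Z (ph a (dt D y' y))"
proof -
  interpret Z: Dsg E Z dZ by fact
  have "ph (WC.TT a) (dt D y y') = inv\<^bsub>DE E\<^esub> ph (WC.TT a) (WD.TT (dt D y' y))"
    using assms(2-) by (simp add: WD.TT_dt ph.inv_right)
  also have "\<dots> = WE.TT (ph a (dt D y' y))" using assms(2-) by (simp add: ph_TT)
  finally show ?thesis using assms(2-) by (simp add: Z.P_TT)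
qed

text \<open>Both sides are additive in the first variable, so the law need only be checked on objects, where
  \<open>H\<close> vanishes.\<close>

lemma quadratic_right:
  assumes N: "Dsg D N dN" and Z: "Dsg E Z dZ"
    and Fh: "\<And>y. y \<in> carrier (sge N) \<Longrightarrow> (\<lambda>x. F x y) \<in> hom (D0 C) (sge Z)"
    and Fob: "\<And>A y y'. A \<in> Obj C \<Longrightarrow> y \<in> carrier (sge N) \<Longrightarrow> y' \<in> carrier (sge N) \<Longrightarrow>
      F (D_ob C A) (y \<otimes>\<^bsub>sge N\<^esub> y') = F (D_ob C A) y \<otimes>\<^bsub>sge Z\<^esub> F (D_ob C A) y'"
    and dF: "\<And>x y. x \<in> carrier (D0 C) \<Longrightarrow> y \<in> carrier (sge N) \<Longrightarrow> dZ (F x y) = F0 x (dN y)"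
    and xy: "x \<in> carrier (D0 C)" "y \<in> carrier (sge N)" "y' \<in> carrier (sge N)"
  shows "F x (y \<otimes>\<^bsub>sge N\<^esub> y') = F x y \<otimes>\<^bsub>sge Z\<^esub> F x y' \<otimes>\<^bsub>sge Z\<^esub>
      sgP Z (ph (D0_H C x) (dt D (dN y) (dN y')))"
proof -
  interpret N: Dsg D N dN by fact
  interpret Z: Dsg E Z dZ by fact
  have Fc: "F x y \<in> carrier (sge Z)" if "x \<in> carrier (D0 C)" "y \<in> carrier (sge N)" for x y
    using Fh[OF that(2)] that(1) by (auto simp: hom_def)
  have Fm: "F (x \<otimes>\<^bsub>D0 C\<^esub> x') y = F x y \<otimes>\<^bsub>sge Z\<^esub> F x' y"
    if "x \<in> carrier (D0 C)" "x' \<in> carrier (D0 C)" "y \<in> carrier (sge N)" for x x' y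
    using Fh[OF that(3)] that(1,2) by (auto simp: hom_def)
  show ?thesis
  proof (rule WC.D0_hom_eqI[OF Z.G.is_group _ _ _ xy(1)])
    show "(\<lambda>x. F x (y \<otimes>\<^bsub>sge N\<^esub> y')) \<in> hom (D0 C) (sge Z)" using xy by (intro Fh) simp
    show "(\<lambda>x. F x y \<otimes>\<^bsub>sge Z\<^esub> F x y' \<otimes>\<^bsub>sge Z\<^esub> sgP Z (ph (D0_H C x) (dt D (dN y) (dN y'))))
        \<in> hom (D0 C) (sge Z)"
    proof (rule homI)
      \<comment> \<open>Regrouping costs P of F(v,y)\<otimes>F(u,y') taken in degree 0; this is the
        cross term v\<otimes>u of H(u + v) paired with y\<otimes>y'.\<close>
      fix u v assume uv: "u \<in> carrier (D0 C)" "v \<in> carrier (D0 C)"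
      show "F (u \<otimes>\<^bsub>D0 C\<^esub> v) y \<otimes>\<^bsub>sge Z\<^esub> F (u \<otimes>\<^bsub>D0 C\<^esub> v) y' \<otimes>\<^bsub>sge Z\<^esub>
            sgP Z (ph (D0_H C (u \<otimes>\<^bsub>D0 C\<^esub> v)) (dt D (dN y) (dN y')))
          = F u y \<otimes>\<^bsub>sge Z\<^esub> F u y' \<otimes>\<^bsub>sge Z\<^esub> sgP Z (ph (D0_H C u) (dt D (dN y) (dN y'))) \<otimes>\<^bsub>sge Z\<^esub>
           (F v y \<otimes>\<^bsub>sge Z\<^esub> F v y' \<otimes>\<^bsub>sge Z\<^esub> sgP Z (ph (D0_H C v) (dt D (dN y) (dN y'))))"
        using uv xy
        by (subst Z.shuffle) (simp_all add: Fc Fm dF WC.D0_H_mult ph.add_left ph_dt)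
    qed (use xy Fc in simp)
  qed (use xy in \<open>simp add: Fob Fc\<close>)
qed

lemma F0_right:
  "x \<in> carrier (D0 C) \<Longrightarrow> y \<in> carrier (D0 D) \<Longrightarrow> y' \<in> carrier (D0 D) \<Longrightarrow>
     F0 x (y \<otimes>\<^bsub>D0 D\<^esub> y') = F0 x y \<otimes>\<^bsub>D0 E\<^esub> F0 x y' \<otimes>\<^bsub>D0 E\<^esub> bd E (dw E (ph (D0_H C x) (dt D y y')))"
  using quadratic_right[OF Dsg_D0sg[OF WD.waldhausen_category_axioms] Dsg_D0sg[OF WE.waldhausen_category_axioms],
      of F0 x y y'] F0_hom L_hom(1)
  by (simp add: F0_ob hom_mult)

text \<open>Both sides are quadratic in x with deviation F0(x',y)\<otimes>F0(x,y), since \<Delta> is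
  additive and H contributes its cross term. At an object A, where \<Delta>(A) = A\<otimes>A and
  H(A) = 0, both are quadratic in y and vanish on objects.\<close>

lemma H_F0:
  assumes x: "x \<in> carrier (D0 C)" and y: "y \<in> carrier (D0 D)"
  shows "D0_H E (F0 x y) = ph (WC.DD x) (D0_H D y) \<otimes>\<^bsub>DE E\<^esub> ph (D0_H C x) (dt D y y)"
proof (rule WC.D0_quadratic_eqI[OF WE.Q.T.is_group _ _ _ _ _ _ x,
      where \<beta> = "\<lambda>x x'. dt E (F0 x' y) (F0 x y)"])
  fix A assume A: "A \<in> Obj C"
  let ?A = "D_ob C A"
  have "D0_H E (F0 ?A y) = ph (dt C ?A ?A) (D0_H D y)"
  proof (rule WD.D0_quadratic_eqI[OF WE.Q.T.is_group _ _ _ _ _ _ y,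
        where \<beta> = "\<lambda>y y'. dt E (F0 ?A y') (F0 ?A y)"])
    fix y y' assume "y \<in> carrier (D0 D)" "y' \<in> carrier (D0 D)"
    then show "D0_H E (F0 ?A (y \<otimes>\<^bsub>D0 D\<^esub> y'))
        = D0_H E (F0 ?A y) \<otimes>\<^bsub>DE E\<^esub> D0_H E (F0 ?A y') \<otimes>\<^bsub>DE E\<^esub> dt E (F0 ?A y') (F0 ?A y)"
      using A by (simp add: F0_right WE.D0_H_mult)
  qed (use A in \<open>simp_all add: F0_ob_ob WD.D0_H_mult ph.add_right ph_dt\<close>)
  then show "D0_H E (F0 ?A y) = ph (WC.DD ?A) (D0_H D y) \<otimes>\<^bsub>DE E\<^esub> ph (D0_H C ?A) (dt D y y)"
    using A y by (simp add: WC.DD_ob)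
qed (use y in \<open>simp_all add: F0_mult WE.D0_H_mult WC.D0_H_mult WC.DD_mult ph.add_left ph_dt WE.Q.T.m_ac\<close>)

text \<open>Once F satisfies the relations of the tensor product and lies over \<open>F0\<close>,
  compatibility with H, T and cross effects follows, since these are computed in degree 0.\<close>

lemma phi_morphism_exists:
  assumes M: "Dsg C M dM" and N: "Dsg D N dN" and Z: "Dsg E Z dZ"
    and Fc: "\<And>x y. x \<in> carrier (sge M) \<Longrightarrow> y \<in> carrier (sge N) \<Longrightarrow> F x y \<in> carrier (sge Z)"
    and left: "\<And>x x' y. x \<in> carrier (sge M) \<Longrightarrow> x' \<in> carrier (sge M) \<Longrightarrow> y \<in> carrier (sge N) \<Longrightarrow>
       F (x \<otimes>\<^bsub>sge M\<^esub> x') y = F x y \<otimes>\<^bsub>sge Z\<^esub> F x' y"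
    and right: "\<And>x y y'. x \<in> carrier (sge M) \<Longrightarrow> y \<in> carrier (sge N) \<Longrightarrow> y' \<in> carrier (sge N) \<Longrightarrow>
       F x (y \<otimes>\<^bsub>sge N\<^esub> y') = F x y \<otimes>\<^bsub>sge Z\<^esub> F x y' \<otimes>\<^bsub>sge Z\<^esub>
         sgP Z (ph (D0_H C (dM x)) (dt D (dN y) (dN y')))"
    and P_left: "\<And>a y. a \<in> carrier (DE C) \<Longrightarrow> y \<in> carrier (sge N) \<Longrightarrow>
       F (sgP M a) y = sgP Z (ph a (dt D (dN y) (dN y)))"
    and P_right: "\<And>x b. x \<in> carrier (sge M) \<Longrightarrow> b \<in> carrier (DE D) \<Longrightarrow>
       F x (sgP N b) = sgP Z (ph (WC.DD (dM x)) b)"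
    and dF: "\<And>x y. x \<in> carrier (sge M) \<Longrightarrow> y \<in> carrier (sge N) \<Longrightarrow> dZ (F x y) = F0 (dM x) (dN y)"
  obtains f where "f \<in> sg_hom (M \<circledcirc> N) Z" "snd f = phi"
    and "\<And>x y. x \<in> carrier (sge M) \<Longrightarrow> y \<in> carrier (sge N) \<Longrightarrow> fst f (circ_elt M N x y) = F x y"
proof -
  interpret M: Dsg C M dM by fact
  interpret N: Dsg D N dN by fact
  interpret Z: Dsg E Z dZ by fact
  interpret MN: square_group_pair M N by unfold_locales
  interpret p: group_hom "tensor_group (DE C) (DE D)" "DE E" phi
    by (intro group_homI phi_hom WE.Q.T.is_group comm_group.axioms(2)[OF tensor_comm_group])
  note te = tensor_elt_closed[of _ "DE C" _ "DE D"]
  show thesis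
    by (rule MN.circ_sg_hom_exists[where g = phi, OF Z.square_group_axioms Fc])
      (use that phi_hom phi_ext in \<open>auto simp: left right P_left P_right M.H_eq N.H_eq Z.H_eq M.cross_eq
         N.cross_eq Z.cross_eq M.cross_eq[unfolded M.ee] N.cross_eq[unfolded N.ee]
         Z.cross_eq[unfolded Z.ee] M.T_TT N.T_TT Z.T_TT M.Delta_DD ph_TT Fc dF ph_dt H_F0 te simp flip: ph_def\<close>)
qed

end

section \<open>Cofiber sequences\<close>

context waldhausen_category
begin

lemma Cmp_assoc': "f \<in> Arr C \<Longrightarrow> g \<in> Arr C \<Longrightarrow> h \<in> Arr C \<Longrightarrow> Tgt C f = Src C g \<Longrightarrow>
    Tgt C g = Src C h \<Longrightarrow> (h \<cdot> g) \<cdot> f = h \<cdot> (g \<cdot> f)"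
  by (rule Cmp_assoc) (auto simp: arrows_iff)

lemma zero_map_Arr: "zero_map C f \<Longrightarrow> f \<in> Arr C"
  by (auto simp: zero_map_def arrows_iff Cmp_simps)

lemma zero_mapI:
  assumes "u \<in> arrows C A (Zero C)" "v \<in> arrows C (Zero C) B" shows "zero_map C (v \<cdot> u)"
  unfolding zero_map_def
  by (rule bexI[of _ A], rule bexI[of _ B], rule bexI[of _ u], rule bexI[of _ v])
    (use assms Src_closed[of u] Tgt_closed[of v] in \<open>auto simp: arrows_iff\<close>)

lemma zero_mapE:
  assumes "zero_map C f"
  obtains u v where "u \<in> arrows C (Src C f) (Zero C)" "v \<in> arrows C (Zero C) (Tgt C f)" "f = v \<cdot> u"
proof -
  obtain A B u v where "u \<in> arrows C A (Zero C)" "v \<in> arrows C (Zero C) B" "f = v \<cdot> u"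
    using assms by (auto simp: zero_map_def)
  moreover from this have "Src C f = A" "Tgt C f = B" by (auto simp: arrows_iff Cmp_simps)
  ultimately show thesis using that by blast
qed

lemma zero_map_unique:
  assumes "zero_map C f" "zero_map C g" "Src C f = Src C g" "Tgt C f = Tgt C g"
  shows "f = g"
proof -
  obtain u v where f: "u \<in> arrows C (Src C f) (Zero C)" "v \<in> arrows C (Zero C) (Tgt C f)" "f = v \<cdot> u"
    using assms(1) by (rule zero_mapE)
  obtain u' v' where g: "u' \<in> arrows C (Src C g) (Zero C)" "v' \<in> arrows C (Zero C) (Tgt C g)" "g = v' \<cdot> u'"
    using assms(2) by (rule zero_mapE)
  have "u = u'" "v = v'"
    using f(1,2) g(1,2) to_Zero_unique[of u "Src C f" u'] from_Zero_unique[of v "Tgt C f" v']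
    unfolding assms(3,4) by blast+
  then show ?thesis using f(3) g(3) by simp
qed

lemma zero_map_exists:
  assumes "A \<in> Obj C" "B \<in> Obj C" obtains z where "zero_map C z" "z \<in> arrows C A B"
proof -
  obtain u v where uv: "u \<in> arrows C A (Zero C)" "v \<in> arrows C (Zero C) B"
    using assms to_Zero_exists from_Zero_exists by blast
  then show thesis using that[OF zero_mapI[OF uv]] by (auto simp: arrows_iff Cmp_simps)
qed

lemma zero_map_Cmp_left:
  assumes "zero_map C f" "g \<in> Arr C" "Tgt C f = Src C g" shows "zero_map C (g \<cdot> f)"
proof -
  obtain u v where f: "u \<in> arrows C (Src C f) (Zero C)" "v \<in> arrows C (Zero C) (Tgt C f)" "f = v \<cdot> u"
    using assms(1) by (rule zero_mapE)
  have gv: "g \<cdot> v \<in> arrows C (Zero C) (Tgt C g)" using f(2) assms(2,3) by (auto simp: arrows_iff Cmp_simps)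
  have "(g \<cdot> v) \<cdot> u = g \<cdot> (v \<cdot> u)" using f(1,2) assms(2,3) by (intro Cmp_assoc') (auto simp: arrows_iff)
  then show ?thesis using zero_mapI[OF f(1) gv] f(3) by simp
qed

lemma zero_map_Cmp_right:
  assumes "zero_map C g" "f \<in> Arr C" "Tgt C f = Src C g" shows "zero_map C (g \<cdot> f)"
proof -
  obtain u v where g: "u \<in> arrows C (Src C g) (Zero C)" "v \<in> arrows C (Zero C) (Tgt C g)" "g = v \<cdot> u"
    using assms(1) by (rule zero_mapE)
  have uf: "u \<cdot> f \<in> arrows C (Src C f) (Zero C)" using g(1) assms(2,3) by (auto simp: arrows_iff Cmp_simps)
  have "(v \<cdot> u) \<cdot> f = v \<cdot> (u \<cdot> f)" using g(1,2) assms(2,3) by (intro Cmp_assoc') (auto simp: arrows_iff)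
  then show ?thesis using zero_mapI[OF uf g(2)] g(3) by simp
qed

lemma pushout_sym: "is_pushout C f g h k \<Longrightarrow> is_pushout C g f k h"
  unfolding is_pushout_def by (auto; metis)

lemma pushoutD:
  assumes "is_pushout C f g h k"
  shows "f \<in> Arr C" "g \<in> Arr C" "h \<in> Arr C" "k \<in> Arr C" "Src C f = Src C g" "Src C h = Tgt C f"
    "Src C k = Tgt C g" "Tgt C h = Tgt C k" "h \<cdot> f = k \<cdot> g"
    and "u \<in> arrows C (Tgt C f) Z \<Longrightarrow> v \<in> arrows C (Tgt C g) Z \<Longrightarrow> u \<cdot> f = v \<cdot> g \<Longrightarrow>
      \<exists>w. w \<in> arrows C (Tgt C k) Z \<and> w \<cdot> h = u \<and> w \<cdot> k = v"
    and "w \<in> arrows C (Tgt C k) Z \<Longrightarrow> w' \<in> arrows C (Tgt C k) Z \<Longrightarrow> w \<cdot> h = w' \<cdot> h \<Longrightarrow> w \<cdot> k = w' \<cdot> k \<Longrightarrow> w = w'"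
proof -
  show A: "f \<in> Arr C" "g \<in> Arr C" "h \<in> Arr C" "k \<in> Arr C" "Src C f = Src C g" "Src C h = Tgt C f"
    "Src C k = Tgt C g" "Tgt C h = Tgt C k" "h \<cdot> f = k \<cdot> g"
    using assms by (auto simp: is_pushout_def)
  have univ: "\<exists>!w. w \<in> arrows C (Tgt C k) Z \<and> w \<cdot> h = u \<and> w \<cdot> k = v"
    if "u \<in> arrows C (Tgt C f) Z" "v \<in> arrows C (Tgt C g) Z" "u \<cdot> f = v \<cdot> g" for u v Z
  proof -
    have "Z \<in> Obj C" using that(1) Tgt_closed by (auto simp: arrows_iff)
    moreover have "\<forall>Z \<in> Obj C. \<forall>u \<in> arrows C (Tgt C f) Z. \<forall>v \<in> arrows C (Tgt C g) Z.
        u \<cdot> f = v \<cdot> g \<longrightarrow> (\<exists>!w. w \<in> arrows C (Tgt C h) Z \<and> w \<cdot> h = u \<and> w \<cdot> k = v)"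
      using assms unfolding is_pushout_def by blast
    ultimately show ?thesis using that unfolding A(8) by blast
  qed
  then show "u \<in> arrows C (Tgt C f) Z \<Longrightarrow> v \<in> arrows C (Tgt C g) Z \<Longrightarrow> u \<cdot> f = v \<cdot> g \<Longrightarrow>
      \<exists>w. w \<in> arrows C (Tgt C k) Z \<and> w \<cdot> h = u \<and> w \<cdot> k = v" by blast
  assume w: "w \<in> arrows C (Tgt C k) Z" "w' \<in> arrows C (Tgt C k) Z" "w \<cdot> h = w' \<cdot> h" "w \<cdot> k = w' \<cdot> k"
  have "w' \<cdot> h \<in> arrows C (Tgt C f) Z" "w' \<cdot> k \<in> arrows C (Tgt C g) Z" "(w' \<cdot> h) \<cdot> f = (w' \<cdot> k) \<cdot> g"
    using w A by (auto simp: arrows_iff Cmp_simps Cmp_assoc' Cmp_simps)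
  then show "w = w'" using univ[of "w' \<cdot> h" Z "w' \<cdot> k"] w by metis
qed

text \<open>The push-out along the map to the zero object is restated as a cokernel: p is universal
  among maps killing i. The component on the zero object is forced and drops out.\<close>

lemma cofseqI:
  assumes i: "i \<in> Cof C" and p: "p \<in> Arr C" "Src C p = Tgt C i" and z: "zero_map C (p \<cdot> i)"
    and univ: "\<And>u Z. u \<in> arrows C (Tgt C i) Z \<Longrightarrow> zero_map C (u \<cdot> i) \<Longrightarrow>
      \<exists>w. w \<in> arrows C (Tgt C p) Z \<and> w \<cdot> p = u"
    and epi: "\<And>v w Z. v \<in> arrows C (Tgt C p) Z \<Longrightarrow> w \<in> arrows C (Tgt C p) Z \<Longrightarrow> v \<cdot> p = w \<cdot> p \<Longrightarrow> v = w"
  shows "cofseq C i p"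
proof -
  have iA: "i \<in> Arr C" using i Cof_Arr by auto
  obtain t where t: "t \<in> arrows C (Src C i) (Zero C)" using to_Zero_exists iA Src_closed by blast
  obtain e where e: "e \<in> arrows C (Zero C) (Tgt C p)" using from_Zero_exists p(1) Tgt_closed by blast
  have "is_pushout C i t p e"
    unfolding is_pushout_def
  proof (intro conjI ballI impI)
    show "p \<cdot> i = e \<cdot> t"
      by (rule zero_map_unique[OF z zero_mapI[OF t e]])
        (use iA p t e in \<open>simp_all add: arrows_iff Cmp_simps\<close>)
    fix Z u v assume Z: "Z \<in> Obj C" and u: "u \<in> arrows C (Tgt C i) Z" and v: "v \<in> arrows C (Tgt C t) Z"
      and eq: "u \<cdot> i = v \<cdot> t"
    have v': "v \<in> arrows C (Zero C) Z" using v t by (simp add: arrows_iff)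
    have "zero_map C (u \<cdot> i)" unfolding eq by (rule zero_mapI[OF t v'])
    then obtain w where w: "w \<in> arrows C (Tgt C p) Z" "w \<cdot> p = u" using univ[OF u] by blast
    have "w \<cdot> e = v" by (rule from_Zero_unique[OF _ v']) (use w e in \<open>auto simp: arrows_iff Cmp_simps\<close>)
    then show "\<exists>!w. w \<in> arrows C (Tgt C p) Z \<and> w \<cdot> p = u \<and> w \<cdot> e = v" using w epi by blast
  qed (use iA p t e in \<open>auto simp: arrows_iff\<close>)
  then show ?thesis using i t e by (auto simp: cofseq_def)
qed

lemma cofseqD:
  assumes "cofseq C i p"
  shows "i \<in> Cof C" "zero_map C (p \<cdot> i)"
    and "u \<in> arrows C (Tgt C i) Z \<Longrightarrow> zero_map C (u \<cdot> i) \<Longrightarrow> \<exists>w. w \<in> arrows C (Tgt C p) Z \<and> w \<cdot> p = u"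
    and "v \<in> arrows C (Tgt C p) Z \<Longrightarrow> w \<in> arrows C (Tgt C p) Z \<Longrightarrow> v \<cdot> p = w \<cdot> p \<Longrightarrow> v = w"
proof -
  note ar = cofseq_arrows[OF assms]
  obtain t e where te: "i \<in> Cof C" "t \<in> arrows C (Src C i) (Zero C)" "e \<in> arrows C (Zero C) (Tgt C p)"
    "is_pushout C i t p e" using assms by (auto simp: cofseq_def)
  show "i \<in> Cof C" by (rule te)
  have univ: "\<exists>!w. w \<in> arrows C (Tgt C p) Z \<and> w \<cdot> p = u \<and> w \<cdot> e = v"
    if "u \<in> arrows C (Tgt C i) Z" "v \<in> arrows C (Zero C) Z" "u \<cdot> i = v \<cdot> t" for u v Z
  proof -
    have "Tgt C t = Zero C" "Tgt C p = Tgt C e" using te(2,3) by (auto simp: arrows_iff)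
    then show ?thesis using pushoutD(10,11)[OF te(4)] that by metis
  qed
  show "zero_map C (p \<cdot> i)"
    using te zero_mapI[OF te(2,3)] by (simp add: is_pushout_def)
  show "\<exists>w. w \<in> arrows C (Tgt C p) Z \<and> w \<cdot> p = u"
    if u: "u \<in> arrows C (Tgt C i) Z" "zero_map C (u \<cdot> i)"
  proof -
    obtain v where v: "v \<in> arrows C (Zero C) Z" using from_Zero_exists[of Z] u Tgt_closed by (auto simp: arrows_iff)
    have "u \<cdot> i = v \<cdot> t"
      by (rule zero_map_unique[OF u(2) zero_mapI[OF te(2) v]])
        (use u v te(2) ar in \<open>auto simp: arrows_iff Cmp_simps\<close>)
    then show ?thesis using univ[OF u(1) v] by blast
  qed
  assume vw: "v \<in> arrows C (Tgt C p) Z" "w \<in> arrows C (Tgt C p) Z" "v \<cdot> p = w \<cdot> p"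
  have we: "w \<cdot> e \<in> arrows C (Zero C) Z" using vw te(3) by (auto simp: arrows_iff Cmp_simps)
  have "v \<cdot> e = w \<cdot> e"
    by (rule from_Zero_unique[OF _ we]) (use vw te(3) in \<open>auto simp: arrows_iff Cmp_simps\<close>)
  moreover have "(w \<cdot> p) \<cdot> i = (w \<cdot> e) \<cdot> t"
    using te(2-4) vw ar by (auto simp: is_pushout_def arrows_iff Cmp_assoc' Cmp_simps)
  moreover have "w \<cdot> p \<in> arrows C (Tgt C i) Z" using vw ar by (auto simp: arrows_iff Cmp_simps)
  ultimately show "v = w" using univ[OF _ we] vw by metis
qed

lemma cofiber_exists:
  assumes "i \<in> Cof C" obtains p where "cofseq C i p"
proof -
  obtain t where t: "t \<in> arrows C (Src C i) (Zero C)"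
    using to_Zero_exists Src_closed Cof_Arr[OF assms] by blast
  then obtain h k where po: "is_pushout C i t h k"
    using pushout_exists[OF assms, of t] by (auto simp: arrows_iff)
  have "k \<in> arrows C (Zero C) (Tgt C h)" using pushoutD[OF po] t by (auto simp: arrows_iff)
  then have "cofseq C i h" unfolding cofseq_def using assms t po by blast
  then show thesis by (rule that)
qed

text \<open>For i : A \<rightarrow> B and j : B \<rightarrow> Z, the induced map B/A \<rightarrow>
  Z/A is a cofibration because it is the push-out of j along B \<rightarrow> B/A. Its cokernel is
  Z/B, by comparing maps out of the chosen quotients.\<close>

lemma cofseq_third:
  assumes ij: "Tgt C i = Src C j" and ip: "cofseq C i p" and jr: "cofseq C j r" and jiq: "cofseq C (j \<cdot> i) q"
  obtains k s where "cofseq C k s" "k \<in> arrows C (Tgt C p) (Tgt C q)" "s \<in> arrows C (Tgt C q) (Tgt C r)"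
    "k \<cdot> p = q \<cdot> j" "s \<cdot> q = r"
proof -
  note ar = cofseq_arrows[OF ip] cofseq_arrows[OF jr] cofseq_arrows[OF jiq]
  have ji: "Tgt C (j \<cdot> i) = Tgt C j" using ar ij by (simp add: Cmp_simps)
  have "zero_map C ((q \<cdot> j) \<cdot> i)" using cofseqD(2)[OF jiq] ar ij ji by (simp add: Cmp_assoc' Cmp_simps)
  then obtain k where k: "k \<in> arrows C (Tgt C p) (Tgt C q)" "k \<cdot> p = q \<cdot> j"
    using cofseqD(3)[OF ip, of "q \<cdot> j" "Tgt C q"] ar ij ji by (auto simp: arrows_iff Cmp_simps)
  have "zero_map C (r \<cdot> (j \<cdot> i))"
    using zero_map_Cmp_right[OF cofseqD(2)[OF jr], of i] ar ij by (simp add: Cmp_simps Cmp_assoc' Cmp_simps)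
  then obtain s where s: "s \<in> arrows C (Tgt C q) (Tgt C r)" "s \<cdot> q = r"
    using cofseqD(3)[OF jiq, of r "Tgt C r"] ar ij ji by (auto simp: arrows_iff Cmp_simps)
  have "is_pushout C j p q k"
    unfolding is_pushout_def
  proof (intro conjI ballI impI)
    fix Z u v assume Z: "Z \<in> Obj C" and u: "u \<in> arrows C (Tgt C j) Z" and v: "v \<in> arrows C (Tgt C p) Z"
      and eq: "u \<cdot> j = v \<cdot> p"
    have "u \<cdot> (j \<cdot> i) = v \<cdot> (p \<cdot> i)" using u v ar ij eq
      by (auto simp: arrows_iff simp flip: Cmp_assoc')
    then have "zero_map C (u \<cdot> (j \<cdot> i))"
      using zero_map_Cmp_left[OF cofseqD(2)[OF ip], of v] v ar by (simp add: arrows_iff Cmp_simps)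
    then obtain w where w: "w \<in> arrows C (Tgt C q) Z" "w \<cdot> q = u"
      using cofseqD(3)[OF jiq, of u Z] u ji by auto
    have "(w \<cdot> k) \<cdot> p = v \<cdot> p"
      using w k ar ij ji eq by (auto simp: arrows_iff Cmp_assoc' Cmp_simps simp flip: Cmp_assoc'[of j q w])
    then have "w \<cdot> k = v" using cofseqD(4)[OF ip, of "w \<cdot> k" Z v] w k v by (auto simp: arrows_iff Cmp_simps)
    then show "\<exists>!w. w \<in> arrows C (Tgt C q) Z \<and> w \<cdot> q = u \<and> w \<cdot> k = v"
      using w cofseqD(4)[OF jiq] by blast
  qed (use ar k ij ji in \<open>auto simp: arrows_iff\<close>)
  then have kC: "k \<in> Cof C" using Cof_pushout cofseqD(1)[OF jr] by blast
  have "cofseq C k s"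
  proof (rule cofseqI[OF kC])
    show "s \<in> Arr C" "Src C s = Tgt C k" using s k by (auto simp: arrows_iff)
    obtain z where z: "zero_map C z" "z \<in> arrows C (Tgt C p) (Tgt C r)" using zero_map_exists ar by blast
    have "(s \<cdot> k) \<cdot> p = r \<cdot> j"
      using s k ar ij ji by (auto simp: arrows_iff Cmp_assoc' Cmp_simps simp flip: Cmp_assoc'[of j q s])
    also have "\<dots> = z \<cdot> p"
      by (rule zero_map_unique[OF cofseqD(2)[OF jr] zero_map_Cmp_right[OF z(1)]])
        (use z ar ij in \<open>auto simp: arrows_iff Cmp_simps\<close>)
    finally have "s \<cdot> k = z"
      using cofseqD(4)[OF ip, of "s \<cdot> k" _ z] z s k by (auto simp: arrows_iff Cmp_simps)
    then show "zero_map C (s \<cdot> k)" using z by simp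
  next
    fix u Z assume u: "u \<in> arrows C (Tgt C k) Z" and uz: "zero_map C (u \<cdot> k)"
    have "zero_map C ((u \<cdot> k) \<cdot> p)"
      using zero_map_Cmp_right[OF uz, of p] u k ar by (auto simp: arrows_iff Cmp_simps)
    moreover have "(u \<cdot> k) \<cdot> p = (u \<cdot> q) \<cdot> j"
      using u k ar ij ji by (auto simp: arrows_iff Cmp_assoc' Cmp_simps)
    ultimately obtain w where w: "w \<in> arrows C (Tgt C r) Z" "w \<cdot> r = u \<cdot> q"
      using cofseqD(3)[OF jr, of "u \<cdot> q" Z] u k ar ij ji by (auto simp: arrows_iff Cmp_simps)
    have "(w \<cdot> s) \<cdot> q = u \<cdot> q" using w s ar by (auto simp: arrows_iff Cmp_assoc' Cmp_simps)
    then have "w \<cdot> s = u" using cofseqD(4)[OF jiq, of "w \<cdot> s" Z u] w s u k by (auto simp: arrows_iff Cmp_simps)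
    then show "\<exists>w. w \<in> arrows C (Tgt C s) Z \<and> w \<cdot> s = u" using w s by (auto simp: arrows_iff)
  next
    fix v w Z assume vw: "v \<in> arrows C (Tgt C s) Z" "w \<in> arrows C (Tgt C s) Z" "v \<cdot> s = w \<cdot> s"
    have "v \<cdot> (s \<cdot> q) = w \<cdot> (s \<cdot> q)"
      using vw s(1) ar by (auto simp: arrows_iff simp flip: Cmp_assoc')
    then have "v \<cdot> r = w \<cdot> r" by (simp only: s(2))
    then show "v = w" using cofseqD(4)[OF jr, of v Z w] vw s by (auto simp: arrows_iff)
  qed
  then show thesis using that k s by blast
qed

text \<open>A cofibration and its push-out have the same cofiber: the quotient map extends over the
  push-out by zero on the other leg.\<close>

lemma pushout_cofseq:
  assumes po: "is_pushout C f g h k" and fp: "cofseq C f p"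
  obtains m where "cofseq C k m" "m \<in> arrows C (Tgt C k) (Tgt C p)" "m \<cdot> h = p" "zero_map C (m \<cdot> k)"
proof -
  note P = pushoutD[OF po] and ar = cofseq_arrows[OF fp]
  have kC: "k \<in> Cof C" using Cof_pushout[OF cofseqD(1)[OF fp] po] .
  obtain z where z: "zero_map C z" "z \<in> arrows C (Tgt C g) (Tgt C p)"
    using zero_map_exists[OF Tgt_closed[OF P(2)] ar(6)] by blast
  have "p \<cdot> f = z \<cdot> g"
    by (rule zero_map_unique[OF cofseqD(2)[OF fp] zero_map_Cmp_right[OF z(1)]])
      (use z ar P in \<open>auto simp: arrows_iff Cmp_simps\<close>)
  then obtain m where m: "m \<in> arrows C (Tgt C k) (Tgt C p)" "m \<cdot> h = p" "m \<cdot> k = z"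
    using P(10)[of p "Tgt C p" z] z ar by (auto simp: arrows_iff)
  have "cofseq C k m"
  proof (rule cofseqI[OF kC])
    show "m \<in> Arr C" "Src C m = Tgt C k" "zero_map C (m \<cdot> k)" using m z by (auto simp: arrows_iff)
  next
    fix u Z assume u: "u \<in> arrows C (Tgt C k) Z" and uz: "zero_map C (u \<cdot> k)"
    have "(u \<cdot> h) \<cdot> f = (u \<cdot> k) \<cdot> g" using u P(1-9) by (auto simp: arrows_iff Cmp_assoc' Cmp_simps)
    moreover have "zero_map C ((u \<cdot> k) \<cdot> g)"
      using zero_map_Cmp_right[OF uz, of g] u P(1-9) by (auto simp: arrows_iff Cmp_simps)
    ultimately obtain w where w: "w \<in> arrows C (Tgt C p) Z" "w \<cdot> p = u \<cdot> h"
      using cofseqD(3)[OF fp, of "u \<cdot> h" Z] u P(1-9) by (auto simp: arrows_iff Cmp_simps)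
    have "w \<cdot> m = u"
    proof (rule P(11))
      show "(w \<cdot> m) \<cdot> h = u \<cdot> h" using w m P(1-9) by (auto simp: arrows_iff Cmp_assoc' Cmp_simps)
      have "(w \<cdot> m) \<cdot> k = w \<cdot> z" using w m P(1-9) by (auto simp: arrows_iff Cmp_assoc' Cmp_simps)
      also have "\<dots> = u \<cdot> k"
        by (rule zero_map_unique[OF zero_map_Cmp_left[OF z(1)] uz])
          (use w z u P(1-9) in \<open>auto simp: arrows_iff Cmp_simps\<close>)
      finally show "(w \<cdot> m) \<cdot> k = u \<cdot> k" .
    qed (use w m u in \<open>auto simp: arrows_iff Cmp_simps\<close>)
    then show "\<exists>w. w \<in> arrows C (Tgt C m) Z \<and> w \<cdot> m = u" using w m by (auto simp: arrows_iff)
  next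
    fix v w Z assume vw: "v \<in> arrows C (Tgt C m) Z" "w \<in> arrows C (Tgt C m) Z" "v \<cdot> m = w \<cdot> m"
    have "v \<cdot> (m \<cdot> h) = w \<cdot> (m \<cdot> h)"
      using vw m(1) P(1-9) by (auto simp: arrows_iff simp flip: Cmp_assoc')
    then have "v \<cdot> p = w \<cdot> p" by (simp only: m(2))
    then show "v = w" using cofseqD(4)[OF fp, of v Z w] vw m by (auto simp: arrows_iff)
  qed
  then show thesis using that m z by blast
qed

end

text \<open>The rows \<open>(i\<^sub>n, p\<^sub>n)\<close> and columns \<open>(j\<^sub>n, q\<^sub>n)\<close> of a \<open>3 \<times> 3\<close> diagram; \<open>w\<close> is the map
  that biexactness requires to be a cofibration.\<close>

locale three_by_three = waldhausen_category C for C :: "('o, 'm) waldcat" (structure) +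
  fixes i\<^sub>1 i\<^sub>2 i\<^sub>3 p\<^sub>1 p\<^sub>2 p\<^sub>3 j\<^sub>1 j\<^sub>2 j\<^sub>3 q\<^sub>1 q\<^sub>2 q\<^sub>3 h k w
  assumes ip: "cofseq C i\<^sub>1 p\<^sub>1" "cofseq C i\<^sub>2 p\<^sub>2" "cofseq C i\<^sub>3 p\<^sub>3"
    and jq: "cofseq C j\<^sub>1 q\<^sub>1" "cofseq C j\<^sub>2 q\<^sub>2" "cofseq C j\<^sub>3 q\<^sub>3"
    and src_tgt: "Src C j\<^sub>1 = Src C i\<^sub>1" "Tgt C j\<^sub>1 = Src C i\<^sub>2" "Tgt C q\<^sub>1 = Src C i\<^sub>3"
      "Src C j\<^sub>2 = Tgt C i\<^sub>1" "Tgt C j\<^sub>2 = Tgt C i\<^sub>2" "Tgt C q\<^sub>2 = Tgt C i\<^sub>3"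
      "Src C j\<^sub>3 = Tgt C p\<^sub>1" "Tgt C j\<^sub>3 = Tgt C p\<^sub>2" "Tgt C q\<^sub>3 = Tgt C p\<^sub>3"
    and comm: "i\<^sub>2 \<cdot> j\<^sub>1 = j\<^sub>2 \<cdot> i\<^sub>1" "p\<^sub>2 \<cdot> j\<^sub>2 = j\<^sub>3 \<cdot> p\<^sub>1" "i\<^sub>3 \<cdot> q\<^sub>1 = q\<^sub>2 \<cdot> i\<^sub>2" "p\<^sub>3 \<cdot> q\<^sub>2 = q\<^sub>3 \<cdot> p\<^sub>2"
    and po: "is_pushout C i\<^sub>1 j\<^sub>1 h k" and w: "w \<in> Cof C" "w \<in> arrows C (Tgt C k) (Tgt C i\<^sub>2)"
      "w \<cdot> h = j\<^sub>2" "w \<cdot> k = i\<^sub>2"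
begin

lemmas ar = cofseq_arrows[OF ip(1)] cofseq_arrows[OF ip(2)] cofseq_arrows[OF ip(3)]
  cofseq_arrows[OF jq(1)] cofseq_arrows[OF jq(2)] cofseq_arrows[OF jq(3)]
lemmas P = pushoutD[OF po]
lemmas P' = P(1-4) P(6-8)
lemma wA: "w \<in> Arr C" "Src C w = Tgt C k" "Tgt C w = Tgt C i\<^sub>2" using w by (auto simp: arrows_iff)

lemma transpose: "three_by_three C j\<^sub>1 j\<^sub>2 j\<^sub>3 q\<^sub>1 q\<^sub>2 q\<^sub>3 i\<^sub>1 i\<^sub>2 i\<^sub>3 p\<^sub>1 p\<^sub>2 p\<^sub>3 k h w"
  using ip jq src_tgt comm w pushout_sym[OF po] P(8) by unfold_locales (simp_all add: arrows_iff)

text \<open>A map killing \<open>w\<close> kills \<open>i\<^sub>2 = w \<cdot> k\<close> and factors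
  over \<open>p\<^sub>2\<close>; it also kills \<open>j\<^sub>2 = w \<cdot> h\<close>, so,
  \<open>p\<^sub>1\<close> being epi, the factor kills \<open>j\<^sub>3\<close> and descends along
  \<open>q\<^sub>3\<close>.\<close>

lemma cofseq_latching: "cofseq C w (q\<^sub>3 \<cdot> p\<^sub>2)"
proof (rule cofseqI[OF w(1)])
  show "q\<^sub>3 \<cdot> p\<^sub>2 \<in> Arr C" "Src C (q\<^sub>3 \<cdot> p\<^sub>2) = Tgt C w"
    using ar src_tgt wA by (simp_all add: Cmp_simps)
  have tA: "q\<^sub>3 \<cdot> p\<^sub>2 \<in> Arr C" "Src C (q\<^sub>3 \<cdot> p\<^sub>2) = Tgt C w" "Tgt C (q\<^sub>3 \<cdot> p\<^sub>2) = Tgt C q\<^sub>3"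
    using ar src_tgt wA by (simp_all add: Cmp_simps)
  obtain z where z: "zero_map C z" "z \<in> arrows C (Tgt C k) (Tgt C q\<^sub>3)"
    using zero_map_exists[of "Tgt C k" "Tgt C q\<^sub>3"] P(4) ar Tgt_closed by metis
  have "(q\<^sub>3 \<cdot> p\<^sub>2) \<cdot> w = z"
  proof (rule P(11))
    have "((q\<^sub>3 \<cdot> p\<^sub>2) \<cdot> w) \<cdot> h = q\<^sub>3 \<cdot> (p\<^sub>2 \<cdot> j\<^sub>2)"
      using ar src_tgt wA P' tA by (simp add: Cmp_assoc' Cmp_simps w(3))
    also have "\<dots> = (q\<^sub>3 \<cdot> j\<^sub>3) \<cdot> p\<^sub>1" using ar src_tgt by (simp add: comm Cmp_assoc' Cmp_simps)
    also have "\<dots> = z \<cdot> h"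
      by (rule zero_map_unique[OF zero_map_Cmp_right[OF cofseqD(2)[OF jq(3)]] zero_map_Cmp_right[OF z(1)]])
        (use z ar P' src_tgt in \<open>auto simp: arrows_iff Cmp_simps\<close>)
    finally show "((q\<^sub>3 \<cdot> p\<^sub>2) \<cdot> w) \<cdot> h = z \<cdot> h" .
    have "((q\<^sub>3 \<cdot> p\<^sub>2) \<cdot> w) \<cdot> k = q\<^sub>3 \<cdot> (p\<^sub>2 \<cdot> i\<^sub>2)"
      using ar src_tgt wA P' tA by (simp add: Cmp_assoc' Cmp_simps w(4))
    also have "\<dots> = z \<cdot> k"
      by (rule zero_map_unique[OF zero_map_Cmp_left[OF cofseqD(2)[OF ip(2)]] zero_map_Cmp_right[OF z(1)]])
        (use z ar P' src_tgt in \<open>auto simp: arrows_iff Cmp_simps\<close>)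
    finally show "((q\<^sub>3 \<cdot> p\<^sub>2) \<cdot> w) \<cdot> k = z \<cdot> k" .
  qed (use z tA wA in \<open>auto simp: arrows_iff Cmp_simps\<close>)
  then show "zero_map C ((q\<^sub>3 \<cdot> p\<^sub>2) \<cdot> w)" using z by simp
next
  fix u Z assume u: "u \<in> arrows C (Tgt C w) Z" and uz: "zero_map C (u \<cdot> w)"
  have uA: "u \<in> Arr C" "Src C u = Tgt C i\<^sub>2" "Tgt C u = Z" using u wA by (auto simp: arrows_iff)
  have "zero_map C ((u \<cdot> w) \<cdot> k)" using uA wA P' by (intro zero_map_Cmp_right[OF uz]) (simp_all add: Cmp_simps)
  then have "zero_map C (u \<cdot> i\<^sub>2)" using uA wA P' w by (simp add: Cmp_assoc' Cmp_simps)
  then obtain v where v: "v \<in> arrows C (Tgt C p\<^sub>2) Z" "v \<cdot> p\<^sub>2 = u"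
    using cofseqD(3)[OF ip(2), of u Z] uA by (auto simp: arrows_iff)
  have vA: "v \<in> Arr C" "Src C v = Tgt C p\<^sub>2" "Tgt C v = Z" using v by (auto simp: arrows_iff)
  obtain z where z: "zero_map C z" "z \<in> arrows C (Tgt C p\<^sub>1) Z"
    using zero_map_exists[of "Tgt C p\<^sub>1" Z] ar vA Tgt_closed by metis
  have "v \<cdot> j\<^sub>3 = z"
  proof (rule cofseqD(4)[OF ip(1)])
    have "zero_map C ((u \<cdot> w) \<cdot> h)" using uA wA P' by (intro zero_map_Cmp_right[OF uz]) (simp_all add: Cmp_simps)
    moreover have "(u \<cdot> w) \<cdot> h = u \<cdot> j\<^sub>2" using uA wA P' w by (simp add: Cmp_assoc' Cmp_simps)
    moreover have "(v \<cdot> p\<^sub>2) \<cdot> j\<^sub>2 = v \<cdot> (p\<^sub>2 \<cdot> j\<^sub>2)"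
      using vA ar src_tgt by (simp add: Cmp_assoc' Cmp_simps)
    moreover have "\<dots> = (v \<cdot> j\<^sub>3) \<cdot> p\<^sub>1" using vA ar src_tgt by (simp add: Cmp_assoc' Cmp_simps comm)
    ultimately have "zero_map C ((v \<cdot> j\<^sub>3) \<cdot> p\<^sub>1)" by (simp add: v(2))
    then show "(v \<cdot> j\<^sub>3) \<cdot> p\<^sub>1 = z \<cdot> p\<^sub>1"
      by (rule zero_map_unique[OF _ zero_map_Cmp_right[OF z(1)]])
        (use z vA ar src_tgt in \<open>auto simp: arrows_iff Cmp_simps\<close>)
  qed (use z vA ar src_tgt in \<open>auto simp: arrows_iff Cmp_simps\<close>)
  then obtain x where x: "x \<in> arrows C (Tgt C q\<^sub>3) Z" "x \<cdot> q\<^sub>3 = v"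
    using cofseqD(3)[OF jq(3), of v Z] z vA src_tgt by (auto simp: arrows_iff)
  then have "x \<cdot> (q\<^sub>3 \<cdot> p\<^sub>2) = u" using ar src_tgt v by (auto simp: arrows_iff simp flip: Cmp_assoc')
  then show "\<exists>x. x \<in> arrows C (Tgt C (q\<^sub>3 \<cdot> p\<^sub>2)) Z \<and> x \<cdot> (q\<^sub>3 \<cdot> p\<^sub>2) = u"
    using x ar src_tgt by (auto simp: Cmp_simps)
next
  fix u v Z assume "u \<in> arrows C (Tgt C (q\<^sub>3 \<cdot> p\<^sub>2)) Z" "v \<in> arrows C (Tgt C (q\<^sub>3 \<cdot> p\<^sub>2)) Z"
    and eq: "u \<cdot> (q\<^sub>3 \<cdot> p\<^sub>2) = v \<cdot> (q\<^sub>3 \<cdot> p\<^sub>2)"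
  then have uv: "u \<in> arrows C (Tgt C q\<^sub>3) Z" "v \<in> arrows C (Tgt C q\<^sub>3) Z"
    using ar src_tgt by (simp_all add: Cmp_simps)
  have "(u \<cdot> q\<^sub>3) \<cdot> p\<^sub>2 = (v \<cdot> q\<^sub>3) \<cdot> p\<^sub>2" using eq uv ar src_tgt by (auto simp: arrows_iff Cmp_assoc' Cmp_simps)
  then have "u \<cdot> q\<^sub>3 = v \<cdot> q\<^sub>3"
    using cofseqD(4)[OF ip(2), of "u \<cdot> q\<^sub>3" Z "v \<cdot> q\<^sub>3"] uv ar src_tgt by (auto simp: arrows_iff Cmp_simps)
  then show "u = v" using cofseqD(4)[OF jq(3)] uv by blast
qed

text \<open>The composite \<open>w \<cdot> k\<close> is \<open>i\<^sub>2\<close>, the cofiber of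
  \<open>k\<close> is that of \<open>i\<^sub>1\<close>, and the induced map of quotients is
  \<open>j\<^sub>3\<close>. The relation for a composite of cofibrations applies, and the sum inside
  its bracket is the boundary of the third column.\<close>

lemma latching_relation:
  obtains m where "cofseq C k m" "m \<in> arrows C (Tgt C k) (Tgt C p\<^sub>1)" "m \<cdot> h = p\<^sub>1" "zero_map C (m \<cdot> k)"
    and "D_cs C w (q\<^sub>3 \<cdot> p\<^sub>2) \<otimes>\<^bsub>D1 C\<^esub> D_cs C k m = D_cs C i\<^sub>2 p\<^sub>2 \<otimes>\<^bsub>D1 C\<^esub> D_cs C j\<^sub>3 q\<^sub>3 \<otimes>\<^bsub>D1 C\<^esub>
      sqbr (Dmod C) (D_ob C (Tgt C j\<^sub>1)) (bd C (D_cs C j\<^sub>3 q\<^sub>3))"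
proof -
  obtain m where m: "cofseq C k m" "m \<in> arrows C (Tgt C k) (Tgt C p\<^sub>1)" "m \<cdot> h = p\<^sub>1" "zero_map C (m \<cdot> k)"
    using pushout_cofseq[OF po ip(1)] by blast
  have mA: "m \<in> Arr C" "Src C m = Tgt C k" "Tgt C m = Tgt C p\<^sub>1" using m(2) by (auto simp: arrows_iff)
  \<comment> \<open>Compared on the legs of the push-out: both sides give
    \<open>p\<^sub>2 \<cdot> j\<^sub>2\<close> on \<open>h\<close> and zero on
    \<open>k\<close>.\<close>
  have "j\<^sub>3 \<cdot> m = p\<^sub>2 \<cdot> w"
  proof (rule P(11))
    show "(j\<^sub>3 \<cdot> m) \<cdot> h = (p\<^sub>2 \<cdot> w) \<cdot> h"
      using mA ar src_tgt wA P' by (simp add: Cmp_assoc' Cmp_simps m(3) w(3) comm)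
    show "(j\<^sub>3 \<cdot> m) \<cdot> k = (p\<^sub>2 \<cdot> w) \<cdot> k"
    proof (rule zero_map_unique)
      show "zero_map C ((j\<^sub>3 \<cdot> m) \<cdot> k)"
        using zero_map_Cmp_left[OF m(4), of j\<^sub>3] mA ar src_tgt P' by (simp add: Cmp_assoc' Cmp_simps)
      show "zero_map C ((p\<^sub>2 \<cdot> w) \<cdot> k)"
        using cofseqD(2)[OF ip(2)] mA ar src_tgt P' wA by (simp add: Cmp_assoc' Cmp_simps w(4))
    qed (use mA wA ar src_tgt P' in \<open>simp_all add: Cmp_simps\<close>)
  qed (use mA wA ar src_tgt P' in \<open>auto simp: arrows_iff Cmp_simps\<close>)
  then have "D_cs C w (q\<^sub>3 \<cdot> p\<^sub>2) \<otimes>\<^bsub>D1 C\<^esub> D_cs C k m = D_cs C (w \<cdot> k) p\<^sub>2 \<otimes>\<^bsub>D1 C\<^esub> D_cs C j\<^sub>3 q\<^sub>3 \<otimes>\<^bsub>D1 C\<^esub>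
      sqbr (Dmod C) (D_ob C (Src C k))
        (inv\<^bsub>D0 C\<^esub> D_ob C (Tgt C p\<^sub>2) \<otimes>\<^bsub>D0 C\<^esub> D_ob C (Tgt C (q\<^sub>3 \<cdot> p\<^sub>2)) \<otimes>\<^bsub>D0 C\<^esub> D_ob C (Tgt C m))"
    by (intro D_cs_cs_rel) (use m mA wA w ip jq cofseq_latching ar src_tgt in \<open>auto simp: arrows_iff Cmp_simps\<close>)
  then show thesis
    using that m ar src_tgt mA P' jq(3) by (simp add: w(4) bd_cs Cmp_simps)
qed

text \<open>Passing from the push-out to the last corner by rows or by columns gives the outer
  terms. Inside the push-out the quotient by the first corner is a coproduct, and its two cofiber
  sequences differ by the last bracket.\<close>

theorem D_three_by_three:
  "D_cs C i\<^sub>2 p\<^sub>2 \<otimes>\<^bsub>D1 C\<^esub> D_cs C j\<^sub>3 q\<^sub>3 \<otimes>\<^bsub>D1 C\<^esub> D_cs C j\<^sub>1 q\<^sub>1 \<otimes>\<^bsub>D1 C\<^esub>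
      sqbr (Dmod C) (D_ob C (Tgt C j\<^sub>1)) (bd C (D_cs C j\<^sub>3 q\<^sub>3))
    = D_cs C j\<^sub>2 q\<^sub>2 \<otimes>\<^bsub>D1 C\<^esub> D_cs C i\<^sub>3 p\<^sub>3 \<otimes>\<^bsub>D1 C\<^esub> D_cs C i\<^sub>1 p\<^sub>1 \<otimes>\<^bsub>D1 C\<^esub>
      (sqbr (Dmod C) (D_ob C (Tgt C i\<^sub>1)) (bd C (D_cs C i\<^sub>3 p\<^sub>3)) \<otimes>\<^bsub>D1 C\<^esub>
       sqbr (Dmod C) (D_ob C (Tgt C q\<^sub>1)) (D_ob C (Tgt C p\<^sub>1)))"
proof -
  obtain m where m: "cofseq C k m" "m \<in> arrows C (Tgt C k) (Tgt C p\<^sub>1)" "m \<cdot> h = p\<^sub>1" "zero_map C (m \<cdot> k)"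
    and xm: "D_cs C w (q\<^sub>3 \<cdot> p\<^sub>2) \<otimes>\<^bsub>D1 C\<^esub> D_cs C k m = D_cs C i\<^sub>2 p\<^sub>2 \<otimes>\<^bsub>D1 C\<^esub> D_cs C j\<^sub>3 q\<^sub>3 \<otimes>\<^bsub>D1 C\<^esub>
      sqbr (Dmod C) (D_ob C (Tgt C j\<^sub>1)) (bd C (D_cs C j\<^sub>3 q\<^sub>3))"
    by (rule latching_relation)
  interpret tr: three_by_three C j\<^sub>1 j\<^sub>2 j\<^sub>3 q\<^sub>1 q\<^sub>2 q\<^sub>3 i\<^sub>1 i\<^sub>2 i\<^sub>3 p\<^sub>1 p\<^sub>2 p\<^sub>3 k h w by (rule transpose)
  obtain n where n: "cofseq C h n" "n \<in> arrows C (Tgt C h) (Tgt C q\<^sub>1)" "n \<cdot> k = q\<^sub>1" "zero_map C (n \<cdot> h)"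
    and xn: "D_cs C w (p\<^sub>3 \<cdot> q\<^sub>2) \<otimes>\<^bsub>D1 C\<^esub> D_cs C h n = D_cs C j\<^sub>2 q\<^sub>2 \<otimes>\<^bsub>D1 C\<^esub> D_cs C i\<^sub>3 p\<^sub>3 \<otimes>\<^bsub>D1 C\<^esub>
      sqbr (Dmod C) (D_ob C (Tgt C i\<^sub>1)) (bd C (D_cs C i\<^sub>3 p\<^sub>3))"
    by (rule tr.latching_relation)
  have mA: "m \<in> Arr C" "Src C m = Tgt C k" "Tgt C m = Tgt C p\<^sub>1" using m(2) by (auto simp: arrows_iff)
  have nA: "n \<in> Arr C" "Src C n = Tgt C k" "Tgt C n = Tgt C q\<^sub>1" using n(2) P(8) by (auto simp: arrows_iff)
  \<comment> \<open>This is the diagonal of the push-out square, equal to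
    \<open>h \<cdot> i\<^sub>1\<close>; one choice of quotient for it serves both
    filtrations.\<close>
  have "k \<cdot> j\<^sub>1 \<in> Cof C" using Cof_Cmp cofseqD(1)[OF jq(1)] cofseqD(1)[OF m(1)] P(7) by simp
  then obtain q where q: "cofseq C (k \<cdot> j\<^sub>1) q" by (rule cofiber_exists)
  have q': "cofseq C (h \<cdot> i\<^sub>1) q" using q P(9) by simp
  note qA = cofseq_arrows[OF q]
  have qs: "Src C q = Tgt C k" using qA P ar by (simp add: Cmp_simps)
  obtain \<kappa>\<^sub>1 s\<^sub>1 where 1: "cofseq C \<kappa>\<^sub>1 s\<^sub>1" "\<kappa>\<^sub>1 \<in> arrows C (Tgt C q\<^sub>1) (Tgt C q)" "s\<^sub>1 \<in> arrows C (Tgt C q) (Tgt C m)"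
    "\<kappa>\<^sub>1 \<cdot> q\<^sub>1 = q \<cdot> k" "s\<^sub>1 \<cdot> q = m"
    by (rule cofseq_third[OF P(7)[symmetric] jq(1) m(1) q])
  obtain \<kappa>\<^sub>2 s\<^sub>2 where 2: "cofseq C \<kappa>\<^sub>2 s\<^sub>2" "\<kappa>\<^sub>2 \<in> arrows C (Tgt C p\<^sub>1) (Tgt C q)" "s\<^sub>2 \<in> arrows C (Tgt C q) (Tgt C n)"
    "\<kappa>\<^sub>2 \<cdot> p\<^sub>1 = q \<cdot> h" "s\<^sub>2 \<cdot> q = n"
    by (rule cofseq_third[OF P(6)[symmetric] ip(1) n(1) q'])
  have 1: "\<kappa>\<^sub>1 \<in> Arr C" "Src C \<kappa>\<^sub>1 = Tgt C q\<^sub>1" "Tgt C \<kappa>\<^sub>1 = Tgt C q" "s\<^sub>1 \<in> Arr C" "Src C s\<^sub>1 = Tgt C q"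
    "Tgt C s\<^sub>1 = Tgt C p\<^sub>1" and 1: "cofseq C \<kappa>\<^sub>1 s\<^sub>1" "\<kappa>\<^sub>1 \<cdot> q\<^sub>1 = q \<cdot> k" "s\<^sub>1 \<cdot> q = m" and A1: "\<kappa>\<^sub>1 \<in> Arr C"
    "Src C \<kappa>\<^sub>1 = Tgt C q\<^sub>1" "Tgt C \<kappa>\<^sub>1 = Tgt C q" "s\<^sub>1 \<in> Arr C" "Src C s\<^sub>1 = Tgt C q" "Tgt C s\<^sub>1 = Tgt C p\<^sub>1"
    using 1 mA by (auto simp: arrows_iff)
  have A2: "\<kappa>\<^sub>2 \<in> Arr C" "Src C \<kappa>\<^sub>2 = Tgt C p\<^sub>1" "Tgt C \<kappa>\<^sub>2 = Tgt C q" "s\<^sub>2 \<in> Arr C" "Src C s\<^sub>2 = Tgt C q"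
    "Tgt C s\<^sub>2 = Tgt C q\<^sub>1" using 2 nA by (auto simp: arrows_iff)
  \<comment> \<open>Each projection is the identity on its own summand; that it vanishes on the
    other is contained in the two cofiber sequences.\<close>
  have id1: "s\<^sub>2 \<cdot> \<kappa>\<^sub>1 = Ide C (Tgt C q\<^sub>1)"
  proof (rule cofseqD(4)[OF jq(1)])
    have "(s\<^sub>2 \<cdot> \<kappa>\<^sub>1) \<cdot> q\<^sub>1 = (s\<^sub>2 \<cdot> q) \<cdot> k" using A1 A2 ar qA qs P' by (simp add: Cmp_assoc' Cmp_simps 1)
    then show "(s\<^sub>2 \<cdot> \<kappa>\<^sub>1) \<cdot> q\<^sub>1 = Ide C (Tgt C q\<^sub>1) \<cdot> q\<^sub>1" using ar by (simp add: 2 n Ide_left)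
  qed (use A1 A2 ar in \<open>auto simp: arrows_iff Cmp_simps\<close>)
  have id2: "s\<^sub>1 \<cdot> \<kappa>\<^sub>2 = Ide C (Tgt C p\<^sub>1)"
  proof (rule cofseqD(4)[OF ip(1)])
    have "(s\<^sub>1 \<cdot> \<kappa>\<^sub>2) \<cdot> p\<^sub>1 = (s\<^sub>1 \<cdot> q) \<cdot> h" using A1 A2 ar qA qs P' by (simp add: Cmp_assoc' Cmp_simps 2)
    then show "(s\<^sub>1 \<cdot> \<kappa>\<^sub>2) \<cdot> p\<^sub>1 = Ide C (Tgt C p\<^sub>1) \<cdot> p\<^sub>1" using ar by (simp add: 1 m Ide_left)
  qed (use A1 A2 ar in \<open>auto simp: arrows_iff Cmp_simps\<close>)
  \<comment> \<open>Maps u and v on the summands pull back to maps that vanish on the first corner.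
    They therefore glue to a map on the push-out, and this descends to the quotient for the same
    reason.\<close>
  have cop: "is_coproduct C \<kappa>\<^sub>1 \<kappa>\<^sub>2"
    unfolding is_coproduct_def
  proof (intro conjI ballI)
    fix Z u v assume Z: "Z \<in> Obj C" and uv: "u \<in> arrows C (Src C \<kappa>\<^sub>1) Z" "v \<in> arrows C (Src C \<kappa>\<^sub>2) Z"
    have uvA: "u \<in> Arr C" "Src C u = Tgt C q\<^sub>1" "Tgt C u = Z" "v \<in> Arr C" "Src C v = Tgt C p\<^sub>1" "Tgt C v = Z"
      using uv A1 A2 by (auto simp: arrows_iff)
    have zu: "zero_map C ((u \<cdot> q\<^sub>1) \<cdot> j\<^sub>1)" and zv: "zero_map C ((v \<cdot> p\<^sub>1) \<cdot> i\<^sub>1)"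
      using zero_map_Cmp_left[OF cofseqD(2)[OF jq(1)], of u] zero_map_Cmp_left[OF cofseqD(2)[OF ip(1)], of v]
        uvA ar by (simp_all add: Cmp_assoc' Cmp_simps)
    have "(v \<cdot> p\<^sub>1) \<cdot> i\<^sub>1 = (u \<cdot> q\<^sub>1) \<cdot> j\<^sub>1"
      by (rule zero_map_unique[OF zv zu]) (use uvA ar src_tgt in \<open>simp_all add: Cmp_simps\<close>)
    then obtain x where x: "x \<in> arrows C (Tgt C k) Z" "x \<cdot> h = v \<cdot> p\<^sub>1" "x \<cdot> k = u \<cdot> q\<^sub>1"
      using P(10)[of "v \<cdot> p\<^sub>1" Z "u \<cdot> q\<^sub>1"] uvA ar by (auto simp: arrows_iff Cmp_simps)
    have xA: "x \<in> Arr C" "Src C x = Tgt C k" "Tgt C x = Z" using x by (auto simp: arrows_iff)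
    have "x \<cdot> (k \<cdot> j\<^sub>1) = (u \<cdot> q\<^sub>1) \<cdot> j\<^sub>1" using xA P' by (simp add: x(3) flip: Cmp_assoc')
    then obtain y where y: "y \<in> arrows C (Tgt C q) Z" "y \<cdot> q = x"
      using cofseqD(3)[OF q, of x Z] zu xA P' by (auto simp: arrows_iff Cmp_simps)
    have yA: "y \<in> Arr C" "Src C y = Tgt C q" "Tgt C y = Z" using y by (auto simp: arrows_iff)
    have "y \<cdot> \<kappa>\<^sub>1 = u"
    proof (rule cofseqD(4)[OF jq(1)])
      have "(y \<cdot> \<kappa>\<^sub>1) \<cdot> q\<^sub>1 = (y \<cdot> q) \<cdot> k" using yA A1 ar qA qs P' by (simp add: Cmp_assoc' Cmp_simps 1)
      then show "(y \<cdot> \<kappa>\<^sub>1) \<cdot> q\<^sub>1 = u \<cdot> q\<^sub>1" by (simp add: y x)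
    qed (use yA A1 uvA in \<open>auto simp: arrows_iff Cmp_simps\<close>)
    moreover have "y \<cdot> \<kappa>\<^sub>2 = v"
    proof (rule cofseqD(4)[OF ip(1)])
      have "(y \<cdot> \<kappa>\<^sub>2) \<cdot> p\<^sub>1 = (y \<cdot> q) \<cdot> h" using yA A2 ar qA qs P' by (simp add: Cmp_assoc' Cmp_simps 2)
      then show "(y \<cdot> \<kappa>\<^sub>2) \<cdot> p\<^sub>1 = v \<cdot> p\<^sub>1" by (simp add: y x)
    qed (use yA A2 uvA in \<open>auto simp: arrows_iff Cmp_simps\<close>)
    moreover have "y' = y" if y': "y' \<in> arrows C (Tgt C q) Z" "y' \<cdot> \<kappa>\<^sub>1 = u" "y' \<cdot> \<kappa>\<^sub>2 = v" for y'
    proof (rule cofseqD(4)[OF q y'(1) y(1)])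
      have yA': "y' \<in> Arr C" "Src C y' = Tgt C q" "Tgt C y' = Z" using y' by (auto simp: arrows_iff)
      have "y' \<cdot> q = x"
      proof (rule P(11))
        have "(y' \<cdot> q) \<cdot> h = (y' \<cdot> \<kappa>\<^sub>2) \<cdot> p\<^sub>1" using yA' A2 ar qA qs P' by (simp add: Cmp_assoc' Cmp_simps 2)
        then show "(y' \<cdot> q) \<cdot> h = x \<cdot> h" by (simp add: y' x)
        have "(y' \<cdot> q) \<cdot> k = (y' \<cdot> \<kappa>\<^sub>1) \<cdot> q\<^sub>1" using yA' A1 ar qA qs P' by (simp add: Cmp_assoc' Cmp_simps 1)
        then show "(y' \<cdot> q) \<cdot> k = x \<cdot> k" by (simp add: y' x)
      qed (use yA' xA qA qs in \<open>auto simp: arrows_iff Cmp_simps\<close>)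
      then show "y' \<cdot> q = y \<cdot> q" by (simp add: y)
    qed
    ultimately show "\<exists>!y. y \<in> arrows C (Tgt C \<kappa>\<^sub>1) Z \<and> y \<cdot> \<kappa>\<^sub>1 = u \<and> y \<cdot> \<kappa>\<^sub>2 = v"
      using y(1) unfolding A1(3) by (intro ex1I[of _ y]) blast+
  qed (use A1 A2 in auto)
  let ?br = "sqbr (Dmod C)" and ?o = "D_ob C"
  have c1: "D_cs C k m \<otimes>\<^bsub>D1 C\<^esub> D_cs C j\<^sub>1 q\<^sub>1 = D_cs C (k \<cdot> j\<^sub>1) q \<otimes>\<^bsub>D1 C\<^esub> D_cs C \<kappa>\<^sub>1 s\<^sub>1 \<otimes>\<^bsub>D1 C\<^esub>
      ?br (?o (Src C j\<^sub>1)) (inv\<^bsub>D0 C\<^esub> ?o (Tgt C q) \<otimes>\<^bsub>D0 C\<^esub> ?o (Tgt C m) \<otimes>\<^bsub>D0 C\<^esub> ?o (Tgt C q\<^sub>1))"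
    by (rule D_cs_cs_rel) (use jq(1) m q 1 A1 mA P(7) in \<open>auto simp: arrows_iff\<close>)
  have c2: "D_cs C h n \<otimes>\<^bsub>D1 C\<^esub> D_cs C i\<^sub>1 p\<^sub>1 = D_cs C (h \<cdot> i\<^sub>1) q \<otimes>\<^bsub>D1 C\<^esub> D_cs C \<kappa>\<^sub>2 s\<^sub>2 \<otimes>\<^bsub>D1 C\<^esub>
      ?br (?o (Src C i\<^sub>1)) (inv\<^bsub>D0 C\<^esub> ?o (Tgt C q) \<otimes>\<^bsub>D0 C\<^esub> ?o (Tgt C n) \<otimes>\<^bsub>D0 C\<^esub> ?o (Tgt C p\<^sub>1))"
    by (rule D_cs_cs_rel) (use ip(1) n q' 2 A2 nA P(6) in \<open>auto simp: arrows_iff\<close>)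
  have c3: "?br (?o (Tgt C q\<^sub>1)) (?o (Tgt C p\<^sub>1)) = inv\<^bsub>D1 C\<^esub> D_cs C \<kappa>\<^sub>2 s\<^sub>2 \<otimes>\<^bsub>D1 C\<^esub> D_cs C \<kappa>\<^sub>1 s\<^sub>1"
    by (rule D_coprod_rel[OF cop])
      (use 1 2 A1 A2 id1 id2 cofseqD(2)[OF 1(1)] cofseqD(2)[OF 2(1)] in \<open>auto simp: arrows_iff\<close>)
  \<comment> \<open>The two classes common to both filtrations: x belongs to the map from the
    push-out to the last corner, y to the diagonal of the push-out square.\<close>
  define x where "x = D_cs C w (q\<^sub>3 \<cdot> p\<^sub>2)"
  define y where "y = D_cs C (k \<cdot> j\<^sub>1) q"
  define \<beta> where "\<beta> = ?br (?o (Src C i\<^sub>1)) (inv\<^bsub>D0 C\<^esub> ?o (Tgt C q) \<otimes>\<^bsub>D0 C\<^esub> ?o (Tgt C q\<^sub>1) \<otimes>\<^bsub>D0 C\<^esub> ?o (Tgt C p\<^sub>1))"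
  define \<gamma> where "\<gamma> = ?br (?o (Tgt C q\<^sub>1)) (?o (Tgt C p\<^sub>1))"
  define a where "a = ?br (?o (Tgt C j\<^sub>1)) (bd C (D_cs C j\<^sub>3 q\<^sub>3))"
  define b where "b = ?br (?o (Tgt C i\<^sub>1)) (bd C (D_cs C i\<^sub>3 p\<^sub>3))"
  have cl [simp]: "D_cs C i\<^sub>1 p\<^sub>1 \<in> carrier (D1 C)" "D_cs C i\<^sub>2 p\<^sub>2 \<in> carrier (D1 C)" "D_cs C i\<^sub>3 p\<^sub>3 \<in> carrier (D1 C)"
    "D_cs C j\<^sub>1 q\<^sub>1 \<in> carrier (D1 C)" "D_cs C j\<^sub>2 q\<^sub>2 \<in> carrier (D1 C)" "D_cs C j\<^sub>3 q\<^sub>3 \<in> carrier (D1 C)"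
    "D_cs C k m \<in> carrier (D1 C)" "D_cs C h n \<in> carrier (D1 C)" "D_cs C \<kappa>\<^sub>1 s\<^sub>1 \<in> carrier (D1 C)"
    "D_cs C \<kappa>\<^sub>2 s\<^sub>2 \<in> carrier (D1 C)" "x \<in> carrier (D1 C)" "y \<in> carrier (D1 C)"
    using ip jq m n 1 2 q cofseq_latching by (simp_all add: x_def y_def)
  have ob: "?o (Src C i\<^sub>1) \<in> carrier (D0 C)" "?o (Tgt C q) \<in> carrier (D0 C)" "?o (Tgt C q\<^sub>1) \<in> carrier (D0 C)"
    "?o (Tgt C p\<^sub>1) \<in> carrier (D0 C)" "?o (Tgt C j\<^sub>1) \<in> carrier (D0 C)" "?o (Tgt C i\<^sub>1) \<in> carrier (D0 C)"
    using ar qA by simp_all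
  have cl' [simp]: "\<beta> \<in> carrier (D1 C)" "\<gamma> \<in> carrier (D1 C)" "a \<in> carrier (D1 C)" "b \<in> carrier (D1 C)"
    using ob by (simp_all add: \<beta>_def \<gamma>_def a_def b_def)
  have swap: "?br u v \<otimes>\<^bsub>D1 C\<^esub> t = t \<otimes>\<^bsub>D1 C\<^esub> ?br u v"
    if "u \<in> carrier (D0 C)" "v \<in> carrier (D0 C)" "t \<in> carrier (D1 C)" for u v t
    using Q.w_central[of "dt C u v" t] that by (simp add: sqbr_def ab_tensor_elt_closed)
  \<comment> \<open>The two relations list the quotients in opposite orders, but the brackets agree
    because their values commute.\<close>
  have \<beta>': "?br (?o (Src C j\<^sub>1)) (inv\<^bsub>D0 C\<^esub> ?o (Tgt C q) \<otimes>\<^bsub>D0 C\<^esub> ?o (Tgt C m) \<otimes>\<^bsub>D0 C\<^esub> ?o (Tgt C q\<^sub>1)) = \<beta>"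
    using ob by (simp add: \<beta>_def src_tgt mA Q.br.add_right Q.br.inv_right Q.G1.m_assoc
        swap[of "?o (Src C i\<^sub>1)" "?o (Tgt C p\<^sub>1)" "?br (?o (Src C i\<^sub>1)) (?o (Src C i\<^sub>3))"])
  have xm: "x \<otimes>\<^bsub>D1 C\<^esub> D_cs C k m = D_cs C i\<^sub>2 p\<^sub>2 \<otimes>\<^bsub>D1 C\<^esub> D_cs C j\<^sub>3 q\<^sub>3 \<otimes>\<^bsub>D1 C\<^esub> a"
    using xm by (simp only: x_def a_def)
  have xn: "x \<otimes>\<^bsub>D1 C\<^esub> D_cs C h n = D_cs C j\<^sub>2 q\<^sub>2 \<otimes>\<^bsub>D1 C\<^esub> D_cs C i\<^sub>3 p\<^sub>3 \<otimes>\<^bsub>D1 C\<^esub> b"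
    using xn by (simp only: x_def b_def comm(4))
  have c1: "D_cs C k m \<otimes>\<^bsub>D1 C\<^esub> D_cs C j\<^sub>1 q\<^sub>1 = y \<otimes>\<^bsub>D1 C\<^esub> D_cs C \<kappa>\<^sub>1 s\<^sub>1 \<otimes>\<^bsub>D1 C\<^esub> \<beta>"
    using c1 by (simp only: \<beta>' y_def)
  have c2: "D_cs C h n \<otimes>\<^bsub>D1 C\<^esub> D_cs C i\<^sub>1 p\<^sub>1 = y \<otimes>\<^bsub>D1 C\<^esub> D_cs C \<kappa>\<^sub>2 s\<^sub>2 \<otimes>\<^bsub>D1 C\<^esub> \<beta>"
    using c2 by (simp only: \<beta>_def y_def nA P(9))
  have c3: "D_cs C \<kappa>\<^sub>1 s\<^sub>1 = D_cs C \<kappa>\<^sub>2 s\<^sub>2 \<otimes>\<^bsub>D1 C\<^esub> \<gamma>" using c3 by (simp add: \<gamma>_def)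
  have "D_cs C i\<^sub>2 p\<^sub>2 \<otimes>\<^bsub>D1 C\<^esub> D_cs C j\<^sub>3 q\<^sub>3 \<otimes>\<^bsub>D1 C\<^esub> D_cs C j\<^sub>1 q\<^sub>1 \<otimes>\<^bsub>D1 C\<^esub> a
      = D_cs C i\<^sub>2 p\<^sub>2 \<otimes>\<^bsub>D1 C\<^esub> D_cs C j\<^sub>3 q\<^sub>3 \<otimes>\<^bsub>D1 C\<^esub> (a \<otimes>\<^bsub>D1 C\<^esub> D_cs C j\<^sub>1 q\<^sub>1)"
    using swap[of "?o (Tgt C j\<^sub>1)" "bd C (D_cs C j\<^sub>3 q\<^sub>3)" "D_cs C j\<^sub>1 q\<^sub>1"] ob
    by (simp add: Q.G1.m_assoc flip: a_def)
  also have "\<dots> = x \<otimes>\<^bsub>D1 C\<^esub> (D_cs C k m \<otimes>\<^bsub>D1 C\<^esub> D_cs C j\<^sub>1 q\<^sub>1)"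
    using xm by (simp flip: Q.G1.m_assoc)
  also have "\<dots> = x \<otimes>\<^bsub>D1 C\<^esub> (y \<otimes>\<^bsub>D1 C\<^esub> D_cs C \<kappa>\<^sub>2 s\<^sub>2 \<otimes>\<^bsub>D1 C\<^esub> (\<gamma> \<otimes>\<^bsub>D1 C\<^esub> \<beta>))"
    by (simp add: c1 c3 Q.G1.m_assoc)
  also have "\<gamma> \<otimes>\<^bsub>D1 C\<^esub> \<beta> = \<beta> \<otimes>\<^bsub>D1 C\<^esub> \<gamma>"
    using swap[OF ob(3,4) cl'(1)] by (simp flip: \<gamma>_def)
  also have "x \<otimes>\<^bsub>D1 C\<^esub> (y \<otimes>\<^bsub>D1 C\<^esub> D_cs C \<kappa>\<^sub>2 s\<^sub>2 \<otimes>\<^bsub>D1 C\<^esub> (\<beta> \<otimes>\<^bsub>D1 C\<^esub> \<gamma>))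
      = x \<otimes>\<^bsub>D1 C\<^esub> (D_cs C h n \<otimes>\<^bsub>D1 C\<^esub> D_cs C i\<^sub>1 p\<^sub>1) \<otimes>\<^bsub>D1 C\<^esub> \<gamma>"
    by (simp add: c2 Q.G1.m_assoc)
  also have "\<dots> = D_cs C j\<^sub>2 q\<^sub>2 \<otimes>\<^bsub>D1 C\<^esub> D_cs C i\<^sub>3 p\<^sub>3 \<otimes>\<^bsub>D1 C\<^esub> (b \<otimes>\<^bsub>D1 C\<^esub> D_cs C i\<^sub>1 p\<^sub>1) \<otimes>\<^bsub>D1 C\<^esub> \<gamma>"
    using xn by (simp flip: Q.G1.m_assoc)
  also have "b \<otimes>\<^bsub>D1 C\<^esub> D_cs C i\<^sub>1 p\<^sub>1 = D_cs C i\<^sub>1 p\<^sub>1 \<otimes>\<^bsub>D1 C\<^esub> b"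
    unfolding b_def by (rule swap) (use ob in simp_all)
  finally show ?thesis by (simp add: Q.G1.m_assoc flip: a_def b_def \<gamma>_def)
qed

end

section \<open>The product morphisms\<close>

context biexact
begin

lemmas DC0 = Dsg_D0sg[OF WC.waldhausen_category_axioms]
lemmas DC1 = Dsg_D1sg[OF WC.waldhausen_category_axioms]
lemmas DD0 = Dsg_D0sg[OF WD.waldhausen_category_axioms]
lemmas DD1 = Dsg_D1sg[OF WD.waldhausen_category_axioms]
lemmas DE0 = Dsg_D0sg[OF WE.waldhausen_category_axioms]
lemmas DE1 = Dsg_D1sg[OF WE.waldhausen_category_axioms]

text \<open>P(x\<otimes>x') is [x',x] and F is additive in x, so the value is a commutator in the
  target, that is, P of a tensor of degree 0 images.\<close>

lemma P_left_D0:
  assumes N: "Dsg D N dN" and Z: "Dsg E Z dZ"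
    and Fh: "(\<lambda>x. F x y) \<in> hom (D0 C) (sge Z)"
    and dF: "\<And>x. x \<in> carrier (D0 C) \<Longrightarrow> dZ (F x y) = F0 x (dN y)"
    and a: "a \<in> carrier (DE C)" and y: "y \<in> carrier (sge N)"
  shows "F (bd C (dw C a)) y = sgP Z (ph a (dt D (dN y) (dN y)))"
proof -
  interpret N: Dsg D N dN by fact
  interpret Z: Dsg E Z dZ by fact
  interpret F: group_hom "D0 C" "sge Z" "\<lambda>x. F x y"
    by (intro group_homI Fh WC.Q.G0.is_group Z.G.is_group)
  show ?thesis
  proof (rule ab_tensor_hom_eqI[OF Z.G.is_group _ _ _ a])
    show "(\<lambda>a. F (bd C (dw C a)) y) \<in> hom (DE C) (sge Z)" by (rule homI) simp_all
    show "(\<lambda>a. sgP Z (ph a (dt D (dN y) (dN y)))) \<in> hom (DE C) (sge Z)"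
      by (rule homI) (use y in \<open>simp_all add: ph.add_left\<close>)
    fix x x' assume x: "x \<in> carrier (D0 C)" "x' \<in> carrier (D0 C)"
    then have "F (bd C (dw C (dt C x x'))) y = gcommutator (sge Z) (F x' y) (F x y)"
      using WC.Q.d_br[of x x'] F.hom_gcommutator[of x' x] by (simp add: sqbr_def)
    then show "F (bd C (dw C (dt C x x'))) y = sgP Z (ph (dt C x x') (dt D (dN y) (dN y)))"
      using x y by (simp add: Z.gcommutator_dt dF ph_dt)
  qed
qed

text \<open>The relation not yet available is the one for x\<circledcirc>P(b). Both sides are
  additive in x, and at an object \<Delta>(A) = A\<otimes>A while A \<and> - preserves
  commutators.\<close>

lemma phi00_exists:
  obtains f where "f \<in> sg_hom (D0sg C \<circledcirc> D0sg D) (D0sg E)" "snd f = phi"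
    and "\<And>x y. x \<in> carrier (D0 C) \<Longrightarrow> y \<in> carrier (D0 D) \<Longrightarrow>
       fst f (circ_elt (D0sg C) (D0sg D) x y) = F0 x y"
proof -
  have P: "F0 x (bd D (dw D b)) = bd E (dw E (ph (WC.DD x) b))"
    if x: "x \<in> carrier (D0 C)" and b: "b \<in> carrier (DE D)" for x b
  proof (rule WC.D0_hom_eqI[OF WE.Q.G0.is_group F0_hom _ _ x])
    show "(\<lambda>x. bd E (dw E (ph (WC.DD x) b))) \<in> hom (D0 C) (D0 E)"
      by (rule homI) (use b in \<open>simp_all add: WC.DD_mult ph.add_left\<close>)
    fix A assume A: "A \<in> Obj C"
    interpret L: group_hom "D0 D" "D0 E" "L0 A"
      by (intro group_homI L_hom A WD.Q.G0.is_group WE.Q.G0.is_group)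
    have "L0 A (bd D (dw D b)) = bd E (dw E (ph (dt C (D_ob C A) (D_ob C A)) b))"
    proof (rule ab_tensor_hom_eqI[OF WE.Q.G0.is_group _ _ _ b])
      show "(\<lambda>b. L0 A (bd D (dw D b))) \<in> hom (DE D) (D0 E)" by (rule homI) simp_all
      show "(\<lambda>b. bd E (dw E (ph (dt C (D_ob C A) (D_ob C A)) b))) \<in> hom (DE D) (D0 E)"
        by (rule homI) (use A in \<open>simp_all add: ph.add_right\<close>)
      fix y y' assume y: "y \<in> carrier (D0 D)" "y' \<in> carrier (D0 D)"
      then show "L0 A (bd D (dw D (dt D y y'))) = bd E (dw E (ph (dt C (D_ob C A) (D_ob C A)) (dt D y y')))"
        using A WD.Q.d_br[of y y'] L.hom_gcommutator[of y' y] WE.Q.d_br[of "L0 A y" "L0 A y'"]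
        by (simp add: sqbr_def ph_dt F0_ob)
    qed
    then show "F0 (D_ob C A) (bd D (dw D b)) = bd E (dw E (ph (WC.DD (D_ob C A)) b))"
      using A b by (simp add: F0_ob WC.DD_ob)
  qed (use b in simp)
  show thesis
    by (rule phi_morphism_exists[OF DC0 DD0 DE0, of F0])
      (use that P P_left_D0[OF DD0 DE0, of F0] F0_hom in \<open>auto simp: F0_mult F0_right\<close>)
qed

section \<open>Products of one degree 0 and one degree 1 argument\<close>

lemma F1_mult: "x \<in> carrier (D0 C) \<Longrightarrow> x' \<in> carrier (D0 C) \<Longrightarrow> c \<in> carrier (D1 D) \<Longrightarrow>
    F1 (x \<otimes>\<^bsub>D0 C\<^esub> x') c = F1 x c \<otimes>\<^bsub>D1 E\<^esub> F1 x' c"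
  using F1_hom[of c] by (auto simp: hom_def)

lemma bd_F1:
  assumes x: "x \<in> carrier (D0 C)" and c: "c \<in> carrier (D1 D)"
  shows "bd E (F1 x c) = F0 x (bd D c)"
proof (rule WC.D0_hom_eqI[OF WE.Q.G0.is_group _ F0_hom _ x])
  show "(\<lambda>x. bd E (F1 x c)) \<in> hom (D0 C) (D0 E)"
    by (rule homI) (use c in \<open>simp_all add: F1_mult\<close>)
qed (use c in \<open>simp_all add: F1_ob F0_ob exact_fun.ind_bd[OF exact_left]\<close>)

lemma F1_right:
  "x \<in> carrier (D0 C) \<Longrightarrow> c \<in> carrier (D1 D) \<Longrightarrow> c' \<in> carrier (D1 D) \<Longrightarrow>
     F1 x (c \<otimes>\<^bsub>D1 D\<^esub> c') = F1 x c \<otimes>\<^bsub>D1 E\<^esub> F1 x c' \<otimes>\<^bsub>D1 E\<^esub> dw E (ph (D0_H C x) (dt D (bd D c) (bd D c')))"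
  using quadratic_right[OF DD1 DE1, of F1 x c c'] F1_hom L_hom(2)
  by (simp add: F1_ob hom_mult bd_F1)

lemma F1_P_left:
  "a \<in> carrier (DE C) \<Longrightarrow> c \<in> carrier (D1 D) \<Longrightarrow>
     F1 (bd C (dw C a)) c = dw E (ph a (dt D (bd D c) (bd D c)))"
  using P_left_D0[OF DD1 DE1, of F1 c a] F1_hom by (simp add: bd_F1)

text \<open>As in degree 0, with preservation of brackets by A \<and> - in place of preservation of
  commutators.\<close>

lemma F1_P_right:
  assumes x: "x \<in> carrier (D0 C)" and b: "b \<in> carrier (DE D)"
  shows "F1 x (dw D b) = dw E (ph (WC.DD x) b)"
proof (rule WC.D0_hom_eqI[OF WE.Q.G1.is_group F1_hom _ _ x])
  show "(\<lambda>x. dw E (ph (WC.DD x) b)) \<in> hom (D0 C) (D1 E)"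
    by (rule homI) (use b in \<open>simp_all add: WC.DD_mult ph.add_left\<close>)
  fix A assume A: "A \<in> Obj C"
  interpret L: group_hom "D1 D" "D1 E" "L1 A"
    by (intro group_homI L_hom A WD.Q.G1.is_group WE.Q.G1.is_group)
  have "L1 A (dw D b) = dw E (ph (dt C (D_ob C A) (D_ob C A)) b)"
  proof (rule ab_tensor_hom_eqI[OF WE.Q.G1.is_group _ _ _ b])
    show "(\<lambda>b. L1 A (dw D b)) \<in> hom (DE D) (D1 E)" by (rule homI) simp_all
    show "(\<lambda>b. dw E (ph (dt C (D_ob C A) (D_ob C A)) b)) \<in> hom (DE D) (D1 E)"
      by (rule homI) (use A in \<open>simp_all add: ph.add_right\<close>)
  qed (use A in \<open>simp add: ph_dt F0_ob exact_fun.ind_br[OF exact_left]\<close>)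
  then show "F1 (D_ob C A) (dw D b) = dw E (ph (WC.DD (D_ob C A)) b)"
    using A b by (simp add: F1_ob WC.DD_ob)
qed (use b in simp)

lemma phi01_exists:
  obtains f where "f \<in> sg_hom (D0sg C \<circledcirc> D1sg D) (D1sg E)" "snd f = phi"
    and "\<And>x y. x \<in> carrier (D0 C) \<Longrightarrow> y \<in> carrier (D1 D) \<Longrightarrow>
       fst f (circ_elt (D0sg C) (D1sg D) x y) = F1 x y"
  by (rule phi_morphism_exists[OF DC0 DD1 DE1, of F1])
    (use that in \<open>auto simp: F1_mult F1_right F1_P_left F1_P_right bd_F1\<close>)

text \<open>For \<open>c\<close> of degree 1 the product with \<open>c\<close> is quadratic, not additive, in the other variable;
  it is prescribed on objects by the functors \<open>- \<and> B\<close>.\<close>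

definition "\<beta> c y y' = dw E (ph (D0_H C (bd C c)) (dt D y y'))"

definition F2 where
  "F2 c = (SOME h. (\<forall>y\<in>carrier (D0 D). h y \<in> carrier (D1 E)) \<and>
     (\<forall>y\<in>carrier (D0 D). \<forall>y'\<in>carrier (D0 D). h (y \<otimes>\<^bsub>D0 D\<^esub> y') = h y \<otimes>\<^bsub>D1 E\<^esub> h y' \<otimes>\<^bsub>D1 E\<^esub> \<beta> c y y') \<and>
     (\<forall>B\<in>Obj D. h (D_ob D B) = R1 B c))"

lemma \<beta>_closed [simp]:
  "c \<in> carrier (D1 C) \<Longrightarrow> y \<in> carrier (D0 D) \<Longrightarrow> y' \<in> carrier (D0 D) \<Longrightarrow> \<beta> c y y' \<in> carrier (D1 E)"
  by (simp add: \<beta>_def)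

lemma \<beta>_cocycle:
  assumes c: "c \<in> carrier (D1 C)" shows "central_cocycle (D1 E) (D0 D) (\<beta> c)"
proof -
  interpret biadditive_map "D0 D" "D0 D" "D1 E" "\<beta> c"
    by (intro biadditive_mapI biadditiveI WD.Q.G0.is_group WE.Q.G1.is_group)
      (use c in \<open>simp_all add: \<beta>_def WD.Q.e.add_left WD.Q.e.add_right ph.add_right\<close>)
  show ?thesis
    by unfold_locales (use c in \<open>simp add: \<beta>_def WE.Q.w_central\<close>)
qed

lemma R1_closed: "B \<in> Obj D \<Longrightarrow> c \<in> carrier (D1 C) \<Longrightarrow> R1 B c \<in> carrier (D1 E)"
  using exact_fun.ind1_hom[OF exact_right] by (auto simp: hom_def)

lemma F2_closed [simp]: "c \<in> carrier (D1 C) \<Longrightarrow> y \<in> carrier (D0 D) \<Longrightarrow> F2 c y \<in> carrier (D1 E)"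
  and F2_right: "c \<in> carrier (D1 C) \<Longrightarrow> y \<in> carrier (D0 D) \<Longrightarrow> y' \<in> carrier (D0 D) \<Longrightarrow>
     F2 c (y \<otimes>\<^bsub>D0 D\<^esub> y') = F2 c y \<otimes>\<^bsub>D1 E\<^esub> F2 c y' \<otimes>\<^bsub>D1 E\<^esub> \<beta> c y y'"
  and F2_ob: "c \<in> carrier (D1 C) \<Longrightarrow> B \<in> Obj D \<Longrightarrow> F2 c (D_ob D B) = R1 B c"
proof -
  have "\<exists>h. (\<forall>y\<in>carrier (D0 D). h y \<in> carrier (D1 E)) \<and>
     (\<forall>y\<in>carrier (D0 D). \<forall>y'\<in>carrier (D0 D). h (y \<otimes>\<^bsub>D0 D\<^esub> y') = h y \<otimes>\<^bsub>D1 E\<^esub> h y' \<otimes>\<^bsub>D1 E\<^esub> \<beta> c y y') \<and>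
     (\<forall>B\<in>Obj D. h (D_ob D B) = R1 B c)" if c: "c \<in> carrier (D1 C)"
  proof (rule WD.D0_quadratic_lift[OF WE.Q.sq1_nil2 \<beta>_cocycle[OF c], of "\<lambda>B. R1 B c"])
    show "R1 (Zero D) c = \<one>\<^bsub>D1 E\<^esub>" by (rule R_Zero[OF c])
  qed (use R1_closed c in blast)+
  note props = someI_ex[OF this, folded F2_def]
  show "c \<in> carrier (D1 C) \<Longrightarrow> y \<in> carrier (D0 D) \<Longrightarrow> F2 c y \<in> carrier (D1 E)"
    "c \<in> carrier (D1 C) \<Longrightarrow> y \<in> carrier (D0 D) \<Longrightarrow> y' \<in> carrier (D0 D) \<Longrightarrow>
     F2 c (y \<otimes>\<^bsub>D0 D\<^esub> y') = F2 c y \<otimes>\<^bsub>D1 E\<^esub> F2 c y' \<otimes>\<^bsub>D1 E\<^esub> \<beta> c y y'"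
    "c \<in> carrier (D1 C) \<Longrightarrow> B \<in> Obj D \<Longrightarrow> F2 c (D_ob D B) = R1 B c"
    using props by blast+
qed

text \<open>Both sides have the deviation \<partial>\<beta> in y, and on an object B both come from
  the functor - \<and> B.\<close>

lemma bd_F2:
  assumes c: "c \<in> carrier (D1 C)" and y: "y \<in> carrier (D0 D)"
  shows "bd E (F2 c y) = F0 (bd C c) y"
  by (rule WD.D0_quadratic_eqI[OF WE.Q.G0.is_group _ _ _ _ _ _ y, where \<beta> = "\<lambda>y y'. bd E (\<beta> c y y')"])
    (use c in \<open>simp_all add: F2_right F0_right \<beta>_def F2_ob F0_right_ob exact_fun.ind_bd[OF exact_right] R1_closed\<close>)

text \<open>Additivity in c survives the extension over y: exchanging \<open>F2 c y'\<close> with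
  \<open>F2 c' y\<close> costs the cross term of H at \<partial>c + \<partial>c', so both sides have
  the deviation of c + c'.\<close>

lemma F2_mult:
  assumes c: "c \<in> carrier (D1 C)" "c' \<in> carrier (D1 C)" and y: "y \<in> carrier (D0 D)"
  shows "F2 (c \<otimes>\<^bsub>D1 C\<^esub> c') y = F2 c y \<otimes>\<^bsub>D1 E\<^esub> F2 c' y"
proof (rule WD.D0_quadratic_eqI[OF WE.Q.G1.is_group _ _ _ _ _ _ y, where \<beta> = "\<beta> (c \<otimes>\<^bsub>D1 C\<^esub> c')"])
  interpret E1: Dsg E "D1sg E" "bd E" by (rule DE1)
  fix y y' assume y: "y \<in> carrier (D0 D)" "y' \<in> carrier (D0 D)"
  have "F2 c y \<otimes>\<^bsub>D1 E\<^esub> F2 c y' \<otimes>\<^bsub>D1 E\<^esub> \<beta> c y y' \<otimes>\<^bsub>D1 E\<^esub> (F2 c' y \<otimes>\<^bsub>D1 E\<^esub> F2 c' y' \<otimes>\<^bsub>D1 E\<^esub> \<beta> c' y y')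
      = F2 c y \<otimes>\<^bsub>D1 E\<^esub> F2 c' y \<otimes>\<^bsub>D1 E\<^esub> (F2 c y' \<otimes>\<^bsub>D1 E\<^esub> F2 c' y') \<otimes>\<^bsub>D1 E\<^esub> \<beta> (c \<otimes>\<^bsub>D1 C\<^esub> c') y y'"
    using E1.shuffle[of "F2 c y" "F2 c y'" "F2 c' y" "F2 c' y'" "ph (D0_H C (bd C c)) (dt D y y')"
        "ph (D0_H C (bd C c')) (dt D y y')"] c y
    by (simp add: \<beta>_def bd_F2 WC.D0_H_mult ph.add_left ph_dt)
  then show "F2 c (y \<otimes>\<^bsub>D0 D\<^esub> y') \<otimes>\<^bsub>D1 E\<^esub> F2 c' (y \<otimes>\<^bsub>D0 D\<^esub> y')
      = F2 c y \<otimes>\<^bsub>D1 E\<^esub> F2 c' y \<otimes>\<^bsub>D1 E\<^esub> (F2 c y' \<otimes>\<^bsub>D1 E\<^esub> F2 c' y') \<otimes>\<^bsub>D1 E\<^esub> \<beta> (c \<otimes>\<^bsub>D1 C\<^esub> c') y y'"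
    using c y by (simp add: F2_right)
next
  fix B assume B: "B \<in> Obj D"
  then show "F2 (c \<otimes>\<^bsub>D1 C\<^esub> c') (D_ob D B) = F2 c (D_ob D B) \<otimes>\<^bsub>D1 E\<^esub> F2 c' (D_ob D B)"
    using c hom_mult[OF exact_fun.ind1_hom[OF exact_right[OF B]], of c c'] by (simp add: F2_ob)
qed (use c in \<open>simp_all add: F2_right\<close>)

text \<open>In y the right side has as deviation a paired with y\<otimes>y' + y'\<otimes>y. On the
  left H\<partial>\<omega>(a) = a + T(a), and under \<omega> the summand T(a) amounts to reversing y
  and y'.\<close>

lemma F2_P_left:
  assumes a: "a \<in> carrier (DE C)" and y: "y \<in> carrier (D0 D)"
  shows "F2 (dw C a) y = dw E (ph a (dt D y y))"
proof (rule WD.D0_quadratic_eqI[OF WE.Q.G1.is_group _ _ _ _ _ _ y, where \<beta> = "\<beta> (dw C a)"])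
  fix y y' assume y: "y \<in> carrier (D0 D)" "y' \<in> carrier (D0 D)"
  have "dw E (ph (WC.TT a) (dt D y y')) = dw E (ph a (dt D y' y))"
    using P_ph_TT[OF DE1 a y] by simp
  then have "\<beta> (dw C a) y y' = dw E (ph a (dt D y y') \<otimes>\<^bsub>DE E\<^esub> ph a (dt D y' y))"
    using a y by (simp add: \<beta>_def WC.D0_H_bd_w ph.add_left)
  then have "dw E (ph a (dt D y y)) \<otimes>\<^bsub>D1 E\<^esub> dw E (ph a (dt D y' y')) \<otimes>\<^bsub>D1 E\<^esub> \<beta> (dw C a) y y'
      = dw E (ph a (dt D y y) \<otimes>\<^bsub>DE E\<^esub> ph a (dt D y' y') \<otimes>\<^bsub>DE E\<^esub> (ph a (dt D y y') \<otimes>\<^bsub>DE E\<^esub> ph a (dt D y' y)))"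
    using a y by simp
  also have "\<dots> = dw E (ph a (dt D (y \<otimes>\<^bsub>D0 D\<^esub> y') (y \<otimes>\<^bsub>D0 D\<^esub> y')))"
    using a y by (simp add: WD.Q.e.add_left WD.Q.e.add_right ph.add_right WE.Q.T.m_ac del: WE.Q.w.hom_mult)
  finally show "dw E (ph a (dt D (y \<otimes>\<^bsub>D0 D\<^esub> y') (y \<otimes>\<^bsub>D0 D\<^esub> y')))
      = dw E (ph a (dt D y y)) \<otimes>\<^bsub>D1 E\<^esub> dw E (ph a (dt D y' y')) \<otimes>\<^bsub>D1 E\<^esub> \<beta> (dw C a) y y'" by simp
next
  fix B assume B: "B \<in> Obj D"
  interpret R: group_hom "D1 C" "D1 E" "R1 B"
    by (intro group_homI exact_fun.ind1_hom[OF exact_right] B WC.Q.G1.is_group WE.Q.G1.is_group)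
  have "R1 B (dw C a) = dw E (ph a (dt D (D_ob D B) (D_ob D B)))"
  proof (rule ab_tensor_hom_eqI[OF WE.Q.G1.is_group _ _ _ a])
    show "(\<lambda>a. R1 B (dw C a)) \<in> hom (DE C) (D1 E)" by (rule homI) simp_all
    show "(\<lambda>a. dw E (ph a (dt D (D_ob D B) (D_ob D B)))) \<in> hom (DE C) (D1 E)"
      by (rule homI) (use B in \<open>simp_all add: ph.add_left\<close>)
  qed (use B in \<open>simp add: ph_dt F0_right_ob exact_fun.ind_br[OF exact_right]\<close>)
  then show "F2 (dw C a) (D_ob D B) = dw E (ph a (dt D (D_ob D B) (D_ob D B)))"
    using a B by (simp add: F2_ob)
qed (use a in \<open>simp_all add: F2_right\<close>)

text \<open>Apply the quadratic law to y' + y = y + y' + [y',y]. The commutator has no deviation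
  against y + y', and exchanging \<open>F2 c y'\<close> with \<open>F2 c y\<close> contributes the
  first tensor.\<close>

lemma F2_gcommutator:
  assumes c: "c \<in> carrier (D1 C)" and y: "y \<in> carrier (D0 D)" "y' \<in> carrier (D0 D)"
  shows "F2 c (gcommutator (D0 D) y' y) = dw E (dt E (F0 (bd C c) y) (F0 (bd C c) y') \<otimes>\<^bsub>DE E\<^esub>
      ph (D0_H C (bd C c)) (dt D y' y) \<otimes>\<^bsub>DE E\<^esub> inv\<^bsub>DE E\<^esub> ph (D0_H C (bd C c)) (dt D y y'))"
proof -
  interpret E1: Dsg E "D1sg E" "bd E" by (rule DE1)
  let ?k = "gcommutator (D0 D) y' y" and ?h = "D0_H C (bd C c)"
  let ?p = "ph ?h (dt D y y')" and ?q = "ph ?h (dt D y' y)" and ?r = "dt E (F0 (bd C c) y) (F0 (bd C c) y')"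
  note [simp] = c y
  have "F2 c (y' \<otimes>\<^bsub>D0 D\<^esub> y) = F2 c (y \<otimes>\<^bsub>D0 D\<^esub> y' \<otimes>\<^bsub>D0 D\<^esub> ?k)"
    by (subst WD.Q.G0.gcommutator_swap) simp_all
  then have "F2 c y' \<otimes>\<^bsub>D1 E\<^esub> F2 c y \<otimes>\<^bsub>D1 E\<^esub> dw E ?q
      = F2 c y \<otimes>\<^bsub>D1 E\<^esub> F2 c y' \<otimes>\<^bsub>D1 E\<^esub> (dw E ?p \<otimes>\<^bsub>D1 E\<^esub> F2 c ?k)"
    by (simp add: F2_right \<beta>_def WD.Q.tensor_gcommutator WE.Q.G1.m_assoc)
  moreover have "F2 c y' \<otimes>\<^bsub>D1 E\<^esub> F2 c y = F2 c y \<otimes>\<^bsub>D1 E\<^esub> F2 c y' \<otimes>\<^bsub>D1 E\<^esub> dw E ?r"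
    using E1.swap_dt[of "F2 c y'" "F2 c y"] by (simp add: bd_F2)
  ultimately have "F2 c y \<otimes>\<^bsub>D1 E\<^esub> F2 c y' \<otimes>\<^bsub>D1 E\<^esub> (dw E ?r \<otimes>\<^bsub>D1 E\<^esub> dw E ?q)
      = F2 c y \<otimes>\<^bsub>D1 E\<^esub> F2 c y' \<otimes>\<^bsub>D1 E\<^esub> (dw E ?p \<otimes>\<^bsub>D1 E\<^esub> F2 c ?k)"
    by (simp add: WE.Q.G1.m_assoc)
  then have "dw E ?r \<otimes>\<^bsub>D1 E\<^esub> dw E ?q = dw E ?p \<otimes>\<^bsub>D1 E\<^esub> F2 c ?k"
    by (subst (asm) WE.Q.G1.Units_l_cancel) simp_all
  also have "\<dots> = F2 c ?k \<otimes>\<^bsub>D1 E\<^esub> dw E ?p" by (simp add: WE.Q.w_central)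
  finally show ?thesis by (simp add: WE.Q.G1.m_assoc)
qed

text \<open>On a generator \<partial>\<omega>(y\<otimes>y') = [y',y], and the terms found for it are
  those of \<Delta>(\<partial>c) = (\<partial>c|\<partial>c) - H(\<partial>c) + TH(\<partial>c), the
  last one after reversing y and y'.\<close>

lemma F2_P_right:
  assumes c: "c \<in> carrier (D1 C)" and b: "b \<in> carrier (DE D)"
  shows "F2 c (bd D (dw D b)) = dw E (ph (WC.DD (bd C c)) b)"
proof (rule ab_tensor_hom_eqI[OF WE.Q.G1.is_group _ _ _ b])
  show "(\<lambda>b. F2 c (bd D (dw D b))) \<in> hom (DE D) (D1 E)"
    by (rule homI) (use c in \<open>simp_all add: F2_right \<beta>_def WD.Q.tensor_dw\<close>)
  show "(\<lambda>b. dw E (ph (WC.DD (bd C c)) b)) \<in> hom (DE D) (D1 E)"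
    by (rule homI) (use c in \<open>simp_all add: ph.add_right\<close>)
  fix y y' assume y: "y \<in> carrier (D0 D)" "y' \<in> carrier (D0 D)"
  let ?h = "D0_H C (bd C c)"
  let ?p = "ph ?h (dt D y y')" and ?q = "ph ?h (dt D y' y)" and ?r = "dt E (F0 (bd C c) y) (F0 (bd C c) y')"
  have T: "dw E (ph (WC.TT ?h) (dt D y y')) = dw E ?q"
    using P_ph_TT[OF DE1 _ y, of ?h] c by simp
  have "ph (WC.DD (bd C c)) (dt D y y') = ?r \<otimes>\<^bsub>DE E\<^esub> inv\<^bsub>DE E\<^esub> ?p \<otimes>\<^bsub>DE E\<^esub> ph (WC.TT ?h) (dt D y y')"
    using c y by (simp add: WC.DD_def ph.add_left ph.inv_left ph_dt)
  then have "dw E (ph (WC.DD (bd C c)) (dt D y y')) = dw E (?r \<otimes>\<^bsub>DE E\<^esub> inv\<^bsub>DE E\<^esub> ?p \<otimes>\<^bsub>DE E\<^esub> ?q)"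
    using c y by (simp add: T)
  also have "?r \<otimes>\<^bsub>DE E\<^esub> inv\<^bsub>DE E\<^esub> ?p \<otimes>\<^bsub>DE E\<^esub> ?q = ?r \<otimes>\<^bsub>DE E\<^esub> ?q \<otimes>\<^bsub>DE E\<^esub> inv\<^bsub>DE E\<^esub> ?p"
    using c y by (simp add: WE.Q.T.m_ac)
  finally show "F2 c (bd D (dw D (dt D y y'))) = dw E (ph (WC.DD (bd C c)) (dt D y y'))"
    using F2_gcommutator[OF c y] WD.Q.d_br[of y y'] y by (simp add: sqbr_def)
qed

lemma phi10_exists:
  obtains f where "f \<in> sg_hom (D1sg C \<circledcirc> D0sg D) (D1sg E)" "snd f = phi"
    and "\<And>x y. x \<in> carrier (D1 C) \<Longrightarrow> y \<in> carrier (D0 D) \<Longrightarrow>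
       fst f (circ_elt (D1sg C) (D0sg D) x y) = F2 x y"
  by (rule phi_morphism_exists[OF DC1 DD0 DE1, of F2])
    (use that in \<open>auto simp: F2_mult F2_right \<beta>_def F2_P_left F2_P_right bd_F2\<close>)

end


section \<open>Uniqueness\<close>

context waldhausen_category
begin

lemma DE_induct [consumes 1, case_names ob one mult inv]:
  assumes "a \<in> carrier (DE C)"
    and ob: "\<And>A B. A \<in> Obj C \<Longrightarrow> B \<in> Obj C \<Longrightarrow> R (dt C (D_ob C A) (D_ob C B))"
    and one: "R \<one>\<^bsub>DE C\<^esub>"
    and mult: "\<And>a b. a \<in> carrier (DE C) \<Longrightarrow> b \<in> carrier (DE C) \<Longrightarrow> R a \<Longrightarrow> R b \<Longrightarrow> R (a \<otimes>\<^bsub>DE C\<^esub> b)"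
    and inv: "\<And>a. a \<in> carrier (DE C) \<Longrightarrow> R a \<Longrightarrow> R (inv\<^bsub>DE C\<^esub> a)"
  shows "R a"
  using assms(1)
proof (induction rule: ab_tensor_induct)
  case (gen x y)
  have "R (dt C (D_ob C A) y)" if "A \<in> Obj C" for A
    using gen(2) by (induction rule: D0_induct)
      (simp_all add: that ob one mult inv Q.e.add_right Q.e.inv_right)
  with gen(1) show ?case
    by (induction rule: D0_induct) (simp_all add: gen(2) one mult inv Q.e.add_left Q.e.inv_left)
qed (simp_all add: one mult inv)

end

context biexact
begin

lemma phi_ee_eq:
  assumes g: "g \<in> hom (tensor_group (DE C) (DE D)) (DE E)" and "phi_ee C D E Fo g"
    and a: "a \<in> carrier (DE C)" and b: "b \<in> carrier (DE D)"
  shows "g (tensor_elt (DE C) (DE D) a b) = ph a b"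
proof -
  interpret g: group_hom "tensor_group (DE C) (DE D)" "DE E" g
    by (intro group_homI g WE.Q.T.is_group comm_group.axioms(2)[OF tensor_comm_group])
  interpret t: biadditive_map "DE C" "DE D" "tensor_group (DE C) (DE D)" "tensor_elt (DE C) (DE D)"
    by (intro biadditive_mapI tensor_biadditive WC.Q.T.is_group WD.Q.T.is_group WC.Q.T.is_monoid
        WD.Q.T.is_monoid comm_group.axioms(2)[OF tensor_comm_group])
  have ob: "g (tensor_elt (DE C) (DE D) (dt C (D_ob C A) (D_ob C A')) (dt D (D_ob D B) (D_ob D B')))
      = ph (dt C (D_ob C A) (D_ob C A')) (dt D (D_ob D B) (D_ob D B'))"
    if "A \<in> Obj C" "A' \<in> Obj C" "B \<in> Obj D" "B' \<in> Obj D" for A A' B B'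
    using assms(2) that by (simp add: phi_ee_def D_ee_def ph_dt F0_ob_ob D0sg_def)
  have 1: "g (tensor_elt (DE C) (DE D) (dt C (D_ob C A) (D_ob C A')) b) = ph (dt C (D_ob C A) (D_ob C A')) b"
    if A: "A \<in> Obj C" "A' \<in> Obj C" for A A'
    using b by (induction rule: WD.DE_induct)
      (simp_all add: A ob t.add_right t.inv_right ph.add_right ph.inv_right)
  show ?thesis
    using a by (induction rule: WC.DE_induct)
      (simp_all add: 1 b t.add_left t.inv_left ph.add_left ph.inv_left)
qed

lemma phi_phi_ee: "phi_ee C D E Fo phi"
  by (auto simp: phi_ee_def D_ee_def D0sg_def ph_dt F0_ob_ob simp flip: ph_def)

text \<open>The object values determine the \<open>ee\<close>-part, and with it the bars, which are
  P of tensors. Bars enter both the quadratic law and the relations for P.\<close>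

lemma morphism_snd:
  assumes M: "Dsg C M dM" and N: "Dsg D N dN" and Z: "Dsg E Z dZ"
    and f: "f \<in> sg_hom (M \<circledcirc> N) Z" and ee: "phi_ee C D E Fo (snd f)"
    and a: "a \<in> carrier (DE C)" and b: "b \<in> carrier (DE D)"
  shows "snd f (tensor_elt (DE C) (DE D) a b) = ph a b"
    and "fst f (bar_elt M N a b) = sgP Z (ph a b)"
proof -
  interpret M: Dsg C M dM by fact
  interpret N: Dsg D N dN by fact
  interpret Z: Dsg E Z dZ by fact
  interpret MN: square_group_pair M N by unfold_locales
  note F = sg_homD[OF f]
  have "snd f \<in> hom (tensor_group (DE C) (DE D)) (DE E)" using group_hom.homh[OF F(4)] by simp
  from phi_ee_eq[OF this ee a b] show 1: "snd f (tensor_elt (DE C) (DE D) a b) = ph a b" .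
  show "fst f (bar_elt M N a b) = sgP Z (ph a b)"
    using F(6)[of "MN.tt a b"] MN.pp_tt[of a b] tensor_elt_closed[OF a b] a b by (simp add: 1)
qed

text \<open>For an object A the symbol A\<circledcirc>y is additive in y because H(A) = 0, so values
  on pairs of objects determine the rest.\<close>

lemma phi00_value:
  assumes f: "is_phi00 C D E Fo f" and x: "x \<in> carrier (D0 C)" and y: "y \<in> carrier (D0 D)"
  shows "fst f (circ_elt (D0sg C) (D0sg D) x y) = F0 x y"
proof -
  interpret M: Dsg C "D0sg C" "\<lambda>x. x" by (rule DC0)
  interpret N: Dsg D "D0sg D" "\<lambda>x. x" by (rule DD0)
  interpret MN: square_group_pair "D0sg C" "D0sg D" by unfold_locales
  have fh: "f \<in> sg_hom (D0sg C \<circledcirc> D0sg D) (D0sg E)" and fe: "phi_ee C D E Fo (snd f)"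
    and fo: "\<And>A B. A \<in> Obj C \<Longrightarrow> B \<in> Obj D \<Longrightarrow> fst f (MN.cc (D_ob C A) (D_ob D B)) = D_ob E (Fo (A, B))"
    using f by (auto simp: is_phi00_def)
  interpret f: group_hom MN.K "D0 E" "fst f" using sg_homD(3)[OF fh] by simp
  show ?thesis
  proof (rule WC.D0_hom_eqI[OF WE.Q.G0.is_group _ F0_hom[OF y] _ x])
    show "(\<lambda>x. fst f (MN.cc x y)) \<in> hom (D0 C) (D0 E)"
      using MN.cc_closed MN.cc_add_left y by (intro homI) simp_all
    fix A assume A: "A \<in> Obj C"
    show "fst f (MN.cc (D_ob C A) y) = F0 (D_ob C A) y"
      unfolding F0_ob[OF A y]
    proof (rule WD.D0_hom_eqI[OF WE.Q.G0.is_group _ L_hom(1)[OF A] _ y])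
      show "(\<lambda>y. fst f (MN.cc (D_ob C A) y)) \<in> hom (D0 D) (D0 E)"
        using MN.cc_closed MN.cc_add_right MN.b.one_left A N.cross_eq by (intro homI) simp_all
    qed (use A fo in \<open>simp add: exact_fun.ind_ob[OF exact_left]\<close>)
  qed
qed

lemma phi01_value:
  assumes f: "is_phi01 C D E Fo Fm f" and x: "x \<in> carrier (D0 C)" and c: "c \<in> carrier (D1 D)"
  shows "fst f (circ_elt (D0sg C) (D1sg D) x c) = F1 x c"
proof -
  interpret M: Dsg C "D0sg C" "\<lambda>x. x" by (rule DC0)
  interpret N: Dsg D "D1sg D" "bd D" by (rule DD1)
  interpret MN: square_group_pair "D0sg C" "D1sg D" by unfold_locales
  have fh: "f \<in> sg_hom (D0sg C \<circledcirc> D1sg D) (D1sg E)" and fe: "phi_ee C D E Fo (snd f)"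
    and fwe: "\<And>A g. A \<in> Obj C \<Longrightarrow> g \<in> Weq D \<Longrightarrow> fst f (MN.cc (D_ob C A) (D_we D g)) = D_we E (Fm (Ide C A, g))"
    and fcs: "\<And>A i p. A \<in> Obj C \<Longrightarrow> cofseq D i p \<Longrightarrow> fst f (MN.cc (D_ob C A) (D_cs D i p))
          = D_cs E (Fm (Ide C A, i)) (Fm (Ide C A, p))"
    using f by (auto simp: is_phi01_def)
  note fs = morphism_snd[OF DC0 DD1 DE1 fh fe]
  interpret f: group_hom MN.K "D1 E" "fst f" using sg_homD(3)[OF fh] by simp
  show ?thesis
  proof (rule WC.D0_hom_eqI[OF WE.Q.G1.is_group _ F1_hom[OF c] _ x])
    show "(\<lambda>x. fst f (MN.cc x c)) \<in> hom (D0 C) (D1 E)"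
      using MN.cc_closed MN.cc_add_left c by (intro homI) simp_all
    fix A assume A: "A \<in> Obj C"
    have h: "(\<lambda>y. fst f (MN.cc (D_ob C A) y)) \<in> hom (D1 D) (D1 E)"
      using MN.cc_closed MN.cc_add_right MN.b.one_left A N.cross_eq by (intro homI) simp_all
    interpret h: group_hom "D1 D" "D1 E" "\<lambda>y. fst f (MN.cc (D_ob C A) y)"
      by (intro group_homI h WD.Q.G1.is_group WE.Q.G1.is_group)
    interpret L: group_hom "D1 D" "D1 E" "L1 A"
      by (intro group_homI L_hom A WD.Q.G1.is_group WE.Q.G1.is_group)
    have "fst f (MN.cc (D_ob C A) c) = L1 A c"
      using c
    proof (induction rule: WD.D1_induct)
      \<comment> \<open>Elements \<omega>(b) are not among the prescribed generators; the relation
        for x\<circledcirc>P(b) expresses their values through the \<open>ee\<close>-part.\<close>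
      case (w b)
      then have "fst f (MN.cc (D_ob C A) (dw D b)) = dw E (ph (WC.DD (D_ob C A)) b)"
        using MN.cc_P_right[of "D_ob C A" b] A fs(2) by (simp add: M.Delta_DD)
      then show ?case using F1_P_right[of "D_ob C A" b] w A by (simp add: F1_ob)
    qed (simp_all add: fwe fcs A exact_fun.ind_we[OF exact_left] exact_fun.ind_cs[OF exact_left])
    then show "fst f (MN.cc (D_ob C A) c) = F1 (D_ob C A) c" using A c by (simp add: F1_ob)
  qed
qed

text \<open>For fixed c the map in y obeys the same quadratic law as \<open>F2 c\<close>, so objects
  suffice; in c both sides are additive and are compared on generators and on values of
  \<omega>.\<close>

lemma phi10_value:
  assumes f: "is_phi10 C D E Fo Fm f" and c: "c \<in> carrier (D1 C)" and y: "y \<in> carrier (D0 D)"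
  shows "fst f (circ_elt (D1sg C) (D0sg D) c y) = F2 c y"
proof -
  interpret M: Dsg C "D1sg C" "bd C" by (rule DC1)
  interpret N: Dsg D "D0sg D" "\<lambda>x. x" by (rule DD0)
  interpret MN: square_group_pair "D1sg C" "D0sg D" by unfold_locales
  have fh: "f \<in> sg_hom (D1sg C \<circledcirc> D0sg D) (D1sg E)" and fe: "phi_ee C D E Fo (snd f)"
    and fwe: "\<And>B g. B \<in> Obj D \<Longrightarrow> g \<in> Weq C \<Longrightarrow> fst f (MN.cc (D_we C g) (D_ob D B)) = D_we E (Fm (g, Ide D B))"
    and fcs: "\<And>B i p. B \<in> Obj D \<Longrightarrow> cofseq C i p \<Longrightarrow> fst f (MN.cc (D_cs C i p) (D_ob D B))
          = D_cs E (Fm (i, Ide D B)) (Fm (p, Ide D B))"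
    using f by (auto simp: is_phi10_def)
  note fs = morphism_snd[OF DC1 DD0 DE1 fh fe]
  interpret f: group_hom MN.K "D1 E" "fst f" using sg_homD(3)[OF fh] by simp
  have fcl: "fst f (MN.cc c y) \<in> carrier (D1 E)" if "c \<in> carrier (D1 C)" "y \<in> carrier (D0 D)" for c y
    using MN.cc_closed that by simp
  have gen: "fst f (MN.cc c y) = F2 c y"
    if c: "c \<in> carrier (D1 C)" and g: "\<And>B. B \<in> Obj D \<Longrightarrow> fst f (MN.cc c (D_ob D B)) = R1 B c" for c
  proof (rule WD.D0_quadratic_eqI[OF WE.Q.G1.is_group _ _ _ _ _ _ y, where \<beta> = "\<beta> c"])
    fix y y' assume y: "y \<in> carrier (D0 D)" "y' \<in> carrier (D0 D)"
    have "fst f (MN.bb (D0_H C (bd C c)) (dt D y y')) = \<beta> c y y'"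
      using fs(2) c y by (simp add: \<beta>_def)
    then show "fst f (MN.cc c (y \<otimes>\<^bsub>D0 D\<^esub> y')) = fst f (MN.cc c y) \<otimes>\<^bsub>D1 E\<^esub> fst f (MN.cc c y') \<otimes>\<^bsub>D1 E\<^esub> \<beta> c y y'"
      using MN.cc_closed MN.cc_add_right[of c y y'] MN.bb_closed c y N.cross_eq by simp
  qed (use c g fcl in \<open>simp_all add: F2_right F2_ob\<close>)
  have h: "(\<lambda>c. fst f (MN.cc c y)) \<in> hom (D1 C) (D1 E)"
    using MN.cc_closed MN.cc_add_left y by (intro homI) simp_all
  interpret h: group_hom "D1 C" "D1 E" "\<lambda>c. fst f (MN.cc c y)"
    by (intro group_homI h WC.Q.G1.is_group WE.Q.G1.is_group)
  interpret F2: group_hom "D1 C" "D1 E" "\<lambda>c. F2 c y"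
    by (intro group_homI homI WC.Q.G1.is_group WE.Q.G1.is_group) (simp_all add: F2_mult y)
  show ?thesis
    using c
  proof (induction rule: WC.D1_induct)
    case (we g) then show ?case by (intro gen) (simp_all add: fwe exact_fun.ind_we[OF exact_right])
  next
    case (cs i p) then show ?case by (intro gen) (simp_all add: fcs exact_fun.ind_cs[OF exact_right])
  next
    case (w a)
    then show ?case using MN.cc_P_left[of a y] y fs(2) N.cross_eq by (simp add: F2_P_left)
  qed simp_all
qed

lemma ex1_phi00: "\<exists>!f. is_phi00 C D E Fo f"
proof (rule ex_ex1I)
  obtain f where "f \<in> sg_hom (D0sg C \<circledcirc> D0sg D) (D0sg E)" "snd f = phi"
    and "\<And>x y. x \<in> carrier (D0 C) \<Longrightarrow> y \<in> carrier (D0 D) \<Longrightarrow>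
       fst f (circ_elt (D0sg C) (D0sg D) x y) = F0 x y" by (rule phi00_exists) blast
  then have "is_phi00 C D E Fo f" by (simp add: is_phi00_def F0_ob_ob phi_phi_ee)
  then show "\<exists>f. is_phi00 C D E Fo f" ..
next
  fix f g assume fg: "is_phi00 C D E Fo f" "is_phi00 C D E Fo g"
  interpret M: Dsg C "D0sg C" "\<lambda>x. x" by (rule DC0)
  interpret N: Dsg D "D0sg D" "\<lambda>x. x" by (rule DD0)
  interpret MN: square_group_pair "D0sg C" "D0sg D" by unfold_locales
  show "f = g"
    by (rule MN.circ_sg_hom_eqI[of f "D0sg E" g])
      (use fg in \<open>auto simp: is_phi00_def phi00_value[OF fg(1)] phi00_value[OF fg(2)] morphism_snd(1)[OF DC0 DD0 DE0]\<close>)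
qed

lemma ex1_phi01: "\<exists>!f. is_phi01 C D E Fo Fm f"
proof (rule ex_ex1I)
  obtain f where "f \<in> sg_hom (D0sg C \<circledcirc> D1sg D) (D1sg E)" "snd f = phi"
    and "\<And>x y. x \<in> carrier (D0 C) \<Longrightarrow> y \<in> carrier (D1 D) \<Longrightarrow>
       fst f (circ_elt (D0sg C) (D1sg D) x y) = F1 x y" by (rule phi01_exists) blast
  then have "is_phi01 C D E Fo Fm f"
    by (simp add: is_phi01_def F1_ob phi_phi_ee exact_fun.ind_we[OF exact_left] exact_fun.ind_cs[OF exact_left])
  then show "\<exists>f. is_phi01 C D E Fo Fm f" ..
next
  fix f g assume fg: "is_phi01 C D E Fo Fm f" "is_phi01 C D E Fo Fm g"
  interpret M: Dsg C "D0sg C" "\<lambda>x. x" by (rule DC0)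
  interpret N: Dsg D "D1sg D" "bd D" by (rule DD1)
  interpret MN: square_group_pair "D0sg C" "D1sg D" by unfold_locales
  show "f = g"
    by (rule MN.circ_sg_hom_eqI[of f "D1sg E" g])
      (use fg in \<open>auto simp: is_phi01_def phi01_value[OF fg(1)] phi01_value[OF fg(2)] morphism_snd(1)[OF DC0 DD1 DE1]\<close>)
qed

lemma ex1_phi10: "\<exists>!f. is_phi10 C D E Fo Fm f"
proof (rule ex_ex1I)
  obtain f where "f \<in> sg_hom (D1sg C \<circledcirc> D0sg D) (D1sg E)" "snd f = phi"
    and "\<And>x y. x \<in> carrier (D1 C) \<Longrightarrow> y \<in> carrier (D0 D) \<Longrightarrow>
       fst f (circ_elt (D1sg C) (D0sg D) x y) = F2 x y" by (rule phi10_exists) blast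
  then have "is_phi10 C D E Fo Fm f"
    by (simp add: is_phi10_def F2_ob phi_phi_ee exact_fun.ind_we[OF exact_right] exact_fun.ind_cs[OF exact_right])
  then show "\<exists>f. is_phi10 C D E Fo Fm f" ..
next
  fix f g assume fg: "is_phi10 C D E Fo Fm f" "is_phi10 C D E Fo Fm g"
  interpret M: Dsg C "D1sg C" "bd C" by (rule DC1)
  interpret N: Dsg D "D0sg D" "\<lambda>x. x" by (rule DD0)
  interpret MN: square_group_pair "D1sg C" "D0sg D" by unfold_locales
  show "f = g"
    by (rule MN.circ_sg_hom_eqI[of f "D1sg E" g])
      (use fg in \<open>auto simp: is_phi10_def phi10_value[OF fg(1)] phi10_value[OF fg(2)] morphism_snd(1)[OF DC1 DD0 DE1]\<close>)
qed

end

section \<open>Compatibility of the products with the boundary\<close>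

context biexact
begin

interpretation E1: Dsg E "D1sg E" "bd E" by (rule DE1)

lemma F1_one_inv: "d \<in> carrier (D1 D) \<Longrightarrow> F1 \<one>\<^bsub>D0 C\<^esub> d = \<one>\<^bsub>D1 E\<^esub>"
    "d \<in> carrier (D1 D) \<Longrightarrow> x \<in> carrier (D0 C) \<Longrightarrow> F1 (inv\<^bsub>D0 C\<^esub> x) d = inv\<^bsub>D1 E\<^esub> F1 x d"
  using group_hom.hom_one[of "D0 C" "D1 E" "\<lambda>x. F1 x d"] group_hom.hom_inv[of "D0 C" "D1 E" "\<lambda>x. F1 x d" x]
    F1_hom[of d] WC.Q.G0.is_group WE.Q.G1.is_group
  by (auto simp: group_hom_def group_hom_axioms_def)

lemma D0_H_inv:
  assumes "x \<in> carrier (D0 C)" "D0_H C x = \<one>\<^bsub>DE C\<^esub>"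
  shows "D0_H C (inv\<^bsub>D0 C\<^esub> x) = dt C x x"
proof -
  interpret C0: Dsg C "D0sg C" "\<lambda>x. x" by (rule DC0)
  have "D0_H C (inv\<^bsub>D0 C\<^esub> x) \<otimes>\<^bsub>DE C\<^esub> inv\<^bsub>DE C\<^esub> dt C x x = \<one>\<^bsub>DE C\<^esub>"
    using WC.D0_H_mult[of "inv\<^bsub>D0 C\<^esub> x" x, symmetric] C0.H_one assms by (simp add: WC.Q.e.inv_right)
  then show ?thesis using assms WC.Q.T.inv_equality[of "D0_H C (inv\<^bsub>D0 C\<^esub> x)" "inv\<^bsub>DE C\<^esub> dt C x x"]
    by simp
qed

text \<open>From the value 0 at -y + y, with the deviation read off at (-y,y).\<close>

lemma F2_inv:
  assumes c: "c \<in> carrier (D1 C)" and y: "y \<in> carrier (D0 D)"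
  shows "F2 c (inv\<^bsub>D0 D\<^esub> y) = inv\<^bsub>D1 E\<^esub> F2 c y \<otimes>\<^bsub>D1 E\<^esub> \<beta> c y y"
proof -
  have \<beta>: "\<beta> c (inv\<^bsub>D0 D\<^esub> y) y = inv\<^bsub>D1 E\<^esub> \<beta> c y y"
    using c y by (simp add: \<beta>_def WD.Q.e.inv_left ph.inv_right)
  have "F2 c \<one>\<^bsub>D0 D\<^esub> = \<one>\<^bsub>D1 E\<^esub>" using F2_ob[OF c, of "Zero D"] R_Zero[OF c] by simp
  then have "F2 c (inv\<^bsub>D0 D\<^esub> y) \<otimes>\<^bsub>D1 E\<^esub> F2 c y \<otimes>\<^bsub>D1 E\<^esub> inv\<^bsub>D1 E\<^esub> \<beta> c y y = \<one>\<^bsub>D1 E\<^esub>"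
    using F2_right[OF c, of "inv\<^bsub>D0 D\<^esub> y" y] y by (simp add: \<beta>)
  then have "F2 c (inv\<^bsub>D0 D\<^esub> y) = inv\<^bsub>D1 E\<^esub> (F2 c y \<otimes>\<^bsub>D1 E\<^esub> inv\<^bsub>D1 E\<^esub> \<beta> c y y)"
    using c y by (intro WE.Q.G1.inv_equality[symmetric]) (simp_all add: WE.Q.G1.m_assoc)
  also have "\<dots> = \<beta> c y y \<otimes>\<^bsub>D1 E\<^esub> inv\<^bsub>D1 E\<^esub> F2 c y" using c y by (simp add: WE.Q.G1.inv_mult_group)
  finally show ?thesis using c y by (simp add: \<beta>_def WE.Q.w_central)
qed

text \<open>H(x) = 0 makes H(-x) = x\<otimes>x, which combines with the cross term -v\<otimes>x to
  -u\<otimes>x.\<close>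

lemma D0_H_boundary:
  assumes "x \<in> carrier (D0 C)" "v \<in> carrier (D0 C)" "D0_H C x = \<one>\<^bsub>DE C\<^esub>"
    and "u = inv\<^bsub>D0 C\<^esub> x \<otimes>\<^bsub>D0 C\<^esub> v"
  shows "D0_H C u = inv\<^bsub>DE C\<^esub> dt C u x \<otimes>\<^bsub>DE C\<^esub> D0_H C v"
proof -
  note [simp] = assms(1,2)
  have "D0_H C u = dt C x x \<otimes>\<^bsub>DE C\<^esub> D0_H C v \<otimes>\<^bsub>DE C\<^esub> inv\<^bsub>DE C\<^esub> dt C v x"
    by (simp add: assms(4) WC.D0_H_mult D0_H_inv assms(3) WC.Q.e.inv_right)
  then show ?thesis
    by (simp add: assms(4) WC.Q.e.add_left WC.Q.e.inv_left WC.Q.T.inv_mult WC.Q.T.m_ac)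
qed

text \<open>When the boundaries are \<open>-x + v\<close> and \<open>-y + z\<close> the identity to be proved amounts to a
  relation in \<open>D1 E\<close> without inverses, which the relations on generators give directly.\<close>

lemma boundary_reduction:
  assumes c: "c \<in> carrier (D1 C)" "bd C c = inv\<^bsub>D0 C\<^esub> x \<otimes>\<^bsub>D0 C\<^esub> v"
    and d: "d \<in> carrier (D1 D)" "bd D d = inv\<^bsub>D0 D\<^esub> y \<otimes>\<^bsub>D0 D\<^esub> z"
    and cl: "x \<in> carrier (D0 C)" "v \<in> carrier (D0 C)" "y \<in> carrier (D0 D)" "z \<in> carrier (D0 D)"
    and Hx: "D0_H C x = \<one>\<^bsub>DE C\<^esub>"
    and key: "F2 c y \<otimes>\<^bsub>D1 E\<^esub> F1 v d \<otimes>\<^bsub>D1 E\<^esub> dw E (ph (D0_H C v) (dt D y (bd D d))) = F1 x d \<otimes>\<^bsub>D1 E\<^esub> F2 c z"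
  shows "F1 (bd C c) d = F2 c (bd D d)"
proof -
  note [simp] = c(1) d(1) cl
  let ?u = "F2 c y" and ?s = "F1 x d" and ?h = "D0_H C (bd C c)"
  let ?t = "ph (D0_H C v) (dt D y (bd D d))"
  have H': "?h = inv\<^bsub>DE C\<^esub> dt C (bd C c) x \<otimes>\<^bsub>DE C\<^esub> D0_H C v"
    by (rule D0_H_boundary[OF _ _ Hx c(2)]) simp_all
  have B: "dt D y y \<otimes>\<^bsub>DE D\<^esub> inv\<^bsub>DE D\<^esub> dt D y z = inv\<^bsub>DE D\<^esub> dt D y (bd D d)"
    by (simp add: d(2) WD.Q.e.add_right WD.Q.e.inv_right WD.Q.T.inv_mult)
  have "F2 c (bd D d) = inv\<^bsub>D1 E\<^esub> ?u \<otimes>\<^bsub>D1 E\<^esub> (dw E (ph ?h (dt D y y)) \<otimes>\<^bsub>D1 E\<^esub> F2 c z) \<otimes>\<^bsub>D1 E\<^esub>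
      dw E (inv\<^bsub>DE E\<^esub> ph ?h (dt D y z))"
    by (simp add: d(2) F2_right F2_inv \<beta>_def WE.Q.G1.m_assoc WD.Q.e.inv_left ph.inv_right)
  also have "dw E (ph ?h (dt D y y)) \<otimes>\<^bsub>D1 E\<^esub> F2 c z = F2 c z \<otimes>\<^bsub>D1 E\<^esub> dw E (ph ?h (dt D y y))"
    by (simp add: WE.Q.w_central)
  also have "inv\<^bsub>D1 E\<^esub> ?u \<otimes>\<^bsub>D1 E\<^esub> (F2 c z \<otimes>\<^bsub>D1 E\<^esub> dw E (ph ?h (dt D y y))) \<otimes>\<^bsub>D1 E\<^esub> dw E (inv\<^bsub>DE E\<^esub> ph ?h (dt D y z))
      = inv\<^bsub>D1 E\<^esub> ?u \<otimes>\<^bsub>D1 E\<^esub> F2 c z \<otimes>\<^bsub>D1 E\<^esub> dw E (ph ?h (dt D y y \<otimes>\<^bsub>DE D\<^esub> inv\<^bsub>DE D\<^esub> dt D y z))"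
    by (simp add: WE.Q.G1.m_assoc ph.add_right ph.inv_right)
  also have "ph ?h (dt D y y \<otimes>\<^bsub>DE D\<^esub> inv\<^bsub>DE D\<^esub> dt D y z)
      = dt E (bd E ?u) (bd E ?s) \<otimes>\<^bsub>DE E\<^esub> inv\<^bsub>DE E\<^esub> ?t"
    unfolding B H' by (simp add: ph.inv_right ph.inv_left ph.add_left WE.Q.T.inv_mult ph_dt bd_F1 bd_F2)
  finally have F2: "F2 c (bd D d) = inv\<^bsub>D1 E\<^esub> ?u \<otimes>\<^bsub>D1 E\<^esub> F2 c z \<otimes>\<^bsub>D1 E\<^esub>
      (dw E (dt E (bd E ?u) (bd E ?s)) \<otimes>\<^bsub>D1 E\<^esub> dw E (inv\<^bsub>DE E\<^esub> ?t))"
    by simp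
  \<comment> \<open>The tensor that \<open>F2\<close> picked up is the cost of turning u + s into s
    + u. With s + u added on the left, the assumed relation applies and s + u can then be
    cancelled.\<close>
  have sw: "?s \<otimes>\<^bsub>D1 E\<^esub> ?u = ?u \<otimes>\<^bsub>D1 E\<^esub> ?s \<otimes>\<^bsub>D1 E\<^esub> dw E (dt E (bd E ?u) (bd E ?s))"
    using E1.swap_dt[of ?s ?u] by simp
  have "(?s \<otimes>\<^bsub>D1 E\<^esub> ?u) \<otimes>\<^bsub>D1 E\<^esub> F2 c (bd D d)
      = ?s \<otimes>\<^bsub>D1 E\<^esub> F2 c z \<otimes>\<^bsub>D1 E\<^esub> (dw E (dt E (bd E ?u) (bd E ?s)) \<otimes>\<^bsub>D1 E\<^esub> dw E (inv\<^bsub>DE E\<^esub> ?t))"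
    unfolding F2 by (simp add: WE.Q.G1.m_assoc)
  also have "?s \<otimes>\<^bsub>D1 E\<^esub> F2 c z = ?u \<otimes>\<^bsub>D1 E\<^esub> F1 v d \<otimes>\<^bsub>D1 E\<^esub> dw E ?t" by (rule key[symmetric])
  also have "?u \<otimes>\<^bsub>D1 E\<^esub> F1 v d \<otimes>\<^bsub>D1 E\<^esub> dw E ?t \<otimes>\<^bsub>D1 E\<^esub>
        (dw E (dt E (bd E ?u) (bd E ?s)) \<otimes>\<^bsub>D1 E\<^esub> dw E (inv\<^bsub>DE E\<^esub> ?t))
      = ?u \<otimes>\<^bsub>D1 E\<^esub> (F1 v d \<otimes>\<^bsub>D1 E\<^esub> dw E (dt E (bd E ?u) (bd E ?s)))"
  proof -
    have "dw E ?t \<otimes>\<^bsub>D1 E\<^esub> (dw E (dt E (bd E ?u) (bd E ?s)) \<otimes>\<^bsub>D1 E\<^esub> dw E (inv\<^bsub>DE E\<^esub> ?t))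
        = dw E (dt E (bd E ?u) (bd E ?s))"
      using WE.Q.w_central[of ?t "dw E (dt E (bd E ?u) (bd E ?s)) \<otimes>\<^bsub>D1 E\<^esub> dw E (inv\<^bsub>DE E\<^esub> ?t)"]
      by (simp add: WE.Q.G1.m_assoc)
    then show ?thesis by (simp add: WE.Q.G1.m_assoc)
  qed
  also have "F1 v d \<otimes>\<^bsub>D1 E\<^esub> dw E (dt E (bd E ?u) (bd E ?s)) = dw E (dt E (bd E ?u) (bd E ?s)) \<otimes>\<^bsub>D1 E\<^esub> F1 v d"
    by (simp add: WE.Q.w_central)
  also have "?u \<otimes>\<^bsub>D1 E\<^esub> (dw E (dt E (bd E ?u) (bd E ?s)) \<otimes>\<^bsub>D1 E\<^esub> F1 v d)
      = ?u \<otimes>\<^bsub>D1 E\<^esub> ?s \<otimes>\<^bsub>D1 E\<^esub> dw E (dt E (bd E ?u) (bd E ?s)) \<otimes>\<^bsub>D1 E\<^esub> F1 (bd C c) d"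
  proof -
    have "?s \<otimes>\<^bsub>D1 E\<^esub> dw E (dt E (bd E ?u) (bd E ?s)) = dw E (dt E (bd E ?u) (bd E ?s)) \<otimes>\<^bsub>D1 E\<^esub> ?s"
      by (simp add: WE.Q.w_central)
    then have "?u \<otimes>\<^bsub>D1 E\<^esub> ?s \<otimes>\<^bsub>D1 E\<^esub> dw E (dt E (bd E ?u) (bd E ?s))
        = ?u \<otimes>\<^bsub>D1 E\<^esub> dw E (dt E (bd E ?u) (bd E ?s)) \<otimes>\<^bsub>D1 E\<^esub> ?s" by (simp add: WE.Q.G1.m_assoc)
    then show ?thesis by (simp add: c(2) F1_mult F1_one_inv WE.Q.G1.m_assoc)
  qed
  finally have "(?s \<otimes>\<^bsub>D1 E\<^esub> ?u) \<otimes>\<^bsub>D1 E\<^esub> F2 c (bd D d) = (?s \<otimes>\<^bsub>D1 E\<^esub> ?u) \<otimes>\<^bsub>D1 E\<^esub> F1 (bd C c) d"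
    by (simp only: sw)
  then show ?thesis by (subst (asm) WE.Q.G1.Units_l_cancel) simp_all
qed

text \<open>The commutator of p and q is a bracket with \<partial>p = -x' + x, so exchanging them
  replaces x by x'. This reconciles the order of summands in the relation for a map of cofiber
  sequences with the order produced by the boundary of a cofiber sequence.\<close>

lemma bracket_swap:
  assumes "p \<in> carrier (D1 E)" "q \<in> carrier (D1 E)" "x \<in> carrier (D0 E)" "x' \<in> carrier (D0 E)"
    and "bd E p = inv\<^bsub>D0 E\<^esub> x' \<otimes>\<^bsub>D0 E\<^esub> x"
  shows "p \<otimes>\<^bsub>D1 E\<^esub> q \<otimes>\<^bsub>D1 E\<^esub> sqbr (Dmod E) x (bd E q) = q \<otimes>\<^bsub>D1 E\<^esub> p \<otimes>\<^bsub>D1 E\<^esub> sqbr (Dmod E) x' (bd E q)"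
proof -
  note [simp] = assms(1-4)
  let ?b = "bd E q"
  have anti: "dw E (dt E x y) = inv\<^bsub>D1 E\<^esub> dw E (dt E y x)" if "x \<in> carrier (D0 E)" "y \<in> carrier (D0 E)" for x y
    using WE.Q.br_sym[of x y] that by (intro WE.Q.G1.inv_equality[symmetric]) simp_all
  have "p \<otimes>\<^bsub>D1 E\<^esub> q = q \<otimes>\<^bsub>D1 E\<^esub> p \<otimes>\<^bsub>D1 E\<^esub> dw E (inv\<^bsub>DE E\<^esub> dt E ?b x' \<otimes>\<^bsub>DE E\<^esub> dt E ?b x)"
    using E1.swap_dt[of p q] by (simp add: assms(5) WE.Q.e.add_right WE.Q.e.inv_right)
  then show ?thesis by (simp add: sqbr_def anti[of x] anti[of x'] WE.Q.G1.m_assoc)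
qed

section \<open>The identity on pairs of degree 1 generators\<close>

lemma Fm_simps:
  assumes "f \<in> Arr C" "g \<in> Arr D"
  shows "Fm (f, g) \<in> Arr E" "Src E (Fm (f, g)) = Fo (Src C f, Src D g)" "Tgt E (Fm (f, g)) = Fo (Tgt C f, Tgt D g)"
  using biexact assms by (auto simp: biexact_functor_def is_functor_def prod_cat_def arrows_def)

lemma Fm_Cmp:
  assumes "f \<in> Arr C" "f' \<in> Arr C" "Tgt C f = Src C f'" "g \<in> Arr D" "g' \<in> Arr D" "Tgt D g = Src D g'"
  shows "Fm (f', g') \<cdot>\<^bsub>E\<^esub> Fm (f, g) = Fm (f' \<cdot>\<^bsub>C\<^esub> f, g' \<cdot>\<^bsub>D\<^esub> g)"
  using biexact assms by (auto simp: biexact_functor_def is_functor_def prod_cat_def)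

lemma Fm_interchange:
  assumes "f \<in> Arr C" "g \<in> Arr D"
  shows "Fm (f, Ide D (Tgt D g)) \<cdot>\<^bsub>E\<^esub> Fm (Ide C (Src C f), g) = Fm (f, g)"
    and "Fm (Ide C (Tgt C f), g) \<cdot>\<^bsub>E\<^esub> Fm (f, Ide D (Src D g)) = Fm (f, g)"
  using assms
  by (simp_all add: Fm_Cmp WC.Src_closed WC.Tgt_closed WD.Src_closed WD.Tgt_closed WC.Ide_left
      WC.Ide_right WD.Ide_left WD.Ide_right)

lemma R1_values:
  "B \<in> Obj D \<Longrightarrow> f \<in> Weq C \<Longrightarrow> R1 B (D_we C f) = D_we E (Fm (f, Ide D B))"
  "B \<in> Obj D \<Longrightarrow> cofseq C i p \<Longrightarrow> R1 B (D_cs C i p) = D_cs E (Fm (i, Ide D B)) (Fm (p, Ide D B))"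
  by (simp_all add: exact_fun.ind_we[OF exact_right] exact_fun.ind_cs[OF exact_right])

lemma L1_values:
  "A \<in> Obj C \<Longrightarrow> g \<in> Weq D \<Longrightarrow> L1 A (D_we D g) = D_we E (Fm (Ide C A, g))"
  "A \<in> Obj C \<Longrightarrow> cofseq D j q \<Longrightarrow> L1 A (D_cs D j q) = D_cs E (Fm (Ide C A, j)) (Fm (Ide C A, q))"
  by (simp_all add: exact_fun.ind_we[OF exact_left] exact_fun.ind_cs[OF exact_left])

lemma Fm_Weq:
  "A \<in> Obj C \<Longrightarrow> g \<in> Weq D \<Longrightarrow> Fm (Ide C A, g) \<in> Weq E"
  "B \<in> Obj D \<Longrightarrow> f \<in> Weq C \<Longrightarrow> Fm (f, Ide D B) \<in> Weq E"
  using exact_fun.G(9)[OF exact_left] exact_fun.G(9)[OF exact_right] by auto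

lemma Fm_cofseq:
  "A \<in> Obj C \<Longrightarrow> cofseq D j q \<Longrightarrow> cofseq E (Fm (Ide C A, j)) (Fm (Ide C A, q))"
  "B \<in> Obj D \<Longrightarrow> cofseq C i p \<Longrightarrow> cofseq E (Fm (i, Ide D B)) (Fm (p, Ide D B))"
  using exact_fun.cofseq[OF exact_left] exact_fun.cofseq[OF exact_right] by auto

text \<open>f \<and> g factors in two ways through weak equivalences in one variable, and classes
  add along composites; as H vanishes on objects no correction remains.\<close>

lemma boundary_we_we:
  assumes f: "f \<in> Weq C" and g: "g \<in> Weq D"
  shows "F1 (bd C (D_we C f)) (D_we D g) = F2 (D_we C f) (bd D (D_we D g))"
proof (rule boundary_reduction[OF _ WC.bd_we[OF f] _ WD.bd_we[OF g]])
  have A: "f \<in> Arr C" "g \<in> Arr D" using f g WC.Weq_Arr WD.Weq_Arr by auto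
  have "D_we E (Fm (f, Ide D (Tgt D g))) \<otimes>\<^bsub>D1 E\<^esub> D_we E (Fm (Ide C (Src C f), g))
      = D_we E (Fm (Ide C (Tgt C f), g)) \<otimes>\<^bsub>D1 E\<^esub> D_we E (Fm (f, Ide D (Src D g)))"
    using A Fm_Weq f g
    by (simp add: Fm_simps Fm_interchange WC.Weq_Obj WD.Weq_Obj flip: WE.D_we_Cmp)
  then show "F2 (D_we C f) (D_ob D (Tgt D g)) \<otimes>\<^bsub>D1 E\<^esub> F1 (D_ob C (Src C f)) (D_we D g) \<otimes>\<^bsub>D1 E\<^esub>
      dw E (ph (D0_H C (D_ob C (Src C f))) (dt D (D_ob D (Tgt D g)) (bd D (D_we D g))))
    = F1 (D_ob C (Tgt C f)) (D_we D g) \<otimes>\<^bsub>D1 E\<^esub> F2 (D_we C f) (D_ob D (Src D g))"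
    using f g Fm_Weq by (simp add: F2_ob F1_ob R1_values L1_values WC.Weq_Obj WD.Weq_Obj)
qed (use f g in \<open>simp_all add: WC.Weq_Obj WD.Weq_Obj\<close>)

lemma dw_anti: "x \<in> carrier (D0 E) \<Longrightarrow> y \<in> carrier (D0 E) \<Longrightarrow> dw E (dt E x y) = inv\<^bsub>D1 E\<^esub> dw E (dt E y x)"
  using WE.Q.br_sym[of x y] by (intro WE.Q.G1.inv_equality[symmetric]) simp_all

text \<open>This expresses the deviation by brackets, the form in which it occurs in the relations
  of \<open>Dmod E\<close>.\<close>

lemma \<beta>_boundary:
  assumes c: "c \<in> carrier (D1 C)" "bd C c = inv\<^bsub>D0 C\<^esub> x \<otimes>\<^bsub>D0 C\<^esub> v"
    and x: "x \<in> carrier (D0 C)" "v \<in> carrier (D0 C)" "D0_H C x = \<one>\<^bsub>DE C\<^esub>"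
    and y: "y \<in> carrier (D0 D)" "y' \<in> carrier (D0 D)"
  shows "\<beta> c y y' = sqbr (Dmod E) (F0 x y') (bd E (F2 c y)) \<otimes>\<^bsub>D1 E\<^esub> dw E (ph (D0_H C v) (dt D y y'))"
proof -
  have "ph (D0_H C (bd C c)) (dt D y y')
      = inv\<^bsub>DE E\<^esub> dt E (bd E (F2 c y)) (F0 x y') \<otimes>\<^bsub>DE E\<^esub> ph (D0_H C v) (dt D y y')"
    unfolding D0_H_boundary[OF x c(2)]
    using c(1) x(1,2) y by (simp add: ph.add_left ph.inv_left ph_dt bd_F2)
  then show ?thesis
    using c(1) x(1,2) y dw_anti[of "F0 x y'" "bd E (F2 c y)"] by (simp add: \<beta>_def sqbr_def)
qed

text \<open>Smashing with f gives a weak equivalence between the cofiber sequences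
  \<open>Src C f\<close> \<and> (j,q) and \<open>Tgt C f\<close> \<and> (j,q). Its relation lists
  the subobject before the quotient, while the boundary of (j,q) produces the opposite order;
  \<open>bracket_swap\<close> mediates.\<close>

lemma boundary_we_cs:
  assumes f: "f \<in> Weq C" and jq: "cofseq D j q"
  shows "F1 (bd C (D_we C f)) (D_cs D j q) = F2 (D_we C f) (bd D (D_cs D j q))"
proof -
  let ?A = "Src C f" and ?A' = "Tgt C f" and ?c = "D_we C f" and ?d = "D_cs D j q"
  note jA = WD.cofseq_arrows[OF jq]
  have fA: "f \<in> Arr C" and ob: "?A \<in> Obj C" "?A' \<in> Obj C" using f WC.Weq_Arr WC.Weq_Obj by auto
  have [simp]: "?c \<in> carrier (D1 C)" "?d \<in> carrier (D1 D)" using f jq by simp_all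
  let ?e = "D_cs E (Fm (Ide C ?A, j)) (Fm (Ide C ?A, q))" and ?e' = "D_cs E (Fm (Ide C ?A', j)) (Fm (Ide C ?A', q))"
  let ?cC = "D_we E (Fm (f, Ide D (Src D j)))" and ?cD = "D_we E (Fm (f, Ide D (Tgt D j)))"
    and ?cQ = "D_we E (Fm (f, Ide D (Tgt D q)))"
  have [simp]: "?e \<in> carrier (D1 E)" "?e' \<in> carrier (D1 E)" "?cC \<in> carrier (D1 E)" "?cD \<in> carrier (D1 E)"
    "?cQ \<in> carrier (D1 E)" using Fm_cofseq Fm_Weq f jq ob jA by simp_all
  have comm: "Fm (f, Ide D (Tgt D g)) \<cdot>\<^bsub>E\<^esub> Fm (Ide C ?A, g) = Fm (Ide C ?A', g) \<cdot>\<^bsub>E\<^esub> Fm (f, Ide D (Src D g))"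
    if "g \<in> Arr D" for g using that fA by (simp add: Fm_interchange)
  have bdQ: "bd E ?cQ = inv\<^bsub>D0 E\<^esub> D_ob E (Fo (?A', Tgt D q)) \<otimes>\<^bsub>D0 E\<^esub> D_ob E (Fo (?A, Tgt D q))"
    "bd E ?cC = inv\<^bsub>D0 E\<^esub> D_ob E (Fo (?A', Src D j)) \<otimes>\<^bsub>D0 E\<^esub> D_ob E (Fo (?A, Src D j))"
    using Fm_Weq f jA fA by (simp_all add: WE.bd_we Fm_simps)
  have "?cC \<otimes>\<^bsub>D1 E\<^esub> ?cQ \<otimes>\<^bsub>D1 E\<^esub> sqbr (Dmod E) (D_ob E (Fo (?A, Src D j))) (bd E ?cQ)
      = inv\<^bsub>D1 E\<^esub> ?e' \<otimes>\<^bsub>D1 E\<^esub> ?cD \<otimes>\<^bsub>D1 E\<^esub> ?e"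
    using WE.D_we_cs_rel[OF Fm_cofseq(1)[OF ob(1) jq] Fm_cofseq(1)[OF ob(2) jq]
        Fm_Weq(2)[OF _ f] Fm_Weq(2)[OF _ f] Fm_Weq(2)[OF _ f], of "Src D j" "Tgt D j" "Tgt D q"]
      comm[of j] comm[of q] jA ob fA
    by (simp add: Fm_simps WE.arrows_iff bdQ)
  moreover have "?cC \<otimes>\<^bsub>D1 E\<^esub> ?cQ \<otimes>\<^bsub>D1 E\<^esub> sqbr (Dmod E) (D_ob E (Fo (?A, Src D j))) (bd E ?cQ)
      = ?cQ \<otimes>\<^bsub>D1 E\<^esub> ?cC \<otimes>\<^bsub>D1 E\<^esub> sqbr (Dmod E) (D_ob E (Fo (?A', Src D j))) (bd E ?cQ)"
    by (rule bracket_swap[OF _ _ _ _ bdQ(2)]) (use ob jA in simp_all)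
  ultimately have rel: "?e' \<otimes>\<^bsub>D1 E\<^esub> (?cQ \<otimes>\<^bsub>D1 E\<^esub> ?cC \<otimes>\<^bsub>D1 E\<^esub>
        sqbr (Dmod E) (D_ob E (Fo (?A', Src D j))) (bd E ?cQ)) = ?cD \<otimes>\<^bsub>D1 E\<^esub> ?e"
    by (simp add: WE.Q.G1.m_assoc)
  let ?Q = "D_ob D (Tgt D q)" and ?S = "D_ob D (Src D j)"
  have v: "F2 ?c ?Q = ?cQ" "F2 ?c ?S = ?cC" "F2 ?c (D_ob D (Tgt D j)) = ?cD"
    "F1 (D_ob C ?A) ?d = ?e" "F1 (D_ob C ?A') ?d = ?e'"
    using f jq jA ob by (simp_all add: F2_ob R1_values F1_ob L1_values)
  show ?thesis
  proof (rule boundary_reduction[OF _ WC.bd_we[OF f]])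
    show "bd D ?d = inv\<^bsub>D0 D\<^esub> D_ob D (Tgt D j) \<otimes>\<^bsub>D0 D\<^esub> (?Q \<otimes>\<^bsub>D0 D\<^esub> ?S)"
      using jA by (simp add: WD.bd_cs[OF jq] WD.Q.G0.m_assoc)
    have "F2 ?c (?Q \<otimes>\<^bsub>D0 D\<^esub> ?S) = ?cQ \<otimes>\<^bsub>D1 E\<^esub> ?cC \<otimes>\<^bsub>D1 E\<^esub> sqbr (Dmod E) (D_ob E (Fo (?A', Src D j))) (bd E ?cQ)"
      using jA ob WE.Q.br.closed by (simp add: F2_right v \<beta>_boundary[OF _ WC.bd_we[OF f]] F0_ob_ob)
    then show "F2 ?c (D_ob D (Tgt D j)) \<otimes>\<^bsub>D1 E\<^esub> F1 (D_ob C ?A) ?d \<otimes>\<^bsub>D1 E\<^esub>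
        dw E (ph (D0_H C (D_ob C ?A)) (dt D (D_ob D (Tgt D j)) (bd D ?d)))
      = F1 (D_ob C ?A') ?d \<otimes>\<^bsub>D1 E\<^esub> F2 ?c (?Q \<otimes>\<^bsub>D0 D\<^esub> ?S)"
      using rel ob jA by (simp add: v)
  qed (use ob jA in simp_all)
qed

lemma bd_cs': "cofseq C i p \<Longrightarrow> bd C (D_cs C i p)
    = inv\<^bsub>D0 C\<^esub> D_ob C (Tgt C i) \<otimes>\<^bsub>D0 C\<^esub> (D_ob C (Tgt C p) \<otimes>\<^bsub>D0 C\<^esub> D_ob C (Src C i))"
  using WC.cofseq_arrows[of i p] by (simp add: WC.bd_cs WC.Q.G0.m_assoc)

text \<open>The variables do not play symmetric roles: here v is a sum of two classes, and the one
  tensor in H(v) supplies the bracket that the previous case obtained from the deviation of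
  \<open>F2\<close>.\<close>

lemma boundary_cs_we:
  assumes ip: "cofseq C i p" and g: "g \<in> Weq D"
  shows "F1 (bd C (D_cs C i p)) (D_we D g) = F2 (D_cs C i p) (bd D (D_we D g))"
proof -
  let ?S = "Src D g" and ?S' = "Tgt D g" and ?c = "D_cs C i p" and ?d = "D_we D g"
  note iA = WC.cofseq_arrows[OF ip]
  have gA: "g \<in> Arr D" and ob: "?S \<in> Obj D" "?S' \<in> Obj D" using g WD.Weq_Arr WD.Weq_Obj by auto
  have [simp]: "?c \<in> carrier (D1 C)" "?d \<in> carrier (D1 D)" using g ip by simp_all
  let ?A = "Src C i" and ?B = "Tgt C i" and ?R = "Tgt C p"
  let ?e = "D_cs E (Fm (i, Ide D ?S)) (Fm (p, Ide D ?S))" and ?e' = "D_cs E (Fm (i, Ide D ?S')) (Fm (p, Ide D ?S'))"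
  let ?dA = "D_we E (Fm (Ide C ?A, g))" and ?dB = "D_we E (Fm (Ide C ?B, g))" and ?dR = "D_we E (Fm (Ide C ?R, g))"
  have [simp]: "?e \<in> carrier (D1 E)" "?e' \<in> carrier (D1 E)" "?dA \<in> carrier (D1 E)" "?dB \<in> carrier (D1 E)"
    "?dR \<in> carrier (D1 E)" using Fm_cofseq Fm_Weq g ip ob iA by simp_all
  have comm: "Fm (Ide C (Tgt C f), g) \<cdot>\<^bsub>E\<^esub> Fm (f, Ide D ?S) = Fm (f, Ide D ?S') \<cdot>\<^bsub>E\<^esub> Fm (Ide C (Src C f), g)"
    if "f \<in> Arr C" for f using that gA by (simp add: Fm_interchange)
  have bdR: "bd E ?dR = inv\<^bsub>D0 E\<^esub> D_ob E (Fo (?R, ?S')) \<otimes>\<^bsub>D0 E\<^esub> D_ob E (Fo (?R, ?S))"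
    "bd E ?dA = inv\<^bsub>D0 E\<^esub> D_ob E (Fo (?A, ?S')) \<otimes>\<^bsub>D0 E\<^esub> D_ob E (Fo (?A, ?S))"
    using Fm_Weq g iA gA by (simp_all add: WE.bd_we Fm_simps)
  have "?dA \<otimes>\<^bsub>D1 E\<^esub> ?dR \<otimes>\<^bsub>D1 E\<^esub> sqbr (Dmod E) (D_ob E (Fo (?A, ?S))) (bd E ?dR)
      = inv\<^bsub>D1 E\<^esub> ?e' \<otimes>\<^bsub>D1 E\<^esub> ?dB \<otimes>\<^bsub>D1 E\<^esub> ?e"
    using WE.D_we_cs_rel[OF Fm_cofseq(2)[OF ob(1) ip] Fm_cofseq(2)[OF ob(2) ip]
        Fm_Weq(1)[OF _ g] Fm_Weq(1)[OF _ g] Fm_Weq(1)[OF _ g], of ?A ?B ?R]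
      comm[of i] comm[of p] iA ob gA
    by (simp add: Fm_simps WE.arrows_iff bdR)
  moreover have "?dA \<otimes>\<^bsub>D1 E\<^esub> ?dR \<otimes>\<^bsub>D1 E\<^esub> sqbr (Dmod E) (D_ob E (Fo (?A, ?S))) (bd E ?dR)
      = ?dR \<otimes>\<^bsub>D1 E\<^esub> ?dA \<otimes>\<^bsub>D1 E\<^esub> sqbr (Dmod E) (D_ob E (Fo (?A, ?S'))) (bd E ?dR)"
    by (rule bracket_swap[OF _ _ _ _ bdR(2)]) (use ob iA in simp_all)
  ultimately have rel: "?e' \<otimes>\<^bsub>D1 E\<^esub> (?dR \<otimes>\<^bsub>D1 E\<^esub> ?dA) \<otimes>\<^bsub>D1 E\<^esub>
        sqbr (Dmod E) (D_ob E (Fo (?A, ?S'))) (bd E ?dR) = ?dB \<otimes>\<^bsub>D1 E\<^esub> ?e"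
    using iA ob by (simp add: WE.Q.G1.m_assoc)
  have v: "F2 ?c (D_ob D ?S) = ?e" "F2 ?c (D_ob D ?S') = ?e'" "F1 (D_ob C ?A) ?d = ?dA"
    "F1 (D_ob C ?B) ?d = ?dB" "F1 (D_ob C ?R) ?d = ?dR"
    using g ip iA ob by (simp_all add: F2_ob R1_values F1_ob L1_values)
  have Hv: "D0_H C (D_ob C ?R \<otimes>\<^bsub>D0 C\<^esub> D_ob C ?A) = dt C (D_ob C ?A) (D_ob C ?R)"
    using iA by (simp add: WC.D0_H_mult)
  show ?thesis
  proof (rule boundary_reduction[OF _ bd_cs'[OF ip] _ WD.bd_we[OF g]])
    show "F2 ?c (D_ob D ?S') \<otimes>\<^bsub>D1 E\<^esub> F1 (D_ob C ?R \<otimes>\<^bsub>D0 C\<^esub> D_ob C ?A) ?d \<otimes>\<^bsub>D1 E\<^esub>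
        dw E (ph (D0_H C (D_ob C ?R \<otimes>\<^bsub>D0 C\<^esub> D_ob C ?A)) (dt D (D_ob D ?S') (bd D ?d)))
      = F1 (D_ob C ?B) ?d \<otimes>\<^bsub>D1 E\<^esub> F2 ?c (D_ob D ?S)"
      using rel ob iA bd_F1[of "D_ob C ?R" ?d] by (simp add: v Hv F1_mult ph_dt F0_ob_ob sqbr_def)
  qed (use ob iA in simp_all)
qed

text \<open>The products form a 3 x 3 diagram in E, and biexactness makes its corner map a
  cofibration. H of the sum from (i,p) and the deviation of \<open>F2\<close> at the sum from (j,q)
  together account for the three brackets of \<open>D_three_by_three\<close>.\<close>

lemma boundary_cs_cs:
  assumes ip: "cofseq C i p" and jq: "cofseq D j q"
  shows "F1 (bd C (D_cs C i p)) (D_cs D j q) = F2 (D_cs C i p) (bd D (D_cs D j q))"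
proof -
  let ?c = "D_cs C i p" and ?d = "D_cs D j q"
  note iA = WC.cofseq_arrows[OF ip] and jA = WD.cofseq_arrows[OF jq]
  have [simp]: "?c \<in> carrier (D1 C)" "?d \<in> carrier (D1 D)" using jq ip by simp_all
  let ?A = "Src C i" and ?B = "Tgt C i" and ?R = "Tgt C p"
  let ?S = "Src D j" and ?D = "Tgt D j" and ?Q = "Tgt D q"
  have comm: "Fm (f, Ide D (Tgt D g)) \<cdot>\<^bsub>E\<^esub> Fm (Ide C (Src C f), g) = Fm (Ide C (Tgt C f), g) \<cdot>\<^bsub>E\<^esub> Fm (f, Ide D (Src D g))"
    if "f \<in> Arr C" "g \<in> Arr D" for f g using that by (simp add: Fm_interchange)
  have ij: "i \<in> Cof C" "j \<in> Cof D" using ip jq by (auto simp: cofseq_def)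
  have "Fm (i, Ide D ?S) \<in> Cof E" "Fm (Ide C ?A, j) \<in> Arr E"
    using exact_fun.G(8)[OF exact_right] jA iA ij(1) by (simp_all add: Fm_simps)
  then obtain h k where po: "is_pushout E (Fm (i, Ide D ?S)) (Fm (Ide C ?A, j)) h k"
    using WE.pushout_exists[of "Fm (i, Ide D ?S)" "Fm (Ide C ?A, j)"] iA jA by (auto simp: Fm_simps)
  note P = WE.pushoutD[OF po]
  obtain w where w: "w \<in> arrows E (Tgt E k) (Fo (?B, ?D))" "w \<cdot>\<^bsub>E\<^esub> h = Fm (Ide C ?B, j)"
    "w \<cdot>\<^bsub>E\<^esub> k = Fm (i, Ide D ?D)"
    using P(10)[of "Fm (Ide C ?B, j)" "Fo (?B, ?D)" "Fm (i, Ide D ?D)"] comm[of i j] iA jA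
    by (auto simp: Fm_simps WE.arrows_iff)
  have "w \<in> Cof E"
    using biexact ij po w P(8) unfolding biexact_functor_def by metis
  then interpret X: three_by_three E "Fm (i, Ide D ?S)" "Fm (i, Ide D ?D)" "Fm (i, Ide D ?Q)"
      "Fm (p, Ide D ?S)" "Fm (p, Ide D ?D)" "Fm (p, Ide D ?Q)"
      "Fm (Ide C ?A, j)" "Fm (Ide C ?B, j)" "Fm (Ide C ?R, j)"
      "Fm (Ide C ?A, q)" "Fm (Ide C ?B, q)" "Fm (Ide C ?R, q)" h k w
    using Fm_cofseq ip jq iA jA comm[of i j] comm[of p j] comm[of i q] comm[of p q] po w
    by unfold_locales (simp_all add: Fm_simps)
  have v: "F2 ?c (D_ob D B) = D_cs E (Fm (i, Ide D B)) (Fm (p, Ide D B))" if "B \<in> Obj D" for B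
    using that ip by (simp add: F2_ob R1_values)
  have v': "F1 (D_ob C A) ?d = D_cs E (Fm (Ide C A, j)) (Fm (Ide C A, q))" if "A \<in> Obj C" for A
    using that jq by (simp add: F1_ob L1_values)
  have Hv: "D0_H C (D_ob C ?R \<otimes>\<^bsub>D0 C\<^esub> D_ob C ?A) = dt C (D_ob C ?A) (D_ob C ?R)"
    using iA by (simp add: WC.D0_H_mult)
  show ?thesis
  proof (rule boundary_reduction[OF _ bd_cs'[OF ip]])
    show "bd D ?d = inv\<^bsub>D0 D\<^esub> D_ob D ?D \<otimes>\<^bsub>D0 D\<^esub> (D_ob D ?Q \<otimes>\<^bsub>D0 D\<^esub> D_ob D ?S)"
      using jA by (simp add: WD.bd_cs[OF jq] WD.Q.G0.m_assoc)
    \<comment> \<open>The last bracket comes from the tensor in H of the sum for (i,p), paired with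
      the quotient and the subobject of (j,q); in the diagram it belongs to the coproduct.\<close>
    have "F2 ?c (D_ob D ?Q \<otimes>\<^bsub>D0 D\<^esub> D_ob D ?S) = F2 ?c (D_ob D ?Q) \<otimes>\<^bsub>D1 E\<^esub> F2 ?c (D_ob D ?S) \<otimes>\<^bsub>D1 E\<^esub>
        (sqbr (Dmod E) (D_ob E (Fo (?B, ?S))) (bd E (F2 ?c (D_ob D ?Q))) \<otimes>\<^bsub>D1 E\<^esub>
         sqbr (Dmod E) (D_ob E (Fo (?A, ?Q))) (D_ob E (Fo (?R, ?S))))"
      using jA iA by (simp add: F2_right \<beta>_boundary[OF _ bd_cs'[OF ip]] F0_ob_ob Hv ph_dt)
        (simp add: sqbr_def)
    then show "F2 ?c (D_ob D ?D) \<otimes>\<^bsub>D1 E\<^esub> F1 (D_ob C ?R \<otimes>\<^bsub>D0 C\<^esub> D_ob C ?A) ?d \<otimes>\<^bsub>D1 E\<^esub>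
        dw E (ph (D0_H C (D_ob C ?R \<otimes>\<^bsub>D0 C\<^esub> D_ob C ?A)) (dt D (D_ob D ?D) (bd D ?d)))
      = F1 (D_ob C ?B) ?d \<otimes>\<^bsub>D1 E\<^esub> F2 ?c (D_ob D ?Q \<otimes>\<^bsub>D0 D\<^esub> D_ob D ?S)"
      using X.D_three_by_three iA jA bd_F1[of "D_ob C ?R" ?d] X.ip X.jq
      by (simp add: v v' Hv F1_mult ph_dt F0_ob_ob Fm_simps WE.Q.G1.m_assoc sqbr_def ab_tensor_elt_closed)
  qed (use iA jA in simp_all)
qed

text \<open>In d both sides have the same deviation, the pairing of H(\<partial>c) with
  \<partial>d\<otimes>\<partial>d'; in c both are additive; and on values of \<omega> both are given
  by the relations for P. This leaves pairs of generators.\<close>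

lemma boundary:
  assumes c: "c \<in> carrier (D1 C)" and d: "d \<in> carrier (D1 D)"
  shows "F1 (bd C c) d = F2 c (bd D d)"
proof -
  have gen: "F1 (bd C c) d = F2 c (bd D d)"
    if c: "c \<in> carrier (D1 C)" and "\<And>g. g \<in> Weq D \<Longrightarrow> F1 (bd C c) (D_we D g) = F2 c (bd D (D_we D g))"
      and "\<And>j q. cofseq D j q \<Longrightarrow> F1 (bd C c) (D_cs D j q) = F2 c (bd D (D_cs D j q))" for c
  proof -
    have agree: "F1 (bd C c) \<one>\<^bsub>D1 D\<^esub> = F2 c (bd D \<one>\<^bsub>D1 D\<^esub>)"
      "\<And>d. d \<in> carrier (D1 D) \<Longrightarrow> F1 (bd C c) d = F2 c (bd D d) \<Longrightarrow>
        F1 (bd C c) (inv\<^bsub>D1 D\<^esub> d) = F2 c (bd D (inv\<^bsub>D1 D\<^esub> d))"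
      by (rule quadratic_law_agree[OF WD.Q.G1.is_group WE.Q.G1.is_group, of "F1 (bd C c)" "\<lambda>d. F2 c (bd D d)"
          "\<lambda>d d'. dw E (ph (D0_H C (bd C c)) (dt D (bd D d) (bd D d')))"];
          use c in \<open>simp add: F1_right F2_right \<beta>_def\<close>)+
    show ?thesis
      using d
      by (induction rule: WD.D1_induct)
        (use c that agree in \<open>simp_all add: F1_right F2_right \<beta>_def F1_P_right F2_P_right del: WD.Q.d.hom_one WD.Q.d.hom_inv\<close>)
  qed
  interpret F2: group_hom "D1 C" "D1 E" "\<lambda>c. F2 c (bd D d)"
    by (intro group_homI homI WC.Q.G1.is_group WE.Q.G1.is_group) (simp_all add: F2_mult d)
  show ?thesis
    using c
  proof (induction rule: WC.D1_induct)
    case (we f) then show ?case by (intro gen boundary_we_we boundary_we_cs) simp_all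
  next
    case (cs i p) then show ?case by (intro gen boundary_cs_we boundary_cs_cs) simp_all
  qed (use d in \<open>simp_all add: F1_P_left F2_P_left F1_mult F2_mult F1_one_inv\<close>)
qed

end

section \<open>The identities of morphisms of square groups\<close>

lemma sg_comp_hom:
  assumes f: "f \<in> sg_hom M N" and g: "g \<in> sg_hom N Z"
  shows "sg_comp M g f \<in> sg_hom M Z"
proof -
  note F = sg_homD[OF f] and G = sg_homD[OF g]
  interpret M: square_group M by (rule F)
  interpret fe: group_hom "sge M" "sge N" "fst f" by (rule F)
  interpret fee: group_hom "sgee M" "sgee N" "snd f" by (rule F)
  interpret ge: group_hom "sge N" "sge Z" "fst g" by (rule G)
  interpret gee: group_hom "sgee N" "sgee Z" "snd g" by (rule G)
  have "compose (carrier (sge M)) (fst g) (fst f) \<in> hom (sge M) (sge Z)"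
    "compose (carrier (sgee M)) (snd g) (snd f) \<in> hom (sgee M) (sgee Z)"
    by (rule homI; simp add: compose_eq)+
  then show ?thesis
    using F(1,5,6) G(2,5,6) by (simp add: sg_comp_def sg_hom_def compose_eq)
qed

lemma sg_comp_values:
  "u \<in> carrier (sge M) \<Longrightarrow> fst (sg_comp M g f) u = fst g (fst f u)"
  "a \<in> carrier (sgee M) \<Longrightarrow> snd (sg_comp M g f) a = snd g (snd f a)"
  by (simp_all add: sg_comp_def compose_eq)

context biexact
begin

lemma Dsg_bd_values:
  "c \<in> carrier (D1 C) \<Longrightarrow> fst (Dsg_bd C) c = bd C c" "a \<in> carrier (DE C) \<Longrightarrow> snd (Dsg_bd C) a = a"
  "d \<in> carrier (D1 D) \<Longrightarrow> fst (Dsg_bd D) d = bd D d" "b \<in> carrier (DE D) \<Longrightarrow> snd (Dsg_bd D) b = b"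
  "e \<in> carrier (D1 E) \<Longrightarrow> fst (Dsg_bd E) e = bd E e" "r \<in> carrier (DE E) \<Longrightarrow> snd (Dsg_bd E) r = r"
  by (simp_all add: Dsg_bd_def D1sg_def)

text \<open>Both sides of each identity are morphisms with \<open>ee\<close>-part \<open>phi\<close>, so it suffices to compare
  them on the symbols \<open>x \<circledcirc> y\<close>.\<close>

lemma identities:
  assumes f00: "is_phi00 C D E Fo f00" and f01: "is_phi01 C D E Fo Fm f01" and f10: "is_phi10 C D E Fo Fm f10"
  shows "sg_comp (D1sg C \<circledcirc> D1sg D) f01
        (circ_map (D1sg C) (D0sg C) (Dsg_bd C) (D1sg D) (D1sg D) (sg_id (D1sg D)))
      = sg_comp (D1sg C \<circledcirc> D1sg D) f10
        (circ_map (D1sg C) (D1sg C) (sg_id (D1sg C)) (D1sg D) (D0sg D) (Dsg_bd D))"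
    and "sg_comp (D0sg C \<circledcirc> D1sg D) (Dsg_bd E) f01
      = sg_comp (D0sg C \<circledcirc> D1sg D) f00
        (circ_map (D0sg C) (D0sg C) (sg_id (D0sg C)) (D1sg D) (D0sg D) (Dsg_bd D))"
    and "sg_comp (D1sg C \<circledcirc> D0sg D) (Dsg_bd E) f10
      = sg_comp (D1sg C \<circledcirc> D0sg D) f00
        (circ_map (D1sg C) (D0sg C) (Dsg_bd C) (D0sg D) (D0sg D) (sg_id (D0sg D)))"
proof -
  interpret C0: Dsg C "D0sg C" "\<lambda>x. x" by (rule DC0)
  interpret C1: Dsg C "D1sg C" "bd C" by (rule DC1)
  interpret D0: Dsg D "D0sg D" "\<lambda>x. x" by (rule DD0)
  interpret D1: Dsg D "D1sg D" "bd D" by (rule DD1)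
  interpret M11: square_group_pair "D1sg C" "D1sg D" by unfold_locales
  interpret M01: square_group_pair "D0sg C" "D1sg D" by unfold_locales
  interpret M10: square_group_pair "D1sg C" "D0sg D" by unfold_locales
  have h00: "f00 \<in> sg_hom (D0sg C \<circledcirc> D0sg D) (D0sg E)" and e00: "phi_ee C D E Fo (snd f00)"
    and h01: "f01 \<in> sg_hom (D0sg C \<circledcirc> D1sg D) (D1sg E)" and e01: "phi_ee C D E Fo (snd f01)"
    and h10: "f10 \<in> sg_hom (D1sg C \<circledcirc> D0sg D) (D1sg E)" and e10: "phi_ee C D E Fo (snd f10)"
    using f00 f01 f10 by (auto simp: is_phi00_def is_phi01_def is_phi10_def)
  note snds = morphism_snd(1)[OF DC0 DD0 DE0 h00 e00] morphism_snd(1)[OF DC0 DD1 DE1 h01 e01]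
    morphism_snd(1)[OF DC1 DD0 DE1 h10 e10]
  note vals = phi00_value[OF f00] phi01_value[OF f01] phi10_value[OF f10]
  note bC = Dsg_bd_hom[OF WC.waldhausen_category_axioms] and bD = Dsg_bd_hom[OF WD.waldhausen_category_axioms]
    and bE = Dsg_bd_hom[OF WE.waldhausen_category_axioms]
  note iC0 = sg_id_hom[OF C0.square_group_axioms] and iC1 = sg_id_hom[OF C1.square_group_axioms]
    and iD0 = sg_id_hom[OF D0.square_group_axioms] and iD1 = sg_id_hom[OF D1.square_group_axioms]
  note m1 = circ_map_props[OF bC iD1] and m2 = circ_map_props[OF iC1 bD]
    and m3 = circ_map_props[OF iC0 bD] and m4 = circ_map_props[OF bC iD0]
  show "sg_comp (D1sg C \<circledcirc> D1sg D) f01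
        (circ_map (D1sg C) (D0sg C) (Dsg_bd C) (D1sg D) (D1sg D) (sg_id (D1sg D)))
      = sg_comp (D1sg C \<circledcirc> D1sg D) f10
        (circ_map (D1sg C) (D1sg C) (sg_id (D1sg C)) (D1sg D) (D0sg D) (Dsg_bd D))"
    by (rule M11.circ_sg_hom_eqI[OF sg_comp_hom[OF m1(1) h01] sg_comp_hom[OF m2(1) h10]])
      (use m1(2,3) m2(2,3) M11.cc_closed tensor_elt_closed[of _ "DE C" _ "DE D"] in
        \<open>simp_all add: sg_comp_values sg_id_def Dsg_bd_values snds vals boundary\<close>)
  show "sg_comp (D0sg C \<circledcirc> D1sg D) (Dsg_bd E) f01
      = sg_comp (D0sg C \<circledcirc> D1sg D) f00
        (circ_map (D0sg C) (D0sg C) (sg_id (D0sg C)) (D1sg D) (D0sg D) (Dsg_bd D))"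
    by (rule M01.circ_sg_hom_eqI[OF sg_comp_hom[OF h01 bE] sg_comp_hom[OF m3(1) h00]])
      (use m3(2,3) M01.cc_closed tensor_elt_closed[of _ "DE C" _ "DE D"] in
        \<open>simp_all add: sg_comp_values sg_id_def Dsg_bd_values snds vals bd_F1\<close>)
  show "sg_comp (D1sg C \<circledcirc> D0sg D) (Dsg_bd E) f10
      = sg_comp (D1sg C \<circledcirc> D0sg D) f00
        (circ_map (D1sg C) (D0sg C) (Dsg_bd C) (D0sg D) (D0sg D) (sg_id (D0sg D)))"
    by (rule M10.circ_sg_hom_eqI[OF sg_comp_hom[OF h10 bE] sg_comp_hom[OF m4(1) h00]])
      (use m4(2,3) M10.cc_closed tensor_elt_closed[of _ "DE C" _ "DE D"] in
        \<open>simp_all add: sg_comp_values sg_id_def Dsg_bd_values snds vals bd_F2\<close>)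
qed

end

theorem theorem2p5:
  fixes C :: "('o, 'm) waldcat" and D :: "('p, 'n) waldcat" and E :: "('q, 'r) waldcat"
    and Fo :: "'o \<times> 'p \<Rightarrow> 'q" and Fm :: "'m \<times> 'n \<Rightarrow> 'r"
  assumes "waldhausen_category C" and "waldhausen_category D" and "waldhausen_category E"
    and "biexact_functor C D E Fo Fm"
  shows "(\<exists>!\<phi>. is_phi00 C D E Fo \<phi>) \<and>
         (\<exists>!\<phi>. is_phi01 C D E Fo Fm \<phi>) \<and>
         (\<exists>!\<phi>. is_phi10 C D E Fo Fm \<phi>) \<and>
         (\<forall>\<phi>00 \<phi>01 \<phi>10.
            is_phi00 C D E Fo \<phi>00 \<and> is_phi01 C D E Fo Fm \<phi>01 \<and> is_phi10 C D E Fo Fm \<phi>10 \<longrightarrow>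
            sg_comp (D1sg C \<circledcirc> D1sg D) \<phi>01
                (circ_map (D1sg C) (D0sg C) (Dsg_bd C) (D1sg D) (D1sg D) (sg_id (D1sg D)))
              = sg_comp (D1sg C \<circledcirc> D1sg D) \<phi>10
                (circ_map (D1sg C) (D1sg C) (sg_id (D1sg C)) (D1sg D) (D0sg D) (Dsg_bd D)) \<and>
            sg_comp (D0sg C \<circledcirc> D1sg D) (Dsg_bd E) \<phi>01
              = sg_comp (D0sg C \<circledcirc> D1sg D) \<phi>00
                (circ_map (D0sg C) (D0sg C) (sg_id (D0sg C)) (D1sg D) (D0sg D) (Dsg_bd D)) \<and>
            sg_comp (D1sg C \<circledcirc> D0sg D) (Dsg_bd E) \<phi>10
              = sg_comp (D1sg C \<circledcirc> D0sg D) \<phi>00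
                (circ_map (D1sg C) (D0sg C) (Dsg_bd C) (D0sg D) (D0sg D) (sg_id (D0sg D))))"
proof -
  interpret biexact C D E Fo Fm
    using assms by (simp add: biexact_def biexact_axioms_def)
  show ?thesis using ex1_phi00 ex1_phi01 ex1_phi10 identities by blast
qed

end
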